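(* Let $B$ and $A$ be Artin algebras with $B$ representation-finite, and let $\varphi: B\to A$ be a homomorphism of algebras preserving identities. Then: (1) If $\mathrm{fin.dim}(\varphi)\leq 1$, then $A$ has finite finitistic dimension. (2) If $2\leq \mathrm{fin.dim}(\varphi)<\infty$ and if, for every $A$-module $X$ of finite projective dimension, the $A$-module ${}_{A}A\otimes_{B}X$ has finite projective dimension, then $A$ has finite finitistic dimension.
   Context: All algebras are Artin $R$-algebras over a commutative Artin ring $R$; all modules are finitely generated left modules. An Artin algebra is representation-finite if it has only finitely many isomorphism classes of indecomposable modules. The finitistic dimension of $A$ is the supremum of the projective dimensions of those $A$-modules that have finite projective dimension. Let $\varphi: B\to A$ be a homomorphism of Artin algebras preserving identities. Every $A$-module is viewed as a $B$-module via $\varphi$. An exact sequence of $A$-modules $\cdots\to M_{i+1}\to M_i\xrightarrow{t_i}M_{i-1}\to\cdots$ is called $(A,B)$-exact if there are $B$-homomorphisms $h_i: M_i\to M_{i+1}$ such that $t_i=t_ih_{i-1}t_i$ for all $i$. An $A$-module $X$ is $(A,B)$-projective if $X$ is isomorphic to a direct summand of $A\otimes_B X$ as an $A$-module. An $(A,B)$-projective resolution of an $A$-module $X$ is an $(A,B)$-exact sequence $\cdots\to P_1\to P_0\to X\to 0$ with all $P_i$ $(A,B)$-projective. The relative projective dimension of ${}_AX$ is the infimum of those $n\ge 0$ for which there is an $(A,B)$-projective resolution $0\to P_n\to\cdots\to P_0\to X\to 0$ (infinite if no such resolution exists). The relative finitistic dimension $\mathrm{fin.dim}(\varphi)$ is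 the supremum of the relative projective dimensions of all $A$-modules $X$ whose (ordinary) projective dimension over $A$ is finite. *)

theory Defs
  imports "HOL-Algebra.Module" "HOL-Algebra.RingHom" "HOL-Algebra.Free_Abelian_Groups"
    "HOL-Library.Extended_Nat"
begin

section \<open>Modules over not necessarily commutative rings\<close>

text \<open>The locale \<^locale>\<open>Module.module\<close> of the library requires a commutative base ring. We keep its
  record type (whose fields for multiplication and one are meaningless for modules) and only drop
  commutativity.\<close>

locale left_module = R?: ring R + M?: abelian_group M
    for R :: "('a, 'c) ring_scheme" (structure) and M :: "('a, 'm) module" (structure) +
  assumes smult_closed [simp, intro]:
      "\<lbrakk>a \<in> carrier R; x \<in> carrier M\<rbrakk> \<Longrightarrow> a \<odot>\<^bsub>M\<^esub> x \<in> carrier M"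
    and smult_l_distr:
      "\<lbrakk>a \<in> carrier R; b \<in> carrier R; x \<in> carrier M\<rbrakk> \<Longrightarrow>
        (a \<oplus> b) \<odot>\<^bsub>M\<^esub> x = a \<odot>\<^bsub>M\<^esub> x \<oplus>\<^bsub>M\<^esub> b \<odot>\<^bsub>M\<^esub> x"
    and smult_r_distr:
      "\<lbrakk>a \<in> carrier R; x \<in> carrier M; y \<in> carrier M\<rbrakk> \<Longrightarrow>
        a \<odot>\<^bsub>M\<^esub> (x \<oplus>\<^bsub>M\<^esub> y) = a \<odot>\<^bsub>M\<^esub> x \<oplus>\<^bsub>M\<^esub> a \<odot>\<^bsub>M\<^esub> y"
    and smult_assoc1:
      "\<lbrakk>a \<in> carrier R; b \<in> carrier R; x \<in> carrier M\<rbrakk> \<Longrightarrow>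
        (a \<otimes> b) \<odot>\<^bsub>M\<^esub> x = a \<odot>\<^bsub>M\<^esub> (b \<odot>\<^bsub>M\<^esub> x)"
    and smult_one [simp]: "x \<in> carrier M \<Longrightarrow> \<one> \<odot>\<^bsub>M\<^esub> x = x"

definition finitely_generated ::
    "('a, 'c) ring_scheme \<Rightarrow> ('a, 'm) module \<Rightarrow> bool" where
  "finitely_generated A M \<longleftrightarrow> (\<exists>S. finite S \<and> S \<subseteq> carrier M \<and>
     (\<forall>x \<in> carrier M. \<exists>c \<in> S \<rightarrow> carrier A. x = (\<Oplus>\<^bsub>M\<^esub>s\<in>S. c s \<odot>\<^bsub>M\<^esub> s)))"

definition fg_module :: "('a, 'c) ring_scheme \<Rightarrow> ('a, 'm) module \<Rightarrow> bool" where
  "fg_module A M \<longleftrightarrow> left_module A M \<and> finitely_generated A M"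

definition module_hom ::
    "('a, 'c) ring_scheme \<Rightarrow> ('a, 'm) module \<Rightarrow> ('a, 'n) module \<Rightarrow> ('m \<Rightarrow> 'n) set" where
  "module_hom A M N = {f \<in> carrier M \<rightarrow> carrier N.
     (\<forall>x \<in> carrier M. \<forall>y \<in> carrier M. f (x \<oplus>\<^bsub>M\<^esub> y) = f x \<oplus>\<^bsub>N\<^esub> f y) \<and>
     (\<forall>a \<in> carrier A. \<forall>x \<in> carrier M. f (a \<odot>\<^bsub>M\<^esub> x) = a \<odot>\<^bsub>N\<^esub> f x)}"

definition module_isomorphic ::
    "('a, 'c) ring_scheme \<Rightarrow> ('a, 'm) module \<Rightarrow> ('a, 'n) module \<Rightarrow> bool" where
  "module_isomorphic A M N \<longleftrightarrow> (\<exists>f \<in> module_hom A M N. bij_betw f (carrier M) (carrier N))"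

definition zero_module :: "('a, 'm) module \<Rightarrow> bool" where
  "zero_module M \<longleftrightarrow> carrier M = {\<zero>\<^bsub>M\<^esub>}"

definition internal_direct_sum ::
    "('a, 'c) ring_scheme \<Rightarrow> ('a, 'm) module \<Rightarrow> 'm set \<Rightarrow> 'm set \<Rightarrow> bool" where
  "internal_direct_sum A M U V \<longleftrightarrow> submodule U A M \<and> submodule V A M \<and>
     U \<inter> V = {\<zero>\<^bsub>M\<^esub>} \<and> U <+>\<^bsub>M\<^esub> V = carrier M"

definition iso_to_direct_summand ::
    "('a, 'c) ring_scheme \<Rightarrow> ('a, 'm) module \<Rightarrow> ('a, 'n) module \<Rightarrow> bool" where
  "iso_to_direct_summand A X Y \<longleftrightarrow>
     (\<exists>U V. internal_direct_sum A Y U V \<and> module_isomorphic A X (Y\<lparr>carrier := U\<rparr>))"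

definition indecomposable :: "('a, 'c) ring_scheme \<Rightarrow> ('a, 'm) module \<Rightarrow> bool" where
  "indecomposable A M \<longleftrightarrow> \<not> zero_module M \<and>
     (\<forall>U V. internal_direct_sum A M U V \<longrightarrow> U = {\<zero>\<^bsub>M\<^esub>} \<or> V = {\<zero>\<^bsub>M\<^esub>})"


section \<open>A type containing all finitely generated modules\<close>

text \<open>HOL cannot quantify over modules of all types inside a definition. If the elements of \<open>A\<close>
  have type \<open>'a\<close>, every quotient of \<open>A\<^sup>n\<close> (with \<open>n\<close> arbitrary) lives on a set of subsets of
  \<open>nat \<Rightarrow> 'a\<close>, so the type below contains an isomorphic copy of every finitely generated
  \<open>A\<close>-module (lemma \<open>fg_module_has_copy\<close>). All quantifications over ``all \<open>A\<close>-modules'' range over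
  this type; properties of a single module are defined for modules over arbitrary types.\<close>

type_synonym 'a umodule = "('a, (nat \<Rightarrow> 'a) set) module"

lemma left_module_transport:
  fixes M :: "('a, 'm) module" and N :: "('a, 'n) module"
  assumes "left_module A M" and bij: "bij_betw f (carrier M) (carrier N)"
    and zero: "\<zero>\<^bsub>N\<^esub> = f \<zero>\<^bsub>M\<^esub>"
    and add: "\<And>x y. \<lbrakk>x \<in> carrier M; y \<in> carrier M\<rbrakk> \<Longrightarrow> f x \<oplus>\<^bsub>N\<^esub> f y = f (x \<oplus>\<^bsub>M\<^esub> y)"
    and smult: "\<And>a x. \<lbrakk>a \<in> carrier A; x \<in> carrier M\<rbrakk> \<Longrightarrow> a \<odot>\<^bsub>N\<^esub> f x = f (a \<odot>\<^bsub>M\<^esub> x)"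
  shows "left_module A N"
proof -
  interpret left_module A M by fact
  have surj: "\<exists>x \<in> carrier M. y = f x" if "y \<in> carrier N" for y
    using bij that by (auto simp: bij_betw_def)
  have cl: "f x \<in> carrier N" if "x \<in> carrier M" for x
    using bij that by (auto simp: bij_betw_def)
  have "abelian_group N"
  proof (rule abelian_groupI)
    fix x y assume "x \<in> carrier N" "y \<in> carrier N"
    then show "x \<oplus>\<^bsub>N\<^esub> y \<in> carrier N" using surj cl add by (metis M.add.m_closed)
  next
    show "\<zero>\<^bsub>N\<^esub> \<in> carrier N" using zero cl by simp
  next
    fix x y z assume "x \<in> carrier N" "y \<in> carrier N" "z \<in> carrier N"
    then obtain x' y' z' where "x = f x'" "y = f y'" "z = f z'"
      "x' \<in> carrier M" "y' \<in> carrier M" "z' \<in> carrier M" using surj by metis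
    then show "x \<oplus>\<^bsub>N\<^esub> y \<oplus>\<^bsub>N\<^esub> z = x \<oplus>\<^bsub>N\<^esub> (y \<oplus>\<^bsub>N\<^esub> z)" by (simp add: add M.a_assoc)
  next
    fix x y assume "x \<in> carrier N" "y \<in> carrier N"
    then obtain x' y' where "x = f x'" "y = f y'" "x' \<in> carrier M" "y' \<in> carrier M"
      using surj by metis
    then show "x \<oplus>\<^bsub>N\<^esub> y = y \<oplus>\<^bsub>N\<^esub> x" by (simp add: add M.a_comm)
  next
    fix x assume "x \<in> carrier N"
    then obtain x' where "x = f x'" "x' \<in> carrier M" using surj by metis
    then show "\<zero>\<^bsub>N\<^esub> \<oplus>\<^bsub>N\<^esub> x = x" by (simp add: add zero)
  next
    fix x assume "x \<in> carrier N"
    then obtain x' where x': "x = f x'" "x' \<in> carrier M" using surj by metis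
    then show "\<exists>y \<in> carrier N. y \<oplus>\<^bsub>N\<^esub> x = \<zero>\<^bsub>N\<^esub>"
      by (intro bexI[of _ "f (\<ominus>\<^bsub>M\<^esub> x')"]) (simp_all add: add zero cl M.l_neg)
  qed
  moreover have "left_module_axioms A N"
  proof (rule left_module_axioms.intro)
    fix a x assume "a \<in> carrier A" "x \<in> carrier N"
    then show "a \<odot>\<^bsub>N\<^esub> x \<in> carrier N" using surj cl smult by (metis smult_closed)
  next
    fix a b x assume *: "a \<in> carrier A" "b \<in> carrier A" "x \<in> carrier N"
    then obtain x' where "x = f x'" "x' \<in> carrier M" using surj by metis
    with * show "(a \<oplus>\<^bsub>A\<^esub> b) \<odot>\<^bsub>N\<^esub> x = a \<odot>\<^bsub>N\<^esub> x \<oplus>\<^bsub>N\<^esub> b \<odot>\<^bsub>N\<^esub> x"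
      by (simp add: add smult smult_l_distr)
  next
    fix a x y assume *: "a \<in> carrier A" "x \<in> carrier N" "y \<in> carrier N"
    then obtain x' y' where "x = f x'" "y = f y'" "x' \<in> carrier M" "y' \<in> carrier M"
      using surj by metis
    with * show "a \<odot>\<^bsub>N\<^esub> (x \<oplus>\<^bsub>N\<^esub> y) = a \<odot>\<^bsub>N\<^esub> x \<oplus>\<^bsub>N\<^esub> a \<odot>\<^bsub>N\<^esub> y"
      by (simp add: add smult smult_r_distr)
  next
    fix a b x assume *: "a \<in> carrier A" "b \<in> carrier A" "x \<in> carrier N"
    then obtain x' where "x = f x'" "x' \<in> carrier M" using surj by metis
    with * show "(a \<otimes>\<^bsub>A\<^esub> b) \<odot>\<^bsub>N\<^esub> x = a \<odot>\<^bsub>N\<^esub> (b \<odot>\<^bsub>N\<^esub> x)"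
      by (simp add: smult smult_assoc1)
  next
    fix x assume "x \<in> carrier N"
    then obtain x' where "x = f x'" "x' \<in> carrier M" using surj by metis
    then show "\<one>\<^bsub>A\<^esub> \<odot>\<^bsub>N\<^esub> x = x" by (simp add: smult)
  qed
  ultimately show ?thesis by (intro left_module.intro R.ring_axioms)
qed

lemma module_hom_finsum:
  assumes M: "left_module A M" and N: "left_module A N" and f: "f \<in> module_hom A M N"
    and g: "finite S" "g \<in> S \<rightarrow> carrier M"
  shows "f (\<Oplus>\<^bsub>M\<^esub>s\<in>S. g s) = (\<Oplus>\<^bsub>N\<^esub>s\<in>S. f (g s))"
proof -
  interpret M: left_module A M by fact
  interpret N: left_module A N by fact
  interpret abelian_group_hom M N f
    using f by (intro abelian_group_homI)
      (auto simp: module_hom_def group_hom_def group_hom_axioms_def hom_def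
        M.M.a_group N.M.a_group M.M.abelian_group_axioms N.M.abelian_group_axioms)
  from g show ?thesis
  proof (induction S rule: finite_induct)
    case (insert s S)
    have "f (g s \<oplus>\<^bsub>M\<^esub> (\<Oplus>\<^bsub>M\<^esub>s\<in>S. g s)) = f (g s) \<oplus>\<^bsub>N\<^esub> f (\<Oplus>\<^bsub>M\<^esub>s\<in>S. g s)"
      using insert f by (auto simp: module_hom_def Pi_iff)
    with insert show ?case
      by (subst M.M.finsum_insert; (subst N.M.finsum_insert)?) (auto simp: Pi_iff)
  qed simp
qed

lemma fg_module_has_copy:
  fixes A :: "('a, 'c) ring_scheme" and M :: "('a, 'm) module"
  assumes "fg_module A M"
  obtains N :: "'a umodule" where "fg_module A N" "module_isomorphic A M N"
proof -
  have M: "left_module A M" using assms by (simp add: fg_module_def)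
  interpret left_module A M by fact
  from assms obtain S where S: "finite S" "S \<subseteq> carrier M"
    and gen: "\<And>x. x \<in> carrier M \<Longrightarrow>
      \<exists>c \<in> S \<rightarrow> carrier A. x = (\<Oplus>\<^bsub>M\<^esub>s\<in>S. c s \<odot>\<^bsub>M\<^esub> s)"
    by (auto simp: fg_module_def finitely_generated_def)
  obtain e :: "'m \<Rightarrow> nat" where e: "inj_on e S"
    using S(1) by (meson finite_imp_inj_to_nat_seg)
  define F where "F x = {d :: nat \<Rightarrow> 'a. x = (\<Oplus>\<^bsub>M\<^esub>s\<in>S. d (e s) \<odot>\<^bsub>M\<^esub> s)}" for x
  have "F x \<noteq> {}" if x: "x \<in> carrier M" for x
  proof -
    obtain c where c: "c \<in> S \<rightarrow> carrier A" "x = (\<Oplus>\<^bsub>M\<^esub>s\<in>S. c s \<odot>\<^bsub>M\<^esub> s)" using gen[OF x] by blast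
    have "(\<Oplus>\<^bsub>M\<^esub>s\<in>S. c s \<odot>\<^bsub>M\<^esub> s) = (\<Oplus>\<^bsub>M\<^esub>s\<in>S. c (inv_into S e (e s)) \<odot>\<^bsub>M\<^esub> s)"
      using c S e by (intro M.finsum_cong') (auto simp: Pi_iff subset_iff)
    then have "c \<circ> inv_into S e \<in> F x" using c by (simp add: F_def)
    then show ?thesis by blast
  qed
  then have inj: "inj_on F (carrier M)"
    by (intro inj_onI) (force simp: F_def)
  define G where "G = inv_into (carrier M) F"
  have GF [simp]: "G (F x) = x" if "x \<in> carrier M" for x
    using inj that by (simp add: G_def)
  define N :: "'a umodule" where
    "N = \<lparr>carrier = F ` carrier M, monoid.mult = undefined,
          monoid.one = undefined, ring.zero = F \<zero>\<^bsub>M\<^esub>,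
          ring.add = (\<lambda>x y. F (G x \<oplus>\<^bsub>M\<^esub> G y)), smult = (\<lambda>a x. F (a \<odot>\<^bsub>M\<^esub> G x))\<rparr>"
  have bij: "bij_betw F (carrier M) (carrier N)"
    using inj by (simp add: N_def bij_betw_def)
  have N: "left_module A N"
    by (rule left_module_transport[OF M bij]) (simp_all add: N_def)
  have F: "F \<in> module_hom A M N"
    by (auto simp: module_hom_def N_def)
  have "finitely_generated A N"
    unfolding finitely_generated_def
  proof (intro exI[of _ "F ` S"] conjI ballI)
    show "finite (F ` S)" "F ` S \<subseteq> carrier N" using S by (auto simp: N_def)
    fix y assume "y \<in> carrier N"
    then obtain x where x: "x \<in> carrier M" "y = F x" by (auto simp: N_def)
    obtain c where c: "c \<in> S \<rightarrow> carrier A" "x = (\<Oplus>\<^bsub>M\<^esub>s\<in>S. c s \<odot>\<^bsub>M\<^esub> s)" using gen[OF x(1)] by blast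
    interpret N: left_module A N by fact
    have injS: "inj_on F S" using inj S by (meson inj_on_subset)
    have "y = (\<Oplus>\<^bsub>N\<^esub>s\<in>S. F (c s \<odot>\<^bsub>M\<^esub> s))"
      unfolding x c(2) using c S by (intro module_hom_finsum[OF M N F]) (auto simp: Pi_iff subset_iff)
    also have "\<dots> = (\<Oplus>\<^bsub>N\<^esub>s\<in>S. c (G (F s)) \<odot>\<^bsub>N\<^esub> F s)"
      using c S F by (intro N.M.finsum_cong')
        (auto simp: Pi_iff subset_iff module_hom_def intro!: N.smult_closed)
    also have "\<dots> = (\<Oplus>\<^bsub>N\<^esub>s\<in>F ` S. c (G s) \<odot>\<^bsub>N\<^esub> s)"
      using c S F injS by (intro N.M.finsum_reindex[symmetric])
        (auto simp: Pi_iff subset_iff module_hom_def intro!: N.smult_closed)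
    finally show "\<exists>c \<in> F ` S \<rightarrow> carrier A. y = (\<Oplus>\<^bsub>N\<^esub>s\<in>F ` S. c s \<odot>\<^bsub>N\<^esub> s)"
      using c S by (intro bexI[of _ "c \<circ> G"]) (auto simp: subset_iff)
  qed
  with N F bij show ?thesis
    by (intro that[of N]) (auto simp: fg_module_def module_isomorphic_def)
qed


section \<open>Artin algebras\<close>

locale artinian_cring = cring +
  assumes descending_chain_condition:
    "\<lbrakk>\<And>n::nat. ideal (I n) R; \<And>n. I (Suc n) \<subseteq> I n\<rbrakk> \<Longrightarrow> \<exists>N. \<forall>n\<ge>N. I n = I N"

locale artin_algebra = R?: artinian_cring R + A?: ring A + left_module R A
    for R :: "('r, 'c) ring_scheme" (structure) and A :: "('r, 'a) module" (structure) +
  assumes smult_mult_left: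
      "\<lbrakk>r \<in> carrier R; a \<in> carrier A; b \<in> carrier A\<rbrakk> \<Longrightarrow>
        (r \<odot>\<^bsub>A\<^esub> a) \<otimes>\<^bsub>A\<^esub> b = r \<odot>\<^bsub>A\<^esub> (a \<otimes>\<^bsub>A\<^esub> b)"
    and smult_mult_right:
      "\<lbrakk>r \<in> carrier R; a \<in> carrier A; b \<in> carrier A\<rbrakk> \<Longrightarrow>
        a \<otimes>\<^bsub>A\<^esub> (r \<odot>\<^bsub>A\<^esub> b) = r \<odot>\<^bsub>A\<^esub> (a \<otimes>\<^bsub>A\<^esub> b)"
    and fin_gen: "finitely_generated R A"

text \<open>The library's \<^const>\<open>ring_hom\<close> includes preservation of the identity.\<close>

definition algebra_hom ::
    "('r, 'c) ring_scheme \<Rightarrow> ('r, 'b) module \<Rightarrow> ('r, 'a) module \<Rightarrow> ('b \<Rightarrow> 'a) set" where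
  "algebra_hom R B A = ring_hom B A \<inter> module_hom R B A"

definition representation_finite :: "('b, 'c) ring_scheme \<Rightarrow> bool" where
  "representation_finite B \<longleftrightarrow>
     (let Ind = {M :: 'b umodule. fg_module B M \<and> indecomposable B M}
      in finite (Ind // {(M, N) \<in> Ind \<times> Ind. module_isomorphic B M N}))"


section \<open>Projective dimension and finitistic dimension\<close>

definition projective :: "('a, 'c) ring_scheme \<Rightarrow> ('a, 'm) module \<Rightarrow> bool" where
  "projective A P \<longleftrightarrow>
     (\<forall>(M :: 'a umodule) (N :: 'a umodule) g f.
        fg_module A M \<and> fg_module A N \<and> g \<in> module_hom A M N \<and> g ` carrier M = carrier N \<and>
        f \<in> module_hom A P N \<longrightarrow>
        (\<exists>h \<in> module_hom A P M. \<forall>x \<in> carrier P. g (h x) = f x))"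

text \<open>Sequences are indexed by the integers, with \<open>t i\<close> mapping \<open>M i\<close> to \<open>M (i - 1)\<close>.\<close>

definition exact_sequence ::
    "('a, 'c) ring_scheme \<Rightarrow> (int \<Rightarrow> ('a, 'm) module) \<Rightarrow> (int \<Rightarrow> 'm \<Rightarrow> 'm) \<Rightarrow> bool" where
  "exact_sequence A M t \<longleftrightarrow>
     (\<forall>i. fg_module A (M i) \<and> t i \<in> module_hom A (M i) (M (i - 1)) \<and>
          t (i + 1) ` carrier (M (i + 1)) = a_kernel (M i) (M (i - 1)) (t i))"

text \<open>An exact sequence \<open>0 \<rightarrow> M n \<rightarrow> \<dots> \<rightarrow> M 0 \<rightarrow> X \<rightarrow> 0\<close>, with \<open>X\<close> placed in degree \<open>-1\<close> and all
  further modules zero. Since \<open>X\<close> may live over a type different from that of the \<open>M i\<close>, it is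
  represented by an isomorphic module \<open>M (-1)\<close>.\<close>

definition bounded_resolution_shape ::
    "('a, 'c) ring_scheme \<Rightarrow> ('a, 'm) module \<Rightarrow> nat \<Rightarrow>
     (int \<Rightarrow> 'a umodule) \<Rightarrow> (int \<Rightarrow> (nat \<Rightarrow> 'a) set \<Rightarrow> (nat \<Rightarrow> 'a) set) \<Rightarrow> bool" where
  "bounded_resolution_shape A X n M t \<longleftrightarrow>
     exact_sequence A M t \<and> module_isomorphic A (M (-1)) X \<and>
     (\<forall>i. i < -1 \<or> int n < i \<longrightarrow> zero_module (M i))"

definition proj_dim :: "('a, 'c) ring_scheme \<Rightarrow> ('a, 'm) module \<Rightarrow> enat" where
  "proj_dim A X = Inf {enat n | n. \<exists>M t.
     bounded_resolution_shape A X n M t \<and> (\<forall>i\<ge>0. projective A (M i))}"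

definition fin_dim :: "('a, 'c) ring_scheme \<Rightarrow> enat" where
  "fin_dim A = Sup {proj_dim A X | X :: 'a umodule. fg_module A X \<and> proj_dim A X < \<infinity>}"


section \<open>Change of rings\<close>

text \<open>Here \<open>\<phi>\<close> is a ring homomorphism from \<open>B\<close> to \<open>A\<close>.\<close>

definition restrict_scalars ::
    "('b \<Rightarrow> 'a) \<Rightarrow> ('a, 'm) module \<Rightarrow> ('b, 'm) module" where
  "restrict_scalars \<phi> M =
     \<lparr>carrier = carrier M, monoid.mult = monoid.mult M, monoid.one = \<one>\<^bsub>M\<^esub>,
      ring.zero = \<zero>\<^bsub>M\<^esub>, ring.add = ring.add M, smult = (\<lambda>b x. \<phi> b \<odot>\<^bsub>M\<^esub> x)\<rparr>"

lemma restrict_scalars_left_module: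
  assumes "left_module A M" "ring B" "\<phi> \<in> ring_hom B A"
  shows "left_module B (restrict_scalars \<phi> M)"
proof -
  interpret left_module A M by fact
  interpret B: ring B by fact
  have "abelian_group (restrict_scalars \<phi> M)"
  proof (rule abelian_groupI)
    fix x assume "x \<in> carrier (restrict_scalars \<phi> M)"
    then show "\<exists>y \<in> carrier (restrict_scalars \<phi> M).
        y \<oplus>\<^bsub>restrict_scalars \<phi> M\<^esub> x = \<zero>\<^bsub>restrict_scalars \<phi> M\<^esub>"
      by (intro bexI[of _ "\<ominus>\<^bsub>M\<^esub> x"]) (simp_all add: restrict_scalars_def M.l_neg)
  qed (simp_all add: restrict_scalars_def M.a_assoc, simp add: M.a_comm)
  then show ?thesis
    using assms(3) ring_hom_closed[OF assms(3)]
    by (intro left_module.intro left_module_axioms.intro B.ring_axioms)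
      (auto simp: restrict_scalars_def ring_hom_def smult_l_distr smult_r_distr smult_assoc1)
qed

text \<open>\<open>A \<otimes>\<^sub>B Y\<close> for a \<open>B\<close>-module \<open>Y\<close>: the free abelian group on \<open>A \<times> Y\<close> modulo the subgroup
  generated by the usual relations, \<open>A\<close> being a right \<open>B\<close>-module via \<open>\<phi>\<close>. The elements are cosets
  of the subgroup of relations; \<open>a \<in> A\<close> sends the coset of \<open>\<Sum> (a', y)\<close> to that of \<open>\<Sum> (a a', y)\<close>.\<close>

definition tensor_relations ::
    "('a, 'c) ring_scheme \<Rightarrow> ('b, 'd) ring_scheme \<Rightarrow> ('b \<Rightarrow> 'a) \<Rightarrow> ('b, 'm) module \<Rightarrow>
     ('a \<times> 'm \<Rightarrow>\<^sub>0 int) set" where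
  "tensor_relations A B \<phi> Y =
     {frag_of (a \<oplus>\<^bsub>A\<^esub> a', y) - frag_of (a, y) - frag_of (a', y) | a a' y.
        a \<in> carrier A \<and> a' \<in> carrier A \<and> y \<in> carrier Y} \<union>
     {frag_of (a, y \<oplus>\<^bsub>Y\<^esub> y') - frag_of (a, y) - frag_of (a, y') | a y y'.
        a \<in> carrier A \<and> y \<in> carrier Y \<and> y' \<in> carrier Y} \<union>
     {frag_of (a \<otimes>\<^bsub>A\<^esub> \<phi> b, y) - frag_of (a, b \<odot>\<^bsub>Y\<^esub> y) | a b y.
        a \<in> carrier A \<and> b \<in> carrier B \<and> y \<in> carrier Y}"

definition tensor ::
    "('a, 'c) ring_scheme \<Rightarrow> ('b, 'd) ring_scheme \<Rightarrow> ('b \<Rightarrow> 'a) \<Rightarrow> ('b, 'm) module \<Rightarrow>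
     ('a, ('a \<times> 'm \<Rightarrow>\<^sub>0 int) set) module" where
  "tensor A B \<phi> Y =
     (let F = free_Abelian_group (carrier A \<times> carrier Y);
          N = generate F (tensor_relations A B \<phi> Y)
      in \<lparr>carrier = carrier (F Mod N), monoid.mult = undefined, monoid.one = undefined,
          ring.zero = \<one>\<^bsub>F Mod N\<^esub>, ring.add = (\<lambda>x y. x \<otimes>\<^bsub>F Mod N\<^esub> y),
          smult = (\<lambda>a C. \<Union>c\<in>C. N #>\<^bsub>F\<^esub> frag_extend (\<lambda>(a', y). frag_of (a \<otimes>\<^bsub>A\<^esub> a', y)) c)\<rparr>)"

lemma tensor_left_module:
  assumes A: "ring A" and Y: "left_module B Y" and \<phi>: "\<phi> \<in> ring_hom B A"
  shows "left_module A (tensor A B \<phi> Y)"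
proof -
  interpret A: ring A by fact
  interpret Y: left_module B Y by fact
  let ?S = "carrier A \<times> carrier Y"
  define F where "F = free_Abelian_group ?S"
  define N where "N = generate F (tensor_relations A B \<phi> Y)"
  let ?L = "\<lambda>a. frag_extend (\<lambda>(a', y). frag_of (a \<otimes>\<^bsub>A\<^esub> a', y))"
  interpret F: comm_group F unfolding F_def by (rule abelian_free_Abelian_group)
  have carF [simp]: "c \<in> carrier F \<longleftrightarrow> Poly_Mapping.keys c \<subseteq> ?S" for c by (simp add: F_def)
  have multF [simp]: "x \<otimes>\<^bsub>F\<^esub> y = x + y" for x y by (simp add: F_def)
  have oneF [simp]: "\<one>\<^bsub>F\<^esub> = 0" by (simp add: F_def)
  have invF: "inv\<^bsub>F\<^esub> x = - x" if "x \<in> carrier F" for x using that by (simp add: F_def)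
  have \<phi>c: "\<phi> b \<in> carrier A" if "b \<in> carrier B" for b using \<phi> that by (auto simp: ring_hom_def)
  have frag: "frag_of (a, y) \<in> carrier F" if "a \<in> carrier A" "y \<in> carrier Y" for a y
    using that by simp
  have diffF: "x - y \<in> carrier F" if "x \<in> carrier F" "y \<in> carrier F" for x y
    using that keys_diff[of x y] unfolding carF by blast
  have rel: "tensor_relations A B \<phi> Y \<subseteq> carrier F"
    unfolding tensor_relations_def using \<phi>c
    by (auto simp del: carF intro!: diffF frag)
  have sub: "subgroup N F" unfolding N_def by (rule F.generate_is_subgroup[OF rel])
  then have norm: "N \<lhd> F" using F.normal_iff_subgroup by blast
  interpret Q: comm_group "F Mod N" using F.abelian_FactGroup[OF sub] .
  have NF: "N \<subseteq> carrier F" using sub by (rule subgroup.subset)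
  have N0: "0 \<in> N" using subgroup.one_closed[OF sub] by simp
  have Nadd: "x + y \<in> N" if "x \<in> N" "y \<in> N" for x y
    using subgroup.m_closed[OF sub that] by simp
  have Nneg: "- x \<in> N" if "x \<in> N" for x
    using subgroup.m_inv_closed[OF sub that] invF NF that by auto
  have Ndiff: "x - y \<in> N" if "x \<in> N" "y \<in> N" for x y
    using Nadd[OF that(1) Nneg[OF that(2)]] by simp
  have LF: "?L a c \<in> carrier F" if a: "a \<in> carrier A" and c: "c \<in> carrier F" for a c
  proof -
    have "(\<Union>x \<in> Poly_Mapping.keys c.
        Poly_Mapping.keys (case x of (a', y) \<Rightarrow> frag_of (a \<otimes>\<^bsub>A\<^esub> a', y))) \<subseteq> ?S"
    proof (rule UN_least)
      fix p assume "p \<in> Poly_Mapping.keys c"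
      then obtain a' y where "p = (a', y)" "a' \<in> carrier A" "y \<in> carrier Y" using c by auto
      then show "Poly_Mapping.keys (case p of (a', y) \<Rightarrow> frag_of (a \<otimes>\<^bsub>A\<^esub> a', y)) \<subseteq> ?S"
        using a by simp
    qed
    then show ?thesis using keys_frag_extend unfolding carF by (rule order_trans[rotated])
  qed
  have relN: "x \<in> N" if "x \<in> tensor_relations A B \<phi> Y" for x
    unfolding N_def using that by (rule generate.incl)
  have Lrel: "?L a x \<in> N" if a: "a \<in> carrier A" and x: "x \<in> tensor_relations A B \<phi> Y" for a x
  proof -
    consider
      b b' y where "x = frag_of (b \<oplus>\<^bsub>A\<^esub> b', y) - frag_of (b, y) - frag_of (b', y)"
        "b \<in> carrier A" "b' \<in> carrier A" "y \<in> carrier Y"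
    | b y y' where "x = frag_of (b, y \<oplus>\<^bsub>Y\<^esub> y') - frag_of (b, y) - frag_of (b, y')"
        "b \<in> carrier A" "y \<in> carrier Y" "y' \<in> carrier Y"
    | b r y where "x = frag_of (b \<otimes>\<^bsub>A\<^esub> \<phi> r, y) - frag_of (b, r \<odot>\<^bsub>Y\<^esub> y)"
        "b \<in> carrier A" "r \<in> carrier B" "y \<in> carrier Y"
      using x unfolding tensor_relations_def by blast
    then show ?thesis
    proof cases
      case 1
      then have "?L a x = frag_of (a \<otimes>\<^bsub>A\<^esub> b \<oplus>\<^bsub>A\<^esub> a \<otimes>\<^bsub>A\<^esub> b', y) - frag_of (a \<otimes>\<^bsub>A\<^esub> b, y) - frag_of (a \<otimes>\<^bsub>A\<^esub> b', y)"
        using a by (simp add: frag_extend_diff A.r_distr)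
      moreover have "a \<otimes>\<^bsub>A\<^esub> b \<in> carrier A" "a \<otimes>\<^bsub>A\<^esub> b' \<in> carrier A" using a 1 by auto
      ultimately show ?thesis using 1 by (intro relN) (unfold tensor_relations_def, blast)
    next
      case 2
      then have "?L a x = frag_of (a \<otimes>\<^bsub>A\<^esub> b, y \<oplus>\<^bsub>Y\<^esub> y') - frag_of (a \<otimes>\<^bsub>A\<^esub> b, y) - frag_of (a \<otimes>\<^bsub>A\<^esub> b, y')"
        using a by (simp add: frag_extend_diff)
      moreover have "a \<otimes>\<^bsub>A\<^esub> b \<in> carrier A" using a 2 by auto
      ultimately show ?thesis using 2 by (intro relN) (unfold tensor_relations_def, blast)
    next
      case 3
      then have "?L a x = frag_of ((a \<otimes>\<^bsub>A\<^esub> b) \<otimes>\<^bsub>A\<^esub> \<phi> r, y) - frag_of (a \<otimes>\<^bsub>A\<^esub> b, r \<odot>\<^bsub>Y\<^esub> y)"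
        using a by (simp add: frag_extend_diff A.m_assoc \<phi>c)
      moreover have "a \<otimes>\<^bsub>A\<^esub> b \<in> carrier A" using a 3 by auto
      ultimately show ?thesis using 3 by (intro relN) (unfold tensor_relations_def, blast)
    qed
  qed
  have LN: "?L a x \<in> N" if a: "a \<in> carrier A" and x: "x \<in> N" for a x
    using x unfolding N_def
  proof (induction x rule: generate.induct)
    case one then show ?case using N0 N_def by simp
  next
    case (incl h) then show ?case using Lrel[OF a] N_def by simp
  next
    case (inv h)
    then have "inv\<^bsub>F\<^esub> h = - h" using rel invF by blast
    then show ?case using Nneg[OF Lrel[OF a inv]] N_def by (simp add: frag_extend_minus)
  next
    case (eng x y) then show ?case using Nadd N_def by (simp add: frag_extend_add)
  qed
  have coset: "N #>\<^bsub>F\<^esub> c = {n + c | n. n \<in> N}" for c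
    by (auto simp: r_coset_def)
  have coset_eq: "N #>\<^bsub>F\<^esub> c = N #>\<^bsub>F\<^esub> d" if "c - d \<in> N" for c d
    unfolding coset
  proof (intro subset_antisym subsetI)
    fix x assume "x \<in> {n + c | n. n \<in> N}"
    then obtain n where "n \<in> N" "x = n + c" by blast
    then show "x \<in> {n + d | n. n \<in> N}"
      using Nadd[OF \<open>n \<in> N\<close> that] by (auto intro!: exI[of _ "n + (c - d)"])
  next
    fix x assume "x \<in> {n + d | n. n \<in> N}"
    then obtain n where "n \<in> N" "x = n + d" by blast
    then show "x \<in> {n + c | n. n \<in> N}"
      using Ndiff[OF \<open>n \<in> N\<close> that] by (auto intro!: exI[of _ "n - (c - d)"])
  qed
  let ?T = "tensor A B \<phi> Y"
  have carT: "carrier ?T = {N #>\<^bsub>F\<^esub> c | c. c \<in> carrier F}"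
    by (auto simp: tensor_def Let_def F_def[symmetric] N_def[symmetric] FactGroup_def RCOSETS_def)
  have smultT: "a \<odot>\<^bsub>?T\<^esub> (N #>\<^bsub>F\<^esub> c) = N #>\<^bsub>F\<^esub> ?L a c" if a: "a \<in> carrier A" for a c
  proof -
    have "N #>\<^bsub>F\<^esub> ?L a c' = N #>\<^bsub>F\<^esub> ?L a c" if "c' \<in> N #>\<^bsub>F\<^esub> c" for c'
    proof -
      obtain n where n: "n \<in> N" "c' = n + c" using \<open>c' \<in> _\<close> unfolding coset by blast
      show ?thesis using LN[OF a n(1)] by (intro coset_eq) (simp add: n frag_extend_add)
    qed
    moreover have "c \<in> N #>\<^bsub>F\<^esub> c" unfolding coset using N0 by force
    ultimately have "(\<Union>c' \<in> N #>\<^bsub>F\<^esub> c. N #>\<^bsub>F\<^esub> ?L a c') = N #>\<^bsub>F\<^esub> ?L a c" by blast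
    then show ?thesis by (simp add: tensor_def Let_def F_def N_def)
  qed
  have addT: "(N #>\<^bsub>F\<^esub> c) \<oplus>\<^bsub>?T\<^esub> (N #>\<^bsub>F\<^esub> d) = N #>\<^bsub>F\<^esub> (c + d)"
    if "c \<in> carrier F" "d \<in> carrier F" for c d
    using normal.rcos_sum[OF norm that]
    by (simp add: tensor_def Let_def F_def[symmetric] N_def[symmetric] FactGroup_def)
  have T: "carrier ?T = carrier (F Mod N)" "\<zero>\<^bsub>?T\<^esub> = \<one>\<^bsub>F Mod N\<^esub>"
    "\<And>x y. x \<oplus>\<^bsub>?T\<^esub> y = x \<otimes>\<^bsub>F Mod N\<^esub> y"
    by (simp_all add: tensor_def Let_def F_def N_def)
  have ab: "abelian_group ?T"
    by (rule abelian_groupI) (use Q.l_inv_ex in \<open>simp_all add: T Q.m_assoc Q.m_comm Q.m_lcomm del: mult_FactGroup one_FactGroup\<close>)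
  have L_add: "?L (a \<oplus>\<^bsub>A\<^esub> b) c - (?L a c + ?L b c) \<in> N"
    if ab: "a \<in> carrier A" "b \<in> carrier A" and c: "Poly_Mapping.keys c \<subseteq> ?S" for a b c
    using c
  proof (induction c rule: free_Abelian_group_induct[consumes 1, case_names zero diff one])
    case (diff x y)
    then show ?case using Ndiff[OF diff(3,4)] by (simp add: frag_extend_diff algebra_simps)
  next
    case (one p)
    obtain a' y where p: "p = (a', y)" "a' \<in> carrier A" "y \<in> carrier Y" using one by blast
    have "frag_of (a \<otimes>\<^bsub>A\<^esub> a' \<oplus>\<^bsub>A\<^esub> b \<otimes>\<^bsub>A\<^esub> a', y) - frag_of (a \<otimes>\<^bsub>A\<^esub> a', y) - frag_of (b \<otimes>\<^bsub>A\<^esub> a', y) \<in> N"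
      using ab p by (intro relN) (unfold tensor_relations_def, blast)
    then show ?case using ab p by (simp add: A.l_distr algebra_simps)
  qed (simp add: N0)
  have L_mult: "?L (a \<otimes>\<^bsub>A\<^esub> b) c = ?L a (?L b c)"
    if ab: "a \<in> carrier A" "b \<in> carrier A" and c: "Poly_Mapping.keys c \<subseteq> ?S" for a b c
    using c by (induction c rule: free_Abelian_group_induct[consumes 1, case_names zero diff one])
      (use ab in \<open>auto simp: frag_extend_diff A.m_assoc\<close>)
  have L_one: "?L \<one>\<^bsub>A\<^esub> c = c" if c: "Poly_Mapping.keys c \<subseteq> ?S" for c
    using c by (induction c rule: free_Abelian_group_induct[consumes 1, case_names zero diff one]) (auto simp: frag_extend_diff)
  have add_closed: "c + d \<in> carrier F" if "c \<in> carrier F" "d \<in> carrier F" for c d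
    using F.m_closed[OF that] by simp
  have "left_module_axioms A ?T"
  proof (rule left_module_axioms.intro)
    fix a x assume "a \<in> carrier A" "x \<in> carrier ?T"
    then show "a \<odot>\<^bsub>?T\<^esub> x \<in> carrier ?T" using LF unfolding carT by (auto simp: smultT simp del: carF)
  next
    fix a b x assume *: "a \<in> carrier A" "b \<in> carrier A" "x \<in> carrier ?T"
    then obtain c where c: "x = N #>\<^bsub>F\<^esub> c" "c \<in> carrier F" unfolding carT by blast
    with * show "(a \<oplus>\<^bsub>A\<^esub> b) \<odot>\<^bsub>?T\<^esub> x = a \<odot>\<^bsub>?T\<^esub> x \<oplus>\<^bsub>?T\<^esub> b \<odot>\<^bsub>?T\<^esub> x"
      using L_add[OF *(1,2), of c] LF[OF *(1) c(2)] LF[OF *(2) c(2)]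
      by (simp add: smultT addT del: carF) (simp add: coset_eq)
  next
    fix a x y assume *: "a \<in> carrier A" "x \<in> carrier ?T" "y \<in> carrier ?T"
    then obtain c d where "x = N #>\<^bsub>F\<^esub> c" "c \<in> carrier F" "y = N #>\<^bsub>F\<^esub> d" "d \<in> carrier F"
      unfolding carT by blast
    with * show "a \<odot>\<^bsub>?T\<^esub> (x \<oplus>\<^bsub>?T\<^esub> y) = a \<odot>\<^bsub>?T\<^esub> x \<oplus>\<^bsub>?T\<^esub> a \<odot>\<^bsub>?T\<^esub> y"
      by (simp add: smultT addT LF frag_extend_add del: carF)
  next
    fix a b x assume *: "a \<in> carrier A" "b \<in> carrier A" "x \<in> carrier ?T"
    then obtain c where c: "x = N #>\<^bsub>F\<^esub> c" "c \<in> carrier F" unfolding carT by blast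
    with * show "(a \<otimes>\<^bsub>A\<^esub> b) \<odot>\<^bsub>?T\<^esub> x = a \<odot>\<^bsub>?T\<^esub> (b \<odot>\<^bsub>?T\<^esub> x)"
      using L_mult[OF *(1,2), of c] by (simp add: smultT)
  next
    fix x assume *: "x \<in> carrier ?T"
    then obtain c where c: "x = N #>\<^bsub>F\<^esub> c" "c \<in> carrier F" unfolding carT by blast
    with * show "\<one>\<^bsub>A\<^esub> \<odot>\<^bsub>?T\<^esub> x = x" using L_one[of c] by (simp add: smultT)
  qed
  with ab show ?thesis by (intro left_module.intro A)
qed

definition induced ::
    "('a, 'c) ring_scheme \<Rightarrow> ('b, 'd) ring_scheme \<Rightarrow> ('b \<Rightarrow> 'a) \<Rightarrow> ('a, 'm) module \<Rightarrow>
     ('a, ('a \<times> 'm \<Rightarrow>\<^sub>0 int) set) module" where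
  "induced A B \<phi> X = tensor A B \<phi> (restrict_scalars \<phi> X)"


section \<open>Relative homological algebra\<close>

definition relatively_exact ::
    "('a, 'c) ring_scheme \<Rightarrow> ('b, 'd) ring_scheme \<Rightarrow> ('b \<Rightarrow> 'a) \<Rightarrow>
     (int \<Rightarrow> ('a, 'm) module) \<Rightarrow> (int \<Rightarrow> 'm \<Rightarrow> 'm) \<Rightarrow> bool" where
  "relatively_exact A B \<phi> M t \<longleftrightarrow> exact_sequence A M t \<and>
     (\<exists>h. (\<forall>i. h i \<in> module_hom B (restrict_scalars \<phi> (M i)) (restrict_scalars \<phi> (M (i + 1)))) \<and>
          (\<forall>i. \<forall>x \<in> carrier (M i). t i x = t i (h (i - 1) (t i x))))"

definition relatively_projective ::
    "('a, 'c) ring_scheme \<Rightarrow> ('b, 'd) ring_scheme \<Rightarrow> ('b \<Rightarrow> 'a) \<Rightarrow>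
     ('a, 'm) module \<Rightarrow> bool" where
  "relatively_projective A B \<phi> X \<longleftrightarrow> iso_to_direct_summand A X (induced A B \<phi> X)"

definition rel_proj_dim ::
    "('a, 'c) ring_scheme \<Rightarrow> ('b, 'd) ring_scheme \<Rightarrow> ('b \<Rightarrow> 'a) \<Rightarrow>
     ('a, 'm) module \<Rightarrow> enat" where
  "rel_proj_dim A B \<phi> X = Inf {enat n | n. \<exists>M t.
     bounded_resolution_shape A X n M t \<and> relatively_exact A B \<phi> M t \<and>
     (\<forall>i\<ge>0. relatively_projective A B \<phi> (M i))}"

definition rel_fin_dim ::
    "('a, 'c) ring_scheme \<Rightarrow> ('b, 'd) ring_scheme \<Rightarrow> ('b \<Rightarrow> 'a) \<Rightarrow> enat" where
  "rel_fin_dim A B \<phi> =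
     Sup {rel_proj_dim A B \<phi> X | X :: 'a umodule. fg_module A X \<and> proj_dim A X < \<infinity>}"

end

theory Submission
  imports Defs "HOL-Library.Multiset"
begin

text \<open>Since \<open>B\<close> is representation-finite, the modules \<open>A \<otimes>\<^sub>B N\<close> with \<open>N\<close> an indecomposable \<open>B\<close>-module have,
  up to isomorphism, only finitely many indecomposable direct summands, and every relatively projective
  module, being a summand of some \<open>A \<otimes>\<^sub>B X\<close>, is a direct sum of copies of these. By Igusa and Todorov, there
  is a common bound for the finite projective dimensions of cokernels of monomorphisms between such direct
  sums: the pairs of direct sums whose \<open>n\<close>-th syzygies are stably isomorphic correspond to an ascending
  chain of subgroups of a free abelian group of finite rank, and the chain stops. This settles relative
  dimension at most 1. In general one argues by induction along \<open>0 \<rightarrow> K \<rightarrow> A \<otimes>\<^sub>B X \<rightarrow> X \<rightarrow> 0\<close>, which is exact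
  both relatively and absolutely; the hypothesis on \<open>A \<otimes>\<^sub>B X\<close> keeps the projective dimension of \<open>K\<close> finite.\<close>

section \<open>Left modules\<close>

text \<open>A relatively projective module may have infinite projective dimension over
  \<open>A\<close>, so nothing can be read off the terms of a relative resolution. What survives is
  this: if the cokernel Z of an injection from X to Y has dimension at most r, then the r-th
  syzygies of X and Y are stably isomorphic. That relation depends only on the multiplicities of the
  summands and, because direct summands can be cancelled (Krull-Schmidt), it is membership in a
  subgroup growing with r; hence it holds at a stage independent of Z. After so many syzygies the
  middle term is the left one plus a projective, and the injection has an endomorphism of X as a
  component. By Fitting's lemma X may be replaced by the summand where this endomorphism is
  nilpotent. That summand has finite projective dimension even if X has not, and its indecomposable
  summands come from a finite list. Syzygies and Schanuel's lemma are needed for ordinary and for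
  B-split sequences, so they are developed once, over a class of admissible surjections. Modules are
  treated up to isomorphism, since sums and quotients tend to leave the one type they range
  over.\<close>

context left_module
begin

lemma smult_l_null [simp]: "x \<in> carrier M \<Longrightarrow> \<zero> \<odot>\<^bsub>M\<^esub> x = \<zero>\<^bsub>M\<^esub>"
  using smult_l_distr[of \<zero> \<zero> x] by (metis M.add.r_cancel_one' R.l_zero R.zero_closed smult_closed)

lemma smult_r_null [simp]: "a \<in> carrier R \<Longrightarrow> a \<odot>\<^bsub>M\<^esub> \<zero>\<^bsub>M\<^esub> = \<zero>\<^bsub>M\<^esub>"
  using smult_r_distr[of a "\<zero>\<^bsub>M\<^esub>" "\<zero>\<^bsub>M\<^esub>"]
  by (metis M.add.r_cancel_one' M.l_zero M.zero_closed smult_closed)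

lemma smult_l_minus: "\<lbrakk>a \<in> carrier R; x \<in> carrier M\<rbrakk> \<Longrightarrow> (\<ominus> a) \<odot>\<^bsub>M\<^esub> x = \<ominus>\<^bsub>M\<^esub> (a \<odot>\<^bsub>M\<^esub> x)"
  using smult_l_distr[of "\<ominus> a" a x] M.minus_equality[of "(\<ominus> a) \<odot>\<^bsub>M\<^esub> x" "a \<odot>\<^bsub>M\<^esub> x"]
  by (simp add: R.l_neg)

lemma smult_r_minus: "\<lbrakk>a \<in> carrier R; x \<in> carrier M\<rbrakk> \<Longrightarrow> a \<odot>\<^bsub>M\<^esub> (\<ominus>\<^bsub>M\<^esub> x) = \<ominus>\<^bsub>M\<^esub> (a \<odot>\<^bsub>M\<^esub> x)"
  using smult_r_distr[of a "\<ominus>\<^bsub>M\<^esub> x" x] M.minus_equality[of "a \<odot>\<^bsub>M\<^esub> (\<ominus>\<^bsub>M\<^esub> x)" "a \<odot>\<^bsub>M\<^esub> x"]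
  by (simp add: M.l_neg)

text \<open>The locale \<open>submodule\<close> asks for an additive subgroup; closure under
  negatives comes for free, since the negative of \<open>x\<close> is its multiple by
  \<open>\<ominus> \<one>\<close>.\<close>

lemma submodule_iff:
  "submodule N R M \<longleftrightarrow> N \<subseteq> carrier M \<and> \<zero>\<^bsub>M\<^esub> \<in> N \<and> (\<forall>x\<in>N. \<forall>y\<in>N. x \<oplus>\<^bsub>M\<^esub> y \<in> N) \<and>
     (\<forall>a\<in>carrier R. \<forall>x\<in>N. a \<odot>\<^bsub>M\<^esub> x \<in> N)"
proof
  assume "submodule N R M"
  then interpret submodule N R M .
  show "N \<subseteq> carrier M \<and> \<zero>\<^bsub>M\<^esub> \<in> N \<and> (\<forall>x\<in>N. \<forall>y\<in>N. x \<oplus>\<^bsub>M\<^esub> y \<in> N) \<and>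
     (\<forall>a\<in>carrier R. \<forall>x\<in>N. a \<odot>\<^bsub>M\<^esub> x \<in> N)"
    using subset one_closed m_closed smult_closed by auto
next
  assume N: "N \<subseteq> carrier M \<and> \<zero>\<^bsub>M\<^esub> \<in> N \<and> (\<forall>x\<in>N. \<forall>y\<in>N. x \<oplus>\<^bsub>M\<^esub> y \<in> N) \<and>
     (\<forall>a\<in>carrier R. \<forall>x\<in>N. a \<odot>\<^bsub>M\<^esub> x \<in> N)"
  have "\<ominus>\<^bsub>M\<^esub> x \<in> N" if "x \<in> N" for x
  proof -
    have x: "x \<in> carrier M" using N that by blast
    then have "\<ominus>\<^bsub>M\<^esub> x = (\<ominus> \<one>) \<odot>\<^bsub>M\<^esub> x" using smult_l_minus[of \<one> x] by simp
    then show ?thesis using N that by simp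
  qed
  then show "submodule N R M"
    using N by (intro submodule.intro subgroup.intro submodule_axioms.intro) (auto simp: a_inv_def)
qed

lemma submoduleI:
  assumes "N \<subseteq> carrier M" "\<zero>\<^bsub>M\<^esub> \<in> N" "\<And>x y. \<lbrakk>x \<in> N; y \<in> N\<rbrakk> \<Longrightarrow> x \<oplus>\<^bsub>M\<^esub> y \<in> N"
    "\<And>a x. \<lbrakk>a \<in> carrier R; x \<in> N\<rbrakk> \<Longrightarrow> a \<odot>\<^bsub>M\<^esub> x \<in> N"
  shows "submodule N R M"
  using assms by (auto simp: submodule_iff)

lemma submoduleD:
  assumes "submodule N R M"
  shows "x \<in> N \<Longrightarrow> x \<in> carrier M" "\<zero>\<^bsub>M\<^esub> \<in> N" "\<lbrakk>x \<in> N; y \<in> N\<rbrakk> \<Longrightarrow> x \<oplus>\<^bsub>M\<^esub> y \<in> N"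
    "\<lbrakk>a \<in> carrier R; x \<in> N\<rbrakk> \<Longrightarrow> a \<odot>\<^bsub>M\<^esub> x \<in> N" "x \<in> N \<Longrightarrow> \<ominus>\<^bsub>M\<^esub> x \<in> N"
    "\<lbrakk>x \<in> N; y \<in> N\<rbrakk> \<Longrightarrow> x \<ominus>\<^bsub>M\<^esub> y \<in> N"
proof -
  note * = assms[unfolded submodule_iff]
  interpret N: submodule N R M by fact
  show neg: "\<ominus>\<^bsub>M\<^esub> x \<in> N" if "x \<in> N" for x using N.m_inv_closed[OF that] by (simp add: a_inv_def)
  show "x \<in> N \<Longrightarrow> x \<in> carrier M" "\<zero>\<^bsub>M\<^esub> \<in> N" "\<lbrakk>x \<in> N; y \<in> N\<rbrakk> \<Longrightarrow> x \<oplus>\<^bsub>M\<^esub> y \<in> N"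
    "\<lbrakk>a \<in> carrier R; x \<in> N\<rbrakk> \<Longrightarrow> a \<odot>\<^bsub>M\<^esub> x \<in> N" "\<lbrakk>x \<in> N; y \<in> N\<rbrakk> \<Longrightarrow> x \<ominus>\<^bsub>M\<^esub> y \<in> N"
    using * neg by (auto simp: a_minus_def)
qed

lemma submodule_zero: "submodule {\<zero>\<^bsub>M\<^esub>} R M" and submodule_carrier: "submodule (carrier M) R M"
  by (auto intro!: submoduleI)

lemma submodule_Inter:
  "\<lbrakk>\<NN> \<noteq> {}; \<And>N. N \<in> \<NN> \<Longrightarrow> submodule N R M\<rbrakk> \<Longrightarrow> submodule (\<Inter>\<NN>) R M"
  unfolding submodule_iff by blast

lemma submodule_Int: "\<lbrakk>submodule N R M; submodule N' R M\<rbrakk> \<Longrightarrow> submodule (N \<inter> N') R M"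
  by (auto simp: submodule_iff)

lemma left_module_submodule: "submodule N R M \<Longrightarrow> left_module R (M\<lparr>carrier := N\<rparr>)"
proof -
  assume N: "submodule N R M"
  note D = submoduleD[OF N]
  have "abelian_group (M\<lparr>carrier := N\<rparr>)"
  proof (rule abelian_groupI)
    fix x assume "x \<in> carrier (M\<lparr>carrier := N\<rparr>)"
    then show "\<exists>y \<in> carrier (M\<lparr>carrier := N\<rparr>). y \<oplus>\<^bsub>M\<lparr>carrier := N\<rparr>\<^esub> x = \<zero>\<^bsub>M\<lparr>carrier := N\<rparr>\<^esub>"
      by (intro bexI[of _ "\<ominus>\<^bsub>M\<^esub> x"]) (use D in \<open>simp_all add: M.l_neg\<close>)
  qed (use D in \<open>simp_all add: M.a_assoc, simp add: M.a_comm\<close>)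
  then show "left_module R (M\<lparr>carrier := N\<rparr>)"
    using D by (intro left_module.intro left_module_axioms.intro R.ring_axioms)
      (simp_all add: smult_l_distr smult_r_distr smult_assoc1)
qed

lemma submodule_submodule:
  "submodule N R M \<Longrightarrow> submodule K R (M\<lparr>carrier := N\<rparr>) \<longleftrightarrow> submodule K R M \<and> K \<subseteq> N"
  using left_module.submodule_iff[OF left_module_submodule, of N K] submodule_iff[of N]
  by (auto simp: submodule_iff)

definition gen_by :: "'m set \<Rightarrow> 'm set \<Rightarrow> bool" where
  "gen_by S N \<longleftrightarrow> S \<subseteq> N \<and> (\<forall>K. submodule K R M \<longrightarrow> S \<subseteq> K \<longrightarrow> N \<subseteq> K)"

lemma gen_by_Inter:
  "S \<subseteq> carrier M \<Longrightarrow> submodule (\<Inter>{K. submodule K R M \<and> S \<subseteq> K}) R M \<and>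
     gen_by S (\<Inter>{K. submodule K R M \<and> S \<subseteq> K})"
  using submodule_carrier by (auto simp: gen_by_def intro!: submodule_Inter)

lemma finsum_smult_ldistr:
  "\<lbrakk>finite S; a \<in> carrier R; f \<in> S \<rightarrow> carrier M\<rbrakk> \<Longrightarrow>
     a \<odot>\<^bsub>M\<^esub> (\<Oplus>\<^bsub>M\<^esub>i\<in>S. f i) = (\<Oplus>\<^bsub>M\<^esub>i\<in>S. a \<odot>\<^bsub>M\<^esub> f i)"
  by (induction S rule: finite_induct) (auto simp: Pi_def smult_r_distr)

lemma submodule_finsum:
  assumes "submodule N R M" "finite S" "f \<in> S \<rightarrow> N"
  shows "(\<Oplus>\<^bsub>M\<^esub>i\<in>S. f i) \<in> N"
  using assms(2,3)
proof (induction S rule: finite_induct)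
  case (insert x S)
  then have "f \<in> S \<rightarrow> carrier M" "f x \<in> carrier M" "f x \<in> N" "f \<in> S \<rightarrow> N"
    using submoduleD(1)[OF assms(1)] by auto
  then show ?case using insert submoduleD(3)[OF assms(1)] by simp
qed (simp add: submoduleD(2)[OF assms(1)])

text \<open>The linear combinations of \<open>S\<close> form a submodule containing
  \<open>S\<close>, so they are everything once \<open>S\<close> generates in the sense of
  \<open>gen_by\<close>; conversely every submodule is closed under finite sums.\<close>

lemma finitely_generated_iff: "finitely_generated R M \<longleftrightarrow> (\<exists>S. finite S \<and> gen_by S (carrier M))"
proof
  assume "finitely_generated R M"
  then obtain S where S: "finite S" "S \<subseteq> carrier M"
    and gen: "\<And>x. x \<in> carrier M \<Longrightarrow> \<exists>c \<in> S \<rightarrow> carrier R. x = (\<Oplus>\<^bsub>M\<^esub>s\<in>S. c s \<odot>\<^bsub>M\<^esub> s)"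
    by (auto simp: finitely_generated_def)
  have "gen_by S (carrier M)"
    unfolding gen_by_def
  proof (intro conjI allI impI subsetI)
    fix K x assume K: "submodule K R M" "S \<subseteq> K" and "x \<in> carrier M"
    then obtain c where c: "c \<in> S \<rightarrow> carrier R" "x = (\<Oplus>\<^bsub>M\<^esub>s\<in>S. c s \<odot>\<^bsub>M\<^esub> s)" using gen by blast
    then show "x \<in> K" using K S by (auto intro!: submodule_finsum submoduleD(4))
  qed (use S in auto)
  then show "\<exists>S. finite S \<and> gen_by S (carrier M)" using S by blast
next
  assume "\<exists>S. finite S \<and> gen_by S (carrier M)"
  then obtain S where S: "finite S" "S \<subseteq> carrier M"
    and gen: "\<And>K. submodule K R M \<Longrightarrow> S \<subseteq> K \<Longrightarrow> carrier M \<subseteq> K" by (auto simp: gen_by_def)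
  let ?L = "\<lambda>c. (\<Oplus>\<^bsub>M\<^esub>s\<in>S. c s \<odot>\<^bsub>M\<^esub> s)"
  have cl: "(\<lambda>s. c s \<odot>\<^bsub>M\<^esub> s) \<in> S \<rightarrow> carrier M" if "c \<in> S \<rightarrow> carrier R" for c using that S by auto
  have "carrier M \<subseteq> ?L ` (S \<rightarrow> carrier R)"
  proof (rule gen)
    show "submodule (?L ` (S \<rightarrow> carrier R)) R M"
    proof (rule submoduleI)
      show "?L ` (S \<rightarrow> carrier R) \<subseteq> carrier M" using cl by auto
      have "?L (\<lambda>_. \<zero>) = (\<Oplus>\<^bsub>M\<^esub>s\<in>S. \<zero>\<^bsub>M\<^esub>)" using S by (intro M.finsum_cong') auto
      then have "?L (\<lambda>_. \<zero>) = \<zero>\<^bsub>M\<^esub>" by simp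
      then show "\<zero>\<^bsub>M\<^esub> \<in> ?L ` (S \<rightarrow> carrier R)" by (intro image_eqI[of _ _ "\<lambda>_. \<zero>"]) auto
    next
      fix x y assume "x \<in> ?L ` (S \<rightarrow> carrier R)" "y \<in> ?L ` (S \<rightarrow> carrier R)"
      then obtain c d where cd: "c \<in> S \<rightarrow> carrier R" "d \<in> S \<rightarrow> carrier R" "x = ?L c" "y = ?L d" by blast
      have "x \<oplus>\<^bsub>M\<^esub> y = (\<Oplus>\<^bsub>M\<^esub>s\<in>S. c s \<odot>\<^bsub>M\<^esub> s \<oplus>\<^bsub>M\<^esub> d s \<odot>\<^bsub>M\<^esub> s)"
        unfolding cd using M.finsum_addf[OF cl[OF cd(1)] cl[OF cd(2)]] by simp
      also have "\<dots> = ?L (\<lambda>s. c s \<oplus> d s)"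
        using cd(1,2) S by (intro M.finsum_cong') (auto simp: smult_l_distr Pi_iff subset_iff)
      finally show "x \<oplus>\<^bsub>M\<^esub> y \<in> ?L ` (S \<rightarrow> carrier R)"
        using cd(1,2) by (intro image_eqI[of _ _ "\<lambda>s. c s \<oplus> d s"]) auto
    next
      fix a x assume "a \<in> carrier R" "x \<in> ?L ` (S \<rightarrow> carrier R)"
      then obtain c where a: "a \<in> carrier R" and c: "c \<in> S \<rightarrow> carrier R" "x = ?L c" by blast
      have "a \<odot>\<^bsub>M\<^esub> x = (\<Oplus>\<^bsub>M\<^esub>s\<in>S. a \<odot>\<^bsub>M\<^esub> (c s \<odot>\<^bsub>M\<^esub> s))"
        unfolding c using finsum_smult_ldistr[OF S(1) a cl[OF c(1)]] .
      also have "\<dots> = ?L (\<lambda>s. a \<otimes> c s)"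
        using a c(1) S by (intro M.finsum_cong') (auto simp: smult_assoc1 Pi_iff subset_iff)
      finally show "a \<odot>\<^bsub>M\<^esub> x \<in> ?L ` (S \<rightarrow> carrier R)"
        using c a by (intro image_eqI[of _ _ "\<lambda>s. a \<otimes> c s"]) auto
    qed
    show "S \<subseteq> ?L ` (S \<rightarrow> carrier R)"
    proof
      fix s assume s: "s \<in> S"
      have "?L (\<lambda>t. if s = t then \<one> else \<zero>) = (\<Oplus>\<^bsub>M\<^esub>t\<in>S. if s = t then s else \<zero>\<^bsub>M\<^esub>)"
        using S s by (intro M.finsum_cong') auto
      also have "\<dots> = s" using M.finsum_singleton[OF s S(1), of "\<lambda>_. s"] S s by auto
      finally show "s \<in> ?L ` (S \<rightarrow> carrier R)" by (intro image_eqI[of _ _ "\<lambda>t. if s = t then \<one> else \<zero>"]) auto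
    qed
  qed
  then show "finitely_generated R M" using S unfolding finitely_generated_def by blast
qed

text \<open>A submodule of \<open>M\<close> containing \<open>S\<close> becomes one of
  \<open>N\<close> by intersecting with \<open>N\<close>, so generation may be tested in the ambient
  module.\<close>

lemma finitely_generated_submodule_iff:
  assumes "submodule N R M"
  shows "finitely_generated R (M\<lparr>carrier := N\<rparr>) \<longleftrightarrow> (\<exists>S. finite S \<and> gen_by S N)"
proof -
  interpret N: left_module R "M\<lparr>carrier := N\<rparr>" by (rule left_module_submodule[OF assms])
  have "N.gen_by S N \<longleftrightarrow> gen_by S N" for S
  proof
    assume *: "N.gen_by S N"
    show "gen_by S N" unfolding gen_by_def
    proof (intro conjI allI impI)
      fix K assume K: "submodule K R M" "S \<subseteq> K"
      have "submodule (K \<inter> N) R (M\<lparr>carrier := N\<rparr>)"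
        using submodule_submodule[OF assms] submodule_Int[OF K(1) assms] by auto
      then show "N \<subseteq> K" using * K unfolding N.gen_by_def by blast
    qed (use * in \<open>auto simp: N.gen_by_def\<close>)
  qed (auto simp: N.gen_by_def gen_by_def submodule_submodule[OF assms])
  then show ?thesis using N.finitely_generated_iff by simp
qed

end

section \<open>Homomorphisms of left modules\<close>

lemma module_hom_closed: "\<lbrakk>f \<in> module_hom A M N; x \<in> carrier M\<rbrakk> \<Longrightarrow> f x \<in> carrier N"
  and module_hom_add: "\<lbrakk>f \<in> module_hom A M N; x \<in> carrier M; y \<in> carrier M\<rbrakk> \<Longrightarrow> f (x \<oplus>\<^bsub>M\<^esub> y) = f x \<oplus>\<^bsub>N\<^esub> f y"
  and module_hom_smult: "\<lbrakk>f \<in> module_hom A M N; a \<in> carrier A; x \<in> carrier M\<rbrakk> \<Longrightarrow> f (a \<odot>\<^bsub>M\<^esub> x) = a \<odot>\<^bsub>N\<^esub> f x"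
  by (auto simp: module_hom_def)

lemma module_homI:
  assumes "\<And>x. x \<in> carrier M \<Longrightarrow> f x \<in> carrier N"
    "\<And>x y. \<lbrakk>x \<in> carrier M; y \<in> carrier M\<rbrakk> \<Longrightarrow> f (x \<oplus>\<^bsub>M\<^esub> y) = f x \<oplus>\<^bsub>N\<^esub> f y"
    "\<And>a x. \<lbrakk>a \<in> carrier A; x \<in> carrier M\<rbrakk> \<Longrightarrow> f (a \<odot>\<^bsub>M\<^esub> x) = a \<odot>\<^bsub>N\<^esub> f x"
  shows "f \<in> module_hom A M N"
  using assms by (auto simp: module_hom_def)

lemma
  assumes M: "left_module A M" and N: "left_module A N" and f: "f \<in> module_hom A M N"
  shows module_hom_zero: "f \<zero>\<^bsub>M\<^esub> = \<zero>\<^bsub>N\<^esub>"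
    and module_hom_neg: "x \<in> carrier M \<Longrightarrow> f (\<ominus>\<^bsub>M\<^esub> x) = \<ominus>\<^bsub>N\<^esub> f x"
    and module_hom_minus: "x \<in> carrier M \<Longrightarrow> y \<in> carrier M \<Longrightarrow> f (x \<ominus>\<^bsub>M\<^esub> y) = f x \<ominus>\<^bsub>N\<^esub> f y"
    and module_hom_image: "submodule K A M \<Longrightarrow> submodule (f ` K) A N"
    and module_hom_vimage: "submodule L A N \<Longrightarrow> submodule {x \<in> carrier M. f x \<in> L} A M"
proof -
  interpret M: left_module A M by fact
  interpret N: left_module A N by fact
  note c [simp] = module_hom_closed[OF f] module_hom_add[OF f] module_hom_smult[OF f]
  show z [simp]: "f \<zero>\<^bsub>M\<^esub> = \<zero>\<^bsub>N\<^esub>"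
    using c(2)[of "\<zero>\<^bsub>M\<^esub>" "\<zero>\<^bsub>M\<^esub>"] c(1)[of "\<zero>\<^bsub>M\<^esub>"]
    by (metis M.M.l_zero M.M.zero_closed N.M.add.r_cancel_one')
  show neg: "f (\<ominus>\<^bsub>M\<^esub> x) = \<ominus>\<^bsub>N\<^esub> f x" if "x \<in> carrier M" for x
    using c(2)[of "\<ominus>\<^bsub>M\<^esub> x" x] N.M.minus_equality[of "f (\<ominus>\<^bsub>M\<^esub> x)" "f x"] that
    by (simp add: M.M.l_neg)
  show "f (x \<ominus>\<^bsub>M\<^esub> y) = f x \<ominus>\<^bsub>N\<^esub> f y" if "x \<in> carrier M" "y \<in> carrier M"
    using that by (simp add: a_minus_def neg)
  show "submodule (f ` K) A N" if K: "submodule K A M"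
  proof (rule N.submoduleI)
    note D = M.submoduleD[OF K]
    show "f ` K \<subseteq> carrier N" using D by auto
    show "\<zero>\<^bsub>N\<^esub> \<in> f ` K" using D(2) z by (metis image_eqI)
    fix x y assume "x \<in> f ` K" "y \<in> f ` K"
    then obtain x' y' where "x' \<in> K" "y' \<in> K" "x = f x'" "y = f y'" by blast
    then show "x \<oplus>\<^bsub>N\<^esub> y \<in> f ` K" using D by (metis (no_types, lifting) c(2) image_eqI)
  next
    note D = M.submoduleD[OF K]
    fix a x assume "a \<in> carrier A" "x \<in> f ` K"
    then obtain x' where "x' \<in> K" "x = f x'" "a \<in> carrier A" by blast
    then show "a \<odot>\<^bsub>N\<^esub> x \<in> f ` K" using D by (metis (no_types, lifting) c(3) image_eqI)
  qed
  show "submodule {x \<in> carrier M. f x \<in> L} A M" if L: "submodule L A N"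
    using N.submoduleD[OF L] by (intro M.submoduleI) auto
qed

section \<open>Finitely generated modules over an Artinian commutative ring\<close>

lemma (in abelian_group) minus_add_cancel:
  "\<lbrakk>x \<in> carrier G; y \<in> carrier G\<rbrakk> \<Longrightarrow> (x \<ominus> y) \<oplus> y = x"
  "\<lbrakk>x \<in> carrier G; y \<in> carrier G\<rbrakk> \<Longrightarrow> (x \<oplus> y) \<ominus> y = x"
  "\<lbrakk>x \<in> carrier G; y \<in> carrier G\<rbrakk> \<Longrightarrow> y \<oplus> (x \<ominus> y) = x"
  "\<lbrakk>x \<in> carrier G; y \<in> carrier G\<rbrakk> \<Longrightarrow> (y \<oplus> x) \<ominus> y = x"
     apply (simp_all add: a_minus_def a_assoc l_neg r_neg)
   apply (metis a_comm a_assoc a_inv_closed r_neg r_zero)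
  apply (metis a_comm a_assoc a_inv_closed r_neg r_zero)
  done

lemma (in abelian_group) diff_eq_0_iff:
  "\<lbrakk>x \<in> carrier G; y \<in> carrier G\<rbrakk> \<Longrightarrow> x \<ominus> y = \<zero> \<longleftrightarrow> x = y"
  using minus_add_cancel(1)[of x y] by (auto simp: a_minus_def r_neg)

lemma (in abelian_group) diff_add_eq:
  "\<lbrakk>x \<in> carrier G; y \<in> carrier G; u \<in> carrier G; v \<in> carrier G\<rbrakk> \<Longrightarrow>
     (x \<oplus> y) \<ominus> (u \<oplus> v) = (x \<ominus> u) \<oplus> (y \<ominus> v)"
  by (simp add: a_minus_def minus_add a_ac)

context left_module
begin

lemma submodule_sum:
  assumes "submodule N R M" "submodule K R M"
  shows "submodule {x \<oplus>\<^bsub>M\<^esub> y | x y. x \<in> N \<and> y \<in> K} R M"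
proof (rule submoduleI)
  note D = submoduleD[OF assms(1)] and E = submoduleD[OF assms(2)]
  let ?S = "{x \<oplus>\<^bsub>M\<^esub> y | x y. x \<in> N \<and> y \<in> K}"
  show "?S \<subseteq> carrier M" using D E by auto
  show "\<zero>\<^bsub>M\<^esub> \<in> ?S" using D(2) E(2) M.l_zero[OF M.zero_closed] by (metis (mono_tags, lifting) mem_Collect_eq)
  show "x \<oplus>\<^bsub>M\<^esub> y \<in> ?S" if "x \<in> ?S" "y \<in> ?S" for x y
  proof -
    obtain a b c d where "a \<in> N" "b \<in> K" "c \<in> N" "d \<in> K" "x = a \<oplus>\<^bsub>M\<^esub> b" "y = c \<oplus>\<^bsub>M\<^esub> d"
      using \<open>x \<in> ?S\<close> \<open>y \<in> ?S\<close> by blast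
    then have "x \<oplus>\<^bsub>M\<^esub> y = (a \<oplus>\<^bsub>M\<^esub> c) \<oplus>\<^bsub>M\<^esub> (b \<oplus>\<^bsub>M\<^esub> d)"
      using D E by (simp add: M.a_ac)
    then show ?thesis using D(3) E(3) \<open>a \<in> N\<close> \<open>b \<in> K\<close> \<open>c \<in> N\<close> \<open>d \<in> K\<close> by blast
  qed
  show "a \<odot>\<^bsub>M\<^esub> x \<in> ?S" if "a \<in> carrier R" "x \<in> ?S" for a x
  proof -
    obtain u v where "u \<in> N" "v \<in> K" "x = u \<oplus>\<^bsub>M\<^esub> v" using \<open>x \<in> ?S\<close> by blast
    then have "a \<odot>\<^bsub>M\<^esub> x = (a \<odot>\<^bsub>M\<^esub> u) \<oplus>\<^bsub>M\<^esub> (a \<odot>\<^bsub>M\<^esub> v)"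
      using D E that by (simp add: smult_r_distr)
    then show ?thesis using D(4) E(4) \<open>u \<in> N\<close> \<open>v \<in> K\<close> that by blast
  qed
qed

lemma submodule_cyclic:
  assumes x: "x \<in> carrier M"
  shows "submodule {a \<odot>\<^bsub>M\<^esub> x | a. a \<in> carrier R} R M"
proof -
  let ?S = "(\<lambda>a. a \<odot>\<^bsub>M\<^esub> x) ` carrier R"
  have "submodule ?S R M"
  proof (rule submoduleI)
    show "?S \<subseteq> carrier M" using x by auto
    show "\<zero>\<^bsub>M\<^esub> \<in> ?S" using smult_l_null[OF x, symmetric] by (rule image_eqI) simp
    fix u v assume "u \<in> ?S" "v \<in> ?S"
    then obtain a b where ab: "a \<in> carrier R" "b \<in> carrier R" "u = a \<odot>\<^bsub>M\<^esub> x" "v = b \<odot>\<^bsub>M\<^esub> x" by blast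
    show "u \<oplus>\<^bsub>M\<^esub> v \<in> ?S" using ab x by (intro image_eqI[of _ _ "a \<oplus> b"]) (simp_all add: smult_l_distr)
  next
    fix a u assume a: "a \<in> carrier R" and "u \<in> ?S"
    then obtain b where b: "b \<in> carrier R" "u = b \<odot>\<^bsub>M\<^esub> x" by blast
    show "a \<odot>\<^bsub>M\<^esub> u \<in> ?S" using a b x by (intro image_eqI[of _ _ "a \<otimes> b"]) (simp_all add: smult_assoc1)
  qed
  moreover have "?S = {a \<odot>\<^bsub>M\<^esub> x | a. a \<in> carrier R}" by blast
  ultimately show ?thesis by simp
qed

lemma gen_by_insert:
  assumes x: "x \<in> carrier M" and N: "submodule N R M" "gen_by S N"
  shows "gen_by (insert x S) {u \<oplus>\<^bsub>M\<^esub> v | u v. u \<in> N \<and> v \<in> {a \<odot>\<^bsub>M\<^esub> x | a. a \<in> carrier R}}"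
  unfolding gen_by_def
proof (intro conjI allI impI)
  note D = submoduleD[OF N(1)]
  have "u \<in> {u \<oplus>\<^bsub>M\<^esub> v | u v. u \<in> N \<and> v \<in> {a \<odot>\<^bsub>M\<^esub> x | a. a \<in> carrier R}}" if "u \<in> N" for u
  proof -
    have "u = u \<oplus>\<^bsub>M\<^esub> \<zero> \<odot>\<^bsub>M\<^esub> x" using that D x by simp
    then show ?thesis using that R.zero_closed by blast
  qed
  moreover have "\<zero>\<^bsub>M\<^esub> \<oplus>\<^bsub>M\<^esub> \<one> \<odot>\<^bsub>M\<^esub> x = x" using x by simp
  then have "x \<in> {u \<oplus>\<^bsub>M\<^esub> v | u v. u \<in> N \<and> v \<in> {a \<odot>\<^bsub>M\<^esub> x | a. a \<in> carrier R}}"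
    using D(2) R.one_closed by (metis (mono_tags, lifting) mem_Collect_eq)
  ultimately show "insert x S \<subseteq> {u \<oplus>\<^bsub>M\<^esub> v | u v. u \<in> N \<and> v \<in> {a \<odot>\<^bsub>M\<^esub> x | a. a \<in> carrier R}}"
    using N(2) by (auto simp: gen_by_def)
  fix K assume K: "submodule K R M" "insert x S \<subseteq> K"
  then have "N \<subseteq> K" "x \<in> K" using N(2) by (auto simp: gen_by_def)
  then show "{u \<oplus>\<^bsub>M\<^esub> v | u v. u \<in> N \<and> v \<in> {a \<odot>\<^bsub>M\<^esub> x | a. a \<in> carrier R}} \<subseteq> K"
    using submoduleD[OF K(1)] by auto
qed

text \<open>Induction on the number of generators: with \<open>K\<close> the span of the other
  generators, a chain is controlled by its traces on \<open>K\<close> and by the ideals of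
  coefficients that occur in front of the new generator \<open>x\<close>. The chain only has to
  start inside \<open>T\<close>, which keeps the induction going when \<open>T\<close> is replaced
  by \<open>K\<close>.\<close>

lemma dcc_gen_by:
  assumes "artinian_cring R" "finite S" "S \<subseteq> carrier M" "submodule T R M" "gen_by S T"
    "\<And>n::nat. submodule (N n) R M" "\<And>n. N (Suc n) \<subseteq> N n" "N 0 \<subseteq> T"
  shows "\<exists>k. \<forall>n\<ge>k. N n = N k"
  using assms(2-)
proof (induction S arbitrary: T N rule: finite_induct)
  case empty
  then have "T = {\<zero>\<^bsub>M\<^esub>}"
    using submodule_zero submoduleD(2)[of T] unfolding gen_by_def by blast
  moreover have "N n \<subseteq> N 0" for n using lift_Suc_antimono_le[of N, OF empty(5)] by blast
  ultimately have "N n = {\<zero>\<^bsub>M\<^esub>}" for n using empty submoduleD(2)[OF empty(4)] by blast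
  then show ?case by simp
next
  case (insert x S)
  interpret R: artinian_cring R by fact
  have x: "x \<in> carrier M" and S: "S \<subseteq> carrier M" using insert by auto
  obtain K where K: "submodule K R M" "gen_by S K" using gen_by_Inter[OF S] by blast
  note D = submoduleD[OF K(1)] and E = submoduleD[OF insert.prems(4)]
  let ?T = "{u \<oplus>\<^bsub>M\<^esub> v | u v. u \<in> K \<and> v \<in> {a \<odot>\<^bsub>M\<^esub> x | a. a \<in> carrier R}}"
  have "T \<subseteq> ?T" using insert.prems(3) gen_by_insert[OF x K] submodule_sum[OF K(1) submodule_cyclic[OF x]]
    unfolding gen_by_def by blast
  have mono: "N n \<subseteq> N m" if "m \<le> n" for m n using lift_Suc_antimono_le[of N, OF insert.prems(5)] that by blast
  \<comment> \<open>The coefficients that \<open>x\<close> can have in an element of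
    \<open>N n\<close>; this ideal plays the role of the image of \<open>N n\<close> modulo
    \<open>K\<close>.\<close>
  define I where "I n = {r \<in> carrier R. \<exists>t\<in>K. t \<oplus>\<^bsub>M\<^esub> r \<odot>\<^bsub>M\<^esub> x \<in> N n}" for n
  have "ideal (I n) R" for n
  proof (rule idealI[OF R.ring_axioms])
    show "subgroup (I n) (add_monoid R)"
    proof (rule R.add.subgroupI)
      show "I n \<subseteq> carrier R" by (auto simp: I_def)
      have "\<zero> \<in> I n" using x D(2) E(2)[of n] by (auto simp: I_def intro!: bexI[of _ "\<zero>\<^bsub>M\<^esub>"])
      then show "I n \<noteq> {}" by blast
    next
      fix r assume "r \<in> I n"
      then obtain t where "r \<in> carrier R" "t \<in> K" "t \<oplus>\<^bsub>M\<^esub> r \<odot>\<^bsub>M\<^esub> x \<in> N n" by (auto simp: I_def)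
      then have "\<ominus>\<^bsub>M\<^esub> t \<oplus>\<^bsub>M\<^esub> (\<ominus> r) \<odot>\<^bsub>M\<^esub> x \<in> N n"
        using E(5)[of "t \<oplus>\<^bsub>M\<^esub> r \<odot>\<^bsub>M\<^esub> x" n] D x by (simp add: smult_l_minus M.minus_add)
      then show "\<ominus> r \<in> I n" using D(5)[OF \<open>t \<in> K\<close>] \<open>r \<in> carrier R\<close> by (auto simp: I_def)
    next
      fix r s assume "r \<in> I n" "s \<in> I n"
      then obtain t u where *: "r \<in> carrier R" "t \<in> K" "t \<oplus>\<^bsub>M\<^esub> r \<odot>\<^bsub>M\<^esub> x \<in> N n"
        "s \<in> carrier R" "u \<in> K" "u \<oplus>\<^bsub>M\<^esub> s \<odot>\<^bsub>M\<^esub> x \<in> N n" by (auto simp: I_def)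
      have "(t \<oplus>\<^bsub>M\<^esub> u) \<oplus>\<^bsub>M\<^esub> (r \<oplus> s) \<odot>\<^bsub>M\<^esub> x = (t \<oplus>\<^bsub>M\<^esub> r \<odot>\<^bsub>M\<^esub> x) \<oplus>\<^bsub>M\<^esub> (u \<oplus>\<^bsub>M\<^esub> s \<odot>\<^bsub>M\<^esub> x)"
        using * D(1) x by (simp add: smult_l_distr M.a_ac)
      then have "(t \<oplus>\<^bsub>M\<^esub> u) \<oplus>\<^bsub>M\<^esub> (r \<oplus> s) \<odot>\<^bsub>M\<^esub> x \<in> N n" using E(3)[OF *(3,6)] by simp
      then show "r \<oplus> s \<in> I n" using D(3) * by (auto simp: I_def)
    qed
    fix r s assume "r \<in> I n" "s \<in> carrier R"
    then obtain t where *: "r \<in> carrier R" "t \<in> K" "t \<oplus>\<^bsub>M\<^esub> r \<odot>\<^bsub>M\<^esub> x \<in> N n" "s \<in> carrier R" by (auto simp: I_def)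
    have "s \<odot>\<^bsub>M\<^esub> t \<oplus>\<^bsub>M\<^esub> (s \<otimes> r) \<odot>\<^bsub>M\<^esub> x = s \<odot>\<^bsub>M\<^esub> (t \<oplus>\<^bsub>M\<^esub> r \<odot>\<^bsub>M\<^esub> x)"
      using * D(1) x by (simp add: smult_r_distr smult_assoc1)
    then have "s \<odot>\<^bsub>M\<^esub> t \<oplus>\<^bsub>M\<^esub> (s \<otimes> r) \<odot>\<^bsub>M\<^esub> x \<in> N n" using E(4)[OF *(4,3)] by simp
    then show 1: "s \<otimes> r \<in> I n" using * D(4) by (auto simp: I_def)
    then show "r \<otimes> s \<in> I n" using * R.m_comm by simp
  qed
  moreover have "I (Suc n) \<subseteq> I n" for n using insert.prems(5) by (auto simp: I_def)
  ultimately obtain k1 where k1: "\<And>n. n \<ge> k1 \<Longrightarrow> I n = I k1" using R.descending_chain_condition[of I] by blast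
  have "\<exists>k. \<forall>n\<ge>k. N n \<inter> K = N k \<inter> K"
    using insert.prems(4,5) S K by (intro insert.IH[of K]) (auto intro: submodule_Int)
  then obtain k2 where k2: "\<And>n. n \<ge> k2 \<Longrightarrow> N n \<inter> K = N k2 \<inter> K" by blast
  define k where "k = max k1 k2"
  have "N k \<subseteq> N n" if n: "n \<ge> k" for n
  proof
    fix u assume u: "u \<in> N k"
    then have "u \<in> ?T" using mono[of 0 k] insert.prems(6) \<open>T \<subseteq> ?T\<close> by auto
    then obtain t r where t: "t \<in> K" "r \<in> carrier R" "u = t \<oplus>\<^bsub>M\<^esub> r \<odot>\<^bsub>M\<^esub> x" by blast
    then have "r \<in> I k" using u by (auto simp: I_def)
    then have "r \<in> I n" using k1[of k] k1[of n] n by (simp add: k_def)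
    then obtain t' where t': "t' \<in> K" "t' \<oplus>\<^bsub>M\<^esub> r \<odot>\<^bsub>M\<^esub> x \<in> N n" by (auto simp: I_def)
    let ?u = "t' \<oplus>\<^bsub>M\<^esub> r \<odot>\<^bsub>M\<^esub> x"
    have c: "t \<in> carrier M" "t' \<in> carrier M" "r \<odot>\<^bsub>M\<^esub> x \<in> carrier M" using t t' D x by auto
    \<comment> \<open>\<open>u\<close> and \<open>?u\<close> have the same coefficient of
      \<open>x\<close>, so their difference lies in \<open>K\<close>, where the traces of the chain
      have become stationary.\<close>
    have eq: "u \<ominus>\<^bsub>M\<^esub> ?u = t \<ominus>\<^bsub>M\<^esub> t'" using c by (simp add: t M.diff_add_eq M.diff_eq_0_iff)
    have "u \<ominus>\<^bsub>M\<^esub> ?u \<in> N k" using E(6)[OF u] t'(2) mono[OF n] by blast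
    then have "u \<ominus>\<^bsub>M\<^esub> ?u \<in> N k \<inter> K" using eq D(6)[OF t(1) t'(1)] by simp
    then have "u \<ominus>\<^bsub>M\<^esub> ?u \<in> N n" using k2[of k] k2[of n] n by (auto simp: k_def)
    then have "(u \<ominus>\<^bsub>M\<^esub> ?u) \<oplus>\<^bsub>M\<^esub> ?u \<in> N n" using E(3) t'(2) by blast
    then show "u \<in> N n" using c t by (simp add: M.minus_add_cancel)
  qed
  then show ?case using mono by blast
qed

end

text \<open>Iterating a choice of strictly smaller members would give a strictly decreasing chain.
  The predicate \<open>P\<close> carries what the chain condition needs, so that
  \<open>\<XX>\<close> may be any nonempty family of sets satisfying it.\<close>

lemma dcc_minimal:
  assumes dcc: "\<And>N. \<lbrakk>\<And>n::nat. P (N n); \<And>n. N (Suc n) \<subseteq> N n\<rbrakk> \<Longrightarrow> \<exists>k. \<forall>n\<ge>k. N n = N k"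
    and X: "X \<in> \<XX>" and P: "\<And>X. X \<in> \<XX> \<Longrightarrow> P X"
  shows "\<exists>U\<in>\<XX>. \<forall>Y\<in>\<XX>. Y \<subseteq> U \<longrightarrow> Y = U"
proof (rule ccontr)
  assume "\<not> ?thesis"
  then have "\<forall>U\<in>\<XX>. \<exists>Y\<in>\<XX>. Y \<subset> U" by blast
  then obtain g where g: "\<And>U. U \<in> \<XX> \<Longrightarrow> g U \<in> \<XX> \<and> g U \<subset> U" by metis
  have mem: "(g ^^ n) X \<in> \<XX>" for n by (induction n) (use X g in auto)
  have "\<exists>k. \<forall>n\<ge>k. (g ^^ n) X = (g ^^ k) X"
    using mem P g by (intro dcc) auto
  then obtain k where "(g ^^ Suc k) X = (g ^^ k) X" by (meson le_SucI order_refl)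
  then show False using g[OF mem[of k]] by auto
qed

text \<open>No structure theory of Artinian rings is used. On a minimal submodule \<open>U\<close>
  that is not finitely generated, every ring element would act as zero or invertibly, so
  \<open>U\<close> would be a vector space over a field. A hyperplane avoiding a vector
  \<open>u\<close> is finitely generated by minimality, and together with \<open>u\<close> it
  generates \<open>U\<close>, a contradiction.\<close>

theorem artinian_cring_submodule_fg:
  fixes R :: "('r, 'c) ring_scheme" (structure)
  assumes R: "artinian_cring R" and M: "fg_module R M" and N: "submodule N R M"
  shows "fg_module R (M\<lparr>carrier := N\<rparr>)"
proof -
  interpret R: artinian_cring R by fact
  interpret left_module R M using M by (simp add: fg_module_def)
  obtain S where S: "finite S" "gen_by S (carrier M)"
    using M unfolding fg_module_def finitely_generated_iff by blast
  have SM: "S \<subseteq> carrier M" using S by (simp add: gen_by_def)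
  have "\<exists>S. finite S \<and> gen_by S N"
  proof (rule ccontr)
    assume nfg: "\<nexists>S. finite S \<and> gen_by S N"
    let ?X = "{U. submodule U R M \<and> (\<nexists>S. finite S \<and> gen_by S U)}"
    have dcc: "\<exists>k. \<forall>n\<ge>k. L n = L k"
      if L: "\<And>n. submodule (L n) R M" "\<And>n. L (Suc n) \<subseteq> L n" for L :: "nat \<Rightarrow> _"
    proof -
      have "L 0 \<subseteq> carrier M" using submoduleD(1)[OF L(1)] by blast
      then show ?thesis using dcc_gen_by[where N = L, OF R S(1) SM submodule_carrier S(2)] L by simp
    qed
    have "\<exists>U\<in>?X. \<forall>Y\<in>?X. Y \<subseteq> U \<longrightarrow> Y = U"
      using dcc N nfg by (intro dcc_minimal[where P = "\<lambda>U. submodule U R M" and X = N and \<XX> = ?X]) auto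
    then obtain U where "U \<in> ?X" and minU: "\<And>Y. Y \<in> ?X \<Longrightarrow> Y \<subseteq> U \<Longrightarrow> Y = U" by (elim bexE) simp
    then have U: "submodule U R M" "\<nexists>S. finite S \<and> gen_by S U" by simp_all
    have min: "\<exists>S. finite S \<and> gen_by S Y" if "submodule Y R M" "Y \<subseteq> U" "Y \<noteq> U" for Y
      using minU[of Y] that by (cases "\<exists>S. finite S \<and> gen_by S Y") simp_all
    note D = submoduleD[OF U(1)]
    have comm: "r \<odot>\<^bsub>M\<^esub> (s \<odot>\<^bsub>M\<^esub> x) = s \<odot>\<^bsub>M\<^esub> (r \<odot>\<^bsub>M\<^esub> x)"
      if "r \<in> carrier R" "s \<in> carrier R" "x \<in> carrier M" for r s x
      using that by (metis smult_assoc1 R.m_comm)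
    have rU_sub: "submodule ((\<lambda>u. r \<odot>\<^bsub>M\<^esub> u) ` K) R M" if r: "r \<in> carrier R" and K: "submodule K R M" for r K
    proof -
      have "(\<lambda>u. r \<odot>\<^bsub>M\<^esub> u) \<in> module_hom R M M"
        using r by (intro module_homI) (simp_all add: smult_r_distr comm)
      then show ?thesis by (rule module_hom_image[OF left_module_axioms left_module_axioms _ K])
    qed
    \<comment> \<open>If neither held, the image and the kernel of \<open>r\<close> on
      \<open>U\<close> would both be proper submodules, finitely generated by minimality, and then
      so would be their extension \<open>U\<close>.\<close>
    have zero_or_onto: "(\<lambda>u. r \<odot>\<^bsub>M\<^esub> u) ` U = U \<or> (\<forall>u\<in>U. r \<odot>\<^bsub>M\<^esub> u = \<zero>\<^bsub>M\<^esub>)" if r: "r \<in> carrier R" for r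
    proof (rule ccontr)
      assume neg: "\<not> ?thesis"
      let ?f = "\<lambda>u. r \<odot>\<^bsub>M\<^esub> u"
      have "?f ` U \<subseteq> U" using D r by auto
      then obtain S1 where S1: "finite S1" "gen_by S1 (?f ` U)"
        using min[OF rU_sub[OF r U(1)]] neg by blast
      then obtain S1' where S1': "finite S1'" "S1' \<subseteq> U" "S1 = ?f ` S1'"
        unfolding gen_by_def by (meson finite_subset_image)
      define K where "K = {u\<in>U. ?f u = \<zero>\<^bsub>M\<^esub>}"
      have K: "submodule K R M"
        unfolding K_def using D r
        by (intro submoduleI) (auto simp: smult_r_distr comm[of r])
      have "K \<subseteq> U" "K \<noteq> U" using neg by (auto simp: K_def)
      then obtain S2 where S2: "finite S2" "gen_by S2 K" using min[OF K] by blast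
      have "gen_by (S1' \<union> S2) U"
        unfolding gen_by_def
      proof (intro conjI allI impI subsetI)
        fix x assume "x \<in> S1' \<union> S2" then show "x \<in> U" using S1' S2 \<open>K \<subseteq> U\<close> by (auto simp: gen_by_def)
      next
        fix L u assume L: "submodule L R M" "S1' \<union> S2 \<subseteq> L" and u: "u \<in> U"
        have "?f ` U \<subseteq> ?f ` (L \<inter> U)"
          using S1 S1' L rU_sub[OF r submodule_Int[OF L(1) U(1)]] unfolding gen_by_def by blast
        then obtain n where n: "n \<in> L" "n \<in> U" "?f u = ?f n" using u by blast
        have "u \<ominus>\<^bsub>M\<^esub> n \<in> K"
          using n u D r by (auto simp: K_def a_minus_def smult_r_distr smult_r_minus M.r_neg)
        then have "u \<ominus>\<^bsub>M\<^esub> n \<in> L" using S2 L by (auto simp: gen_by_def)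
        then have "(u \<ominus>\<^bsub>M\<^esub> n) \<oplus>\<^bsub>M\<^esub> n \<in> L" using n submoduleD[OF L(1)] by blast
        then show "u \<in> L" using u n D by (simp add: M.minus_add_cancel)
      qed
      then show False using U(2) S1' S2 by blast
    qed
    \<comment> \<open>Stabilisation of the principal ideals of the powers of \<open>r\<close> gives
      \<open>r [^] k = s \<otimes> r [^] Suc k\<close>. Every element of \<open>U\<close> is
      \<open>r [^] k\<close> times another one, because \<open>r\<close> maps \<open>U\<close> onto
      itself, and on such elements \<open>s\<close> undoes \<open>r\<close>.\<close>
    have inv: "\<exists>s\<in>carrier R. \<forall>u\<in>U. s \<odot>\<^bsub>M\<^esub> (r \<odot>\<^bsub>M\<^esub> u) = u"
      if r: "r \<in> carrier R" and nz: "\<not> (\<forall>u\<in>U. r \<odot>\<^bsub>M\<^esub> u = \<zero>\<^bsub>M\<^esub>)" for r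
    proof -
      have rU: "(\<lambda>u. r \<odot>\<^bsub>M\<^esub> u) ` U = U" using zero_or_onto[OF r] nz by blast
      have pow: "(\<lambda>u. (r [^] n) \<odot>\<^bsub>M\<^esub> u) ` U = U" for n :: nat
      proof (induction n)
        case (Suc n)
        have "(\<lambda>u. (r [^] Suc n) \<odot>\<^bsub>M\<^esub> u) ` U = (\<lambda>u. (r [^] n) \<odot>\<^bsub>M\<^esub> u) ` ((\<lambda>u. r \<odot>\<^bsub>M\<^esub> u) ` U)"
          using D(1) r by (simp add: smult_assoc1 image_image cong: image_cong_simp)
        then show ?case using Suc rU by simp
      qed (use D(1) in simp)
      have "\<exists>k. \<forall>n\<ge>k. PIdl (r [^] (n::nat)) = PIdl (r [^] k)"
      proof (rule R.descending_chain_condition)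
        show "ideal (PIdl (r [^] (n::nat))) R" for n using r by (intro R.cgenideal_ideal) simp
        fix n :: nat
        show "PIdl (r [^] Suc n) \<subseteq> PIdl (r [^] n)"
        proof
          fix x assume "x \<in> PIdl (r [^] Suc n)"
          then obtain s where s: "s \<in> carrier R" "x = s \<otimes> (r [^] Suc n)" by (auto simp: cgenideal_def)
          then have "x = (s \<otimes> r) \<otimes> r [^] n" using r by (simp add: R.m_ac)
          then show "x \<in> PIdl (r [^] n)" using s r by (auto simp: cgenideal_def)
        qed
      qed
      then obtain k where "PIdl (r [^] Suc k) = PIdl (r [^] k)" by (meson le_SucI order_refl)
      then have "r [^] k \<in> PIdl (r [^] Suc k)" using R.cgenideal_self r by simp
      then obtain s where s: "s \<in> carrier R" "r [^] k = s \<otimes> (r [^] Suc k)" by (auto simp: cgenideal_def)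
      have "s \<odot>\<^bsub>M\<^esub> (r \<odot>\<^bsub>M\<^esub> u) = u" if u: "u \<in> U" for u
      proof -
        obtain v where v: "v \<in> U" "u = (r [^] k) \<odot>\<^bsub>M\<^esub> v" using pow[of k] u by blast
        have "s \<odot>\<^bsub>M\<^esub> (r \<odot>\<^bsub>M\<^esub> u) = (s \<otimes> r [^] Suc k) \<odot>\<^bsub>M\<^esub> v"
          using D(1)[OF v(1)] r s(1) by (simp add: v(2) smult_assoc1 comm[of "r [^] k" r])
        also have "s \<otimes> r [^] Suc k = r [^] k" by (simp only: s(2)[symmetric])
        finally show ?thesis using v by simp
      qed
      then show ?thesis using s by blast
    qed
    have "U \<noteq> {\<zero>\<^bsub>M\<^esub>}"
    proof
      assume "U = {\<zero>\<^bsub>M\<^esub>}"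
      then have "gen_by {} U" using submoduleD(2) by (auto simp: gen_by_def)
      then show False using U(2) by blast
    qed
    then obtain u where u: "u \<in> U" "u \<noteq> \<zero>\<^bsub>M\<^esub>" using D(2) by blast
    \<comment> \<open>A maximal submodule of \<open>U\<close> missing \<open>u\<close> is the
      hyperplane. Zorn's lemma is called upon because ascending chains in \<open>U\<close> are not
      known to stop.\<close>
    let ?Z = "{V. submodule V R M \<and> V \<subseteq> U \<and> u \<notin> V}"
    have "\<exists>V\<in>?Z. \<forall>X\<in>?Z. V \<subseteq> X \<longrightarrow> X = V"
    proof (rule subset_Zorn_nonempty)
      show "?Z \<noteq> {}" using submodule_zero D(2) u by auto
      fix \<C> assume \<C>: "\<C> \<noteq> {}" "subset.chain ?Z \<C>"
      then have sub: "submodule V R M" "V \<subseteq> U" "u \<notin> V" if "V \<in> \<C>" for V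
        using that by (auto simp: subset.chain_def)
      have tot: "V \<subseteq> W \<or> W \<subseteq> V" if "V \<in> \<C>" "W \<in> \<C>" for V W
        using \<C>(2) that by (auto simp: subset.chain_def)
      have "submodule (\<Union>\<C>) R M"
      proof (rule submoduleI)
        show "\<Union>\<C> \<subseteq> carrier M" using sub D by blast
        show "\<zero>\<^bsub>M\<^esub> \<in> \<Union>\<C>" using \<C>(1) submoduleD(2)[OF sub(1)] by blast
        fix x y assume "x \<in> \<Union>\<C>" "y \<in> \<Union>\<C>"
        then obtain V W where "V \<in> \<C>" "W \<in> \<C>" "x \<in> V" "y \<in> W" by blast
        then show "x \<oplus>\<^bsub>M\<^esub> y \<in> \<Union>\<C>" using tot[of V W] submoduleD(3)[OF sub(1)] by blast
      next
        fix a x assume "a \<in> carrier R" "x \<in> \<Union>\<C>"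
        then show "a \<odot>\<^bsub>M\<^esub> x \<in> \<Union>\<C>" using submoduleD(4)[OF sub(1)] by blast
      qed
      then show "\<Union>\<C> \<in> ?Z" using sub by blast
    qed
    then obtain V where "V \<in> ?Z" and maxV: "\<And>X. X \<in> ?Z \<Longrightarrow> V \<subseteq> X \<Longrightarrow> X = V" by (elim bexE) simp
    then have V: "submodule V R M" "V \<subseteq> U" "u \<notin> V" by simp_all
    have max: "X = V" if "submodule X R M" "X \<subseteq> U" "u \<notin> X" "V \<subseteq> X" for X
      using maxV[of X] that by simp
    have "V \<noteq> U" using V u by blast
    then obtain S1 where S1: "finite S1" "gen_by S1 V" using min[OF V(1,2)] by blast
    have "gen_by (insert u S1) U"
      unfolding gen_by_def
    proof (intro conjI allI impI subsetI)
      fix x assume "x \<in> insert u S1" then show "x \<in> U" using u S1 V by (auto simp: gen_by_def)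
    next
      fix L x assume L: "submodule L R M" "insert u S1 \<subseteq> L" and x: "x \<in> U"
      have VL: "V \<subseteq> L" "u \<in> L" using S1 L by (auto simp: gen_by_def)
      note E = submoduleD[OF V(1)] and F = submoduleD[OF L(1)]
      show "x \<in> L"
      proof (cases "x \<in> V")
        case False
        \<comment> \<open>By maximality of \<open>V\<close> the vector \<open>u\<close> lies in the
          sum of \<open>V\<close> and the multiples of \<open>x\<close>, say
          \<open>u = v + r x\<close>. As \<open>u\<close> is not in \<open>V\<close>,
          \<open>r\<close> does not kill \<open>U\<close>, so it can be inverted and
          \<open>x\<close> recovered from \<open>u\<close> and \<open>v\<close>.\<close>
        let ?T = "{u \<oplus>\<^bsub>M\<^esub> v | u v. u \<in> V \<and> v \<in> {a \<odot>\<^bsub>M\<^esub> x | a. a \<in> carrier R}}"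
        have xM: "x \<in> carrier M" using x D by blast
        have T: "submodule ?T R M" by (intro submodule_sum submodule_cyclic V xM)
        have "gen_by S1 V" by fact
        have "gen_by (insert x V) ?T" using gen_by_insert[OF xM V(1), of V] by (simp add: gen_by_def)
        then have T': "insert x V \<subseteq> ?T" "?T \<subseteq> U" using U(1) x V(2) by (auto simp: gen_by_def)
        have "u \<in> ?T"
        proof (rule ccontr)
          assume "u \<notin> ?T"
          then have "?T = V" using max[OF T T'(2)] T'(1) by simp
          then show False using T'(1) False by simp
        qed
        then obtain v r where v: "v \<in> V" "r \<in> carrier R" "u = v \<oplus>\<^bsub>M\<^esub> r \<odot>\<^bsub>M\<^esub> x" by blast
        have vM: "v \<in> carrier M" "r \<odot>\<^bsub>M\<^esub> x \<in> carrier M" using E(1)[OF v(1)] v(2) xM by simp_all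
        have "\<not> (\<forall>w\<in>U. r \<odot>\<^bsub>M\<^esub> w = \<zero>\<^bsub>M\<^esub>)"
        proof
          assume "\<forall>w\<in>U. r \<odot>\<^bsub>M\<^esub> w = \<zero>\<^bsub>M\<^esub>"
          then have "u = v" using v(3) x vM by simp
          then show False using v(1) V(3) by simp
        qed
        then obtain s where s: "s \<in> carrier R" "\<And>w. w \<in> U \<Longrightarrow> s \<odot>\<^bsub>M\<^esub> (r \<odot>\<^bsub>M\<^esub> w) = w" using inv[OF v(2)] by blast
        have "r \<odot>\<^bsub>M\<^esub> x = u \<ominus>\<^bsub>M\<^esub> v" using vM by (simp add: v(3) M.minus_add_cancel)
        then have "r \<odot>\<^bsub>M\<^esub> x \<in> L" using F(6)[OF VL(2)] v(1) VL(1) by auto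
        then have "s \<odot>\<^bsub>M\<^esub> (r \<odot>\<^bsub>M\<^esub> x) \<in> L" using F s by blast
        then show ?thesis using s x by simp
      qed (use VL in blast)
    qed
    then show False using U(2) S1 by blast
  qed
  then show ?thesis using left_module_submodule[OF N] finitely_generated_submodule_iff[OF N]
    by (simp add: fg_module_def)
qed

theorem artinian_cring_dcc:
  assumes R: "artinian_cring R" and M: "fg_module R M"
    and N: "\<And>n::nat. submodule (N n) R M" "\<And>n. N (Suc n) \<subseteq> N n"
  shows "\<exists>k. \<forall>n\<ge>k. N n = N k"
proof -
  interpret left_module R M using M by (simp add: fg_module_def)
  obtain S where S: "finite S" "gen_by S (carrier M)"
    using M unfolding fg_module_def finitely_generated_iff by blast
  have SM: "S \<subseteq> carrier M" using S(2) by (simp add: gen_by_def)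
  have "N 0 \<subseteq> carrier M" using submoduleD(1)[OF N(1)] by blast
  then show ?thesis using dcc_gen_by[where N = N, OF R S(1) SM submodule_carrier S(2)] N by simp
qed

section \<open>The category of finitely generated modules\<close>

lemma module_hom_comp: "\<lbrakk>f \<in> module_hom A M N; g \<in> module_hom A N L\<rbrakk> \<Longrightarrow> (\<lambda>x. g (f x)) \<in> module_hom A M L"
  by (auto simp: module_hom_def Pi_iff)

lemma module_hom_id: "(\<lambda>x. x) \<in> module_hom A M M"
  by (auto simp: module_hom_def)

lemma module_hom_into: "\<lbrakk>f \<in> module_hom A M N; \<And>x. x \<in> carrier M \<Longrightarrow> f x \<in> K\<rbrakk> \<Longrightarrow> f \<in> module_hom A M (N\<lparr>carrier := K\<rparr>)"
  by (auto simp: module_hom_def)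

lemma module_hom_from: "\<lbrakk>f \<in> module_hom A M N; K \<subseteq> carrier M\<rbrakk> \<Longrightarrow> f \<in> module_hom A (M\<lparr>carrier := K\<rparr>) N"
  by (auto simp: module_hom_def Pi_iff subset_iff)

lemma module_hom_incl: "K \<subseteq> carrier M \<Longrightarrow> (\<lambda>x. x) \<in> module_hom A (M\<lparr>carrier := K\<rparr>) M"
  by (auto simp: module_hom_def)

lemma module_hom_out: "f \<in> module_hom A M (N\<lparr>carrier := K\<rparr>) \<Longrightarrow> K \<subseteq> carrier N \<Longrightarrow> f \<in> module_hom A M N"
  by (auto simp: module_hom_def)

lemma (in left_module) gen_byD: "\<lbrakk>gen_by S N; submodule K R M; S \<subseteq> K\<rbrakk> \<Longrightarrow> N \<subseteq> K"
  unfolding gen_by_def by simp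

text \<open>All the homological algebra rests on these two consequences of being an Artin algebra:
  submodules of finitely generated modules are finitely generated, and descending chains of
  submodules stop. The base ring disappears, and the same results serve \<open>A\<close> and
  \<open>B\<close>. The axioms concern \<open>'a umodule\<close>, since locale assumptions are
  monomorphic.\<close>

locale module_category = ring A for A :: "('a, 'c) ring_scheme" (structure) +
  assumes fg_submodule:
      "\<lbrakk>fg_module A (M :: 'a umodule); submodule N A M\<rbrakk> \<Longrightarrow> fg_module A (M\<lparr>carrier := N\<rparr>)"
    and dcc: "\<lbrakk>fg_module A (M :: 'a umodule); \<And>n::nat. submodule (F n) A M; \<And>n. F (Suc n) \<subseteq> F n\<rbrakk> \<Longrightarrow>
      \<exists>k. \<forall>n\<ge>k. F n = F k"
begin

abbreviation obj :: "('a, 'm) module \<Rightarrow> bool" where "obj \<equiv> fg_module A"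
abbreviation hom :: "('a, 'm) module \<Rightarrow> ('a, 'n) module \<Rightarrow> ('m \<Rightarrow> 'n) set" where "hom \<equiv> module_hom A"

lemma objD: "obj M \<Longrightarrow> left_module A M"
  by (simp add: fg_module_def)

lemma obj_group: "obj M \<Longrightarrow> abelian_group M" and obj_monoid: "obj M \<Longrightarrow> abelian_monoid M"
  using left_module.axioms(2)[OF objD] abelian_group.axioms(1) by blast+

lemmas add_closed [simp] = abelian_monoid.a_closed[OF obj_monoid]
  and zero_mem [simp] = abelian_monoid.zero_closed[OF obj_monoid]
  and neg_closed [simp] = abelian_group.a_inv_closed[OF obj_group]
  and diff_closed [simp] = abelian_group.minus_closed[OF obj_group]
  and smul_closed [simp] = left_module.smult_closed[OF objD]
  and add_zero [simp] = abelian_monoid.r_zero[OF obj_monoid] abelian_monoid.l_zero[OF obj_monoid]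
  and add_neg [simp] = abelian_group.r_neg[OF obj_group] abelian_group.l_neg[OF obj_group]
  and neg_neg [simp] = abelian_group.minus_minus[OF obj_group]
  and neg_add = abelian_group.minus_add[OF obj_group]
  and add_diff_cancel [simp] = abelian_group.minus_add_cancel[OF obj_group]
  and diff_zero_iff = abelian_group.diff_eq_0_iff[OF obj_group]
  and add_diff_add = abelian_group.diff_add_eq[OF obj_group]
  and add_ac = abelian_monoid.a_assoc[OF obj_monoid] abelian_monoid.a_comm[OF obj_monoid] abelian_monoid.a_lcomm[OF obj_monoid]
  and smul_add = left_module.smult_r_distr[OF objD]
  and smul_neg = left_module.smult_r_minus[OF objD]
  and smul_zero [simp] = left_module.smult_r_null[OF objD]

lemma diff_eq: "x \<ominus>\<^bsub>M\<^esub> y = x \<oplus>\<^bsub>M\<^esub> \<ominus>\<^bsub>M\<^esub> y"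
  by (simp add: a_minus_def)

lemma
  assumes "obj M"
  shows neg_zero [simp]: "\<ominus>\<^bsub>M\<^esub> \<zero>\<^bsub>M\<^esub> = \<zero>\<^bsub>M\<^esub>"
    and diff_self [simp]: "x \<in> carrier M \<Longrightarrow> x \<ominus>\<^bsub>M\<^esub> x = \<zero>\<^bsub>M\<^esub>"
    and diff_zero [simp]: "x \<in> carrier M \<Longrightarrow> x \<ominus>\<^bsub>M\<^esub> \<zero>\<^bsub>M\<^esub> = x"
proof -
  show z: "\<ominus>\<^bsub>M\<^esub> \<zero>\<^bsub>M\<^esub> = \<zero>\<^bsub>M\<^esub>" using abelian_group.minus_equality[OF obj_group[OF assms], of "\<zero>\<^bsub>M\<^esub>" "\<zero>\<^bsub>M\<^esub>"] assms by simp
  show "x \<in> carrier M \<Longrightarrow> x \<ominus>\<^bsub>M\<^esub> x = \<zero>\<^bsub>M\<^esub>" "x \<in> carrier M \<Longrightarrow> x \<ominus>\<^bsub>M\<^esub> \<zero>\<^bsub>M\<^esub> = x"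
    using assms z by (simp_all add: diff_eq)
qed

lemma obj_gen:
  assumes "obj M" obtains S where "finite S" "left_module.gen_by A M S (carrier M)"
  using assms left_module.finitely_generated_iff[OF objD[OF assms]] unfolding fg_module_def by blast

lemma objI_gen:
  assumes "left_module A M" "finite S" "left_module.gen_by A M S (carrier M)" shows "obj M"
  using assms left_module.finitely_generated_iff[OF assms(1)] unfolding fg_module_def by blast

lemma hom_simps:
  assumes "f \<in> hom M N" "obj M" "obj N"
  shows "x \<in> carrier M \<Longrightarrow> f x \<in> carrier N"
    "\<lbrakk>x \<in> carrier M; y \<in> carrier M\<rbrakk> \<Longrightarrow> f (x \<oplus>\<^bsub>M\<^esub> y) = f x \<oplus>\<^bsub>N\<^esub> f y"
    "\<lbrakk>a \<in> carrier A; x \<in> carrier M\<rbrakk> \<Longrightarrow> f (a \<odot>\<^bsub>M\<^esub> x) = a \<odot>\<^bsub>N\<^esub> f x"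
    "f \<zero>\<^bsub>M\<^esub> = \<zero>\<^bsub>N\<^esub>"
    "x \<in> carrier M \<Longrightarrow> f (\<ominus>\<^bsub>M\<^esub> x) = \<ominus>\<^bsub>N\<^esub> f x"
    "\<lbrakk>x \<in> carrier M; y \<in> carrier M\<rbrakk> \<Longrightarrow> f (x \<ominus>\<^bsub>M\<^esub> y) = f x \<ominus>\<^bsub>N\<^esub> f y"
  by (fact module_hom_closed[OF assms(1)] module_hom_add[OF assms(1)] module_hom_smult[OF assms(1)]
    module_hom_zero[OF objD[OF assms(2)] objD[OF assms(3)] assms(1)]
    module_hom_neg[OF objD[OF assms(2)] objD[OF assms(3)] assms(1)]
    module_hom_minus[OF objD[OF assms(2)] objD[OF assms(3)] assms(1)])+

lemma hom_add:
  assumes f: "f \<in> hom M N" and g: "g \<in> hom M N" and M: "obj M" and N: "obj N"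
  shows "(\<lambda>x. f x \<oplus>\<^bsub>N\<^esub> g x) \<in> hom M N"
proof -
  note [simp] = hom_simps[OF f M N] hom_simps[OF g M N]
  show ?thesis using M N by (intro module_homI) (simp_all add: smul_add add_ac)
qed

lemma hom_neg:
  assumes f: "f \<in> hom M N" and M: "obj M" and N: "obj N"
  shows "(\<lambda>x. \<ominus>\<^bsub>N\<^esub> f x) \<in> hom M N"
proof -
  note [simp] = hom_simps[OF f M N]
  show ?thesis using M N by (intro module_homI) (simp_all add: smul_neg neg_add)
qed

lemma hom_diff: "\<lbrakk>f \<in> hom M N; g \<in> hom M N; obj M; obj N\<rbrakk> \<Longrightarrow> (\<lambda>x. f x \<ominus>\<^bsub>N\<^esub> g x) \<in> hom M N"
  unfolding a_minus_def by (intro hom_add hom_neg)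

lemma hom_zero: "obj N \<Longrightarrow> (\<lambda>x. \<zero>\<^bsub>N\<^esub>) \<in> hom M N"
  by (intro module_homI) simp_all

lemma hom_comp_pow: "f \<in> hom M M \<Longrightarrow> (f ^^ n) \<in> hom M M"
  by (induction n) (auto simp: module_hom_id id_def intro: module_hom_comp simp: comp_def)

lemma submodule_kernel: "\<lbrakk>f \<in> hom M N; obj M; obj N\<rbrakk> \<Longrightarrow> submodule {x \<in> carrier M. f x = \<zero>\<^bsub>N\<^esub>} A M"
  using module_hom_vimage[of A M N f "{\<zero>\<^bsub>N\<^esub>}"] left_module.submodule_zero[of A N] by (simp add: objD)

lemma submodule_image: "\<lbrakk>f \<in> hom M N; obj M; obj N\<rbrakk> \<Longrightarrow> submodule (f ` carrier M) A N"
  using module_hom_image[of A M N f "carrier M"] left_module.submodule_carrier[of A M] by (simp add: objD)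

lemma obj_image:
  assumes M: "obj M" and N: "left_module A N" and f: "f \<in> hom M N" and onto: "f ` carrier M = carrier N"
  shows "obj N"
proof -
  interpret M: left_module A M by (rule objD[OF M])
  interpret N: left_module A N by (rule N)
  obtain S where S: "finite S" "M.gen_by S (carrier M)" using obj_gen[OF M] .
  have "N.gen_by (f ` S) (carrier N)"
    unfolding N.gen_by_def
  proof (intro conjI allI impI)
    show "f ` S \<subseteq> carrier N" using S onto by (auto simp: M.gen_by_def)
    fix K assume K: "submodule K A N" "f ` S \<subseteq> K"
    have "S \<subseteq> {x \<in> carrier M. f x \<in> K}" using S K by (auto simp: M.gen_by_def)
    then have "carrier M \<subseteq> {x \<in> carrier M. f x \<in> K}"
      using S module_hom_vimage[OF M.left_module_axioms N f K(1)] by (simp add: M.gen_by_def)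
    then have "f ` carrier M \<subseteq> K" by blast
    then show "carrier N \<subseteq> K" using onto by simp
  qed
  then show ?thesis using S(1) by (intro objI_gen[OF N, of "f ` S"]) simp_all
qed

lemma lift_mono:
  assumes K: "obj K" and E: "obj E" and T: "obj T" and i: "i \<in> hom K E" "inj_on i (carrier K)"
    and h: "h \<in> hom T E" "\<And>x. x \<in> carrier T \<Longrightarrow> h x \<in> i ` carrier K"
  obtains k where "k \<in> hom T K" "\<forall>x \<in> carrier T. i (k x) = h x"
proof -
  note [simp] = hom_simps[OF i(1) K E] hom_simps[OF h(1) T E]
  obtain k where k: "\<And>x. x \<in> carrier T \<Longrightarrow> k x \<in> carrier K \<and> i (k x) = h x"
    using h(2) unfolding image_iff by metis
  have "k \<in> hom T K"
    using k K T by (intro module_homI) (auto intro!: inj_onD[OF i(2)])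
  then show ?thesis using that k by simp
qed

text \<open>Two preimages of a point differ by an element that \<open>g\<close> kills, hence
  \<open>h\<close> kills it too; so the value of \<open>q\<close> does not depend on the chosen
  preimage. With \<open>lift_mono\<close> as its dual, this spares explicit work with kernels and
  cosets.\<close>

lemma desc_epi:
  assumes E: "obj E" and Q: "obj Q" and T: "obj T" and g: "g \<in> hom E Q" "g ` carrier E = carrier Q"
    and h: "h \<in> hom E T" "\<And>x. x \<in> carrier E \<Longrightarrow> g x = \<zero>\<^bsub>Q\<^esub> \<Longrightarrow> h x = \<zero>\<^bsub>T\<^esub>"
  obtains q where "q \<in> hom Q T" "\<forall>x \<in> carrier E. q (g x) = h x"
proof -
  note [simp] = hom_simps[OF g(1) E Q] hom_simps[OF h(1) E T]
  have eq: "h x = h y" if "x \<in> carrier E" "y \<in> carrier E" "g x = g y" for x y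
    using h(2)[of "x \<ominus>\<^bsub>E\<^esub> y"] that E Q T by (simp add: diff_zero_iff)
  have surj: "\<exists>x' \<in> carrier E. x = g x'" if "x \<in> carrier Q" for x using that g(2) by blast
  define q where "q y = h (SOME x. x \<in> carrier E \<and> g x = y)" for y
  have q: "q (g x) = h x" if "x \<in> carrier E" for x
    unfolding q_def using that eq by (metis (mono_tags, lifting) someI_ex)
  have "q \<in> hom Q T"
  proof (rule module_homI)
    fix x assume "x \<in> carrier Q"
    then show "q x \<in> carrier T" using surj[of x] q by auto
  next
    fix x y assume "x \<in> carrier Q" "y \<in> carrier Q"
    then obtain x' y' where "x' \<in> carrier E" "y' \<in> carrier E" "x = g x'" "y = g y'" using surj[of x] surj[of y] by auto
    then show "q (x \<oplus>\<^bsub>Q\<^esub> y) = q x \<oplus>\<^bsub>T\<^esub> q y" using q[of "x' \<oplus>\<^bsub>E\<^esub> y'"] q E by simp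
  next
    fix a x assume "a \<in> carrier A" "x \<in> carrier Q"
    then obtain x' where "x' \<in> carrier E" "x = g x'" "a \<in> carrier A" using surj[of x] by auto
    then show "q (a \<odot>\<^bsub>Q\<^esub> x) = a \<odot>\<^bsub>T\<^esub> q x" using q[of "a \<odot>\<^bsub>E\<^esub> x'"] q E by simp
  qed
  then show ?thesis using that q by simp
qed

text \<open>Isomorphisms carry their inverse, which the diagram chases use directly. Being finitely
  generated is included, so that \<open>iso\<close> is reflexive exactly on objects. Agreement with
  bijective homomorphisms is \<open>iso_iff\<close>.\<close>

definition iso :: "'a umodule \<Rightarrow> 'a umodule \<Rightarrow> bool" where
  "iso M N \<longleftrightarrow> obj M \<and> obj N \<and> (\<exists>f \<in> hom M N. \<exists>g \<in> hom N M.
     (\<forall>x \<in> carrier M. g (f x) = x) \<and> (\<forall>y \<in> carrier N. f (g y) = y))"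

lemma isoE:
  assumes "iso M N"
  obtains f g where "obj M" "obj N" "f \<in> hom M N" "g \<in> hom N M"
    "\<forall>x \<in> carrier M. g (f x) = x" "\<forall>y \<in> carrier N. f (g y) = y"
  using assms that unfolding iso_def by (elim conjE bexE) simp

lemma isoI:
  "\<lbrakk>obj M; obj N; f \<in> hom M N; g \<in> hom N M; \<And>x. x \<in> carrier M \<Longrightarrow> g (f x) = x;
     \<And>y. y \<in> carrier N \<Longrightarrow> f (g y) = y\<rbrakk> \<Longrightarrow> iso M N"
  unfolding iso_def by blast

lemma module_isomorphicE:
  assumes "module_isomorphic A M N" "obj M" "obj N"
  obtains f g where "f \<in> hom M N" "g \<in> hom N M"
    "\<forall>x \<in> carrier M. g (f x) = x" "\<forall>y \<in> carrier N. f (g y) = y"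
proof -
  obtain f where f: "f \<in> hom M N" "bij_betw f (carrier M) (carrier N)"
    using assms by (auto simp: module_isomorphic_def)
  then have inj: "inj_on f (carrier M)" and im: "f ` carrier M = carrier N" by (auto simp: bij_betw_def)
  obtain g where g: "g \<in> hom N M" "\<forall>x \<in> carrier N. f (g x) = x"
    using lift_mono[OF assms(2,3,3) f(1) inj module_hom_id] im by metis
  have "\<forall>x \<in> carrier M. g (f x) = x"
    using g f inj by (metis inj_onD module_hom_closed)
  then show ?thesis using that f(1) g by blast
qed

lemma iso_bij: "\<lbrakk>obj M; obj N; f \<in> hom M N; bij_betw f (carrier M) (carrier N)\<rbrakk> \<Longrightarrow> iso M N"
  using module_isomorphicE[of M N] by (metis isoI module_isomorphic_def)

lemma iso_iff: "iso M N \<longleftrightarrow> obj M \<and> obj N \<and> module_isomorphic A M N"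
proof
  assume "iso M N"
  then obtain f g where "obj M" "obj N" "f \<in> hom M N" "g \<in> hom N M"
    "\<forall>x \<in> carrier M. g (f x) = x" "\<forall>y \<in> carrier N. f (g y) = y" by (rule isoE) auto
  then show "obj M \<and> obj N \<and> module_isomorphic A M N"
    unfolding module_isomorphic_def by (auto intro!: bexI[of _ f] bij_betwI[of f _ _ g] simp: module_hom_closed)
next
  assume "obj M \<and> obj N \<and> module_isomorphic A M N"
  then show "iso M N" unfolding module_isomorphic_def using iso_bij by blast
qed

lemma iso_refl [simp]: "iso M M \<longleftrightarrow> obj M"
  by (auto simp: iso_def module_hom_id intro!: bexI[of _ "\<lambda>x. x"])

lemma iso_sym: "iso M N \<Longrightarrow> iso N M"
  unfolding iso_def by blast

lemma iso_trans [trans]: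
  assumes "iso M N" "iso N L" shows "iso M L"
proof -
  obtain f g where 1: "obj M" "obj N" "f \<in> hom M N" "g \<in> hom N M"
    "\<forall>x \<in> carrier M. g (f x) = x" "\<forall>y \<in> carrier N. f (g y) = y" using assms(1) by (rule isoE) auto
  obtain f' g' where 2: "obj N" "obj L" "f' \<in> hom N L" "g' \<in> hom L N"
    "\<forall>x \<in> carrier N. g' (f' x) = x" "\<forall>y \<in> carrier L. f' (g' y) = y" using assms(2) by (rule isoE) auto
  show ?thesis
    using 1 2 by (intro isoI[OF 1(1) 2(2) module_hom_comp[OF 1(3) 2(3)] module_hom_comp[OF 2(4) 1(4)]])
      (auto simp: module_hom_closed[OF 1(3)] module_hom_closed[OF 2(4)])
qed

lemma isoD: "iso M N \<Longrightarrow> obj M" "iso M N \<Longrightarrow> obj N"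
  by (auto simp: iso_def)

lemma copy_obj:
  fixes M :: "('a, 'm) module"
  assumes "obj M"
  obtains N :: "'a umodule" and f g where "obj N" "f \<in> hom M N" "g \<in> hom N M"
    "\<forall>x \<in> carrier M. g (f x) = x" "\<forall>y \<in> carrier N. f (g y) = y"
proof -
  obtain N :: "'a umodule" where N: "obj N" "module_isomorphic A M N" using fg_module_has_copy[OF assms] .
  obtain f g where "f \<in> hom M N" "g \<in> hom N M"
    "\<forall>x \<in> carrier M. g (f x) = x" "\<forall>y \<in> carrier N. f (g y) = y"
    using module_isomorphicE[OF N(2) assms N(1)] by blast
  then show ?thesis by (rule that[OF N(1)])
qed

section \<open>Biproducts and direct sums\<close>

definition biprod :: "'a umodule \<Rightarrow> 'a umodule \<Rightarrow> 'a umodule \<Rightarrow> ((nat \<Rightarrow> 'a) set \<Rightarrow> (nat \<Rightarrow> 'a) set) \<Rightarrow>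
   ((nat \<Rightarrow> 'a) set \<Rightarrow> (nat \<Rightarrow> 'a) set) \<Rightarrow> ((nat \<Rightarrow> 'a) set \<Rightarrow> (nat \<Rightarrow> 'a) set) \<Rightarrow> ((nat \<Rightarrow> 'a) set \<Rightarrow> (nat \<Rightarrow> 'a) set) \<Rightarrow> bool" where
  "biprod M N S i1 i2 p1 p2 \<longleftrightarrow> obj M \<and> obj N \<and> obj S \<and> i1 \<in> hom M S \<and> i2 \<in> hom N S \<and>
     p1 \<in> hom S M \<and> p2 \<in> hom S N \<and> (\<forall>x \<in> carrier M. p1 (i1 x) = x \<and> p2 (i1 x) = \<zero>\<^bsub>N\<^esub>) \<and>
     (\<forall>y \<in> carrier N. p1 (i2 y) = \<zero>\<^bsub>M\<^esub> \<and> p2 (i2 y) = y) \<and> (\<forall>s \<in> carrier S. i1 (p1 s) \<oplus>\<^bsub>S\<^esub> i2 (p2 s) = s)"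

text \<open>A relation rather than an operation: the cartesian product of two modules lives over a
  type of pairs, so within \<open>'a umodule\<close> a direct sum is only determined up to
  isomorphism. Describing it by inclusions and projections treats products, internal sums and split
  sequences alike.\<close>

definition dsum :: "'a umodule \<Rightarrow> 'a umodule \<Rightarrow> 'a umodule \<Rightarrow> bool" where
  "dsum M N S \<longleftrightarrow> (\<exists>i1 i2 p1 p2. biprod M N S i1 i2 p1 p2)"

lemma biprodD:
  assumes "biprod M N S i1 i2 p1 p2"
  shows "obj M" "obj N" "obj S" "i1 \<in> hom M S" "i2 \<in> hom N S" "p1 \<in> hom S M" "p2 \<in> hom S N"
  using assms by (simp_all add: biprod_def)

lemma biprod_simps:
  assumes "biprod M N S i1 i2 p1 p2"
  shows "x \<in> carrier M \<Longrightarrow> p1 (i1 x) = x" "x \<in> carrier M \<Longrightarrow> p2 (i1 x) = \<zero>\<^bsub>N\<^esub>"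
    "y \<in> carrier N \<Longrightarrow> p1 (i2 y) = \<zero>\<^bsub>M\<^esub>" "y \<in> carrier N \<Longrightarrow> p2 (i2 y) = y"
    "s \<in> carrier S \<Longrightarrow> i1 (p1 s) \<oplus>\<^bsub>S\<^esub> i2 (p2 s) = s" "obj M" "obj N" "obj S"
    "x \<in> carrier M \<Longrightarrow> i1 x \<in> carrier S"
    "\<lbrakk>x \<in> carrier M; x' \<in> carrier M\<rbrakk> \<Longrightarrow> i1 (x \<oplus>\<^bsub>M\<^esub> x') = i1 x \<oplus>\<^bsub>S\<^esub> i1 x'"
    "\<lbrakk>a \<in> carrier A; x \<in> carrier M\<rbrakk> \<Longrightarrow> i1 (a \<odot>\<^bsub>M\<^esub> x) = a \<odot>\<^bsub>S\<^esub> i1 x"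
    "i1 \<zero>\<^bsub>M\<^esub> = \<zero>\<^bsub>S\<^esub>" "x \<in> carrier M \<Longrightarrow> i1 (\<ominus>\<^bsub>M\<^esub> x) = \<ominus>\<^bsub>S\<^esub> i1 x"
    "\<lbrakk>x \<in> carrier M; x' \<in> carrier M\<rbrakk> \<Longrightarrow> i1 (x \<ominus>\<^bsub>M\<^esub> x') = i1 x \<ominus>\<^bsub>S\<^esub> i1 x'"
    "y \<in> carrier N \<Longrightarrow> i2 y \<in> carrier S"
    "\<lbrakk>y \<in> carrier N; y' \<in> carrier N\<rbrakk> \<Longrightarrow> i2 (y \<oplus>\<^bsub>N\<^esub> y') = i2 y \<oplus>\<^bsub>S\<^esub> i2 y'"
    "\<lbrakk>a \<in> carrier A; y \<in> carrier N\<rbrakk> \<Longrightarrow> i2 (a \<odot>\<^bsub>N\<^esub> y) = a \<odot>\<^bsub>S\<^esub> i2 y"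
    "i2 \<zero>\<^bsub>N\<^esub> = \<zero>\<^bsub>S\<^esub>" "y \<in> carrier N \<Longrightarrow> i2 (\<ominus>\<^bsub>N\<^esub> y) = \<ominus>\<^bsub>S\<^esub> i2 y"
    "\<lbrakk>y \<in> carrier N; y' \<in> carrier N\<rbrakk> \<Longrightarrow> i2 (y \<ominus>\<^bsub>N\<^esub> y') = i2 y \<ominus>\<^bsub>S\<^esub> i2 y'"
    "s \<in> carrier S \<Longrightarrow> p1 s \<in> carrier M"
    "\<lbrakk>s \<in> carrier S; s' \<in> carrier S\<rbrakk> \<Longrightarrow> p1 (s \<oplus>\<^bsub>S\<^esub> s') = p1 s \<oplus>\<^bsub>M\<^esub> p1 s'"
    "\<lbrakk>a \<in> carrier A; s \<in> carrier S\<rbrakk> \<Longrightarrow> p1 (a \<odot>\<^bsub>S\<^esub> s) = a \<odot>\<^bsub>M\<^esub> p1 s"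
    "p1 \<zero>\<^bsub>S\<^esub> = \<zero>\<^bsub>M\<^esub>" "s \<in> carrier S \<Longrightarrow> p1 (\<ominus>\<^bsub>S\<^esub> s) = \<ominus>\<^bsub>M\<^esub> p1 s"
    "\<lbrakk>s \<in> carrier S; s' \<in> carrier S\<rbrakk> \<Longrightarrow> p1 (s \<ominus>\<^bsub>S\<^esub> s') = p1 s \<ominus>\<^bsub>M\<^esub> p1 s'"
    "s \<in> carrier S \<Longrightarrow> p2 s \<in> carrier N"
    "\<lbrakk>s \<in> carrier S; s' \<in> carrier S\<rbrakk> \<Longrightarrow> p2 (s \<oplus>\<^bsub>S\<^esub> s') = p2 s \<oplus>\<^bsub>N\<^esub> p2 s'"
    "\<lbrakk>a \<in> carrier A; s \<in> carrier S\<rbrakk> \<Longrightarrow> p2 (a \<odot>\<^bsub>S\<^esub> s) = a \<odot>\<^bsub>N\<^esub> p2 s"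
    "p2 \<zero>\<^bsub>S\<^esub> = \<zero>\<^bsub>N\<^esub>" "s \<in> carrier S \<Longrightarrow> p2 (\<ominus>\<^bsub>S\<^esub> s) = \<ominus>\<^bsub>N\<^esub> p2 s"
    "\<lbrakk>s \<in> carrier S; s' \<in> carrier S\<rbrakk> \<Longrightarrow> p2 (s \<ominus>\<^bsub>S\<^esub> s') = p2 s \<ominus>\<^bsub>N\<^esub> p2 s'"
  using assms hom_simps[of i1 M S] hom_simps[of i2 N S] hom_simps[of p1 S M] hom_simps[of p2 S N]
  unfolding biprod_def by simp_all

lemma biprodI:
  assumes "obj M" "obj N" "obj S" "i1 \<in> hom M S" "i2 \<in> hom N S" "p1 \<in> hom S M" "p2 \<in> hom S N"
    "\<And>x. x \<in> carrier M \<Longrightarrow> p1 (i1 x) = x" "\<And>x. x \<in> carrier M \<Longrightarrow> p2 (i1 x) = \<zero>\<^bsub>N\<^esub>"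
    "\<And>y. y \<in> carrier N \<Longrightarrow> p1 (i2 y) = \<zero>\<^bsub>M\<^esub>" "\<And>y. y \<in> carrier N \<Longrightarrow> p2 (i2 y) = y"
    "\<And>s. s \<in> carrier S \<Longrightarrow> i1 (p1 s) \<oplus>\<^bsub>S\<^esub> i2 (p2 s) = s"
  shows "biprod M N S i1 i2 p1 p2"
  using assms by (simp add: biprod_def)

lemma biprod_swap:
  assumes b: "biprod M N S i1 i2 p1 p2" shows "biprod N M S i2 i1 p2 p1"
  using biprodD[OF b] biprod_simps[OF b] by (intro biprodI) (simp_all add: add_ac)

lemma dsumE:
  assumes "dsum M N S" obtains i1 i2 p1 p2 where "biprod M N S i1 i2 p1 p2"
  using assms by (auto simp: dsum_def)

lemma dsumI: "biprod M N S i1 i2 p1 p2 \<Longrightarrow> dsum M N S"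
  by (auto simp: dsum_def)

lemma dsumD: "dsum M N S \<Longrightarrow> obj M" "dsum M N S \<Longrightarrow> obj N" "dsum M N S \<Longrightarrow> obj S"
  by (auto simp: dsum_def biprod_def)

lemma dsum_swap: "dsum M N S \<Longrightarrow> dsum N M S"
  using biprod_swap unfolding dsum_def by blast

definition prod_module :: "('a, 'm) module \<Rightarrow> ('a, 'n) module \<Rightarrow> ('a, 'm \<times> 'n) module" where
  "prod_module M N = \<lparr>carrier = carrier M \<times> carrier N, monoid.mult = undefined, monoid.one = undefined,
     ring.zero = (\<zero>\<^bsub>M\<^esub>, \<zero>\<^bsub>N\<^esub>), ring.add = (\<lambda>x y. (fst x \<oplus>\<^bsub>M\<^esub> fst y, snd x \<oplus>\<^bsub>N\<^esub> snd y)),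
     smult = (\<lambda>a x. (a \<odot>\<^bsub>M\<^esub> fst x, a \<odot>\<^bsub>N\<^esub> snd x))\<rparr>"

lemma left_module_prod: 
  assumes "left_module A M" "left_module A N"
  shows "left_module A (prod_module M N)"
proof -
  interpret M: left_module A M by fact
  interpret N: left_module A N by fact
  have "abelian_group (prod_module M N)"
  proof (rule abelian_groupI)
    fix x assume "x \<in> carrier (prod_module M N)"
    then show "\<exists>y \<in> carrier (prod_module M N). y \<oplus>\<^bsub>prod_module M N\<^esub> x = \<zero>\<^bsub>prod_module M N\<^esub>"
      by (intro bexI[of _ "(\<ominus>\<^bsub>M\<^esub> fst x, \<ominus>\<^bsub>N\<^esub> snd x)"]) (auto simp: prod_module_def M.M.l_neg N.M.l_neg)
  qed (auto simp: prod_module_def M.M.a_ac N.M.a_ac)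
  then show ?thesis
    by (intro left_module.intro left_module_axioms.intro ring_axioms)
      (auto simp: prod_module_def M.smult_l_distr M.smult_r_distr M.smult_assoc1 N.smult_l_distr N.smult_r_distr N.smult_assoc1)
qed

lemma obj_prod:
  assumes M: "obj M" and N: "obj N"
  shows "obj (prod_module M N)"
proof -
  interpret M: left_module A M by (rule objD[OF M])
  interpret N: left_module A N by (rule objD[OF N])
  interpret P: left_module A "prod_module M N" by (rule left_module_prod) unfold_locales
  obtain S where S: "finite S" "M.gen_by S (carrier M)" using obj_gen[OF M] .
  obtain T where T: "finite T" "N.gen_by T (carrier N)" using obj_gen[OF N] .
  have i: "(\<lambda>x. (x, \<zero>\<^bsub>N\<^esub>)) \<in> hom M (prod_module M N)" "(\<lambda>y. (\<zero>\<^bsub>M\<^esub>, y)) \<in> hom N (prod_module M N)"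
    by (auto intro!: module_homI simp: prod_module_def)
  have "P.gen_by ((\<lambda>x. (x, \<zero>\<^bsub>N\<^esub>)) ` S \<union> (\<lambda>y. (\<zero>\<^bsub>M\<^esub>, y)) ` T) (carrier (prod_module M N))"
    unfolding P.gen_by_def
  proof (intro conjI allI impI subsetI)
    fix x assume "x \<in> (\<lambda>x. (x, \<zero>\<^bsub>N\<^esub>)) ` S \<union> (\<lambda>y. (\<zero>\<^bsub>M\<^esub>, y)) ` T"
    then show "x \<in> carrier (prod_module M N)" using S T by (auto simp: prod_module_def M.gen_by_def N.gen_by_def)
  next
    fix K z assume K: "submodule K A (prod_module M N)" "(\<lambda>x. (x, \<zero>\<^bsub>N\<^esub>)) ` S \<union> (\<lambda>y. (\<zero>\<^bsub>M\<^esub>, y)) ` T \<subseteq> K"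
      and z: "z \<in> carrier (prod_module M N)"
    have 1: "carrier M \<subseteq> {x \<in> carrier M. (x, \<zero>\<^bsub>N\<^esub>) \<in> K}"
      using module_hom_vimage[OF M.left_module_axioms P.left_module_axioms i(1) K(1)] K(2)
        M.gen_byD[OF S(2)] S(2)[unfolded M.gen_by_def] by blast
    have 2: "carrier N \<subseteq> {y \<in> carrier N. (\<zero>\<^bsub>M\<^esub>, y) \<in> K}"
      using module_hom_vimage[OF N.left_module_axioms P.left_module_axioms i(2) K(1)] K(2)
        N.gen_byD[OF T(2)] T(2)[unfolded N.gen_by_def] by blast
    obtain x y where xy: "z = (x, y)" "x \<in> carrier M" "y \<in> carrier N" using z by (auto simp: prod_module_def)
    then have "(x, \<zero>\<^bsub>N\<^esub>) \<oplus>\<^bsub>prod_module M N\<^esub> (\<zero>\<^bsub>M\<^esub>, y) \<in> K"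
      using 1 2 P.submoduleD(3)[OF K(1)] by blast
    then show "z \<in> K" using xy by (simp add: prod_module_def)
  qed
  then show ?thesis using S(1) T(1) by (intro objI_gen[OF P.left_module_axioms]) simp_all
qed

text \<open>The product is a finitely generated module over the type of pairs, hence has a copy
  among the objects, to which the structure maps are carried over.\<close>

lemma dsum_exists:
  assumes M: "obj M" and N: "obj N" obtains S where "dsum M N S"
proof -
  let ?P = "prod_module M N"
  obtain S :: "'a umodule" and f g where S: "obj S" and f: "f \<in> hom ?P S" and g: "g \<in> hom S ?P"
    and gf: "\<forall>x \<in> carrier ?P. g (f x) = x" and fg: "\<forall>y \<in> carrier S. f (g y) = y"
    using copy_obj[OF obj_prod[OF M N]] by blast
  have i: "(\<lambda>x. (x, \<zero>\<^bsub>N\<^esub>)) \<in> hom M ?P" "(\<lambda>y. (\<zero>\<^bsub>M\<^esub>, y)) \<in> hom N ?P" "fst \<in> hom ?P M" "snd \<in> hom ?P N"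
    using M N by (auto intro!: module_homI simp: prod_module_def)
  have gc: "g s \<in> carrier ?P" if "s \<in> carrier S" for s using module_hom_closed[OF g that] .
  have sp: "(fst p, \<zero>\<^bsub>N\<^esub>) \<oplus>\<^bsub>?P\<^esub> (\<zero>\<^bsub>M\<^esub>, snd p) = p" if "p \<in> carrier ?P" for p
    using that M N by (auto simp: prod_module_def)
  have cl: "x \<in> carrier M \<Longrightarrow> (x, \<zero>\<^bsub>N\<^esub>) \<in> carrier ?P" "y \<in> carrier N \<Longrightarrow> (\<zero>\<^bsub>M\<^esub>, y) \<in> carrier ?P" for x y
    using M N by (auto simp: prod_module_def)
  have "f (fst (g s), \<zero>\<^bsub>N\<^esub>) \<oplus>\<^bsub>S\<^esub> f (\<zero>\<^bsub>M\<^esub>, snd (g s)) = s" if s: "s \<in> carrier S" for s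
    using sp[OF gc[OF s]] bspec[OF fg s] gc[OF s] i M N module_hom_add[OF f, symmetric]
      cl(1)[of "fst (g s)"] cl(2)[of "snd (g s)"] by (auto simp: module_hom_closed)
  then have "biprod M N S (\<lambda>x. f (x, \<zero>\<^bsub>N\<^esub>)) (\<lambda>y. f (\<zero>\<^bsub>M\<^esub>, y)) (\<lambda>s. fst (g s)) (\<lambda>s. snd (g s))"
    using cl M N by (intro biprodI M N S module_hom_comp[OF i(1) f] module_hom_comp[OF i(2) f]
      module_hom_comp[OF g i(3)] module_hom_comp[OF g i(4)]) (simp_all add: gf)
  then show ?thesis using that dsumI by blast
qed

end

text \<open>The module laws are equations, hence pass to the image under any surjection compatible
  with the operations. Unlike transport along a bijection this covers quotients.\<close>

lemma left_module_surj:
  fixes M :: "('a, 'm) module" and N :: "('a, 'n) module"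
  assumes "left_module A M" and onto: "f ` carrier M = carrier N"
    and zero: "\<zero>\<^bsub>N\<^esub> = f \<zero>\<^bsub>M\<^esub>"
    and add: "\<And>x y. \<lbrakk>x \<in> carrier M; y \<in> carrier M\<rbrakk> \<Longrightarrow> f x \<oplus>\<^bsub>N\<^esub> f y = f (x \<oplus>\<^bsub>M\<^esub> y)"
    and smult: "\<And>a x. \<lbrakk>a \<in> carrier A; x \<in> carrier M\<rbrakk> \<Longrightarrow> a \<odot>\<^bsub>N\<^esub> f x = f (a \<odot>\<^bsub>M\<^esub> x)"
  shows "left_module A N"
proof -
  interpret left_module A M by fact
  have s: "\<exists>x \<in> carrier M. y = f x" if "y \<in> carrier N" for y using onto that by blast
  have cl: "f x \<in> carrier N" if "x \<in> carrier M" for x using onto that by blast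
  have "abelian_group N"
  proof (rule abelian_groupI)
    fix x y assume "x \<in> carrier N" "y \<in> carrier N"
    then show "x \<oplus>\<^bsub>N\<^esub> y \<in> carrier N" using s[of x] s[of y] by (auto simp: add cl)
  next
    show "\<zero>\<^bsub>N\<^esub> \<in> carrier N" by (simp add: zero cl)
  next
    fix x y z assume "x \<in> carrier N" "y \<in> carrier N" "z \<in> carrier N"
    then show "x \<oplus>\<^bsub>N\<^esub> y \<oplus>\<^bsub>N\<^esub> z = x \<oplus>\<^bsub>N\<^esub> (y \<oplus>\<^bsub>N\<^esub> z)"
      using s[of x] s[of y] s[of z] by (auto simp: add M.a_assoc)
  next
    fix x y assume "x \<in> carrier N" "y \<in> carrier N"
    then show "x \<oplus>\<^bsub>N\<^esub> y = y \<oplus>\<^bsub>N\<^esub> x" using s[of x] s[of y] by (auto simp: add M.a_comm)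
  next
    fix x assume "x \<in> carrier N"
    then show "\<zero>\<^bsub>N\<^esub> \<oplus>\<^bsub>N\<^esub> x = x" using s[of x] by (auto simp: add zero)
  next
    fix x assume "x \<in> carrier N"
    then obtain x' where "x' \<in> carrier M" "x = f x'" using s[of x] by blast
    then show "\<exists>y \<in> carrier N. y \<oplus>\<^bsub>N\<^esub> x = \<zero>\<^bsub>N\<^esub>"
      by (intro bexI[of _ "f (\<ominus>\<^bsub>M\<^esub> x')"]) (simp_all add: add zero cl M.l_neg)
  qed
  then show ?thesis
  proof (intro left_module.intro left_module_axioms.intro R.ring_axioms)
    fix a x assume "a \<in> carrier A" "x \<in> carrier N"
    then show "a \<odot>\<^bsub>N\<^esub> x \<in> carrier N" using s[of x] by (auto simp: smult cl)
  next
    fix a b x assume "a \<in> carrier A" "b \<in> carrier A" "x \<in> carrier N"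
    then show "(a \<oplus>\<^bsub>A\<^esub> b) \<odot>\<^bsub>N\<^esub> x = a \<odot>\<^bsub>N\<^esub> x \<oplus>\<^bsub>N\<^esub> b \<odot>\<^bsub>N\<^esub> x" "(a \<otimes>\<^bsub>A\<^esub> b) \<odot>\<^bsub>N\<^esub> x = a \<odot>\<^bsub>N\<^esub> (b \<odot>\<^bsub>N\<^esub> x)"
      using s[of x] by (auto simp: smult add smult_l_distr smult_assoc1)
  next
    fix a x y assume "a \<in> carrier A" "x \<in> carrier N" "y \<in> carrier N"
    then show "a \<odot>\<^bsub>N\<^esub> (x \<oplus>\<^bsub>N\<^esub> y) = a \<odot>\<^bsub>N\<^esub> x \<oplus>\<^bsub>N\<^esub> a \<odot>\<^bsub>N\<^esub> y"
      using s[of x] s[of y] by (auto simp: smult add smult_r_distr)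
  next
    fix x assume "x \<in> carrier N"
    then show "\<one>\<^bsub>A\<^esub> \<odot>\<^bsub>N\<^esub> x = x" using s[of x] by (auto simp: smult)
  qed
qed

context module_category
begin

text \<open>Picked by choice, so that commutativity, associativity and cancellation can only be
  expected up to \<open>iso\<close>.\<close>

definition plus :: "'a umodule \<Rightarrow> 'a umodule \<Rightarrow> 'a umodule" (infixl "\<boxplus>" 65) where
  "M \<boxplus> N = (SOME S. dsum M N S)"

lemma dsum_plus: "\<lbrakk>obj M; obj N\<rbrakk> \<Longrightarrow> dsum M N (M \<boxplus> N)"
  unfolding plus_def using dsum_exists[of M N] by (metis someI_ex)

lemma obj_plus [simp]: "\<lbrakk>obj M; obj N\<rbrakk> \<Longrightarrow> obj (M \<boxplus> N)"
  using dsum_plus dsumD(3) by blast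

lemma dsum_iso:
  assumes d: "dsum M N S" and M: "iso M' M" and N: "iso N' N" and S: "iso S' S"
  shows "dsum M' N' S'"
proof -
  obtain i1 i2 p1 p2 where b: "biprod M N S i1 i2 p1 p2" using d by (rule dsumE)
  obtain f f' where f: "obj M'" "obj M" "f \<in> hom M' M" "f' \<in> hom M M'"
    "\<forall>x \<in> carrier M'. f' (f x) = x" "\<forall>x \<in> carrier M. f (f' x) = x" using M unfolding iso_def by blast
  obtain g g' where g: "obj N'" "obj N" "g \<in> hom N' N" "g' \<in> hom N N'"
    "\<forall>x \<in> carrier N'. g' (g x) = x" "\<forall>x \<in> carrier N. g (g' x) = x" using N unfolding iso_def by blast
  obtain h h' where h: "obj S'" "obj S" "h \<in> hom S' S" "h' \<in> hom S S'"
    "\<forall>x \<in> carrier S'. h' (h x) = x" "\<forall>x \<in> carrier S. h (h' x) = x" using S unfolding iso_def by blast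
  note [simp] = biprod_simps[OF b] f(1,2,5,6) g(1,2,5,6) h(1,2,5,6) hom_simps[OF f(3,1,2)] hom_simps[OF f(4,2,1)]
    hom_simps[OF g(3,1,2)] hom_simps[OF g(4,2,1)] hom_simps[OF h(3,1,2)] hom_simps[OF h(4,2,1)]
  note c = module_hom_comp
  have "h' (i1 (p1 (h s))) \<oplus>\<^bsub>S'\<^esub> h' (i2 (p2 (h s))) = s" if "s \<in> carrier S'" for s
    using that hom_simps(2)[OF h(4,2,1), of "i1 (p1 (h s))" "i2 (p2 (h s))", symmetric] by simp
  then have "biprod M' N' S' (\<lambda>x. h' (i1 (f x))) (\<lambda>x. h' (i2 (g x))) (\<lambda>s. f' (p1 (h s))) (\<lambda>s. g' (p2 (h s)))"
    by (intro biprodI c[OF c[OF f(3) biprodD(4)[OF b]] h(4)] c[OF c[OF g(3) biprodD(5)[OF b]] h(4)]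
      c[OF c[OF h(3) biprodD(6)[OF b]] f(4)] c[OF c[OF h(3) biprodD(7)[OF b]] g(4)]) simp_all
  then show ?thesis by (rule dsumI)
qed

lemma dsum_unique:
  assumes "dsum M N S" "dsum M N S'"
  shows "iso S S'"
proof -
  obtain i1 i2 p1 p2 where b: "biprod M N S i1 i2 p1 p2" using assms(1) by (rule dsumE)
  obtain j1 j2 q1 q2 where b': "biprod M N S' j1 j2 q1 q2" using assms(2) by (rule dsumE)
  note [simp] = biprod_simps[OF b] biprod_simps[OF b']
  note c = module_hom_comp
  show ?thesis
    by (intro isoI[of S S' "\<lambda>s. j1 (p1 s) \<oplus>\<^bsub>S'\<^esub> j2 (p2 s)" "\<lambda>s. i1 (q1 s) \<oplus>\<^bsub>S\<^esub> i2 (q2 s)"] hom_add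
        c[OF biprodD(6)[OF b] biprodD(4)[OF b']] c[OF biprodD(7)[OF b] biprodD(5)[OF b']]
        c[OF biprodD(6)[OF b'] biprodD(4)[OF b]] c[OF biprodD(7)[OF b'] biprodD(5)[OF b]]) simp_all
qed

lemma dsum_iff: "dsum M N S \<longleftrightarrow> obj M \<and> obj N \<and> iso (M \<boxplus> N) S"
proof
  assume d: "dsum M N S"
  then show "obj M \<and> obj N \<and> iso (M \<boxplus> N) S"
    using dsum_unique[OF dsum_plus[OF dsumD(1,2)[OF d]] d] dsumD[OF d] by blast
next
  assume *: "obj M \<and> obj N \<and> iso (M \<boxplus> N) S"
  then show "dsum M N S" using dsum_iso[OF dsum_plus[of M N], of M N S] iso_sym by simp
qed

lemma plus_cong: "iso M M' \<Longrightarrow> iso N N' \<Longrightarrow> iso (M \<boxplus> N) (M' \<boxplus> N')"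
  using dsum_iso[OF dsum_plus[of M N], of M' N' "M \<boxplus> N"] dsum_iff iso_sym isoD by (metis iso_refl obj_plus)

lemma plus_comm: "\<lbrakk>obj M; obj N\<rbrakk> \<Longrightarrow> iso (M \<boxplus> N) (N \<boxplus> M)"
  using dsum_swap[OF dsum_plus[of N M]] dsum_iff by blast

lemma plus_assoc:
  assumes M: "obj M" and N: "obj N" and L: "obj L"
  shows "iso (M \<boxplus> N \<boxplus> L) (M \<boxplus> (N \<boxplus> L))"
proof -
  obtain i1 i2 p1 p2 where b: "biprod M N (M \<boxplus> N) i1 i2 p1 p2" using dsum_plus[OF M N] by (rule dsumE)
  obtain j1 j2 q1 q2 where b': "biprod (M \<boxplus> N) L (M \<boxplus> N \<boxplus> L) j1 j2 q1 q2" using dsum_plus[OF obj_plus[OF M N] L] by (rule dsumE)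
  obtain k1 k2 r1 r2 where b'': "biprod N L (N \<boxplus> L) k1 k2 r1 r2" using dsum_plus[OF N L] by (rule dsumE)
  note [simp] = biprod_simps[OF b] biprod_simps[OF b'] biprod_simps[OF b'']
  note c = module_hom_comp
  have eq: "j1 (i1 (p1 (q1 s))) \<oplus>\<^bsub>M \<boxplus> N \<boxplus> L\<^esub> (j1 (i2 (p2 (q1 s))) \<oplus>\<^bsub>M \<boxplus> N \<boxplus> L\<^esub> j2 (q2 s)) = s"
    if s: "s \<in> carrier (M \<boxplus> N \<boxplus> L)" for s
  proof -
    have "j1 (i1 (p1 (q1 s))) \<oplus>\<^bsub>M \<boxplus> N \<boxplus> L\<^esub> (j1 (i2 (p2 (q1 s))) \<oplus>\<^bsub>M \<boxplus> N \<boxplus> L\<^esub> j2 (q2 s))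
      = (j1 (i1 (p1 (q1 s))) \<oplus>\<^bsub>M \<boxplus> N \<boxplus> L\<^esub> j1 (i2 (p2 (q1 s)))) \<oplus>\<^bsub>M \<boxplus> N \<boxplus> L\<^esub> j2 (q2 s)"
      using s by (simp add: add_ac(1))
    also have "\<dots> = j1 (i1 (p1 (q1 s)) \<oplus>\<^bsub>M \<boxplus> N\<^esub> i2 (p2 (q1 s))) \<oplus>\<^bsub>M \<boxplus> N \<boxplus> L\<^esub> j2 (q2 s)"
      using s by (subst biprod_simps(10)[OF b']) simp_all
    finally show ?thesis using s by simp
  qed
  have "biprod M (N \<boxplus> L) (M \<boxplus> N \<boxplus> L) (\<lambda>x. j1 (i1 x)) (\<lambda>u. j1 (i2 (r1 u)) \<oplus>\<^bsub>M \<boxplus> N \<boxplus> L\<^esub> j2 (r2 u))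
    (\<lambda>t. p1 (q1 t)) (\<lambda>t. k1 (p2 (q1 t)) \<oplus>\<^bsub>N \<boxplus> L\<^esub> k2 (q2 t))"
    by (intro biprodI hom_add c[OF biprodD(4)[OF b] biprodD(4)[OF b']]
        c[OF c[OF biprodD(6)[OF b''] biprodD(5)[OF b]] biprodD(4)[OF b']] c[OF biprodD(7)[OF b''] biprodD(5)[OF b']]
        c[OF biprodD(6)[OF b'] biprodD(6)[OF b]] c[OF c[OF biprodD(6)[OF b'] biprodD(7)[OF b]] biprodD(4)[OF b'']]
        c[OF biprodD(7)[OF b'] biprodD(5)[OF b'']]) (simp_all add: eq)
  then show ?thesis using dsumI dsum_iff iso_sym by blast
qed

lemma plus_right_comm: "\<lbrakk>obj M; obj N; obj L\<rbrakk> \<Longrightarrow> iso (M \<boxplus> N \<boxplus> L) (M \<boxplus> L \<boxplus> N)"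
  by (meson plus_assoc plus_comm plus_cong iso_refl iso_sym iso_trans)

lemma plus_swap4:
  assumes "obj M" "obj N" "obj L" "obj K"
  shows "iso (M \<boxplus> N \<boxplus> (L \<boxplus> K)) (M \<boxplus> L \<boxplus> (N \<boxplus> K))"
proof -
  have "iso (M \<boxplus> N \<boxplus> (L \<boxplus> K)) (M \<boxplus> N \<boxplus> L \<boxplus> K)" using assms by (intro iso_sym[OF plus_assoc]) simp_all
  also have "iso (M \<boxplus> N \<boxplus> L \<boxplus> K) (M \<boxplus> L \<boxplus> N \<boxplus> K)" using assms by (intro plus_cong plus_right_comm) simp_all
  also have "iso (M \<boxplus> L \<boxplus> N \<boxplus> K) (M \<boxplus> L \<boxplus> (N \<boxplus> K))" using assms by (intro plus_assoc) simp_all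
  finally show ?thesis .
qed

lemma zero_obj_iso:
  assumes "obj M" "obj N" "zero_module M" "zero_module N" shows "iso M N"
  using assms by (intro isoI[of M N "\<lambda>_. \<zero>\<^bsub>N\<^esub>" "\<lambda>_. \<zero>\<^bsub>M\<^esub>"] hom_zero) (simp_all add: zero_module_def)

lemma zero_iso: "iso M N \<Longrightarrow> zero_module M \<Longrightarrow> zero_module N"
proof -
  assume "iso M N" "zero_module M"
  then obtain f g where f: "obj M" "obj N" "f \<in> hom M N" "g \<in> hom N M" "\<forall>y \<in> carrier N. f (g y) = y"
    "carrier M = {\<zero>\<^bsub>M\<^esub>}" by (auto elim: isoE simp: zero_module_def)
  then have "y = \<zero>\<^bsub>N\<^esub>" if "y \<in> carrier N" for y
    using that hom_simps(1)[OF f(4,2,1)] hom_simps(4)[OF f(3,1,2)] by (metis singletonD)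
  then show ?thesis using f(2) by (auto simp: zero_module_def)
qed

lemma dsum_zero: "\<lbrakk>obj M; obj Z; zero_module Z\<rbrakk> \<Longrightarrow> dsum M Z M"
  by (rule dsumI[of _ _ _ "\<lambda>x. x" "\<lambda>_. \<zero>\<^bsub>M\<^esub>" "\<lambda>x. x" "\<lambda>_. \<zero>\<^bsub>Z\<^esub>"])
    (simp add: biprod_def module_hom_id hom_zero zero_module_def)

lemma obj_zero_submodule: "obj M \<Longrightarrow> obj (M\<lparr>carrier := {\<zero>\<^bsub>M\<^esub>}\<rparr>)" for M :: "'a umodule"
  using fg_submodule left_module.submodule_zero[OF objD] by blast

lemma zero_module_submodule: "zero_module (M\<lparr>carrier := {\<zero>\<^bsub>M\<^esub>}\<rparr>)"
  by (simp add: zero_module_def)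

section \<open>Retracts and internal direct sums\<close>

definition retr :: "'a umodule \<Rightarrow> 'a umodule \<Rightarrow> bool" where
  "retr X Y \<longleftrightarrow> obj X \<and> obj Y \<and> (\<exists>i \<in> hom X Y. \<exists>p \<in> hom Y X. \<forall>x \<in> carrier X. p (i x) = x)"

lemma retrE:
  assumes "retr X Y" obtains i p where "obj X" "obj Y" "i \<in> hom X Y" "p \<in> hom Y X" "\<forall>x \<in> carrier X. p (i x) = x"
  using assms that unfolding retr_def by (elim conjE bexE) simp

lemma retrI: "\<lbrakk>obj X; obj Y; i \<in> hom X Y; p \<in> hom Y X; \<And>x. x \<in> carrier X \<Longrightarrow> p (i x) = x\<rbrakk> \<Longrightarrow> retr X Y"
  unfolding retr_def by blast

lemma iso_retr: "iso X Y \<Longrightarrow> retr X Y"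
  unfolding iso_def retr_def by blast

lemma retr_trans [trans]:
  assumes "retr X Y" "retr Y Z" shows "retr X Z"
proof -
  obtain i p where 1: "obj X" "obj Y" "i \<in> hom X Y" "p \<in> hom Y X" "\<forall>x \<in> carrier X. p (i x) = x" using assms(1) unfolding retr_def by blast
  obtain j q where 2: "obj Y" "obj Z" "j \<in> hom Y Z" "q \<in> hom Z Y" "\<forall>x \<in> carrier Y. q (j x) = x" using assms(2) unfolding retr_def by blast
  show ?thesis using 1 2 by (intro retrI[OF 1(1) 2(2) module_hom_comp[OF 1(3) 2(3)] module_hom_comp[OF 2(4) 1(4)]])
    (simp add: module_hom_closed[OF 1(3)])
qed

lemma dsum_retr: "dsum M N S \<Longrightarrow> retr M S" "dsum M N S \<Longrightarrow> retr N S"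
proof -
  show *: "retr M S" if d: "dsum M N S" for M N
  proof -
    obtain i1 i2 p1 p2 where b: "biprod M N S i1 i2 p1 p2" using d by (rule dsumE)
    show ?thesis using biprodD[OF b] biprod_simps[OF b] by (intro retrI[of M S i1 p1]) simp_all
  qed
  show "dsum M N S \<Longrightarrow> retr N S" using * dsum_swap by blast
qed

text \<open>The kernel of the retraction is a complement, and \<open>y - i (p y)\<close> is the
  projection onto it.\<close>

lemma retr_biprod:
  assumes X: "obj X" and Y: "obj Y" and i: "i \<in> hom X Y" and p: "p \<in> hom Y X" and pi: "\<forall>x \<in> carrier X. p (i x) = x"
  defines "K \<equiv> Y\<lparr>carrier := {y \<in> carrier Y. p y = \<zero>\<^bsub>X\<^esub>}\<rparr>"
  shows "biprod X K Y i (\<lambda>y. y) p (\<lambda>y. y \<ominus>\<^bsub>Y\<^esub> i (p y))"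
proof -
  note [simp] = hom_simps[OF i X Y] hom_simps[OF p Y X] X Y pi
  have K: "obj K" unfolding K_def by (rule fg_submodule[OF Y submodule_kernel[OF p Y X]])
  have [simp]: "\<zero>\<^bsub>K\<^esub> = \<zero>\<^bsub>Y\<^esub>" by (simp add: K_def)
  have "(\<lambda>y. y \<ominus>\<^bsub>Y\<^esub> i (p y)) \<in> hom Y K"
    unfolding K_def by (intro module_hom_into hom_diff module_hom_id module_hom_comp[OF p i] Y) simp
  moreover have "(\<lambda>y. y) \<in> hom K Y" unfolding K_def by (rule module_hom_incl) simp
  ultimately show ?thesis using i p K by (intro biprodI) (simp_all add: K_def)
qed

lemma retr_dsum: assumes "retr X Y" obtains X' where "dsum X X' Y"
proof -
  obtain i p where 1: "obj X" "obj Y" "i \<in> hom X Y" "p \<in> hom Y X" "\<forall>x \<in> carrier X. p (i x) = x" using assms(1) unfolding retr_def by blast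
  show ?thesis using retr_biprod[OF 1] dsumI that by blast
qed

text \<open>Trivial intersection makes the decomposition of an element unique, and uniqueness is
  what makes the chosen components additive and linear.\<close>

lemma internal_biprod:
  assumes X: "obj X" and U: "submodule U A X" and V: "submodule V A X" and int: "U \<inter> V = {\<zero>\<^bsub>X\<^esub>}"
    and sum: "\<And>x. x \<in> carrier X \<Longrightarrow> \<exists>u\<in>U. \<exists>v\<in>V. x = u \<oplus>\<^bsub>X\<^esub> v"
  obtains p1 p2 where "biprod (X\<lparr>carrier := U\<rparr>) (X\<lparr>carrier := V\<rparr>) X (\<lambda>x. x) (\<lambda>x. x) p1 p2"
proof -
  let ?U = "X\<lparr>carrier := U\<rparr>" and ?V = "X\<lparr>carrier := V\<rparr>"
  note D = left_module.submoduleD[OF objD[OF X] U] and E = left_module.submoduleD[OF objD[OF X] V]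
  have obj: "obj ?U" "obj ?V" using fg_submodule[OF X] U V by auto
  obtain p1 p2 where p: "\<And>x. x \<in> carrier X \<Longrightarrow> p1 x \<in> U \<and> p2 x \<in> V \<and> x = p1 x \<oplus>\<^bsub>X\<^esub> p2 x"
    using sum by metis
  have uniq: "u = u' \<and> v = v'" if *: "u \<in> U" "u' \<in> U" "v \<in> V" "v' \<in> V" "u \<oplus>\<^bsub>X\<^esub> v = u' \<oplus>\<^bsub>X\<^esub> v'" for u u' v v'
  proof -
    have c: "u \<in> carrier X" "u' \<in> carrier X" "v \<in> carrier X" "v' \<in> carrier X" using * D(1) E(1) by auto
    have "(u \<oplus>\<^bsub>X\<^esub> v) \<ominus>\<^bsub>X\<^esub> (u' \<oplus>\<^bsub>X\<^esub> v) = (u' \<oplus>\<^bsub>X\<^esub> v') \<ominus>\<^bsub>X\<^esub> (u' \<oplus>\<^bsub>X\<^esub> v)" using *(5) by simp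
    then have "u \<ominus>\<^bsub>X\<^esub> u' = v' \<ominus>\<^bsub>X\<^esub> v" using c X by (simp add: add_diff_add)
    then have "u \<ominus>\<^bsub>X\<^esub> u' \<in> U \<inter> V" "v' \<ominus>\<^bsub>X\<^esub> v \<in> U \<inter> V" using D(6)[OF *(1,2)] E(6)[OF *(4,3)] by auto
    then show ?thesis using c X int diff_zero_iff[OF X, of u u'] diff_zero_iff[OF X, of v' v] by auto
  qed
  have pI: "p1 x = u \<and> p2 x = v" if "x \<in> carrier X" "u \<in> U" "v \<in> V" "x = u \<oplus>\<^bsub>X\<^esub> v" for x u v
    using uniq[of "p1 x" u "p2 x" v] p[of x] that by simp
  have add: "p1 (x \<oplus>\<^bsub>X\<^esub> y) = p1 x \<oplus>\<^bsub>X\<^esub> p1 y \<and> p2 (x \<oplus>\<^bsub>X\<^esub> y) = p2 x \<oplus>\<^bsub>X\<^esub> p2 y"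
    if xy: "x \<in> carrier X" "y \<in> carrier X" for x y
  proof (rule pI)
    have c: "p1 x \<in> carrier X" "p2 x \<in> carrier X" "p1 y \<in> carrier X" "p2 y \<in> carrier X" using p xy D(1) E(1) by auto
    have "x \<oplus>\<^bsub>X\<^esub> y = (p1 x \<oplus>\<^bsub>X\<^esub> p2 x) \<oplus>\<^bsub>X\<^esub> (p1 y \<oplus>\<^bsub>X\<^esub> p2 y)" using p xy by metis
    then show "x \<oplus>\<^bsub>X\<^esub> y = p1 x \<oplus>\<^bsub>X\<^esub> p1 y \<oplus>\<^bsub>X\<^esub> (p2 x \<oplus>\<^bsub>X\<^esub> p2 y)" using c X by (simp add: add_ac)
  qed (use xy p D E X in auto)
  have smul: "p1 (a \<odot>\<^bsub>X\<^esub> x) = a \<odot>\<^bsub>X\<^esub> p1 x \<and> p2 (a \<odot>\<^bsub>X\<^esub> x) = a \<odot>\<^bsub>X\<^esub> p2 x"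
    if ax: "a \<in> carrier A" "x \<in> carrier X" for a x
  proof (rule pI)
    have c: "p1 x \<in> carrier X" "p2 x \<in> carrier X" using p ax D(1) E(1) by auto
    have "a \<odot>\<^bsub>X\<^esub> x = a \<odot>\<^bsub>X\<^esub> (p1 x \<oplus>\<^bsub>X\<^esub> p2 x)" using p ax by metis
    then show "a \<odot>\<^bsub>X\<^esub> x = a \<odot>\<^bsub>X\<^esub> p1 x \<oplus>\<^bsub>X\<^esub> a \<odot>\<^bsub>X\<^esub> p2 x" using c X ax by (simp add: smul_add)
  qed (use ax p D E X in auto)
  have "biprod ?U ?V X (\<lambda>x. x) (\<lambda>x. x) p1 p2"
  proof (rule biprodI[OF obj X])
    show "(\<lambda>x. x) \<in> hom ?U X" "(\<lambda>x. x) \<in> hom ?V X" using D(1) E(1) by (auto intro!: module_hom_incl)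
    show "p1 \<in> hom X ?U" "p2 \<in> hom X ?V" using p add smul by (auto intro!: module_homI)
    show "p1 x = x" "p2 x = \<zero>\<^bsub>?V\<^esub>" if "x \<in> carrier ?U" for x
      using pI[of x x "\<zero>\<^bsub>X\<^esub>"] that D(1) E(2) X by auto
    show "p1 x = \<zero>\<^bsub>?U\<^esub>" "p2 x = x" if "x \<in> carrier ?V" for x
      using pI[of x "\<zero>\<^bsub>X\<^esub>" x] that E(1) D(2) X by auto
    show "p1 s \<oplus>\<^bsub>X\<^esub> p2 s = s" if "s \<in> carrier X" for s using p[OF that] by simp
  qed
  then show ?thesis by (rule that)
qed

lemma internal_direct_sum_iff:
  assumes X: "obj X"
  shows "internal_direct_sum A X U V \<longleftrightarrow> submodule U A X \<and> submodule V A X \<and> U \<inter> V = {\<zero>\<^bsub>X\<^esub>} \<and>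
    (\<forall>x \<in> carrier X. \<exists>u\<in>U. \<exists>v\<in>V. x = u \<oplus>\<^bsub>X\<^esub> v)"
proof -
  have *: "U <+>\<^bsub>X\<^esub> V = {u \<oplus>\<^bsub>X\<^esub> v | u v. u \<in> U \<and> v \<in> V}" by (auto simp: set_add_def set_mult_def)
  have "U <+>\<^bsub>X\<^esub> V \<subseteq> carrier X" if "submodule U A X" "submodule V A X"
    using left_module.submoduleD(1)[OF objD[OF X] that(1)] left_module.submoduleD(1)[OF objD[OF X] that(2)] X
    unfolding * by auto
  then show ?thesis unfolding internal_direct_sum_def * by blast
qed

lemma hom_inj: "\<lbrakk>f \<in> hom M N; obj M; obj N; \<And>x. x \<in> carrier M \<Longrightarrow> f x = \<zero>\<^bsub>N\<^esub> \<Longrightarrow> x = \<zero>\<^bsub>M\<^esub>\<rbrakk> \<Longrightarrow> inj_on f (carrier M)"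
proof (rule inj_onI)
  fix x y assume *: "f \<in> hom M N" "obj M" "obj N" "\<And>x. x \<in> carrier M \<Longrightarrow> f x = \<zero>\<^bsub>N\<^esub> \<Longrightarrow> x = \<zero>\<^bsub>M\<^esub>" "x \<in> carrier M" "y \<in> carrier M" "f x = f y"
  then have "f (x \<ominus>\<^bsub>M\<^esub> y) = \<zero>\<^bsub>N\<^esub>" using hom_simps[OF *(1-3)] by simp
  then have "x \<ominus>\<^bsub>M\<^esub> y = \<zero>\<^bsub>M\<^esub>" using * by simp
  then show "x = y" using diff_zero_iff[OF *(2,5,6)] by simp
qed

section \<open>Short exact sequences and quotients\<close>

definition ses :: "'a umodule \<Rightarrow> 'a umodule \<Rightarrow> 'a umodule \<Rightarrow> ((nat \<Rightarrow> 'a) set \<Rightarrow> (nat \<Rightarrow> 'a) set) \<Rightarrow>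
    ((nat \<Rightarrow> 'a) set \<Rightarrow> (nat \<Rightarrow> 'a) set) \<Rightarrow> bool" where
  "ses K E Q f g \<longleftrightarrow> obj K \<and> obj E \<and> obj Q \<and> f \<in> hom K E \<and> g \<in> hom E Q \<and> inj_on f (carrier K) \<and>
     g ` carrier E = carrier Q \<and> (\<forall>e \<in> carrier E. g e = \<zero>\<^bsub>Q\<^esub> \<longleftrightarrow> e \<in> f ` carrier K)"

lemma sesD:
  assumes "ses K E Q f g"
  shows "obj K" "obj E" "obj Q" "f \<in> hom K E" "g \<in> hom E Q" "inj_on f (carrier K)" "g ` carrier E = carrier Q"
    "\<And>e. e \<in> carrier E \<Longrightarrow> g e = \<zero>\<^bsub>Q\<^esub> \<longleftrightarrow> e \<in> f ` carrier K" "\<And>x. x \<in> carrier K \<Longrightarrow> g (f x) = \<zero>\<^bsub>Q\<^esub>"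
proof -
  note * = assms[unfolded ses_def]
  show "g (f x) = \<zero>\<^bsub>Q\<^esub>" if "x \<in> carrier K" for x
    using * module_hom_closed[of f A K E x] that by blast
qed (use assms[unfolded ses_def] in simp_all)

lemma sesI:
  assumes "obj K" "obj E" "obj Q" "f \<in> hom K E" "g \<in> hom E Q" "\<And>x. x \<in> carrier K \<Longrightarrow> f x = \<zero>\<^bsub>E\<^esub> \<Longrightarrow> x = \<zero>\<^bsub>K\<^esub>"
   "\<And>x. x \<in> carrier K \<Longrightarrow> g (f x) = \<zero>\<^bsub>Q\<^esub>" "\<And>y. y \<in> carrier Q \<Longrightarrow> \<exists>x \<in> carrier E. y = g x"
    "\<And>e. e \<in> carrier E \<Longrightarrow> g e = \<zero>\<^bsub>Q\<^esub> \<Longrightarrow> \<exists>x \<in> carrier K. e = f x"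
  shows "ses K E Q f g"
proof -
  have "g ` carrier E = carrier Q" using assms(8) module_hom_closed[OF assms(5)] by blast
  moreover have "g e = \<zero>\<^bsub>Q\<^esub> \<longleftrightarrow> e \<in> f ` carrier K" if "e \<in> carrier E" for e
    using assms(7)[of ] assms(9)[OF that] by auto
  ultimately show ?thesis unfolding ses_def using assms hom_inj[OF assms(4,1,2,6)] by simp
qed

lemma ses_surj: "ses K E Q f g \<Longrightarrow> y \<in> carrier Q \<Longrightarrow> \<exists>x \<in> carrier E. y = g x"
  using sesD(7) by blast

lemma ses_ker: "ses K E Q f g \<Longrightarrow> e \<in> carrier E \<Longrightarrow> g e = \<zero>\<^bsub>Q\<^esub> \<Longrightarrow> \<exists>x \<in> carrier K. e = f x"
  using sesD(8) by blast

lemma ses_inj: "ses K E Q f g \<Longrightarrow> x \<in> carrier K \<Longrightarrow> f x = \<zero>\<^bsub>E\<^esub> \<Longrightarrow> x = \<zero>\<^bsub>K\<^esub>"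
  using inj_onD[OF sesD(6), of K E Q f g x "\<zero>\<^bsub>K\<^esub>"] hom_simps(4)[OF sesD(4,1,2)] sesD(1) by (metis zero_mem)

lemma ses_kernel:
  assumes E: "obj E" and Q: "obj Q" and g: "g \<in> hom E Q" "\<And>y. y \<in> carrier Q \<Longrightarrow> \<exists>x \<in> carrier E. y = g x"
  shows "ses (E\<lparr>carrier := {x \<in> carrier E. g x = \<zero>\<^bsub>Q\<^esub>}\<rparr>) E Q (\<lambda>x. x) g"
  using g(2) by (intro sesI fg_submodule[OF E submodule_kernel[OF g(1) E Q]] E Q g(1) module_hom_incl) simp_all

text \<open>Cosets of \<open>N\<close> would be sets of elements and leave the type of objects.
  Instead the carrier consists of one chosen representative per coset, inside \<open>M\<close>, and
  the operations are followed by \<open>rep\<close>, which is constant on cosets.\<close>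

lemma quotient_exists:
  assumes M: "obj (M :: 'a umodule)" and N: "submodule N A M"
  obtains Q q where "obj (Q :: 'a umodule)" "q \<in> hom M Q" "q ` carrier M = carrier Q" "\<forall>x \<in> carrier M. q x = \<zero>\<^bsub>Q\<^esub> \<longleftrightarrow> x \<in> N"
proof -
  note D = left_module.submoduleD[OF objD[OF M] N]
  define rep where "rep x = (SOME y. y \<in> carrier M \<and> x \<ominus>\<^bsub>M\<^esub> y \<in> N)" for x
  have rep: "rep x \<in> carrier M \<and> x \<ominus>\<^bsub>M\<^esub> rep x \<in> N" if "x \<in> carrier M" for x
    using someI[of "\<lambda>y. y \<in> carrier M \<and> x \<ominus>\<^bsub>M\<^esub> y \<in> N" x] that D(2) M unfolding rep_def by simp
  have neg: "y \<ominus>\<^bsub>M\<^esub> x \<in> N" if "x \<ominus>\<^bsub>M\<^esub> y \<in> N" "x \<in> carrier M" "y \<in> carrier M" for x y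
    using D(5)[OF that(1)] that M by (simp add: diff_eq neg_add add_ac(2)[OF M, of y])
  have tr: "x \<ominus>\<^bsub>M\<^esub> z \<in> N" if "x \<ominus>\<^bsub>M\<^esub> y \<in> N" "y \<ominus>\<^bsub>M\<^esub> z \<in> N" "x \<in> carrier M" "y \<in> carrier M" "z \<in> carrier M" for x y z
  proof -
    have "(x \<ominus>\<^bsub>M\<^esub> y) \<oplus>\<^bsub>M\<^esub> (y \<ominus>\<^bsub>M\<^esub> z) = (x \<oplus>\<^bsub>M\<^esub> y) \<ominus>\<^bsub>M\<^esub> (y \<oplus>\<^bsub>M\<^esub> z)" using that M by (simp add: add_diff_add)
    also have "\<dots> = (x \<oplus>\<^bsub>M\<^esub> y) \<ominus>\<^bsub>M\<^esub> (z \<oplus>\<^bsub>M\<^esub> y)" using that M by (simp add: add_ac(2))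
    also have "\<dots> = x \<ominus>\<^bsub>M\<^esub> z" using that M by (subst add_diff_add) simp_all
    finally show ?thesis using D(3)[OF that(1,2)] by simp
  qed
  have rep_eq: "rep x = rep y" if "x \<ominus>\<^bsub>M\<^esub> y \<in> N" "x \<in> carrier M" "y \<in> carrier M" for x y
  proof -
    have "z \<in> carrier M \<and> x \<ominus>\<^bsub>M\<^esub> z \<in> N \<longleftrightarrow> z \<in> carrier M \<and> y \<ominus>\<^bsub>M\<^esub> z \<in> N" for z
      using tr[of x y z] tr[of y x z] neg that by blast
    then show ?thesis unfolding rep_def by simp
  qed
  have eq_rep: "x \<ominus>\<^bsub>M\<^esub> y \<in> N" if "rep x = rep y" "x \<in> carrier M" "y \<in> carrier M" for x y
    using tr[of x "rep x" y] rep[of x] rep[of y] neg[of y "rep y"] that by simp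
  define Q :: "'a umodule" where "Q = \<lparr>carrier = rep ` carrier M, monoid.mult = undefined, monoid.one = undefined,
    ring.zero = rep \<zero>\<^bsub>M\<^esub>, ring.add = (\<lambda>x y. rep (x \<oplus>\<^bsub>M\<^esub> y)), smult = (\<lambda>a x. rep (a \<odot>\<^bsub>M\<^esub> x))\<rparr>"
  have add: "rep x \<oplus>\<^bsub>Q\<^esub> rep y = rep (x \<oplus>\<^bsub>M\<^esub> y)" if "x \<in> carrier M" "y \<in> carrier M" for x y
  proof -
    have "(x \<oplus>\<^bsub>M\<^esub> y) \<ominus>\<^bsub>M\<^esub> (rep x \<oplus>\<^bsub>M\<^esub> rep y) \<in> N" using rep that D(3) M by (simp add: add_diff_add)
    then show ?thesis using rep_eq[of "x \<oplus>\<^bsub>M\<^esub> y" "rep x \<oplus>\<^bsub>M\<^esub> rep y"] rep that M by (simp add: Q_def)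
  qed
  have smul: "a \<odot>\<^bsub>Q\<^esub> rep x = rep (a \<odot>\<^bsub>M\<^esub> x)" if "a \<in> carrier A" "x \<in> carrier M" for a x
  proof -
    have "a \<odot>\<^bsub>M\<^esub> x \<ominus>\<^bsub>M\<^esub> a \<odot>\<^bsub>M\<^esub> rep x = a \<odot>\<^bsub>M\<^esub> (x \<ominus>\<^bsub>M\<^esub> rep x)" using that rep[of x] M by (simp add: diff_eq smul_add smul_neg)
    then have "a \<odot>\<^bsub>M\<^esub> x \<ominus>\<^bsub>M\<^esub> a \<odot>\<^bsub>M\<^esub> rep x \<in> N" using that rep[of x] D(4) by simp
    then show ?thesis using rep_eq[of "a \<odot>\<^bsub>M\<^esub> x" "a \<odot>\<^bsub>M\<^esub> rep x"] rep that M by (simp add: Q_def)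
  qed
  have onto: "rep ` carrier M = carrier Q" by (simp add: Q_def)
  have q: "rep \<in> hom M Q" using add smul by (intro module_homI) (simp_all add: Q_def)
  have "left_module A Q" by (rule left_module_surj[OF objD[OF M] onto]) (simp_all add: add smul, simp add: Q_def)
  then have Q: "obj Q" using obj_image[OF M _ q onto] by blast
  have "\<forall>x \<in> carrier M. rep x = \<zero>\<^bsub>Q\<^esub> \<longleftrightarrow> x \<in> N"
  proof
    fix x assume x: "x \<in> carrier M"
    have "rep x = rep \<zero>\<^bsub>M\<^esub> \<longleftrightarrow> x \<ominus>\<^bsub>M\<^esub> \<zero>\<^bsub>M\<^esub> \<in> N"
      using eq_rep[of x "\<zero>\<^bsub>M\<^esub>"] rep_eq[of x "\<zero>\<^bsub>M\<^esub>"] x zero_mem[OF M] by blast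
    then show "rep x = \<zero>\<^bsub>Q\<^esub> \<longleftrightarrow> x \<in> N" using x M by (simp add: Q_def)
  qed
  then show ?thesis by (rule that[OF Q q onto])
qed

lemma cokernel_exists:
  assumes K: "obj K" and E: "obj E" and f: "f \<in> hom K E" "inj_on f (carrier K)"
  obtains Q g where "ses K E Q f g"
proof -
  show thesis
  proof (rule quotient_exists[OF E submodule_image[OF f(1) K E]])
    fix Q :: "'a umodule" and q assume "obj Q" "q \<in> hom E Q" "q ` carrier E = carrier Q" "\<forall>x \<in> carrier E. q x = \<zero>\<^bsub>Q\<^esub> \<longleftrightarrow> x \<in> f ` carrier K"
    then have "ses K E Q f q" using K E f by (simp add: ses_def)
    then show thesis by (rule that)
  qed
qed

text \<open>For injections \<open>u\<close> and \<open>v\<close>, the cokernels of \<open>u\<close>,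
  of the composite and of \<open>v\<close> form a short exact sequence. It is what turns cokernels
  of iterated injections into iterated extensions.\<close>

lemma ses_comp:
  assumes 1: "ses M N C1 u q1" and 2: "ses N L C2 v q2" and 3: "ses M L C3 (\<lambda>x. v (u x)) q3"
  obtains a b where "ses C1 C3 C2 a b"
proof -
  note [simp] = sesD(1-3,9)[OF 1] sesD(1-3,9)[OF 2] sesD(1-3,9)[OF 3]
    hom_simps[OF sesD(4,1,2)[OF 1]] hom_simps[OF sesD(5,2,3)[OF 1]]
    hom_simps[OF sesD(4,1,2)[OF 2]] hom_simps[OF sesD(5,2,3)[OF 2]] hom_simps[OF sesD(5,2,3)[OF 3]]
  have z1: "q3 (v x) = \<zero>\<^bsub>C3\<^esub>" if "x \<in> carrier N" "q1 x = \<zero>\<^bsub>C1\<^esub>" for x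
  proof -
    from that obtain y where "y \<in> carrier M" "x = u y" using ses_ker[OF 1] by blast
    then show ?thesis by simp
  qed
  have z2: "q2 x = \<zero>\<^bsub>C2\<^esub>" if "x \<in> carrier L" "q3 x = \<zero>\<^bsub>C3\<^esub>" for x
  proof -
    from that obtain y where "y \<in> carrier M" "x = v (u y)" using ses_ker[OF 3] by blast
    then show ?thesis by simp
  qed
  obtain a where a: "a \<in> hom C1 C3" "\<forall>x \<in> carrier N. a (q1 x) = q3 (v x)"
    using desc_epi[OF sesD(2,3)[OF 1] sesD(3)[OF 3] sesD(5,7)[OF 1] module_hom_comp[OF sesD(4)[OF 2] sesD(5)[OF 3]] z1] by blast
  obtain b where b: "b \<in> hom C3 C2" "\<forall>x \<in> carrier L. b (q3 x) = q2 x"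
    using desc_epi[OF sesD(2,3)[OF 3] sesD(3)[OF 2] sesD(5,7)[OF 3] sesD(5)[OF 2] z2] by blast
  have "ses C1 C3 C2 a b"
  proof (rule sesI[OF _ _ _ a(1) b(1)])
    fix x assume "x \<in> carrier C1" "a x = \<zero>\<^bsub>C3\<^esub>"
    then obtain y where y: "y \<in> carrier N" "x = q1 y" "q3 (v y) = \<zero>\<^bsub>C3\<^esub>" using ses_surj[OF 1] a(2) by metis
    then obtain z where "z \<in> carrier M" "v y = v (u z)" using ses_ker[OF 3, of "v y"] by (metis hom_simps(1)[OF sesD(4,1,2)[OF 2]])
    then show "x = \<zero>\<^bsub>C1\<^esub>" using y inj_onD[OF sesD(6)[OF 2], of y "u z"] by simp
  next
    fix x assume "x \<in> carrier C1"
    then obtain y where "y \<in> carrier N" "x = q1 y" using ses_surj[OF 1] by blast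
    then show "b (a x) = \<zero>\<^bsub>C2\<^esub>" using a(2) b(2) by simp
  next
    fix y assume "y \<in> carrier C2"
    then obtain x where "x \<in> carrier L" "y = q2 x" using ses_surj[OF 2] by blast
    then show "\<exists>x \<in> carrier C3. y = b x" using b(2) by (intro bexI[of _ "q3 x"]) simp_all
  next
    fix e assume "e \<in> carrier C3" "b e = \<zero>\<^bsub>C2\<^esub>"
    then obtain x where x: "x \<in> carrier L" "e = q3 x" "q2 x = \<zero>\<^bsub>C2\<^esub>" using ses_surj[OF 3] b(2) by metis
    then obtain y where "y \<in> carrier N" "x = v y" using ses_ker[OF 2] by blast
    then show "\<exists>x \<in> carrier C1. e = a x" using x a(2) by (intro bexI[of _ "q1 y"]) simp_all
  qed simp_all
  then show ?thesis by (rule that)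
qed

end

context module_category
begin

section \<open>Fitting decompositions and indecomposable modules\<close>

text \<open>The union of the chain is a submodule, hence finitely generated, and finitely many
  generators already lie in one member.\<close>

lemma acc:
  assumes M: "obj (M :: 'a umodule)" and N: "\<And>n::nat. submodule (N n) A M" "\<And>n. N n \<subseteq> N (Suc n)"
  obtains k where "\<forall>n\<ge>k. N n = N k"
proof -
  have mono: "N m \<subseteq> N n" if "m \<le> n" for m n using lift_Suc_mono_le[of N, OF N(2) that] .
  note D = left_module.submoduleD[OF objD[OF M] N(1)]
  have U: "submodule (\<Union>n. N n) A M"
  proof (rule left_module.submoduleI[OF objD[OF M]])
    show "(\<Union>n. N n) \<subseteq> carrier M" using D(1) by blast
    show "\<zero>\<^bsub>M\<^esub> \<in> (\<Union>n. N n)" using D(2) by blast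
    fix x y assume "x \<in> (\<Union>n. N n)" "y \<in> (\<Union>n. N n)"
    then obtain m n where "x \<in> N m" "y \<in> N n" by blast
    then have "x \<in> N (max m n)" "y \<in> N (max m n)" using mono[of m "max m n"] mono[of n "max m n"] by auto
    then show "x \<oplus>\<^bsub>M\<^esub> y \<in> (\<Union>n. N n)" using D(3) by blast
  next
    fix a x assume "a \<in> carrier A" "x \<in> (\<Union>n. N n)"
    then show "a \<odot>\<^bsub>M\<^esub> x \<in> (\<Union>n. N n)" using D(4) by blast
  qed
  obtain S where S: "finite S" "left_module.gen_by A M S (\<Union>n. N n)"
    using fg_submodule[OF M U] left_module.finitely_generated_submodule_iff[OF objD[OF M] U]
    unfolding fg_module_def by blast
  have "\<exists>k. S \<subseteq> N k"
  proof -
    have "S \<subseteq> (\<Union>n. N n)" using S(2) unfolding left_module.gen_by_def[OF objD[OF M]] by blast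
    with S(1) show ?thesis
    proof (induction S)
      case (insert x S)
      then obtain k m where "S \<subseteq> N k" "x \<in> N m" by blast
      then have "insert x S \<subseteq> N (max k m)" using mono[of k "max k m"] mono[of m "max k m"] by auto
      then show ?case by blast
    qed simp
  qed
  then obtain k where "S \<subseteq> N k" by blast
  then have "(\<Union>n. N n) \<subseteq> N k" using left_module.gen_byD[OF objD[OF M] S(2) N(1)] by blast
  then have "\<forall>n\<ge>k. N n = N k" using mono by blast
  then show thesis by (rule that)
qed

text \<open>The images of the powers of \<open>f\<close> descend and their kernels ascend; beyond
  the point where both are stationary, \<open>f ^^ n\<close> and its square have the same kernel and
  the same image.\<close>

lemma fitting:
  assumes X: "obj (X :: 'a umodule)" and f: "f \<in> hom X X"
  obtains n where "n > 0" "\<forall>x \<in> carrier X. (f ^^ n) ((f ^^ n) x) = \<zero>\<^bsub>X\<^esub> \<longrightarrow> (f ^^ n) x = \<zero>\<^bsub>X\<^esub>"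
    "\<forall>x \<in> carrier X. \<exists>y \<in> carrier X. (f ^^ n) x = (f ^^ n) ((f ^^ n) y)"
proof -
  note p = hom_comp_pow[OF f]
  have pc: "(f ^^ n) x \<in> carrier X" if "x \<in> carrier X" for n x using hom_simps(1)[OF p X X that] .
  have z: "(f ^^ n) \<zero>\<^bsub>X\<^esub> = \<zero>\<^bsub>X\<^esub>" for n using hom_simps(4)[OF p X X] .
  have "\<exists>k. \<forall>n\<ge>k. (f ^^ n) ` carrier X = (f ^^ k) ` carrier X"
  proof (rule dcc[OF X])
    show "submodule ((f ^^ n) ` carrier X) A X" for n by (rule submodule_image[OF p X X])
    show "(f ^^ Suc n) ` carrier X \<subseteq> (f ^^ n) ` carrier X" for n
      using hom_simps(1)[OF f X X] by (auto simp: funpow_Suc_right simp del: funpow.simps)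
  qed
  then obtain k where k: "\<forall>n\<ge>k. (f ^^ n) ` carrier X = (f ^^ k) ` carrier X" by blast
  obtain l where l: "\<forall>n\<ge>l. {x \<in> carrier X. (f ^^ n) x = \<zero>\<^bsub>X\<^esub>} = {x \<in> carrier X. (f ^^ l) x = \<zero>\<^bsub>X\<^esub>}"
  proof (rule acc[OF X])
    show "submodule {x \<in> carrier X. (f ^^ n) x = \<zero>\<^bsub>X\<^esub>} A X" for n by (rule submodule_kernel[OF p X X])
    show "{x \<in> carrier X. (f ^^ n) x = \<zero>\<^bsub>X\<^esub>} \<subseteq> {x \<in> carrier X. (f ^^ Suc n) x = \<zero>\<^bsub>X\<^esub>}" for n
      using z[of 1] by auto
  qed blast
  \<comment> \<open>The successor makes \<open>n\<close> positive, so that a factor \<open>f\<close>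
    can be split off \<open>f ^^ n\<close> later on.\<close>
  define n where "n = Suc (max k l)"
  have n: "n \<ge> k" "n \<ge> l" "n > 0" by (auto simp: n_def)
  have ff: "(f ^^ n) ((f ^^ n) x) = (f ^^ (n + n)) x" for x by (simp add: funpow_add)
  have "(f ^^ (n + n)) ` carrier X = (f ^^ n) ` carrier X"
    using k[rule_format, of "n + n"] k[rule_format, of n] n by simp
  then have 1: "\<exists>y \<in> carrier X. (f ^^ n) x = (f ^^ n) ((f ^^ n) y)" if "x \<in> carrier X" for x
    unfolding ff using that by blast
  have "{x \<in> carrier X. (f ^^ (n + n)) x = \<zero>\<^bsub>X\<^esub>} = {x \<in> carrier X. (f ^^ n) x = \<zero>\<^bsub>X\<^esub>}"
    using l[rule_format, of "n + n"] l[rule_format, of n] n by simp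
  then have 2: "(f ^^ n) ((f ^^ n) x) = \<zero>\<^bsub>X\<^esub> \<longrightarrow> (f ^^ n) x = \<zero>\<^bsub>X\<^esub>" if "x \<in> carrier X" for x
    unfolding ff using that by blast
  show thesis using that[OF n(3)] 1 2 by blast
qed

text \<open>Writing \<open>g\<close> for \<open>f ^^ n\<close> and \<open>g x = g (g y)\<close>, the
  element \<open>x\<close> splits as \<open>x - g y\<close> plus \<open>g y\<close>. On the first
  summand \<open>f\<close> is nilpotent, on the second it is bijective.\<close>

lemma fitting_direct_sum:
  assumes X: "obj (X :: 'a umodule)" and f: "f \<in> hom X X"
  obtains n where "n > 0" "internal_direct_sum A X {x \<in> carrier X. (f ^^ n) x = \<zero>\<^bsub>X\<^esub>} ((f ^^ n) ` carrier X)"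
    "inj_on f ((f ^^ n) ` carrier X)" "f ` (f ^^ n) ` carrier X = (f ^^ n) ` carrier X"
proof -
  obtain n where n: "n > 0"
    and ker: "\<forall>x \<in> carrier X. (f ^^ n) ((f ^^ n) x) = \<zero>\<^bsub>X\<^esub> \<longrightarrow> (f ^^ n) x = \<zero>\<^bsub>X\<^esub>"
    and im: "\<forall>x \<in> carrier X. \<exists>y \<in> carrier X. (f ^^ n) x = (f ^^ n) ((f ^^ n) y)"
    by (rule fitting[OF X f])
  note p = hom_comp_pow[OF f]
  note [simp] = hom_simps[OF p X X] X
  let ?g = "f ^^ n"
  have ds: "internal_direct_sum A X {x \<in> carrier X. ?g x = \<zero>\<^bsub>X\<^esub>} (?g ` carrier X)"
    unfolding internal_direct_sum_iff[OF X]
  proof (intro conjI ballI)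
    show "submodule {x \<in> carrier X. ?g x = \<zero>\<^bsub>X\<^esub>} A X" by (rule submodule_kernel[OF p X X])
    show "submodule (?g ` carrier X) A X" by (rule submodule_image[OF p X X])
    have "?g \<zero>\<^bsub>X\<^esub> = \<zero>\<^bsub>X\<^esub>" by simp
    then have "\<zero>\<^bsub>X\<^esub> \<in> ?g ` carrier X" by (metis X image_eqI zero_mem)
    then show "{x \<in> carrier X. ?g x = \<zero>\<^bsub>X\<^esub>} \<inter> ?g ` carrier X = {\<zero>\<^bsub>X\<^esub>}"
      using ker \<open>?g \<zero>\<^bsub>X\<^esub> = \<zero>\<^bsub>X\<^esub>\<close> zero_mem[OF X] by blast
    fix x assume x: "x \<in> carrier X"
    then obtain y where y: "y \<in> carrier X" "?g x = ?g (?g y)" using im by blast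
    have "x \<ominus>\<^bsub>X\<^esub> ?g y \<in> {x \<in> carrier X. ?g x = \<zero>\<^bsub>X\<^esub>}" using x y by simp
    moreover have "x = (x \<ominus>\<^bsub>X\<^esub> ?g y) \<oplus>\<^bsub>X\<^esub> ?g y" using x y by simp
    ultimately show "\<exists>u\<in>{x \<in> carrier X. ?g x = \<zero>\<^bsub>X\<^esub>}. \<exists>v\<in>?g ` carrier X. x = u \<oplus>\<^bsub>X\<^esub> v" using y by blast
  qed
  have fg: "f (?g x) = ?g (f x)" for x by (simp add: funpow_swap1)
  obtain m where m: "n = Suc m" using n by (cases n) auto
  have gm: "?g x = (f ^^ m) (f x)" for x by (simp add: m funpow_swap1)
  have fc: "f x \<in> carrier X" if "x \<in> carrier X" for x using hom_simps(1)[OF f X X that] .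
  have inj: "inj_on f (?g ` carrier X)"
  proof (rule inj_onI)
    fix x y assume "x \<in> ?g ` carrier X" "y \<in> ?g ` carrier X" and eq: "f x = f y"
    then obtain u v where uv: "u \<in> carrier X" "v \<in> carrier X" "x = ?g u" "y = ?g v" by blast
    have "?g (?g u) = ?g (?g v)" using eq unfolding uv(3,4) gm by simp
    then have "?g (?g (u \<ominus>\<^bsub>X\<^esub> v)) = \<zero>\<^bsub>X\<^esub>" using uv by simp
    then have "?g (u \<ominus>\<^bsub>X\<^esub> v) = \<zero>\<^bsub>X\<^esub>" using ker uv by (metis X diff_closed)
    then show "x = y" using uv diff_zero_iff[OF X, of "?g u" "?g v"] by simp
  qed
  have "f ` ?g ` carrier X = ?g ` carrier X"
  proof (intro subset_antisym subsetI)
    fix x assume "x \<in> f ` ?g ` carrier X"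
    then obtain u where "u \<in> carrier X" "x = f (?g u)" by blast
    then show "x \<in> ?g ` carrier X" using fc fg by blast
  next
    fix x assume "x \<in> ?g ` carrier X"
    then obtain u where u: "u \<in> carrier X" "x = ?g (?g u)" using im by force
    have "x = f (?g ((f ^^ m) u))" unfolding u(2) by (simp add: m funpow_swap1)
    moreover have "(f ^^ m) u \<in> carrier X" using u(1) hom_simps(1)[OF hom_comp_pow[OF f] X X] by blast
    ultimately show "x \<in> f ` ?g ` carrier X" by blast
  qed
  then show thesis using that[OF n ds inj] by blast
qed

abbreviation indec :: "'a umodule \<Rightarrow> bool" where "indec M \<equiv> obj M \<and> indecomposable A M"

text \<open>One of the two Fitting summands vanishes: if the kernel does, the stable image is all of
  \<open>T\<close> and \<open>f\<close> is bijective on it; otherwise \<open>f ^^ n\<close> is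
  zero.\<close>

lemma indec_nilpotent_or_auto:
  assumes T: "indec T" and f: "f \<in> hom T T"
  shows "bij_betw f (carrier T) (carrier T) \<or> (\<exists>n. \<forall>x \<in> carrier T. (f ^^ n) x = \<zero>\<^bsub>T\<^esub>)"
proof -
  have X: "obj T" using T by simp
  obtain n where n: "n > 0" and ds: "internal_direct_sum A T {x \<in> carrier T. (f ^^ n) x = \<zero>\<^bsub>T\<^esub>} ((f ^^ n) ` carrier T)"
    and fi: "inj_on f ((f ^^ n) ` carrier T)" "f ` (f ^^ n) ` carrier T = (f ^^ n) ` carrier T" by (rule fitting_direct_sum[OF X f])
  from T ds have "{x \<in> carrier T. (f ^^ n) x = \<zero>\<^bsub>T\<^esub>} = {\<zero>\<^bsub>T\<^esub>} \<or> (f ^^ n) ` carrier T = {\<zero>\<^bsub>T\<^esub>}"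
    unfolding indecomposable_def by blast
  then show ?thesis
  proof
    assume z: "{x \<in> carrier T. (f ^^ n) x = \<zero>\<^bsub>T\<^esub>} = {\<zero>\<^bsub>T\<^esub>}"
    have sub: "(f ^^ n) ` carrier T \<subseteq> carrier T" using hom_simps(1)[OF hom_comp_pow[OF f] X X] by (rule image_subsetI)
    have sum: "\<forall>x \<in> carrier T. \<exists>u\<in>{\<zero>\<^bsub>T\<^esub>}. \<exists>v\<in>(f ^^ n) ` carrier T. x = u \<oplus>\<^bsub>T\<^esub> v"
      using ds unfolding internal_direct_sum_iff[OF X] z by (elim conjE)
    have "carrier T \<subseteq> (f ^^ n) ` carrier T"
    proof
      fix x assume "x \<in> carrier T"
      then obtain v where v: "v \<in> (f ^^ n) ` carrier T" "x = \<zero>\<^bsub>T\<^esub> \<oplus>\<^bsub>T\<^esub> v" using sum by blast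
      then have "v \<in> carrier T" using sub by blast
      then show "x \<in> (f ^^ n) ` carrier T" using v X by simp
    qed
    then have "(f ^^ n) ` carrier T = carrier T" using sub by blast
    then show ?thesis using fi by (simp add: bij_betw_def)
  next
    assume "(f ^^ n) ` carrier T = {\<zero>\<^bsub>T\<^esub>}"
    then show ?thesis by blast
  qed
qed

text \<open>Endomorphism rings of indecomposables are local. If neither \<open>f\<close> nor
  \<open>g\<close> is bijective, both are nilpotent. Then \<open>g\<close> is injective, because
  \<open>g x = 0\<close> gives \<open>f x = x\<close> and so \<open>x = 0\<close>, and an injective
  nilpotent map forces the zero module.\<close>

lemma indec_local:
  assumes T: "indec T" and f: "f \<in> hom T T" and g: "g \<in> hom T T" and sum: "\<And>x. x \<in> carrier T \<Longrightarrow> f x \<oplus>\<^bsub>T\<^esub> g x = x"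
  shows "bij_betw f (carrier T) (carrier T) \<or> bij_betw g (carrier T) (carrier T)"
proof (rule ccontr)
  assume neg: "\<not> ?thesis"
  have X: "obj T" using T by simp
  note [simp] = X hom_simps[OF f X X] hom_simps[OF g X X]
  obtain m where m: "\<forall>x \<in> carrier T. (f ^^ m) x = \<zero>\<^bsub>T\<^esub>" using indec_nilpotent_or_auto[OF T f] neg by blast
  obtain n where n: "\<forall>x \<in> carrier T. (g ^^ n) x = \<zero>\<^bsub>T\<^esub>" using indec_nilpotent_or_auto[OF T g] neg by blast
  have ginj: "x = \<zero>\<^bsub>T\<^esub>" if x: "x \<in> carrier T" "g x = \<zero>\<^bsub>T\<^esub>" for x
  proof -
    have "f x = x" using sum[OF x(1)] x by simp
    then have "(f ^^ k) x = x" for k by (induction k) simp_all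
    then show ?thesis using m x(1) by metis
  qed
  have gn: "x = \<zero>\<^bsub>T\<^esub>" if "x \<in> carrier T" "(g ^^ k) x = \<zero>\<^bsub>T\<^esub>" for x k
    using that
  proof (induction k arbitrary: x)
    case (Suc k)
    then have "g ((g ^^ k) x) = \<zero>\<^bsub>T\<^esub>" by simp
    then show ?case using Suc ginj hom_simps(1)[OF hom_comp_pow[OF g] X X] by blast
  qed simp
  have "zero_module T" unfolding zero_module_def using gn n zero_mem[OF X] by blast
  then show False using T by (simp add: indecomposable_def)
qed

lemma bij_inverse_hom:
  assumes "obj M" "obj N" "f \<in> hom M N" "bij_betw f (carrier M) (carrier N)"
  obtains g where "g \<in> hom N M" "\<forall>x \<in> carrier M. g (f x) = x" "\<forall>y \<in> carrier N. f (g y) = y"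
proof -
  have inj: "inj_on f (carrier M)" and im: "f ` carrier M = carrier N" using assms(4) by (auto simp: bij_betw_def)
  have "\<And>x. x \<in> carrier N \<Longrightarrow> x \<in> f ` carrier M" using im by blast
  then obtain g where g: "g \<in> hom N M" "\<forall>x \<in> carrier N. f (g x) = x"
    using lift_mono[OF assms(1,2,2) assms(3) inj module_hom_id] by blast
  have "g (f x) = x" if x: "x \<in> carrier M" for x
  proof (rule inj_onD[OF inj])
    show "f (g (f x)) = f x" using g(2) module_hom_closed[OF assms(3) x] by blast
  qed (use x module_hom_closed[OF assms(3) x] module_hom_closed[OF g(1)] in blast)+
  then show thesis using that[OF g(1)] g(2) by blast
qed

text \<open>The identity of \<open>T\<close> is the sum of its parts through \<open>M\<close> and
  through \<open>N\<close>. By locality one of them is invertible, and composing with its inverse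
  exhibits \<open>T\<close> as a retract of that summand.\<close>

lemma indec_retr_dsum:
  assumes T: "indec T" and TS: "retr T S" and d: "dsum M N S"
  shows "retr T M \<or> retr T N"
proof -
  obtain i p where ip: "obj T" "obj S" "i \<in> hom T S" "p \<in> hom S T" "\<forall>x \<in> carrier T. p (i x) = x" using TS by (rule retrE)
  obtain i1 i2 p1 p2 where b: "biprod M N S i1 i2 p1 p2" using d by (rule dsumE)
  note [simp] = biprod_simps[OF b] hom_simps[OF ip(3,1,2)] hom_simps[OF ip(4,2,1)] ip(1,2,5)
  note c = module_hom_comp
  have h: "(\<lambda>x. p1 (i x)) \<in> hom T M" "(\<lambda>x. p2 (i x)) \<in> hom T N" "(\<lambda>x. p (i1 x)) \<in> hom M T" "(\<lambda>x. p (i2 x)) \<in> hom N T"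
    by (intro c[OF ip(3) biprodD(6)[OF b]] c[OF ip(3) biprodD(7)[OF b]] c[OF biprodD(4)[OF b] ip(4)] c[OF biprodD(5)[OF b] ip(4)])+
  have sum: "p (i1 (p1 (i x))) \<oplus>\<^bsub>T\<^esub> p (i2 (p2 (i x))) = x" if x: "x \<in> carrier T" for x
  proof -
    have "p (i1 (p1 (i x))) \<oplus>\<^bsub>T\<^esub> p (i2 (p2 (i x))) = p (i1 (p1 (i x)) \<oplus>\<^bsub>S\<^esub> i2 (p2 (i x)))"
      using x by (subst hom_simps(2)[OF ip(4,2,1)]) simp_all
    then show ?thesis using x by simp
  qed
  have *: "retr T L" if u: "u \<in> hom T L" and v: "v \<in> hom L T" and L: "obj L"
    and bij: "bij_betw (\<lambda>x. v (u x)) (carrier T) (carrier T)" for u v and L :: "'a umodule"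
  proof -
    obtain w where w: "w \<in> hom T T" "\<forall>x \<in> carrier T. w (v (u x)) = x" "\<forall>x \<in> carrier T. v (u (w x)) = x"
      by (rule bij_inverse_hom[OF ip(1,1) c[OF u v] bij])
    show ?thesis by (rule retrI[OF ip(1) L u c[OF v w(1)]]) (use w in blast)
  qed
  have "bij_betw (\<lambda>x. p (i1 (p1 (i x)))) (carrier T) (carrier T) \<or> bij_betw (\<lambda>x. p (i2 (p2 (i x)))) (carrier T) (carrier T)"
    by (rule indec_local[OF T c[OF h(1,3)] c[OF h(2,4)] sum])
  then show ?thesis using *[OF h(1,3)] *[OF h(2,4)] biprodD(1,2)[OF b] by blast
qed

text \<open>The image of \<open>i\<close> and the kernel of \<open>p\<close> decompose
  \<open>U\<close>. The image is not zero, so the kernel is, and \<open>i\<close> and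
  \<open>p\<close> are inverse to each other.\<close>

lemma indec_retr_indec:
  assumes T: "indec T" and U: "indec U" and r: "retr T U" shows "iso T U"
proof -
  obtain i p where ip: "obj T" "obj U" "i \<in> hom T U" "p \<in> hom U T" "\<forall>x \<in> carrier T. p (i x) = x" using r by (rule retrE)
  note [simp] = hom_simps[OF ip(3,1,2)] hom_simps[OF ip(4,2,1)] ip(1,2,5)
  have "internal_direct_sum A U (i ` carrier T) {x \<in> carrier U. p x = \<zero>\<^bsub>T\<^esub>}"
    unfolding internal_direct_sum_iff[OF ip(2)]
  proof (intro conjI ballI)
    show "submodule (i ` carrier T) A U" "submodule {x \<in> carrier U. p x = \<zero>\<^bsub>T\<^esub>} A U"
      by (intro submodule_image[OF ip(3,1,2)] submodule_kernel[OF ip(4,2,1)])+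
    have "\<zero>\<^bsub>U\<^esub> \<in> i ` carrier T" by (rule image_eqI[of _ _ "\<zero>\<^bsub>T\<^esub>"]) simp_all
    then show "i ` carrier T \<inter> {x \<in> carrier U. p x = \<zero>\<^bsub>T\<^esub>} = {\<zero>\<^bsub>U\<^esub>}"
      by (intro subset_antisym subsetI) auto
    fix x assume x: "x \<in> carrier U"
    then have "x = i (p x) \<oplus>\<^bsub>U\<^esub> (x \<ominus>\<^bsub>U\<^esub> i (p x))" by simp
    moreover have "x \<ominus>\<^bsub>U\<^esub> i (p x) \<in> {x \<in> carrier U. p x = \<zero>\<^bsub>T\<^esub>}" "i (p x) \<in> i ` carrier T" using x by simp_all
    ultimately show "\<exists>u\<in>i ` carrier T. \<exists>v\<in>{x \<in> carrier U. p x = \<zero>\<^bsub>T\<^esub>}. x = u \<oplus>\<^bsub>U\<^esub> v" by blast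
  qed
  then have "i ` carrier T = {\<zero>\<^bsub>U\<^esub>} \<or> {x \<in> carrier U. p x = \<zero>\<^bsub>T\<^esub>} = {\<zero>\<^bsub>U\<^esub>}"
    using U unfolding indecomposable_def by blast
  then show ?thesis
  proof
    assume z: "i ` carrier T = {\<zero>\<^bsub>U\<^esub>}"
    have "x = \<zero>\<^bsub>T\<^esub>" if x: "x \<in> carrier T" for x
    proof -
      have "i x = \<zero>\<^bsub>U\<^esub>" using z x by blast
      then have "p (i x) = \<zero>\<^bsub>T\<^esub>" by simp
      then show ?thesis using x by simp
    qed
    then have "zero_module T" unfolding zero_module_def using zero_mem[OF ip(1)] by blast
    then show ?thesis using T by (simp add: indecomposable_def)
  next
    assume z: "{x \<in> carrier U. p x = \<zero>\<^bsub>T\<^esub>} = {\<zero>\<^bsub>U\<^esub>}"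
    have "i (p x) = x" if x: "x \<in> carrier U" for x
    proof -
      have "x \<ominus>\<^bsub>U\<^esub> i (p x) \<in> {x \<in> carrier U. p x = \<zero>\<^bsub>T\<^esub>}" using x by simp
      then show ?thesis using z x diff_zero_iff[of U x "i (p x)"] by simp
    qed
    then show ?thesis by (intro isoI[OF ip(1,2,3,4)]) simp_all
  qed
qed

section \<open>Decompositions into indecomposables\<close>

inductive msum :: "'a umodule multiset \<Rightarrow> 'a umodule \<Rightarrow> bool" where
  msum_zero: "obj Z \<Longrightarrow> zero_module Z \<Longrightarrow> msum {#} Z"
| msum_add: "msum J X \<Longrightarrow> dsum U X Y \<Longrightarrow> msum (add_mset U J) Y"

lemma msum_obj: "msum J X \<Longrightarrow> obj X"
  by (induction rule: msum.induct) (auto dest: dsumD)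

lemma msum_iso: "msum J X \<Longrightarrow> iso X Y \<Longrightarrow> msum J Y"
proof (induction arbitrary: Y rule: msum.induct)
  case (msum_zero Z)
  then show ?case using zero_iso isoD msum.msum_zero by blast
next
  case (msum_add J X U X')
  have "dsum U X Y" using dsum_iso[OF msum_add(2), of U X Y] msum_add(4) dsumD[OF msum_add(2)] by (simp add: iso_sym)
  then show ?case using msum_add(1) msum.msum_add by blast
qed

lemma msum_union: "msum J X \<Longrightarrow> msum J' X' \<Longrightarrow> dsum X X' Y \<Longrightarrow> msum (J + J') Y"
proof (induction arbitrary: Y rule: msum.induct)
  case (msum_zero Z)
  then have "dsum X' Z X'" "dsum X' Z Y" using dsum_zero[of X' Z] dsumD(2) dsum_swap by blast+
  then have "iso X' Y" by (rule dsum_unique)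
  then show ?case using msum_iso msum_zero by simp
next
  case (msum_add J X U S)
  note o = dsumD[OF msum_add(2)] dsumD[OF msum_add(5)]
  have 1: "msum (J + J') (X \<boxplus> X')" using msum_add o by (intro msum_add(3)) (auto simp: dsum_plus)
  have "iso (U \<boxplus> (X \<boxplus> X')) (U \<boxplus> X \<boxplus> X')" using o by (intro iso_sym[OF plus_assoc]) simp_all
  also have "iso (U \<boxplus> X \<boxplus> X') (S \<boxplus> X')" using o msum_add(2) dsum_iff by (intro plus_cong) simp_all
  also have "iso (S \<boxplus> X') Y" using msum_add(5) dsum_iff by blast
  finally have "dsum U (X \<boxplus> X') Y" using o dsum_iff by simp
  from msum.msum_add[OF 1 this] show ?case by simp
qed

lemma msum_single: "obj M \<Longrightarrow> msum {#M#} M"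
  using msum_add[OF msum_zero[OF obj_zero_submodule zero_module_submodule] dsum_zero[OF _ obj_zero_submodule zero_module_submodule]]
  by blast

text \<open>The inductive description adds summands in some order that the multiset does not
  remember. The inner induction shows that any chosen member can be split off first, by exchanging
  it with the summand that was added last.\<close>

lemma msum_unique: "msum J X \<Longrightarrow> msum J Y \<Longrightarrow> iso X Y"
proof (induction J arbitrary: X Y)
  case empty
  then show ?case by (auto elim!: msum.cases[of "{#}"] intro: zero_obj_iso)
next
  case (add U J)
  have *: "\<exists>X'. msum J X' \<and> dsum U X' X" if "msum (add_mset U J) X" for X
    using that
  proof (induction "size J" arbitrary: J X)
    case 0
    from 0(2) show ?case by (cases rule: msum.cases) (use 0(1) in \<open>auto simp: add_mset_eq_single\<close>)
  next
    case (Suc n)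
    from Suc(3) obtain V K X' where V: "add_mset U J = add_mset V K" "msum K X'" "dsum V X' X"
      by (cases rule: msum.cases) auto
    show ?case
    proof (cases "U = V")
      case True then show ?thesis using V by auto
    next
      case False
      then obtain L where L: "J = add_mset V L" "K = add_mset U L" using V(1) by (auto simp: add_eq_conv_ex)
      then have "n = size L" using Suc(2) by simp
      then obtain X'' where X'': "msum L X''" "dsum U X'' X'" using Suc(1)[of L X'] V(2) L by auto
      note o = dsumD[OF X''(2)] dsumD[OF V(3)]
      have 1: "msum J (V \<boxplus> X'')" unfolding L using msum_add[OF X''(1) dsum_plus] o by simp
      have "iso (U \<boxplus> (V \<boxplus> X'')) (U \<boxplus> V \<boxplus> X'')" using o by (intro iso_sym[OF plus_assoc]) simp_all
      also have "iso (U \<boxplus> V \<boxplus> X'') (V \<boxplus> U \<boxplus> X'')" using o by (intro plus_cong plus_comm) simp_all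
      also have "iso (V \<boxplus> U \<boxplus> X'') (V \<boxplus> (U \<boxplus> X''))" using o by (intro plus_assoc) simp_all
      also have "iso (V \<boxplus> (U \<boxplus> X'')) (V \<boxplus> X')" using o X''(2) dsum_iff by (intro plus_cong) simp_all
      also have "iso (V \<boxplus> X') X" using V(3) dsum_iff by blast
      finally show ?thesis using 1 o dsum_iff by auto
    qed
  qed
  obtain X' Y' where X': "msum J X'" "dsum U X' X" and Y': "msum J Y'" "dsum U Y' Y" using * add.prems by blast
  have "dsum U X' Y" using dsum_iso[OF Y'(2), of U X' Y] add.IH[OF X'(1) Y'(1)] dsumD[OF Y'(2)] by simp
  then show ?case using X'(2) dsum_unique by blast
qed

text \<open>The object \<open>E\<close> only supplies a zero module, for the empty sum.\<close>

lemma msum_exists: "(\<And>U. U \<in># J \<Longrightarrow> obj U) \<Longrightarrow> obj E \<Longrightarrow> \<exists>X. msum J X" for E :: "'a umodule"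
proof (induction J)
  case empty
  then show ?case using msum_zero obj_zero_submodule zero_module_submodule by blast
next
  case (add U J)
  then obtain X where "msum J X" by auto
  then show ?case using msum_add[OF _ dsum_plus[of U X]] add(2) msum_obj by auto
qed

text \<open>A minimal submodule without such a decomposition is neither zero nor indecomposable, so
  it is the direct sum of two proper submodules, which do decompose.\<close>

lemma decompose:
  assumes M: "obj (M :: 'a umodule)" obtains J where "msum J M" "\<forall>U \<in># J. indec U"
proof -
  define P where "P N \<longleftrightarrow> (\<exists>J. msum J (M\<lparr>carrier := N\<rparr>) \<and> (\<forall>U \<in># J. indec U))" for N
  have all: "P N" if N: "submodule N A M" for N
  proof (rule ccontr)
    assume nP: "\<not> P N"
    let ?X = "{N. submodule N A M \<and> \<not> P N}"
    have d: "\<exists>k. \<forall>n\<ge>k. F n = F k" if "\<And>n. submodule (F n) A M" "\<And>n. F (Suc n) \<subseteq> F n" for F :: "nat \<Rightarrow> _"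
      using dcc[OF M, of F] that by blast
    have "\<exists>U\<in>?X. \<forall>Y\<in>?X. Y \<subseteq> U \<longrightarrow> Y = U"
      by (rule dcc_minimal[where P = "\<lambda>U. submodule U A M" and X = N]) (use d N nP in simp_all)
    then obtain N where "N \<in> ?X" and min: "\<forall>Y\<in>?X. Y \<subseteq> N \<longrightarrow> Y = N" by blast
    then have N: "submodule N A M" "\<not> P N" by simp_all
    let ?N = "M\<lparr>carrier := N\<rparr>"
    have oN: "obj ?N" by (rule fg_submodule[OF M N(1)])
    have "\<not> zero_module ?N"
    proof
      assume "zero_module ?N"
      then have "msum {#} ?N" using oN msum_zero by blast
      then show False using N(2) unfolding P_def by (metis empty_iff set_mset_empty)
    qed
    moreover have "\<not> indec ?N"
    proof
      assume "indec ?N"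
      then have "msum {#?N#} ?N \<and> (\<forall>U \<in># {#?N#}. indec U)" using msum_single by simp
      then show False using N(2) unfolding P_def by blast
    qed
    ultimately obtain U V where ds: "internal_direct_sum A ?N U V" and UV: "U \<noteq> {\<zero>\<^bsub>?N\<^esub>}" "V \<noteq> {\<zero>\<^bsub>?N\<^esub>}"
      using oN unfolding indecomposable_def by blast
    from ds have d: "submodule U A ?N" "submodule V A ?N" "U \<inter> V = {\<zero>\<^bsub>?N\<^esub>}"
      and s: "\<And>x. x \<in> carrier ?N \<Longrightarrow> \<exists>u\<in>U. \<exists>v\<in>V. x = u \<oplus>\<^bsub>?N\<^esub> v"
      unfolding internal_direct_sum_iff[OF oN] by simp_all
    have sub: "submodule U A M" "U \<subseteq> N" "submodule V A M" "V \<subseteq> N"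
      using d(1,2) left_module.submodule_submodule[OF objD[OF M] N(1)] by simp_all
    have "U \<noteq> N"
    proof
      assume "U = N" then have "V = {\<zero>\<^bsub>?N\<^esub>}" using d(3) sub(4) by blast
      then show False using UV by simp
    qed
    have "V \<noteq> N"
    proof
      assume "V = N" then have "U = {\<zero>\<^bsub>?N\<^esub>}" using d(3) sub(2) by blast
      then show False using UV by simp
    qed
    have "P U" "P V" using min sub \<open>U \<noteq> N\<close> \<open>V \<noteq> N\<close> by blast+
    then obtain J J' where J: "msum J (M\<lparr>carrier := U\<rparr>)" "\<forall>U \<in># J. indec U" "msum J' (M\<lparr>carrier := V\<rparr>)" "\<forall>U \<in># J'. indec U"
      unfolding P_def by blast
    obtain p1 p2 where "biprod (?N\<lparr>carrier := U\<rparr>) (?N\<lparr>carrier := V\<rparr>) ?N (\<lambda>x. x) (\<lambda>x. x) p1 p2"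
      by (rule internal_biprod[OF oN d s])
    then have "dsum (M\<lparr>carrier := U\<rparr>) (M\<lparr>carrier := V\<rparr>) ?N" using dsumI by simp
    then have "msum (J + J') ?N" by (rule msum_union[OF J(1,3)])
    moreover have "\<forall>U \<in># J + J'. indec U" using J by auto
    ultimately show False using N(2) unfolding P_def by blast
  qed
  have "P (carrier M)" by (rule all[OF left_module.submodule_carrier[OF objD[OF M]]])
  then show thesis using that unfolding P_def by auto
qed

lemma indec_retr_msum:
  assumes T: "indec T" shows "msum J X \<Longrightarrow> retr T X \<Longrightarrow> \<exists>U \<in># J. retr T U"
proof (induction rule: msum.induct)
  case (msum_zero Z)
  obtain i p where ip: "obj T" "obj Z" "i \<in> hom T Z" "p \<in> hom Z T" "\<forall>x \<in> carrier T. p (i x) = x" using msum_zero(3) by (rule retrE)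
  have "x = \<zero>\<^bsub>T\<^esub>" if x: "x \<in> carrier T" for x
  proof -
    have "i x = \<zero>\<^bsub>Z\<^esub>" using hom_simps(1)[OF ip(3,1,2) x] msum_zero(2) by (simp add: zero_module_def)
    then show ?thesis using hom_simps(4)[OF ip(4,2,1)] ip(5) x by metis
  qed
  then have "zero_module T" unfolding zero_module_def using zero_mem[OF ip(1)] by blast
  then show ?case using T by (simp add: indecomposable_def)
next
  case (msum_add J X U Y)
  then show ?case using indec_retr_dsum[OF T msum_add(4) msum_add(2)] by auto
qed

lemma msum_retr: "msum J X \<Longrightarrow> U \<in># J \<Longrightarrow> retr U X"
proof (induction rule: msum.induct)
  case (msum_add J X V Y)
  then show ?case using dsum_retr[OF msum_add(2)] retr_trans by auto
qed simp

end

section \<open>Cancellation of direct summands\<close>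

context module_category
begin

text \<open>The component of \<open>i2\<close> under \<open>q2\<close> compares the two embeddings
  of \<open>C\<close>. If it is invertible, \<open>S\<close> is also the direct sum of the image of
  \<open>Y\<close> and the image of \<open>C\<close> under \<open>i2\<close>; since
  \<open>p1\<close> is the projection along the latter, it maps \<open>Y\<close> isomorphically onto
  \<open>X\<close>.\<close>

lemma cancel_aux:
  assumes b: "biprod X C S i1 i2 p1 p2" and b': "biprod Y C S j1 j2 q1 q2"
    and bij: "bij_betw (\<lambda>c. q2 (i2 c)) (carrier C) (carrier C)"
  shows "iso X Y"
proof -
  note [simp] = biprod_simps[OF b] biprod_simps[OF b']
  note c = module_hom_comp
  obtain w where w: "w \<in> hom C C" "\<forall>c \<in> carrier C. w (q2 (i2 c)) = c" "\<forall>c \<in> carrier C. q2 (i2 (w c)) = c"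
    by (rule bij_inverse_hom[OF biprodD(2,2)[OF b] c[OF biprodD(5)[OF b] biprodD(7)[OF b']] bij])
  note [simp] = hom_simps[OF w(1) biprodD(2,2)[OF b]]
  have h: "(\<lambda>y. p1 (j1 y)) \<in> hom Y X" by (rule c[OF biprodD(4)[OF b'] biprodD(6)[OF b]])
  have "inj_on (\<lambda>y. p1 (j1 y)) (carrier Y)"
  proof (rule hom_inj[OF h])
    fix y assume y: "y \<in> carrier Y" "p1 (j1 y) = \<zero>\<^bsub>X\<^esub>"
    let ?c = "p2 (j1 y)"
    have e: "j1 y = i2 ?c" using biprod_simps(5)[OF b, of "j1 y"] y by simp
    have "q2 (i2 ?c) = \<zero>\<^bsub>C\<^esub>" unfolding e[symmetric] using y by simp
    then have "w (q2 (i2 ?c)) = \<zero>\<^bsub>C\<^esub>" by simp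
    then have "?c = \<zero>\<^bsub>C\<^esub>" using w(2) y by simp
    then have "j1 y = \<zero>\<^bsub>S\<^esub>" using e by simp
    then have "q1 (j1 y) = \<zero>\<^bsub>Y\<^esub>" by simp
    then show "y = \<zero>\<^bsub>Y\<^esub>" using y by simp
  qed simp_all
  moreover have "(\<lambda>y. p1 (j1 y)) ` carrier Y = carrier X"
  proof (intro subset_antisym subsetI)
    fix x assume x: "x \<in> carrier X"
    \<comment> \<open>\<open>i1 x\<close> is corrected by an element coming from \<open>C\<close>,
      invisible to \<open>p1\<close>, so that \<open>q2\<close> kills the result and it comes from
      \<open>Y\<close>.\<close>
    define s where "s = i1 x \<oplus>\<^bsub>S\<^esub> i2 (\<ominus>\<^bsub>C\<^esub> w (q2 (i1 x)))"
    have s: "s \<in> carrier S" unfolding s_def using x by simp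
    have "q2 s = \<zero>\<^bsub>C\<^esub>" unfolding s_def using x w(3) by simp
    then have "j1 (q1 s) = s" using biprod_simps(5)[OF b' s] s by simp
    then have "p1 (j1 (q1 s)) = x" unfolding s_def using x by simp
    then show "x \<in> (\<lambda>y. p1 (j1 y)) ` carrier Y" using s by (intro image_eqI[of _ _ "q1 s"]) simp_all
  qed (use hom_simps(1)[OF h] in force)
  ultimately show ?thesis by (intro iso_sym[OF iso_bij[OF _ _ h]]) (simp_all add: bij_betw_def)
qed

text \<open>An elementary transformation: the complement \<open>C\<close> is replaced by the graph
  of \<open>k\<close>, while \<open>i1\<close> and \<open>p2\<close> stay the same.\<close>

lemma biprod_shear:
  assumes b: "biprod X C S i1 i2 p1 p2" and k: "k \<in> hom C X"
  shows "biprod X C S i1 (\<lambda>c. i2 c \<oplus>\<^bsub>S\<^esub> i1 (k c)) (\<lambda>s. p1 s \<ominus>\<^bsub>X\<^esub> k (p2 s)) p2"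
proof -
  note [simp] = biprod_simps[OF b] hom_simps[OF k biprodD(2,1)[OF b]]
  note c = module_hom_comp
  have "i1 (p1 s) \<ominus>\<^bsub>S\<^esub> i1 (k (p2 s)) \<oplus>\<^bsub>S\<^esub> (i2 (p2 s) \<oplus>\<^bsub>S\<^esub> i1 (k (p2 s))) = s" if s: "s \<in> carrier S" for s
  proof -
    have "i1 (p1 s) \<ominus>\<^bsub>S\<^esub> i1 (k (p2 s)) \<oplus>\<^bsub>S\<^esub> (i2 (p2 s) \<oplus>\<^bsub>S\<^esub> i1 (k (p2 s)))
      = i1 (p1 s) \<ominus>\<^bsub>S\<^esub> i1 (k (p2 s)) \<oplus>\<^bsub>S\<^esub> (i1 (k (p2 s)) \<oplus>\<^bsub>S\<^esub> i2 (p2 s))"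
      using s by (simp add: add_ac(2)[of S "i2 (p2 s)"])
    also have "\<dots> = i1 (p1 s) \<oplus>\<^bsub>S\<^esub> i2 (p2 s)" using s by (simp add: add_ac(1)[symmetric])
    finally show ?thesis using s by simp
  qed
  then show ?thesis
    by (intro biprodI hom_add hom_diff c[OF biprodD(7)[OF b] k] c[OF k biprodD(4)[OF b]] biprodD[OF b]) simp_all
qed

text \<open>The identity of \<open>C\<close> is the sum of a part through \<open>X\<close> and a
  part through \<open>C\<close>, and locality makes one of them invertible. If it is the second, the
  comparison of the two embeddings of \<open>C\<close> is itself invertible; if it is the first, a
  shear makes it so.\<close>

lemma cancel_indec:
  assumes C: "indec C" and X: "dsum X C S" and Y: "dsum Y C S"
  shows "iso X Y"
proof -
  obtain i1 i2 p1 p2 where b: "biprod X C S i1 i2 p1 p2" using X by (rule dsumE)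
  obtain j1 j2 q1 q2 where b': "biprod Y C S j1 j2 q1 q2" using Y by (rule dsumE)
  note [simp] = biprod_simps[OF b] biprod_simps[OF b']
  note c = module_hom_comp
  have h: "(\<lambda>x. q2 (i2 x)) \<in> hom C C" "(\<lambda>x. p2 (j2 x)) \<in> hom C C" "(\<lambda>x. p1 (j2 x)) \<in> hom C X" "(\<lambda>x. q2 (i1 x)) \<in> hom X C"
    by (intro c[OF biprodD(5)[OF b] biprodD(7)[OF b']] c[OF biprodD(5)[OF b'] biprodD(7)[OF b]]
      c[OF biprodD(5)[OF b'] biprodD(6)[OF b]] c[OF biprodD(4)[OF b] biprodD(7)[OF b']])+
  have sum: "q2 (i1 (p1 (j2 x))) \<oplus>\<^bsub>C\<^esub> q2 (i2 (p2 (j2 x))) = x" if x: "x \<in> carrier C" for x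
  proof -
    have "q2 (i1 (p1 (j2 x))) \<oplus>\<^bsub>C\<^esub> q2 (i2 (p2 (j2 x))) = q2 (i1 (p1 (j2 x)) \<oplus>\<^bsub>S\<^esub> i2 (p2 (j2 x)))"
      using x by (subst hom_simps(2)[OF biprodD(7,3,2)[OF b']]) simp_all
    then show ?thesis using x by simp
  qed
  have "bij_betw (\<lambda>x. q2 (i1 (p1 (j2 x)))) (carrier C) (carrier C) \<or> bij_betw (\<lambda>x. q2 (i2 (p2 (j2 x)))) (carrier C) (carrier C)"
    by (rule indec_local[OF C c[OF h(3,4)] c[OF h(2,1)] sum])
  then show ?thesis
  proof
    assume bij: "bij_betw (\<lambda>x. q2 (i1 (p1 (j2 x)))) (carrier C) (carrier C)"
    obtain w where w: "w \<in> hom C C" "\<forall>x \<in> carrier C. w (q2 (i1 (p1 (j2 x)))) = x" "\<forall>x \<in> carrier C. q2 (i1 (p1 (j2 (w x)))) = x"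
      by (rule bij_inverse_hom[OF biprodD(2,2)[OF b] c[OF h(3,4)] bij])
    note [simp] = hom_simps[OF w(1) biprodD(2,2)[OF b]]
    \<comment> \<open>Chosen so that after the shear the component
      \<open>q2 (i2 x) + q2 (i1 (?k x))\<close> is exactly \<open>x\<close>; here \<open>w\<close>
      inverts the part through \<open>X\<close>.\<close>
    let ?k = "\<lambda>x. p1 (j2 (w (x \<ominus>\<^bsub>C\<^esub> q2 (i2 x))))"
    have k: "?k \<in> hom C X"
      by (rule c[OF c[OF hom_diff[OF module_hom_id h(1)] w(1)] h(3)]) simp_all
    have "q2 (i2 x \<oplus>\<^bsub>S\<^esub> i1 (?k x)) = x" if x: "x \<in> carrier C" for x
    proof -
      have "q2 (i2 x \<oplus>\<^bsub>S\<^esub> i1 (?k x)) = q2 (i2 x) \<oplus>\<^bsub>C\<^esub> q2 (i1 (?k x))" using x hom_simps(1)[OF k] by simp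
      also have "q2 (i1 (?k x)) = x \<ominus>\<^bsub>C\<^esub> q2 (i2 x)" using x w(3) by (simp del: hom_simps[OF w(1) biprodD(2,2)[OF b]])
      finally show ?thesis using x by simp
    qed
    then have "bij_betw (\<lambda>x. q2 (i2 x \<oplus>\<^bsub>S\<^esub> i1 (?k x))) (carrier C) (carrier C)"
      by (simp cong: bij_betw_cong add: bij_betw_def)
    then show ?thesis by (rule cancel_aux[OF biprod_shear[OF b k] b'])
  next
    assume bij: "bij_betw (\<lambda>x. q2 (i2 (p2 (j2 x)))) (carrier C) (carrier C)"
    let ?f = "\<lambda>x. q2 (i2 x)"
    \<comment> \<open>So far only a composite is known to be bijective. It makes \<open>?f\<close>
      surjective, so \<open>?f\<close> is not nilpotent on the nonzero module \<open>C\<close> and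
      must be an automorphism.\<close>
    have "bij_betw ?f (carrier C) (carrier C)"
    proof (rule ccontr)
      assume "\<not> ?thesis"
      then obtain n where n: "\<forall>x \<in> carrier C. (?f ^^ n) x = \<zero>\<^bsub>C\<^esub>" using indec_nilpotent_or_auto[OF C h(1)] by blast
      have surj: "\<exists>y \<in> carrier C. x = ?f y" if x: "x \<in> carrier C" for x
      proof -
        have "x \<in> (\<lambda>x. q2 (i2 (p2 (j2 x)))) ` carrier C" using bij x by (simp add: bij_betw_def)
        then obtain z where "z \<in> carrier C" "x = ?f (p2 (j2 z))" by blast
        then show ?thesis using hom_simps(1)[OF h(2)] by (intro bexI[of _ "p2 (j2 z)"]) simp_all
      qed
      have "\<exists>y \<in> carrier C. x = (?f ^^ k) y" if "x \<in> carrier C" for x k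
        using that
      proof (induction k arbitrary: x)
        case (Suc k)
        then obtain y where "y \<in> carrier C" "x = ?f y" using surj by blast
        then show ?case using Suc(1)[of y] by auto
      qed simp
      then have "zero_module C" unfolding zero_module_def using n zero_mem[of C] C by blast
      then show False using C by (simp add: indecomposable_def)
    qed
    then show ?thesis by (rule cancel_aux[OF b b'])
  qed
qed

text \<open>Induction along a decomposition of \<open>C\<close>, cancelling one indecomposable
  summand at a time.\<close>

lemma cancel:
  assumes X: "obj X" and Y: "obj Y" and C: "obj C" and i: "iso (X \<boxplus> C) (Y \<boxplus> C)"
  shows "iso X Y"
proof -
  obtain J where "msum J C" "\<forall>U \<in># J. indec U" using decompose[OF C] .
  then show ?thesis using i
  proof (induction rule: msum.induct)
    case (msum_zero Z)
    have *: "iso (X \<boxplus> Z) X" if "obj X" for X using dsum_zero[OF that msum_zero(1,2)] dsum_iff by blast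
    show ?case using iso_trans[OF iso_sym[OF *[OF X]] iso_trans[OF msum_zero(4) *[OF Y]]] .
  next
    case (msum_add J C' U C)
    note o = dsumD[OF msum_add(2)]
    have *: "iso (X \<boxplus> C' \<boxplus> U) (X \<boxplus> C)" if X: "obj X" for X
    proof -
      have "iso (X \<boxplus> C' \<boxplus> U) (X \<boxplus> (C' \<boxplus> U))" using X o by (intro plus_assoc)
      also have "iso (X \<boxplus> (C' \<boxplus> U)) (X \<boxplus> C)" using X o dsum_swap[OF msum_add(2)] dsum_iff by (intro plus_cong) simp_all
      finally show ?thesis .
    qed
    have "iso (X \<boxplus> C' \<boxplus> U) (Y \<boxplus> C' \<boxplus> U)" using iso_trans[OF iso_trans[OF *[OF X] msum_add(5)] iso_sym[OF *[OF Y]]] .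
    then have "dsum (X \<boxplus> C') U (Y \<boxplus> C' \<boxplus> U)" "dsum (Y \<boxplus> C') U (Y \<boxplus> C' \<boxplus> U)"
      using X Y o dsum_iff by simp_all
    then have "iso (X \<boxplus> C') (Y \<boxplus> C')" using msum_add(4) by (intro cancel_indec[of U]) simp_all
    then show ?case using msum_add by simp
  qed
qed

end

section \<open>Ascending chains of subgroups of a free abelian group of finite rank\<close>

text \<open>The union of the chain is a subgroup of the integers; its least positive element, or 0
  if there is none, generates it and already lies in some \<open>D n\<close>.\<close>

lemma int_subgroup_chain:
  fixes D :: "nat \<Rightarrow> int set"
  assumes zero: "\<And>k. 0 \<in> D k" and diff: "\<And>k x y. x \<in> D k \<Longrightarrow> y \<in> D k \<Longrightarrow> x - y \<in> D k" and mono: "\<And>k. D k \<subseteq> D (Suc k)"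
  obtains n d where "d \<in> D n" "\<And>k e. e \<in> D k \<Longrightarrow> d dvd e"
proof -
  have mono': "D m \<subseteq> D n" if "m \<le> n" for m n using lift_Suc_mono_le[of D, OF mono that] .
  have neg: "- x \<in> D k" if "x \<in> D k" for x k using diff[OF zero that] by simp
  have add: "x + y \<in> D k" if "x \<in> D k" "y \<in> D k" for x y k using diff[OF that(1) neg[OF that(2)]] by simp
  have nmul: "int m * x \<in> D k" if "x \<in> D k" for m x k
    by (induction m) (use that zero add in \<open>auto simp: algebra_simps\<close>)
  have mul: "q * x \<in> D k" if "x \<in> D k" for q x k
  proof (cases "q \<ge> 0")
    case True then show ?thesis using nmul[OF that, of "nat q"] by simp
  next
    case False then show ?thesis using neg[OF nmul[OF that, of "nat (- q)"]] by simp
  qed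
  show thesis
  proof (cases "\<exists>k m. m > 0 \<and> int m \<in> D k")
    case False
    have "e = 0" if "e \<in> D k" for e k
    proof (rule ccontr)
      assume "e \<noteq> 0"
      then have "nat \<bar>e\<bar> > 0" "int (nat \<bar>e\<bar>) \<in> D k" using that neg[OF that] by (auto simp: abs_if)
      then show False using False by blast
    qed
    then show thesis using that[of 0 0] zero by simp
  next
    case True
    define d where "d = (LEAST m. m > 0 \<and> (\<exists>k. int m \<in> D k))"
    have "d > 0 \<and> (\<exists>k. int d \<in> D k)" unfolding d_def by (rule LeastI_ex) (use True in blast)
    then obtain n where d: "d > 0" "int d \<in> D n" by blast
    have least: "m \<ge> d" if "m > 0" "int m \<in> D k" for m k unfolding d_def using that by (intro Least_le) blast
    have "int d dvd e" if e: "e \<in> D k" for e k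
    proof -
      have e': "e \<in> D (max n k)" "int d \<in> D (max n k)" using mono'[of k "max n k"] mono'[of n "max n k"] e d by auto
      have "e mod int d = e - (e div int d) * int d" by (simp add: minus_div_mult_eq_mod)
      then have "e mod int d \<in> D (max n k)" using diff[OF e'(1) mul[OF e'(2)]] by simp
      moreover have eq: "int (nat (e mod int d)) = e mod int d" and lt: "e mod int d < int d" using d by simp_all
      ultimately have "int (nat (e mod int d)) \<in> D (max n k)" by simp
      moreover have "\<not> d \<le> nat (e mod int d)" using lt eq by linarith
      ultimately have "nat (e mod int d) = 0" using least[of "nat (e mod int d)" "max n k"] by blast
      then have "e mod int d = 0" using eq by simp
      then show ?thesis by (simp add: dvd_eq_mod_eq_0)
    qed
    then show thesis using that[OF d(2)] by blast
  qed
qed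

text \<open>The functions supported on \<open>I\<close> form a free abelian group of finite rank. At
  one coordinate \<open>i\<close> the values form a chain of subgroups of the integers, settled by a
  generator; the functions vanishing at \<open>i\<close> form the chain \<open>W\<close>, settled by
  induction.\<close>

lemma subgroup_chain:
  fixes V :: "nat \<Rightarrow> ('i \<Rightarrow> int) set"
  assumes "finite I" and "\<And>k. (\<lambda>_. 0) \<in> V k" and "\<And>k f g. f \<in> V k \<Longrightarrow> g \<in> V k \<Longrightarrow> (\<lambda>i. f i - g i) \<in> V k"
    and "\<And>k. V k \<subseteq> V (Suc k)" and "\<And>k f i. f \<in> V k \<Longrightarrow> i \<notin> I \<Longrightarrow> f i = 0"
  shows "\<exists>n. \<forall>k\<ge>n. V k = V n"
  using assms
proof (induction I arbitrary: V rule: finite_induct)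
  case empty
  then have "V k = {\<lambda>_. 0}" for k by auto
  then show ?case by simp
next
  case (insert i I)
  note zero = insert.prems(1) and diff = insert.prems(2) and mono = insert.prems(3) and supp = insert.prems(4)
  have mono': "V m \<subseteq> V n" if "m \<le> n" for m n using lift_Suc_mono_le[of V, OF mono that] .
  have neg: "(\<lambda>i. - f i) \<in> V k" if "f \<in> V k" for f k using diff[OF zero that] by simp
  have add: "(\<lambda>i. f i + g i) \<in> V k" if "f \<in> V k" "g \<in> V k" for f g k using diff[OF that(1) neg[OF that(2)]] by simp
  have nmul: "(\<lambda>i. int m * f i) \<in> V k" if "f \<in> V k" for m f k
  proof (induction m)
    case (Suc m)
    show ?case using add[OF that Suc] by (simp add: algebra_simps)
  qed (use zero in simp)
  have mul: "(\<lambda>i. q * f i) \<in> V k" if "f \<in> V k" for q f k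
  proof (cases "q \<ge> 0")
    case True then show ?thesis using nmul[OF that, of "nat q"] by simp
  next
    case False then show ?thesis using neg[OF nmul[OF that, of "nat (- q)"]] by simp
  qed
  define W where "W k = {f \<in> V k. f i = 0}" for k
  have "\<exists>n. \<forall>k\<ge>n. W k = W n"
  proof (rule insert.IH)
    show "W k \<subseteq> W (Suc k)" for k using mono[of k] by (auto simp: W_def)
    fix k f j assume "f \<in> W k" "j \<notin> I"
    then show "f j = 0" using supp[of f k j] by (cases "j = i") (auto simp: W_def)
  qed (use zero diff in \<open>auto simp: W_def\<close>)
  then obtain n1 where n1: "\<And>k. k \<ge> n1 \<Longrightarrow> W k = W n1" by blast
  obtain n2 d where d: "d \<in> (\<lambda>f. f i) ` V n2" and dvd: "\<And>k e. e \<in> (\<lambda>f. f i) ` V k \<Longrightarrow> d dvd e"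
  proof (rule int_subgroup_chain[of "\<lambda>k. (\<lambda>f. f i) ` V k"])
    show "0 \<in> (\<lambda>f. f i) ` V k" for k using zero[of k] by (intro image_eqI[of _ _ "\<lambda>_. 0"]) auto
    show "x - y \<in> (\<lambda>f. f i) ` V k" if xy: "x \<in> (\<lambda>f. f i) ` V k" "y \<in> (\<lambda>f. f i) ` V k" for k x y
    proof -
      obtain f g where fg: "f \<in> V k" "g \<in> V k" "x = f i" "y = g i" using xy by blast
      show ?thesis using diff[OF fg(1,2)] fg(3,4) by (intro image_eqI[of _ _ "\<lambda>i. f i - g i"]) simp_all
    qed
  qed (use mono in blast)+
  obtain g where g: "g \<in> V n2" "d = g i" using d by blast
  define n where "n = max n1 n2"
  have "V k \<subseteq> V n" if k: "k \<ge> n" for k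
  proof
    fix f assume f: "f \<in> V k"
    then obtain q where q: "f i = g i * q" using dvd[of "f i" k] g(2) by (auto elim: dvdE)
    have gk: "(\<lambda>j. q * g j) \<in> V n" using mul[OF g(1)] mono'[of n2 n] by (auto simp: n_def)
    \<comment> \<open>Subtracting the multiple of \<open>g\<close> clears the coordinate
      \<open>i\<close>, and what is left lies in the stationary chain \<open>W\<close>.\<close>
    have "(\<lambda>j. f j - q * g j) \<in> W k" unfolding W_def using diff[OF f, of "\<lambda>j. q * g j"] gk mono'[OF k] q by auto
    then have "(\<lambda>j. f j - q * g j) \<in> V n" using n1[of k] n1[of n] k by (auto simp: n_def W_def)
    then show "f \<in> V n" using add[OF _ gk, of "\<lambda>j. f j - q * g j"] by simp
  qed
  then show ?case using mono' by blast
qed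

section \<open>Exact structures\<close>

text \<open>A surjection is admissible if it has a section in \<open>H\<close>. With all maps as \<open>H\<close> this gives
  ordinary homological algebra, with the \<open>B\<close>-homomorphisms as \<open>H\<close> the relative one.\<close>

locale exact_structure = module_category A for A :: "('a, 'c) ring_scheme" (structure) +
  fixes H :: "'a umodule \<Rightarrow> 'a umodule \<Rightarrow> ((nat \<Rightarrow> 'a) set \<Rightarrow> (nat \<Rightarrow> 'a) set) set"
  assumes H_hom: "\<lbrakk>obj M; obj N; f \<in> hom M N\<rbrakk> \<Longrightarrow> f \<in> H M N"
    and H_closed: "\<lbrakk>obj M; obj N; f \<in> H M N; x \<in> carrier M\<rbrakk> \<Longrightarrow> f x \<in> carrier N"
    and H_comp: "\<lbrakk>obj M; obj N; obj L; f \<in> H M N; g \<in> H N L\<rbrakk> \<Longrightarrow> (\<lambda>x. g (f x)) \<in> H M L"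
    and H_add: "\<lbrakk>obj M; obj N; f \<in> H M N; g \<in> H M N\<rbrakk> \<Longrightarrow> (\<lambda>x. f x \<oplus>\<^bsub>N\<^esub> g x) \<in> H M N"
    and H_into: "\<lbrakk>obj M; obj N; f \<in> H M N; submodule K A N; \<And>x. x \<in> carrier M \<Longrightarrow> f x \<in> K\<rbrakk> \<Longrightarrow> f \<in> H M (N\<lparr>carrier := K\<rparr>)"
begin

definition adm :: "'a umodule \<Rightarrow> 'a umodule \<Rightarrow> ((nat \<Rightarrow> 'a) set \<Rightarrow> (nat \<Rightarrow> 'a) set) \<Rightarrow> bool" where
  "adm M N g \<longleftrightarrow> g \<in> hom M N \<and> (\<exists>s \<in> H N M. \<forall>y \<in> carrier N. g (s y) = y)"

definition prj :: "'a umodule \<Rightarrow> bool" where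
  "prj P \<longleftrightarrow> obj P \<and> (\<forall>M N g k. obj M \<and> obj N \<and> adm M N g \<and> k \<in> hom P N \<longrightarrow>
     (\<exists>l \<in> hom P M. \<forall>x \<in> carrier P. g (l x) = k x))"

text \<open>Short exact sequences with admissible second map, the maps forgotten: for projective
  dimensions it only matters which modules occur together, and hiding the maps makes invariance
  under \<open>iso\<close> easy to use.\<close>

definition sq :: "'a umodule \<Rightarrow> 'a umodule \<Rightarrow> 'a umodule \<Rightarrow> bool" where
  "sq K E Q \<longleftrightarrow> (\<exists>f g. ses K E Q f g \<and> adm E Q g)"

lemma prjD: "prj P \<Longrightarrow> obj P"
  by (simp add: prj_def)

lemma prj_lift:
  assumes "prj P" "obj M" "obj N" "adm M N g" "k \<in> hom P N"
  obtains l where "l \<in> hom P M" "\<forall>x \<in> carrier P. g (l x) = k x"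
  using assms unfolding prj_def by blast

lemma admE:
  assumes "adm M N g" obtains s where "g \<in> hom M N" "s \<in> H N M" "\<forall>y \<in> carrier N. g (s y) = y"
  using assms unfolding adm_def by blast

lemma admI: "\<lbrakk>g \<in> hom M N; s \<in> H N M; \<forall>y \<in> carrier N. g (s y) = y\<rbrakk> \<Longrightarrow> adm M N g"
  unfolding adm_def by blast

lemma adm_surj: "adm M N g \<Longrightarrow> obj M \<Longrightarrow> obj N \<Longrightarrow> y \<in> carrier N \<Longrightarrow> \<exists>x \<in> carrier M. y = g x"
  unfolding adm_def using H_closed[of N M] by metis

lemma adm_comp:
  assumes M: "obj M" and N: "obj N" and L: "obj L" and g: "adm M N g" and h: "adm N L h"
  shows "adm M L (\<lambda>x. h (g x))"
proof -
  obtain s where s: "g \<in> hom M N" "s \<in> H N M" "\<forall>y \<in> carrier N. g (s y) = y" using g by (rule admE)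
  obtain t where t: "h \<in> hom N L" "t \<in> H L N" "\<forall>y \<in> carrier L. h (t y) = y" using h by (rule admE)
  have "\<forall>y \<in> carrier L. h (g (s (t y))) = y" using s t H_closed[OF L N t(2)] by simp
  then show ?thesis
    by (rule admI[OF module_hom_comp[OF s(1) t(1)] H_comp[OF L N M t(2) s(2)]])
qed

lemma adm_split: "\<lbrakk>obj M; obj N; g \<in> hom M N; s \<in> hom N M; \<forall>y \<in> carrier N. g (s y) = y\<rbrakk> \<Longrightarrow> adm M N g"
  unfolding adm_def using H_hom by blast

lemma retr_prj:
  assumes "retr P Q" "prj Q" shows "prj P"
  unfolding prj_def
proof (intro conjI allI impI)
  obtain i p where ip: "obj P" "obj Q" "i \<in> hom P Q" "p \<in> hom Q P" "\<forall>x \<in> carrier P. p (i x) = x" using assms(1) by (rule retrE)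
  show "obj P" by fact
  fix M N g k assume *: "obj M \<and> obj N \<and> adm M N g \<and> k \<in> hom P N"
  obtain l where l: "l \<in> hom Q M" "\<forall>x \<in> carrier Q. g (l x) = k (p x)"
    by (rule prj_lift[OF assms(2), of M N g "\<lambda>x. k (p x)"]) (use * module_hom_comp[OF ip(4)] in blast)+
  have "\<forall>x \<in> carrier P. g (l (i x)) = k x" using l(2) ip(5) module_hom_closed[OF ip(3)] by simp
  then show "\<exists>l \<in> hom P M. \<forall>x \<in> carrier P. g (l x) = k x" by (rule bexI[OF _ module_hom_comp[OF ip(3) l(1)]])
qed

lemma prj_iso: "prj P \<Longrightarrow> iso P Q \<Longrightarrow> prj Q"
  using retr_prj iso_retr iso_sym by blast

lemma prj_dsum:
  assumes "prj P" "prj Q" "dsum P Q S" shows "prj S"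
  unfolding prj_def
proof (intro conjI allI impI)
  obtain i1 i2 p1 p2 where b: "biprod P Q S i1 i2 p1 p2" using assms(3) by (rule dsumE)
  note [simp] = biprod_simps[OF b]
  show "obj S" by simp
  fix M N g k assume *: "obj M \<and> obj N \<and> adm M N g \<and> k \<in> hom S N"
  then have MN: "obj M" "obj N" "adm M N g" and k: "k \<in> hom S N" by simp_all
  have g: "g \<in> hom M N" using MN(3) by (simp add: adm_def)
  note [simp] = hom_simps[OF g MN(1,2)] hom_simps[OF k _ MN(2)] MN(1,2)
  obtain l1 where l1: "l1 \<in> hom P M" "\<forall>x \<in> carrier P. g (l1 x) = k (i1 x)"
    by (rule prj_lift[OF assms(1) MN module_hom_comp[OF biprodD(4)[OF b] k]])
  obtain l2 where l2: "l2 \<in> hom Q M" "\<forall>x \<in> carrier Q. g (l2 x) = k (i2 x)"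
    by (rule prj_lift[OF assms(2) MN module_hom_comp[OF biprodD(5)[OF b] k]])
  note [simp] = hom_simps[OF l1(1) _ MN(1)] hom_simps[OF l2(1) _ MN(1)]
  have l: "(\<lambda>s. l1 (p1 s) \<oplus>\<^bsub>M\<^esub> l2 (p2 s)) \<in> hom S M"
    by (intro hom_add module_hom_comp[OF biprodD(6)[OF b] l1(1)] module_hom_comp[OF biprodD(7)[OF b] l2(1)]) simp_all
  have "g (l1 (p1 s) \<oplus>\<^bsub>M\<^esub> l2 (p2 s)) = k s" if s: "s \<in> carrier S" for s
  proof -
    have "g (l1 (p1 s) \<oplus>\<^bsub>M\<^esub> l2 (p2 s)) = k (i1 (p1 s)) \<oplus>\<^bsub>N\<^esub> k (i2 (p2 s))" using s l1(2) l2(2) by simp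
    also have "\<dots> = k (i1 (p1 s) \<oplus>\<^bsub>S\<^esub> i2 (p2 s))" using s by (subst hom_simps(2)[OF k _ MN(2)]) simp_all
    finally show ?thesis using s by simp
  qed
  then show "\<exists>l \<in> hom S M. \<forall>x \<in> carrier S. g (l x) = k x" by (intro bexI[OF _ l] ballI)
qed

lemma prj_plus: "prj P \<Longrightarrow> prj Q \<Longrightarrow> prj (P \<boxplus> Q)"
  using prj_dsum dsum_plus prjD by blast

lemma prj_zero: "obj Z \<Longrightarrow> zero_module Z \<Longrightarrow> prj Z"
  unfolding prj_def
proof (intro conjI allI impI)
  assume Z: "obj Z" "zero_module Z"
  fix M N g k assume *: "obj M \<and> obj N \<and> adm M N g \<and> k \<in> hom Z N"
  then have MN: "obj M" "obj N" and k: "k \<in> hom Z N" and g: "g \<in> hom M N" by (simp_all add: adm_def)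
  have "\<forall>x \<in> carrier Z. g \<zero>\<^bsub>M\<^esub> = k x"
    using Z(2) hom_simps(4)[OF g MN] hom_simps(4)[OF k Z(1) MN(2)] by (simp add: zero_module_def)
  then show "\<exists>l \<in> hom Z M. \<forall>x \<in> carrier Z. g (l x) = k x" by (rule bexI[OF _ hom_zero[OF MN(1)]])
qed

section \<open>Admissible short exact sequences\<close>

lemma sqD: "sq K E Q \<Longrightarrow> obj K" "sq K E Q \<Longrightarrow> obj E" "sq K E Q \<Longrightarrow> obj Q"
  by (auto simp: sq_def ses_def)

lemma sqE: assumes "sq K E Q" obtains f g where "ses K E Q f g" "adm E Q g"
  using assms unfolding sq_def by blast

lemma sqI: "ses K E Q f g \<Longrightarrow> adm E Q g \<Longrightarrow> sq K E Q"
  unfolding sq_def by blast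

lemma sq_iso:
  assumes s: "sq K E Q" and K: "iso K K'" and E: "iso E E'" and Q: "iso Q Q'"
  shows "sq K' E' Q'"
proof -
  obtain f g where fg: "ses K E Q f g" "adm E Q g" using s by (rule sqE)
  obtain a a' where a: "obj K" "obj K'" "a \<in> hom K K'" "a' \<in> hom K' K"
    "\<forall>x \<in> carrier K. a' (a x) = x" "\<forall>x \<in> carrier K'. a (a' x) = x" using K unfolding iso_def by blast
  obtain b b' where b: "obj E" "obj E'" "b \<in> hom E E'" "b' \<in> hom E' E"
    "\<forall>x \<in> carrier E. b' (b x) = x" "\<forall>x \<in> carrier E'. b (b' x) = x" using E unfolding iso_def by blast
  obtain c c' where c: "obj Q" "obj Q'" "c \<in> hom Q Q'" "c' \<in> hom Q' Q"
    "\<forall>x \<in> carrier Q. c' (c x) = x" "\<forall>x \<in> carrier Q'. c (c' x) = x" using Q unfolding iso_def by blast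
  note [simp] = a(1,2,5,6) b(1,2,5,6) c(1,2,5,6) hom_simps[OF a(3,1,2)] hom_simps[OF a(4,2,1)]
    hom_simps[OF b(3,1,2)] hom_simps[OF b(4,2,1)] hom_simps[OF c(3,1,2)] hom_simps[OF c(4,2,1)]
    sesD(9)[OF fg(1)] hom_simps[OF sesD(4,1,2)[OF fg(1)]] hom_simps[OF sesD(5,2,3)[OF fg(1)]]
  have adm: "adm E' Q' (\<lambda>x. c (g (b' x)))"
    by (rule adm_comp[OF b(2) c(1,2) adm_comp[OF b(2,1) c(1) adm_split[OF b(2,1) b(4,3)] fg(2)] adm_split[OF c(1,2) c(3,4)]]) simp_all
  have h: "(\<lambda>x. b (f (a' x))) \<in> hom K' E'" "(\<lambda>x. c (g (b' x))) \<in> hom E' Q'"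
    using module_hom_comp[OF module_hom_comp[OF a(4) sesD(4)[OF fg(1)]] b(3)]
      module_hom_comp[OF module_hom_comp[OF b(4) sesD(5)[OF fg(1)]] c(3)] by simp_all
  have "ses K' E' Q' (\<lambda>x. b (f (a' x))) (\<lambda>x. c (g (b' x)))"
  proof (rule sesI[OF _ _ _ h])
    fix x assume x: "x \<in> carrier K'" "b (f (a' x)) = \<zero>\<^bsub>E'\<^esub>"
    then have "b' (b (f (a' x))) = \<zero>\<^bsub>E\<^esub>" by simp
    then have "f (a' x) = \<zero>\<^bsub>E\<^esub>" using x(1) by simp
    then have "a' x = \<zero>\<^bsub>K\<^esub>" using x(1) ses_inj[OF fg(1), of "a' x"] by simp
    then have "a (a' x) = \<zero>\<^bsub>K'\<^esub>" by simp
    then show "x = \<zero>\<^bsub>K'\<^esub>" using x by simp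
  next
    fix y assume "y \<in> carrier Q'"
    then show "\<exists>x \<in> carrier E'. y = c (g (b' x))" using adm_surj[OF adm] by simp
  next
    fix e assume e: "e \<in> carrier E'" "c (g (b' e)) = \<zero>\<^bsub>Q'\<^esub>"
    then have "c' (c (g (b' e))) = \<zero>\<^bsub>Q\<^esub>" by simp
    then have "g (b' e) = \<zero>\<^bsub>Q\<^esub>" using e(1) by simp
    then obtain x where "x \<in> carrier K" "b' e = f x" using ses_ker[OF fg(1), of "b' e"] e by auto
    then show "\<exists>x \<in> carrier K'. e = b (f (a' x))" using e b(6)[rule_format, of e] by (intro bexI[of _ "a x"]) simp_all
  qed simp_all
  then show ?thesis using adm by (rule sqI)
qed

lemma ses_kernel_iso:
  assumes "ses K E Q f g"
  shows "iso K (E\<lparr>carrier := {x \<in> carrier E. g x = \<zero>\<^bsub>Q\<^esub>}\<rparr>)"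
proof -
  note s = sesD[OF assms]
  let ?K = "E\<lparr>carrier := {x \<in> carrier E. g x = \<zero>\<^bsub>Q\<^esub>}\<rparr>"
  have o: "obj ?K" by (rule fg_submodule[OF s(2) submodule_kernel[OF s(5,2,3)]])
  have f: "f \<in> hom K ?K" by (rule module_hom_into[OF s(4)]) (use s(9) module_hom_closed[OF s(4)] in blast)
  have "f ` carrier K = carrier ?K" using s(8,9) module_hom_closed[OF s(4)] by auto
  then show ?thesis using iso_bij[OF s(1) o f] s(6) by (simp add: bij_betw_def)
qed

lemma sq_split:
  assumes "sq K E P" "prj P" shows "dsum K P E"
proof -
  obtain f g where fg: "ses K E P f g" "adm E P g" using assms(1) by (rule sqE)
  note s = sesD[OF fg(1)]
  obtain l where l: "l \<in> hom P E" "\<forall>x \<in> carrier P. g (l x) = x"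
    by (rule prj_lift[OF assms(2) s(2,3) fg(2) module_hom_id])
  have "dsum P (E\<lparr>carrier := {x \<in> carrier E. g x = \<zero>\<^bsub>P\<^esub>}\<rparr>) E"
    by (rule dsumI[OF retr_biprod[OF s(3,2) l(1) s(5) l(2)]])
  then show ?thesis
    using dsum_iso[OF dsum_swap, of P _ E K P E] ses_kernel_iso[OF fg(1)] s(2,3) by simp
qed

text \<open>\<open>?E\<close> is the fibre product of \<open>g\<close> and \<open>q\<close> inside
  \<open>S\<close>. A section \<open>\<sigma>\<close> of \<open>q\<close> gives the section sending
  \<open>x\<close> to \<open>i1 x + i2 (\<sigma> (g x))\<close> of its projection to
  \<open>B\<close>. That this map lies in \<open>H\<close>, also with values in the fibre product,
  is the purpose of \<open>H_add\<close> and \<open>H_into\<close>.\<close>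

lemma pullback_aux:
  assumes b: "biprod B P S i1 i2 p1 p2" and C: "obj C" and g: "g \<in> hom B C" and q: "ses K P C \<kappa> q" "adm P C q"
  shows "sq K (S\<lparr>carrier := {s \<in> carrier S. g (p1 s) = q (p2 s)}\<rparr>) B" (is "sq K ?E B")
proof -
  note s = sesD[OF q(1)]
  note [simp] = biprod_simps[OF b] C hom_simps[OF g biprodD(1)[OF b] C] hom_simps[OF s(4,1,2)] hom_simps[OF s(5,2,3)] s(1,9)
  note c = module_hom_comp
  have d: "(\<lambda>s. g (p1 s) \<ominus>\<^bsub>C\<^esub> q (p2 s)) \<in> hom S C"
    by (intro hom_diff c[OF biprodD(6)[OF b] g] c[OF biprodD(7)[OF b] s(5)]) simp_all
  have "submodule {s \<in> carrier S. g (p1 s) \<ominus>\<^bsub>C\<^esub> q (p2 s) = \<zero>\<^bsub>C\<^esub>} A S" by (rule submodule_kernel[OF d]) simp_all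
  moreover have "{s \<in> carrier S. g (p1 s) \<ominus>\<^bsub>C\<^esub> q (p2 s) = \<zero>\<^bsub>C\<^esub>} = {s \<in> carrier S. g (p1 s) = q (p2 s)}"
    by (intro Collect_cong conj_cong refl diff_zero_iff) simp_all
  ultimately have sub: "submodule {s \<in> carrier S. g (p1 s) = q (p2 s)} A S" by simp
  have E: "obj ?E" using fg_submodule[OF biprodD(3)[OF b] sub] .
  have h1: "(\<lambda>k. i2 (\<kappa> k)) \<in> hom K ?E"
    by (rule module_hom_into[OF c[OF s(4) biprodD(5)[OF b]]]) simp
  have h2: "p1 \<in> hom ?E B" by (rule module_hom_from[OF biprodD(6)[OF b]]) simp
  obtain \<sigma> where \<sigma>: "\<sigma> \<in> H C P" "\<forall>y \<in> carrier C. q (\<sigma> y) = y" using q(2) by (rule admE)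
  note [simp] = H_closed[OF C biprodD(2)[OF b] \<sigma>(1)]
  have B: "obj B" "obj S" "obj P" by simp_all
  have sec: "(\<lambda>x. i1 x \<oplus>\<^bsub>S\<^esub> i2 (\<sigma> (g x))) \<in> H B ?E"
  proof (rule H_into[OF B(1,2) _ sub])
    show "(\<lambda>x. i1 x \<oplus>\<^bsub>S\<^esub> i2 (\<sigma> (g x))) \<in> H B S"
      by (rule H_add[OF B(1,2) H_hom[OF B(1,2) biprodD(4)[OF b]]
        H_comp[OF B(1) B(3) B(2) H_comp[OF B(1) C B(3) H_hom[OF B(1) C g] \<sigma>(1)] H_hom[OF B(3,2) biprodD(5)[OF b]]]])
  qed (use \<sigma>(2) in simp)
  have adm: "adm ?E B p1" by (rule admI[OF h2 sec]) simp
  have "ses K ?E B (\<lambda>k. i2 (\<kappa> k)) p1"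
  proof (rule sesI[OF s(1) E B(1) h1 h2])
    fix x assume x: "x \<in> carrier K" "i2 (\<kappa> x) = \<zero>\<^bsub>?E\<^esub>"
    then have "p2 (i2 (\<kappa> x)) = \<zero>\<^bsub>P\<^esub>" by simp
    then show "x = \<zero>\<^bsub>K\<^esub>" using x(1) ses_inj[OF q(1)] by simp
  next
    fix e assume e: "e \<in> carrier ?E" "p1 e = \<zero>\<^bsub>B\<^esub>"
    then have "q (p2 e) = \<zero>\<^bsub>C\<^esub>" using hom_simps(4)[OF g B(1) C] by simp
    then obtain x where "x \<in> carrier K" "p2 e = \<kappa> x" using ses_ker[OF q(1), of "p2 e"] e by auto
    then show "\<exists>x \<in> carrier K. e = i2 (\<kappa> x)" using e biprod_simps(5)[OF b, of e] by (intro bexI[of _ x]) simp_all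
  qed (use adm_surj[OF adm E B(1)] in simp_all)
  then show ?thesis using adm by (rule sqI)
qed

text \<open>The fibre product is symmetric in its two factors, so it is an extension of
  \<open>B\<close> by \<open>K\<close> and of \<open>P\<close> by \<open>A'\<close>. Schanuel's
  lemma and the rotation of triangles are both read off this square.\<close>

lemma pullback:
  assumes "sq A' B C" "sq K P C" obtains E where "sq K E B" "sq A' E P"
proof -
  obtain f g where fg: "ses A' B C f g" "adm B C g" using assms(1) by (rule sqE)
  obtain \<kappa> q where q: "ses K P C \<kappa> q" "adm P C q" using assms(2) by (rule sqE)
  note s = sesD[OF fg(1)] and t = sesD[OF q(1)]
  obtain i1 i2 p1 p2 where b: "biprod B P (B \<boxplus> P) i1 i2 p1 p2" using dsum_plus[OF s(2) t(2)] by (rule dsumE)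
  have 1: "sq K ((B \<boxplus> P)\<lparr>carrier := {s \<in> carrier (B \<boxplus> P). g (p1 s) = q (p2 s)}\<rparr>) B"
    by (rule pullback_aux[OF b s(3,5) q])
  have "sq A' ((B \<boxplus> P)\<lparr>carrier := {s \<in> carrier (B \<boxplus> P). q (p2 s) = g (p1 s)}\<rparr>) P"
    by (rule pullback_aux[OF biprod_swap[OF b] t(3,5) fg])
  then have 2: "sq A' ((B \<boxplus> P)\<lparr>carrier := {s \<in> carrier (B \<boxplus> P). g (p1 s) = q (p2 s)}\<rparr>) P"
    by (simp add: eq_commute[of "q _"])
  show thesis using that 1 2 by blast
qed

lemma sq_dsum:
  assumes "sq K E Q" "sq K' E' Q'" "dsum K K' K2" "dsum E E' E2" "dsum Q Q' Q2" shows "sq K2 E2 Q2"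
proof -
  obtain f g where fg: "ses K E Q f g" "adm E Q g" using assms(1) by (rule sqE)
  obtain f' g' where fg': "ses K' E' Q' f' g'" "adm E' Q' g'" using assms(2) by (rule sqE)
  note s = sesD[OF fg(1)] and s' = sesD[OF fg'(1)]
  obtain i1 i2 p1 p2 where b1: "biprod K K' K2 i1 i2 p1 p2" using assms(3) by (rule dsumE)
  obtain j1 j2 q1 q2 where b2: "biprod E E' E2 j1 j2 q1 q2" using assms(4) by (rule dsumE)
  obtain k1 k2 r1 r2 where b3: "biprod Q Q' Q2 k1 k2 r1 r2" using assms(5) by (rule dsumE)
  note [simp] = biprod_simps[OF b1] biprod_simps[OF b2] biprod_simps[OF b3]
    hom_simps[OF s(4,1,2)] hom_simps[OF s(5,2,3)] hom_simps[OF s'(4,1,2)] hom_simps[OF s'(5,2,3)] s(9) s'(9)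
  note c = module_hom_comp
  obtain \<sigma> where \<sigma>: "\<sigma> \<in> H Q E" "\<forall>y \<in> carrier Q. g (\<sigma> y) = y" using fg(2) by (rule admE)
  obtain \<sigma>' where \<sigma>': "\<sigma>' \<in> H Q' E'" "\<forall>y \<in> carrier Q'. g' (\<sigma>' y) = y" using fg'(2) by (rule admE)
  note [simp] = H_closed[OF s(3,2) \<sigma>(1)] H_closed[OF s'(3,2) \<sigma>'(1)]
  let ?f = "\<lambda>x. j1 (f (p1 x)) \<oplus>\<^bsub>E2\<^esub> j2 (f' (p2 x))" and ?g = "\<lambda>x. k1 (g (q1 x)) \<oplus>\<^bsub>Q2\<^esub> k2 (g' (q2 x))"
  have o: "obj K2" "obj E2" "obj Q2" by simp_all
  have h: "?f \<in> hom K2 E2" "?g \<in> hom E2 Q2"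
    by (intro hom_add c[OF c[OF biprodD(6)[OF b1] s(4)] biprodD(4)[OF b2]] c[OF c[OF biprodD(7)[OF b1] s'(4)] biprodD(5)[OF b2]]
      c[OF c[OF biprodD(6)[OF b2] s(5)] biprodD(4)[OF b3]] c[OF c[OF biprodD(7)[OF b2] s'(5)] biprodD(5)[OF b3]] o)+
  have sec: "(\<lambda>x. j1 (\<sigma> (r1 x)) \<oplus>\<^bsub>E2\<^esub> j2 (\<sigma>' (r2 x))) \<in> H Q2 E2"
    by (intro H_add[OF o(3,2)] H_comp[OF o(3) s(2) o(2) H_comp[OF o(3) s(3,2) H_hom[OF o(3) s(3) biprodD(6)[OF b3]] \<sigma>(1)] H_hom[OF s(2) o(2) biprodD(4)[OF b2]]]
      H_comp[OF o(3) s'(2) o(2) H_comp[OF o(3) s'(3,2) H_hom[OF o(3) s'(3) biprodD(7)[OF b3]] \<sigma>'(1)] H_hom[OF s'(2) o(2) biprodD(5)[OF b2]]])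
  have adm: "adm E2 Q2 ?g" by (rule admI[OF h(2) sec]) (use \<sigma>(2) \<sigma>'(2) in simp)
  have comp: "u = \<zero>\<^bsub>Q\<^esub> \<and> v = \<zero>\<^bsub>Q'\<^esub>" if "k1 u \<oplus>\<^bsub>Q2\<^esub> k2 v = \<zero>\<^bsub>Q2\<^esub>" "u \<in> carrier Q" "v \<in> carrier Q'" for u v
  proof -
    have "r1 (k1 u \<oplus>\<^bsub>Q2\<^esub> k2 v) = \<zero>\<^bsub>Q\<^esub>" "r2 (k1 u \<oplus>\<^bsub>Q2\<^esub> k2 v) = \<zero>\<^bsub>Q'\<^esub>" unfolding that(1) by simp_all
    then show ?thesis using that(2,3) by simp
  qed
  have comp2: "u = \<zero>\<^bsub>E\<^esub> \<and> v = \<zero>\<^bsub>E'\<^esub>" if "j1 u \<oplus>\<^bsub>E2\<^esub> j2 v = \<zero>\<^bsub>E2\<^esub>" "u \<in> carrier E" "v \<in> carrier E'" for u v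
  proof -
    have "q1 (j1 u \<oplus>\<^bsub>E2\<^esub> j2 v) = \<zero>\<^bsub>E\<^esub>" "q2 (j1 u \<oplus>\<^bsub>E2\<^esub> j2 v) = \<zero>\<^bsub>E'\<^esub>" unfolding that(1) by simp_all
    then show ?thesis using that(2,3) by simp
  qed
  have "ses K2 E2 Q2 ?f ?g"
  proof (rule sesI[OF o h])
    fix x assume x: "x \<in> carrier K2" "?f x = \<zero>\<^bsub>E2\<^esub>"
    then have "p1 x = \<zero>\<^bsub>K\<^esub>" "p2 x = \<zero>\<^bsub>K'\<^esub>" using comp2[OF x(2)] ses_inj[OF fg(1), of "p1 x"] ses_inj[OF fg'(1), of "p2 x"] by simp_all
    then show "x = \<zero>\<^bsub>K2\<^esub>" using x biprod_simps(5)[OF b1, of x] by simp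
  next
    fix e assume e: "e \<in> carrier E2" "?g e = \<zero>\<^bsub>Q2\<^esub>"
    then have "g (q1 e) = \<zero>\<^bsub>Q\<^esub>" "g' (q2 e) = \<zero>\<^bsub>Q'\<^esub>" using comp[OF e(2)] by simp_all
    then obtain u v where uv: "u \<in> carrier K" "q1 e = f u" "v \<in> carrier K'" "q2 e = f' v"
      using ses_ker[OF fg(1), of "q1 e"] ses_ker[OF fg'(1), of "q2 e"] e by auto
    have "e = ?f (i1 u \<oplus>\<^bsub>K2\<^esub> i2 v)" using uv e(1) biprod_simps(5)[OF b2, of e] by simp
    then show "\<exists>x \<in> carrier K2. e = ?f x" using uv by (intro bexI[of _ "i1 u \<oplus>\<^bsub>K2\<^esub> i2 v"]) simp_all
  qed (use adm_surj[OF adm o(2,3)] in simp_all)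
  then show ?thesis using adm by (rule sqI)
qed

lemma sq_zero_left: "obj Z \<Longrightarrow> zero_module Z \<Longrightarrow> obj Q \<Longrightarrow> sq Z Q Q"
  by (rule sqI[of _ _ _ "\<lambda>_. \<zero>\<^bsub>Q\<^esub>" "\<lambda>x. x"], rule sesI)
    (auto simp: hom_zero module_hom_id zero_module_def intro!: adm_split[of _ _ _ "\<lambda>x. x"])

lemma sq_zero_right: "obj Z \<Longrightarrow> zero_module Z \<Longrightarrow> obj Q \<Longrightarrow> sq Q Q Z"
  by (rule sqI[of _ _ _ "\<lambda>x. x" "\<lambda>_. \<zero>\<^bsub>Z\<^esub>"], rule sesI)
    (auto simp: hom_zero module_hom_id zero_module_def intro!: adm_split[of _ _ _ "\<lambda>x. \<zero>\<^bsub>Q\<^esub>"] exI[of _ "\<zero>\<^bsub>Q\<^esub>"])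

text \<open>The direct sum with the trivial sequence in which \<open>P\<close> is mapped identically
  onto \<open>P\<close>.\<close>

lemma sq_add_right:
  assumes "sq K E Q" "obj P" shows "sq K (E \<boxplus> P) (Q \<boxplus> P)"
proof -
  let ?Z = "P\<lparr>carrier := {\<zero>\<^bsub>P\<^esub>}\<rparr>"
  have Z: "obj ?Z" "zero_module ?Z" using assms(2) obj_zero_submodule zero_module_submodule by auto
  show ?thesis
    by (rule sq_dsum[OF assms(1) sq_zero_left[OF Z assms(2)] dsum_zero[OF _ Z] dsum_plus dsum_plus]) (use sqD[OF assms(1)] assms(2) in simp_all)
qed

lemma sq_add_left:
  assumes "sq K E Q" "obj P" shows "sq (K \<boxplus> P) (E \<boxplus> P) Q"
proof -
  let ?Z = "P\<lparr>carrier := {\<zero>\<^bsub>P\<^esub>}\<rparr>"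
  have Z: "obj ?Z" "zero_module ?Z" using assms(2) obj_zero_submodule zero_module_submodule by auto
  show ?thesis
    by (rule sq_dsum[OF assms(1) sq_zero_right[OF Z assms(2)] dsum_plus dsum_plus dsum_zero[OF _ Z]]) (use sqD[OF assms(1)] assms(2) in simp_all)
qed

section \<open>Stable isomorphism and Schanuel's lemma\<close>

definition stab :: "'a umodule \<Rightarrow> 'a umodule \<Rightarrow> bool" where
  "stab X Y \<longleftrightarrow> obj X \<and> obj Y \<and> (\<exists>P Q. prj P \<and> prj Q \<and> iso (X \<boxplus> P) (Y \<boxplus> Q))"

lemma stabD: "stab X Y \<Longrightarrow> obj X" "stab X Y \<Longrightarrow> obj Y"
  by (auto simp: stab_def)

lemma stab_sym: "stab X Y \<Longrightarrow> stab Y X"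
  unfolding stab_def using iso_sym by blast

lemma iso_stab: "iso X Y \<Longrightarrow> stab X Y"
proof -
  assume i: "iso X Y"
  let ?Z = "X\<lparr>carrier := {\<zero>\<^bsub>X\<^esub>}\<rparr>"
  have Z: "obj ?Z" "prj ?Z" using isoD[OF i] obj_zero_submodule zero_module_submodule prj_zero by auto
  have "iso (X \<boxplus> ?Z) (Y \<boxplus> ?Z)" using i Z by (intro plus_cong) simp_all
  then show ?thesis using Z isoD[OF i] unfolding stab_def by blast
qed

lemma stab_trans [trans]:
  assumes "stab X Y" "stab Y Z" shows "stab X Z"
proof -
  obtain P Q where 1: "prj P" "prj Q" "iso (X \<boxplus> P) (Y \<boxplus> Q)" using assms(1) unfolding stab_def by blast
  obtain P' Q' where 2: "prj P'" "prj Q'" "iso (Y \<boxplus> P') (Z \<boxplus> Q')" using assms(2) unfolding stab_def by blast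
  have o: "obj X" "obj Y" "obj Z" "obj P" "obj Q" "obj P'" "obj Q'" using assms 1 2 prjD stabD by auto
  have "iso (X \<boxplus> (P \<boxplus> P')) (X \<boxplus> P \<boxplus> P')" using o by (intro iso_sym[OF plus_assoc])
  also have "iso (X \<boxplus> P \<boxplus> P') (Y \<boxplus> Q \<boxplus> P')" using o by (intro plus_cong[OF 1(3)]) simp_all
  also have "iso (Y \<boxplus> Q \<boxplus> P') (Y \<boxplus> P' \<boxplus> Q)" using o by (intro plus_right_comm)
  also have "iso (Y \<boxplus> P' \<boxplus> Q) (Z \<boxplus> Q' \<boxplus> Q)" using o by (intro plus_cong[OF 2(3)]) simp_all
  also have "iso (Z \<boxplus> Q' \<boxplus> Q) (Z \<boxplus> (Q' \<boxplus> Q))" using o by (intro plus_assoc)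
  finally show ?thesis unfolding stab_def using o prj_plus[OF 1(1) 2(1)] prj_plus[OF 2(2) 1(2)] by blast
qed

lemma stab_refl [simp]: "stab X X \<longleftrightarrow> obj X"
  using iso_stab stabD by auto

lemma stab_plus:
  assumes "stab X X'" "stab Y Y'" shows "stab (X \<boxplus> Y) (X' \<boxplus> Y')"
proof -
  obtain P Q where 1: "prj P" "prj Q" "iso (X \<boxplus> P) (X' \<boxplus> Q)" using assms(1) unfolding stab_def by blast
  obtain P' Q' where 2: "prj P'" "prj Q'" "iso (Y \<boxplus> P') (Y' \<boxplus> Q')" using assms(2) unfolding stab_def by blast
  have o: "obj X" "obj Y" "obj X'" "obj Y'" "obj P" "obj Q" "obj P'" "obj Q'" using assms 1 2 prjD stabD by auto
  have "iso (X \<boxplus> Y \<boxplus> (P \<boxplus> P')) (X \<boxplus> P \<boxplus> (Y \<boxplus> P'))" using o by (intro plus_swap4)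
  also have "iso (X \<boxplus> P \<boxplus> (Y \<boxplus> P')) (X' \<boxplus> Q \<boxplus> (Y' \<boxplus> Q'))" by (intro plus_cong[OF 1(3) 2(3)])
  also have "iso (X' \<boxplus> Q \<boxplus> (Y' \<boxplus> Q')) (X' \<boxplus> Y' \<boxplus> (Q \<boxplus> Q'))" using o by (intro plus_swap4)
  finally show ?thesis unfolding stab_def using o prj_plus[OF 1(1) 2(1)] prj_plus[OF 1(2) 2(2)] by (metis obj_plus)
qed

lemma stab_plus_prj: "obj X \<Longrightarrow> prj P \<Longrightarrow> stab (X \<boxplus> P) X"
proof -
  assume X: "obj X" and P: "prj P"
  let ?Z = "X\<lparr>carrier := {\<zero>\<^bsub>X\<^esub>}\<rparr>"
  have Z: "obj ?Z" "zero_module ?Z" "prj ?Z" using X obj_zero_submodule zero_module_submodule prj_zero by auto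
  have "iso (X \<boxplus> P \<boxplus> ?Z) (X \<boxplus> P)" using dsum_zero[OF _ Z(1,2), of "X \<boxplus> P"] dsum_iff X prjD[OF P] by auto
  then show ?thesis unfolding stab_def using X P Z prjD[OF P] by auto
qed

lemma stab_dsum_prj: "dsum X P Y \<Longrightarrow> prj P \<Longrightarrow> stab Y X"
  using stab_plus_prj stab_trans iso_stab iso_sym dsum_iff by metis

lemma stab_prj: "stab X Y \<Longrightarrow> prj X \<Longrightarrow> prj Y"
proof -
  assume "stab X Y" "prj X"
  then obtain P Q where *: "prj P" "prj Q" "iso (X \<boxplus> P) (Y \<boxplus> Q)" "obj Y" unfolding stab_def by blast
  then have "prj (Y \<boxplus> Q)" using prj_iso prj_plus \<open>prj X\<close> by blast
  then show ?thesis using retr_prj dsum_retr(1)[OF dsum_plus] *(2,4) prjD by blast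
qed

lemma prj_stab: "prj X \<Longrightarrow> prj Y \<Longrightarrow> stab X Y"
  unfolding stab_def using plus_comm prjD by blast

text \<open>Here Krull-Schmidt cancellation enters the stable theory, once the projective
  complements have been moved out of the way. It makes stable classes a cancellative monoid, so that
  relations between direct sums can be handled inside a group.\<close>

lemma stab_cancel:
  assumes "obj X" "obj Y" "obj C" "stab (X \<boxplus> C) (Y \<boxplus> C)" shows "stab X Y"
proof -
  obtain P Q where 1: "prj P" "prj Q" "iso (X \<boxplus> C \<boxplus> P) (Y \<boxplus> C \<boxplus> Q)" using assms(4) unfolding stab_def by blast
  have o: "obj P" "obj Q" using 1 prjD by auto
  have "iso (X \<boxplus> P \<boxplus> C) (X \<boxplus> C \<boxplus> P)" using assms o by (intro plus_right_comm)
  also note 1(3)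
  also have "iso (Y \<boxplus> C \<boxplus> Q) (Y \<boxplus> Q \<boxplus> C)" using assms o by (intro plus_right_comm)
  finally have "iso (X \<boxplus> P) (Y \<boxplus> Q)" using assms o by (intro cancel[of "X \<boxplus> P" "Y \<boxplus> Q" C]) simp_all
  then show ?thesis unfolding stab_def using assms 1 by blast
qed

text \<open>The pullback \<open>E\<close> of the two presentations is an extension of a projective
  module in two ways. Both split, so \<open>E\<close> is stably \<open>K\<close> and stably
  \<open>K'\<close>.\<close>

lemma schanuel:
  assumes X: "stab X X'" and K: "sq K P X" "prj P" and K': "sq K' P' X'" "prj P'"
  shows "stab K K'"
proof -
  obtain Q Q' where Q: "prj Q" "prj Q'" "iso (X \<boxplus> Q) (X' \<boxplus> Q')" using X unfolding stab_def by blast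
  have o: "obj P" "obj P'" "obj Q" "obj Q'" using Q K K' prjD by auto
  have 1: "sq K (P \<boxplus> Q) (X \<boxplus> Q)" by (rule sq_add_right[OF K(1) o(3)])
  have 2: "sq K' (P' \<boxplus> Q') (X \<boxplus> Q)"
    using sq_iso[OF sq_add_right[OF K'(1) o(4)] _ _ iso_sym[OF Q(3)]] sqD[OF K'(1)] o by simp
  obtain E where E: "sq K' E (P \<boxplus> Q)" "sq K E (P' \<boxplus> Q')" using pullback[OF 1 2] .
  have p: "prj (P \<boxplus> Q)" "prj (P' \<boxplus> Q')" using Q K K' prj_plus by auto
  have "stab E K'" by (rule stab_dsum_prj[OF sq_split[OF E(1) p(1)] p(1)])
  moreover have "stab E K" by (rule stab_dsum_prj[OF sq_split[OF E(2) p(2)] p(2)])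
  ultimately show ?thesis using stab_trans stab_sym by blast
qed

text \<open>A triangle of the stable category: each term of an admissible sequence may be replaced
  by a stably isomorphic one. Rotation is available only in the direction of syzygies.\<close>

definition tri :: "'a umodule \<Rightarrow> 'a umodule \<Rightarrow> 'a umodule \<Rightarrow> bool" where
  "tri X Y Z \<longleftrightarrow> (\<exists>X' Y' Z'. stab X X' \<and> stab Y Y' \<and> stab Z Z' \<and> sq X' Y' Z')"

lemma sq_tri: "sq X Y Z \<Longrightarrow> tri X Y Z"
  unfolding tri_def using sqD stab_refl by blast

end

section \<open>Syzygies and projective dimension\<close>

locale enough_projectives = exact_structure +
  assumes enough: "obj X \<Longrightarrow> \<exists>K P. prj P \<and> sq K P X"
begin

text \<open>The kernel of some admissible surjection from a projective module, not necessarily a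
  minimal one; by \<open>schanuel\<close> the choice is immaterial up to
  \<open>stab\<close>.\<close>

definition Om :: "'a umodule \<Rightarrow> 'a umodule" where
  "Om X = (SOME K. \<exists>P. prj P \<and> sq K P X)"

lemma Om: assumes "obj X" obtains P where "prj P" "sq (Om X) P X"
  using someI_ex[OF enough[OF assms]] unfolding Om_def by blast

lemma obj_Om [simp]: "obj X \<Longrightarrow> obj (Om X)"
  using Om sqD by blast

lemma Om_stab: "stab X Y \<Longrightarrow> stab (Om X) (Om Y)"
  by (metis Om schanuel stabD)

lemma sq_Om: "sq K P X \<Longrightarrow> prj P \<Longrightarrow> stab K (Om X)"
  by (metis Om schanuel sqD(3) stab_refl)

lemma Om_plus: "obj X \<Longrightarrow> obj Y \<Longrightarrow> stab (Om (X \<boxplus> Y)) (Om X \<boxplus> Om Y)"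
proof -
  assume X: "obj X" and Y: "obj Y"
  obtain P where P: "prj P" "sq (Om X) P X" using Om[OF X] .
  obtain Q where Q: "prj Q" "sq (Om Y) Q Y" using Om[OF Y] .
  have "sq (Om X \<boxplus> Om Y) (P \<boxplus> Q) (X \<boxplus> Y)"
    by (rule sq_dsum[OF P(2) Q(2) dsum_plus dsum_plus dsum_plus]) (use X Y P Q prjD in auto)
  then show ?thesis using sq_Om prj_plus[OF P(1) Q(1)] stab_sym by blast
qed

lemma obj_Om_pow [simp]: "obj X \<Longrightarrow> obj ((Om ^^ n) X)"
  by (induction n) auto

lemma Om_pow_stab: "stab X Y \<Longrightarrow> stab ((Om ^^ n) X) ((Om ^^ n) Y)"
  by (induction n) (auto intro: Om_stab)

lemma Om_pow_plus: "obj X \<Longrightarrow> obj Y \<Longrightarrow> stab ((Om ^^ n) (X \<boxplus> Y)) ((Om ^^ n) X \<boxplus> (Om ^^ n) Y)"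
proof (induction n)
  case (Suc n)
  then have "stab ((Om ^^ Suc n) (X \<boxplus> Y)) (Om ((Om ^^ n) X \<boxplus> (Om ^^ n) Y))" using Om_stab by simp
  also have "stab \<dots> ((Om ^^ Suc n) X \<boxplus> (Om ^^ Suc n) Y)" using Suc Om_plus by simp
  finally show ?case .
qed simp

text \<open>Pulling the sequence back along a projective presentation of \<open>Z'\<close> gives an
  extension \<open>E\<close> of \<open>Y'\<close> by the syzygy of \<open>Z'\<close>. The other way
  round \<open>E\<close> is an extension of a projective by \<open>X'\<close>; it splits, so
  \<open>E\<close> is stably \<open>X'\<close>.\<close>

lemma tri_rotate: "tri X Y Z \<Longrightarrow> tri (Om Z) X Y"
proof -
  assume "tri X Y Z"
  then obtain X' Y' Z' where s: "stab X X'" "stab Y Y'" "stab Z Z'" "sq X' Y' Z'" unfolding tri_def by blast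
  obtain P where P: "prj P" "sq (Om Z') P Z'" using Om[OF sqD(3)[OF s(4)]] .
  obtain E where E: "sq (Om Z') E Y'" "sq X' E P" using pullback[OF s(4) P(2)] .
  have "stab E X'" by (rule stab_dsum_prj[OF sq_split[OF E(2) P(1)] P(1)])
  then have "stab X E" using s(1) stab_trans stab_sym by blast
  then show ?thesis unfolding tri_def using Om_stab[OF s(3)] s(2) E(1) by blast
qed

text \<open>Three rotations return the terms to their places, each with one syzygy more.\<close>

lemma tri_Om: "tri X Y Z \<Longrightarrow> tri ((Om ^^ n) X) ((Om ^^ n) Y) ((Om ^^ n) Z)"
proof (induction n)
  case (Suc n)
  then show ?case using tri_rotate[OF tri_rotate[OF tri_rotate]] by simp
qed simp

lemma tri_prj: assumes "tri X Y Z" "prj Z" shows "stab X Y"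
proof -
  obtain X' Y' Z' where s: "stab X X'" "stab Y Y'" "stab Z Z'" "sq X' Y' Z'" using assms(1) unfolding tri_def by blast
  have "prj Z'" using stab_prj s(3) assms(2) by blast
  then have "stab Y' X'" using sq_split[OF s(4)] stab_dsum_prj by blast
  then show ?thesis using s stab_trans stab_sym by blast
qed

text \<open>Projective dimension at most \<open>n\<close>, read off the \<open>n\<close>-th syzygy,
  so that no resolution has to be carried along. The link with resolutions is made by
  \<open>pd_resolution\<close> and \<open>resolution_exists\<close>.\<close>

definition pd :: "nat \<Rightarrow> 'a umodule \<Rightarrow> bool" where
  "pd n X \<longleftrightarrow> obj X \<and> prj ((Om ^^ n) X)"

lemma pd_obj: "pd n X \<Longrightarrow> obj X"
  by (simp add: pd_def)

lemma pd_0 [simp]: "pd 0 X \<longleftrightarrow> prj X"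
  using prjD by (auto simp: pd_def)

lemma pd_Suc: "pd (Suc n) X \<longleftrightarrow> obj X \<and> pd n (Om X)"
  by (auto simp: pd_def funpow_swap1)

lemma pd_stab: "pd n X \<Longrightarrow> stab X Y \<Longrightarrow> pd n Y"
  unfolding pd_def using Om_pow_stab stab_prj stabD by blast

lemma pd_Suc_sq: "sq K P X \<Longrightarrow> prj P \<Longrightarrow> pd (Suc n) X \<longleftrightarrow> pd n K"
  using pd_Suc sq_Om pd_stab stab_sym sqD by metis

lemma prj_Om: "prj X \<Longrightarrow> prj (Om X)"
proof -
  assume X: "prj X"
  obtain P where P: "prj P" "sq (Om X) P X" using Om[OF prjD[OF X]] .
  then show ?thesis using retr_prj dsum_retr(1)[OF sq_split[OF P(2) X]] by blast
qed

lemma pd_mono: "pd n X \<Longrightarrow> n \<le> m \<Longrightarrow> pd m X"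
proof -
  assume X: "pd n X" and nm: "n \<le> m"
  have "pd (n + k) X" for k
    by (induction k) (use X prj_Om in \<open>auto simp: pd_def\<close>)
  then show ?thesis using nm by (metis le_add_diff_inverse)
qed

text \<open>Up to \<open>stab\<close> the syzygies of a direct sum are the sums of the syzygies, and
  projectivity passes to summands.\<close>

lemma pd_retr: "pd n X \<Longrightarrow> retr Y X \<Longrightarrow> pd n Y"
proof -
  assume X: "pd n X" and "retr Y X"
  then obtain Y' where d: "dsum Y Y' X" using retr_dsum by blast
  note o = dsumD[OF d]
  have "pd n (Y \<boxplus> Y')" using pd_stab[OF X] iso_stab iso_sym dsum_iff d by blast
  then have "prj ((Om ^^ n) Y \<boxplus> (Om ^^ n) Y')" unfolding pd_def using stab_prj Om_pow_plus o by blast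
  then show ?thesis unfolding pd_def using retr_prj dsum_retr(1)[OF dsum_plus] o obj_Om_pow by blast
qed

text \<open>Once the \<open>n\<close>-th syzygy of \<open>Z\<close> is projective, the triangle of
  \<open>n\<close>-th syzygies makes those of \<open>X\<close> and \<open>Y\<close> stably
  isomorphic. So neither kernels nor extensions need a shift of the bound; only
  \<open>pd_cokernel\<close>, obtained by rotating, loses one.\<close>

lemma pd_kernel: "tri X Y Z \<Longrightarrow> pd n Y \<Longrightarrow> pd n Z \<Longrightarrow> pd n X"
proof -
  assume t: "tri X Y Z" and Y: "pd n Y" and Z: "pd n Z"
  have "stab ((Om ^^ n) X) ((Om ^^ n) Y)" using tri_prj[OF tri_Om[OF t]] Z by (simp add: pd_def)
  then show ?thesis using Y t stab_prj stab_sym stabD unfolding pd_def tri_def by blast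
qed

lemma pd_ext: "tri X Y Z \<Longrightarrow> pd n X \<Longrightarrow> pd n Z \<Longrightarrow> pd n Y"
proof -
  assume t: "tri X Y Z" and X: "pd n X" and Z: "pd n Z"
  have "stab ((Om ^^ n) X) ((Om ^^ n) Y)" using tri_prj[OF tri_Om[OF t]] Z by (simp add: pd_def)
  then show ?thesis using X t stab_prj stabD unfolding pd_def tri_def by blast
qed

lemma pd_cokernel: "tri X Y Z \<Longrightarrow> pd n X \<Longrightarrow> pd n Y \<Longrightarrow> pd (Suc n) Z"
  using pd_kernel[OF tri_rotate] pd_Suc unfolding tri_def using stabD by blast

end

section \<open>Ordinary projective dimension\<close>

context module_category
begin

definition reg :: "('a, 'a) module" where
  "reg = \<lparr>carrier = carrier A, monoid.mult = undefined, monoid.one = undefined, ring.zero = \<zero>, ring.add = (\<oplus>), smult = (\<otimes>)\<rparr>"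

lemma obj_reg: "obj reg"
proof -
  have "abelian_group reg"
    by (rule abelian_groupI) (auto simp: reg_def a_ac l_neg intro: bexI[of _ "\<ominus> x" for x])
  then have lm: "left_module A reg"
    by (intro left_module.intro left_module_axioms.intro ring_axioms) (auto simp: reg_def l_distr r_distr m_assoc)
  have "left_module.gen_by A reg {\<one>} (carrier reg)"
    unfolding left_module.gen_by_def[OF lm]
  proof (intro conjI allI impI subsetI)
    fix x assume "x \<in> {\<one>}" then show "x \<in> carrier reg" by (simp add: reg_def)
  next
    fix K x assume K: "submodule K A reg" "{\<one>} \<subseteq> K" and x: "x \<in> carrier reg"
    have "x \<odot>\<^bsub>reg\<^esub> \<one> \<in> K" using left_module.submoduleD(4)[OF lm K(1), of x \<one>] K(2) x by (simp add: reg_def)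
    then show "x \<in> K" using x by (simp add: reg_def)
  qed
  then show ?thesis using objI_gen[OF lm] by blast
qed

end

sublocale module_category \<subseteq> ord: exact_structure A "\<lambda>M N. carrier M \<rightarrow> carrier N"
  by unfold_locales (auto simp: Pi_iff module_hom_def)

context module_category
begin

text \<open>Every surjection has a section as a map of sets, and here all such maps belong to
  \<open>H\<close>.\<close>

lemma adm_iff: "ord.adm M N g \<longleftrightarrow> g \<in> hom M N \<and> (\<forall>y \<in> carrier N. \<exists>x \<in> carrier M. y = g x)"
proof
  assume "ord.adm M N g" then show "g \<in> hom M N \<and> (\<forall>y \<in> carrier N. \<exists>x \<in> carrier M. y = g x)"
    unfolding ord.adm_def by (metis PiE)
next
  assume *: "g \<in> hom M N \<and> (\<forall>y \<in> carrier N. \<exists>x \<in> carrier M. y = g x)"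
  then obtain s where "\<forall>y \<in> carrier N. s y \<in> carrier M \<and> g (s y) = y" by metis
  then show "ord.adm M N g" using * by (intro ord.admI[of _ _ _ s]) auto
qed

lemma ses_sq: "ses K E Q f g \<Longrightarrow> ord.sq K E Q"
  using ord.sqI[of K E Q f g] ses_surj[of K E Q f g] sesD(5)[of K E Q f g] by (simp add: adm_iff)

text \<open>\<open>P\<close> is a copy of the regular module, free on the image of
  \<open>\<one>\<close>; a preimage \<open>m\<close> of the value there determines the lift.\<close>

lemma prj_reg:
  assumes R: "obj P" and f: "f \<in> hom reg P" and g: "g \<in> hom P reg"
    and gf: "\<forall>x \<in> carrier reg. g (f x) = x" and fg: "\<forall>y \<in> carrier P. f (g y) = y"
  shows "ord.prj P"
  unfolding ord.prj_def
proof (intro conjI allI impI)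
  show "obj P" by fact
  fix M N h k assume "obj M \<and> obj N \<and> ord.adm M N h \<and> k \<in> hom P N"
  then have M: "obj M" and N: "obj N" and h: "h \<in> hom M N" "\<forall>y \<in> carrier N. \<exists>x \<in> carrier M. y = h x" and k: "k \<in> hom P N"
    by (simp_all add: adm_iff)
  interpret M: left_module A M by (rule objD[OF M])
  note [simp] = hom_simps[OF f obj_reg R] hom_simps[OF g R obj_reg] hom_simps[OF h(1) M N] hom_simps[OF k R N]
  have c: "carrier reg = carrier A" "\<And>x y. x \<oplus>\<^bsub>reg\<^esub> y = x \<oplus> y" "\<And>x y. x \<odot>\<^bsub>reg\<^esub> y = x \<otimes> y" by (simp_all add: reg_def)
  have gc: "g y \<in> carrier A" if "y \<in> carrier P" for y using hom_simps(1)[OF g R obj_reg that] c(1) by simp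
  have 1: "\<one> \<in> carrier reg" by (simp add: c)
  then have "k (f \<one>) \<in> carrier N" by simp
  then obtain m where m: "m \<in> carrier M" "k (f \<one>) = h m" using h(2) by blast
  have l: "(\<lambda>y. g y \<odot>\<^bsub>M\<^esub> m) \<in> hom P M"
  proof (rule module_homI)
    fix x y assume "x \<in> carrier P" "y \<in> carrier P"
    then show "g (x \<oplus>\<^bsub>P\<^esub> y) \<odot>\<^bsub>M\<^esub> m = g x \<odot>\<^bsub>M\<^esub> m \<oplus>\<^bsub>M\<^esub> g y \<odot>\<^bsub>M\<^esub> m" using m gc by (simp add: c M.smult_l_distr)
  next
    fix a x assume "a \<in> carrier A" "x \<in> carrier P"
    then show "g (a \<odot>\<^bsub>P\<^esub> x) \<odot>\<^bsub>M\<^esub> m = a \<odot>\<^bsub>M\<^esub> (g x \<odot>\<^bsub>M\<^esub> m)" using m gc by (simp add: c M.smult_assoc1)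
  qed (use m gc M in simp)
  have "h (g y \<odot>\<^bsub>M\<^esub> m) = k y" if y: "y \<in> carrier P" for y
  proof -
    have "h (g y \<odot>\<^bsub>M\<^esub> m) = g y \<odot>\<^bsub>N\<^esub> k (f \<one>)" using m gc[OF y] by simp
    also have "\<dots> = k (g y \<odot>\<^bsub>P\<^esub> f \<one>)" using gc[OF y] 1 by simp
    also have "g y \<odot>\<^bsub>P\<^esub> f \<one> = f (g y \<odot>\<^bsub>reg\<^esub> \<one>)" using gc[OF y] 1 by simp
    also have "g y \<odot>\<^bsub>reg\<^esub> \<one> = g y" using gc[OF y] by (simp add: c)
    finally show ?thesis using fg y by simp
  qed
  then show "\<exists>l \<in> hom P M. \<forall>x \<in> carrier P. h (l x) = k x" by (intro bexI[OF _ l] ballI)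
qed

text \<open>Each element of \<open>S\<close> contributes one copy of the regular module, mapped onto
  the multiples of that element. Adding the copies one by one stays within direct sums of two
  modules.\<close>

lemma projective_cover_of_finite:
  assumes X: "obj (X :: 'a umodule)" and "finite S" "S \<subseteq> carrier X"
  shows "\<exists>P f. ord.prj P \<and> f \<in> hom P X \<and> S \<subseteq> f ` carrier P"
  using assms(2,3)
proof (induction S rule: finite_induct)
  case empty
  have "ord.prj (X\<lparr>carrier := {\<zero>\<^bsub>X\<^esub>}\<rparr>)" by (rule ord.prj_zero[OF obj_zero_submodule[OF X] zero_module_submodule])
  then show ?case using hom_zero[OF X] by blast
next
  case (insert s S)
  then obtain P f where P: "ord.prj P" "f \<in> hom P X" "S \<subseteq> f ` carrier P" by auto
  have s: "s \<in> carrier X" using insert by simp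
  interpret X: left_module A X by (rule objD[OF X])
  obtain Q :: "'a umodule" and a b where Q: "obj Q" "a \<in> hom reg Q" "b \<in> hom Q reg"
    "\<forall>x \<in> carrier reg. b (a x) = x" "\<forall>y \<in> carrier Q. a (b y) = y" using copy_obj[OF obj_reg] .
  have Qp: "ord.prj Q" by (rule prj_reg[OF Q])
  have c: "carrier reg = carrier A" "\<And>x y. x \<oplus>\<^bsub>reg\<^esub> y = x \<oplus> y" "\<And>x y. x \<odot>\<^bsub>reg\<^esub> y = x \<otimes> y" by (simp_all add: reg_def)
  note P' = ord.prjD[OF P(1)]
  obtain i1 i2 p1 p2 where bp: "biprod P Q (P \<boxplus> Q) i1 i2 p1 p2" using dsum_plus[OF P' Q(1)] by (rule dsumE)
  have r: "(\<lambda>r. r \<odot>\<^bsub>X\<^esub> s) \<in> hom reg X" using s X by (intro module_homI) (simp_all add: c X.smult_l_distr X.smult_assoc1)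
  note [simp] = biprod_simps[OF bp] hom_simps[OF P(2) P' X] hom_simps[OF Q(3,1) obj_reg] hom_simps[OF Q(2) obj_reg Q(1)]
  define F where "F x = f (p1 x) \<oplus>\<^bsub>X\<^esub> b (p2 x) \<odot>\<^bsub>X\<^esub> s" for x
  have F: "F \<in> hom (P \<boxplus> Q) X" unfolding F_def
    by (intro hom_add module_hom_comp[OF biprodD(6)[OF bp] P(2)] module_hom_comp[OF module_hom_comp[OF biprodD(7)[OF bp] Q(3)] r] X) simp
  have "b (p2 (i1 x)) = \<zero>" if "x \<in> carrier P" for x using that hom_simps(4)[OF Q(3,1) obj_reg] by (simp add: reg_def)
  then have "F (i1 x) = f x" if "x \<in> carrier P" for x using that s X by (simp add: F_def)
  then have "f ` carrier P \<subseteq> F ` carrier (P \<boxplus> Q)" by (metis bp biprod_simps(9) image_eqI image_subsetI)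
  moreover have "F (i2 (a \<one>)) = s" using s X Q(4) by (simp add: F_def c)
  then have "s \<in> F ` carrier (P \<boxplus> Q)" by (intro image_eqI[of _ _ "i2 (a \<one>)"]) (simp_all add: c)
  ultimately show ?case using ord.prj_plus[OF P(1) Qp] F P(3) by (intro exI[of _ "P \<boxplus> Q"] exI[of _ F] conjI) auto
qed

lemma ord_enough:
  assumes X: "obj (X :: 'a umodule)" shows "\<exists>K P. ord.prj P \<and> ord.sq K P X"
proof -
  obtain S where S: "finite S" "left_module.gen_by A X S (carrier X)" using obj_gen[OF X] .
  have "S \<subseteq> carrier X" using S(2) unfolding left_module.gen_by_def[OF objD[OF X]] by simp
  then obtain P f where P: "ord.prj P" "f \<in> hom P X" "S \<subseteq> f ` carrier P"
    using projective_cover_of_finite[OF X S(1)] by blast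
  note P' = ord.prjD[OF P(1)]
  have "carrier X \<subseteq> f ` carrier P"
    by (rule left_module.gen_byD[OF objD[OF X] S(2) submodule_image[OF P(2) P' X] P(3)])
  then have "\<And>y. y \<in> carrier X \<Longrightarrow> \<exists>x \<in> carrier P. y = f x" by blast
  then show ?thesis using ses_sq[OF ses_kernel[OF P' X P(2)]] P(1) by blast
qed

end

sublocale module_category \<subseteq> ord: enough_projectives A "\<lambda>M N. carrier M \<rightarrow> carrier N"
  by unfold_locales (rule ord_enough)

section \<open>Injections of X into the direct sum of X and a projective module\<close>

context module_category
begin

text \<open>The map \<open>h\<close> is fed back into itself through its \<open>X\<close>-component:
  \<open>T\<close> is \<open>X\<close> plus \<open>n\<close> copies of \<open>P\<close>, and the
  \<open>X\<close>-component of the injection \<open>h'\<close> is the \<open>n\<close>-th power of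
  that of \<open>h\<close>. The cokernel of \<open>h'\<close> is an iterated extension of copies of
  \<open>Z\<close>, so it inherits the bound \<open>r\<close>.\<close>

lemma iterated_cokernel:
  assumes b: "biprod X P E i1 i2 p1 p2" and s: "ses X E Z h q" and Z: "ord.pd r Z"
  shows "\<exists>T Z' h' q' i p. ses X T Z' h' q' \<and> i \<in> hom X T \<and> p \<in> hom T X \<and> (\<forall>x \<in> carrier X. p (i x) = x) \<and>
    (\<forall>x \<in> carrier X. p (h' x) = ((\<lambda>x. p1 (h x)) ^^ n) x) \<and> ord.pd r Z'"
proof (induction n)
  case 0
  have X: "obj X" using biprodD(1)[OF b] .
  let ?Z = "X\<lparr>carrier := {\<zero>\<^bsub>X\<^esub>}\<rparr>"
  have oZ: "obj ?Z" "zero_module ?Z" using obj_zero_submodule[OF X] zero_module_submodule by auto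
  have "ses X X ?Z (\<lambda>x. x) (\<lambda>_. \<zero>\<^bsub>X\<^esub>)"
  proof (rule sesI[OF X X oZ(1) module_hom_id module_hom_into[OF hom_zero[OF X]]])
    fix y assume "y \<in> carrier ?Z"
    then show "\<exists>x \<in> carrier X. y = \<zero>\<^bsub>X\<^esub>" using zero_mem[OF X] by auto
  next
    fix e assume "e \<in> carrier X"
    then show "\<exists>x \<in> carrier X. e = x" by blast
  qed simp_all
  moreover have "ord.pd r ?Z" using ord.pd_mono[of 0 ?Z r] ord.prj_zero[OF oZ] by simp
  ultimately show ?case
    by (intro exI[of _ X] exI[of _ ?Z] exI[of _ "\<lambda>x. x"] exI[of _ "\<lambda>_. \<zero>\<^bsub>X\<^esub>"] conjI) (simp_all add: module_hom_id)
next
  case (Suc n)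
  then obtain T Z' h' q' i p where IH: "ses X T Z' h' q'" "i \<in> hom X T" "p \<in> hom T X" "\<forall>x \<in> carrier X. p (i x) = x"
    "\<forall>x \<in> carrier X. p (h' x) = ((\<lambda>x. p1 (h x)) ^^ n) x" "ord.pd r Z'" by (elim exE conjE) (rule that)
  note s1 = sesD[OF s] and s2 = sesD[OF IH(1)]
  obtain j1 j2 r1 r2 where t: "biprod T P (T \<boxplus> P) j1 j2 r1 r2" using dsum_plus[OF s2(2) biprodD(2)[OF b]] by (rule dsumE)
  let ?S = "T \<boxplus> P"
  note [simp] = biprod_simps[OF b] biprod_simps[OF t] hom_simps[OF s1(4,1,2)] hom_simps[OF s1(5,2,3)]
    hom_simps[OF s2(4,1,2)] hom_simps[OF s2(5,2,3)] s1(9) s2(9) s1(3) s2(3)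
  note c = module_hom_comp
  \<comment> \<open>\<open>v\<close> is \<open>h'\<close> on the \<open>X\<close>-part and the
    identity on \<open>P\<close>, so it has the cokernel of \<open>h'\<close>. The next injection is
    \<open>h\<close> followed by \<open>v\<close>, whose cokernel is an extension of
    \<open>Z'\<close> by \<open>Z\<close>.\<close>
  define v where "v e = j1 (h' (p1 e)) \<oplus>\<^bsub>?S\<^esub> j2 (p2 e)" for e
  have v: "v \<in> hom E ?S" unfolding v_def
    by (intro hom_add c[OF c[OF biprodD(6)[OF b] s2(4)] biprodD(4)[OF t]] c[OF biprodD(7)[OF b] biprodD(5)[OF t]]) simp_all
  have vc [simp]: "r1 (v e) = h' (p1 e)" "r2 (v e) = p2 e" if "e \<in> carrier E" for e using that by (simp_all add: v_def)
  note [simp] = hom_simps[OF v biprodD(3)[OF b] biprodD(3)[OF t]]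
  have vs: "ses E ?S Z' v (\<lambda>t. q' (r1 t))"
  proof (rule sesI[OF _ _ _ v c[OF biprodD(6)[OF t] s2(5)]])
    fix e assume e: "e \<in> carrier E" "v e = \<zero>\<^bsub>?S\<^esub>"
    then have "r1 (v e) = \<zero>\<^bsub>T\<^esub>" "r2 (v e) = \<zero>\<^bsub>P\<^esub>" by simp_all
    then have "h' (p1 e) = \<zero>\<^bsub>T\<^esub>" "p2 e = \<zero>\<^bsub>P\<^esub>" using e(1) by simp_all
    then have "p1 e = \<zero>\<^bsub>X\<^esub>" "p2 e = \<zero>\<^bsub>P\<^esub>" using ses_inj[OF IH(1), of "p1 e"] e(1) by simp_all
    then show "e = \<zero>\<^bsub>E\<^esub>" using biprod_simps(5)[OF b e(1)] by simp
  next
    fix y assume "y \<in> carrier Z'"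
    then obtain x where "x \<in> carrier T" "y = q' x" using ses_surj[OF IH(1)] by blast
    then show "\<exists>x \<in> carrier ?S. y = q' (r1 x)" by (intro bexI[of _ "j1 x"]) simp_all
  next
    fix e assume e: "e \<in> carrier ?S" "q' (r1 e) = \<zero>\<^bsub>Z'\<^esub>"
    then obtain x where x: "x \<in> carrier X" "r1 e = h' x" using ses_ker[OF IH(1), of "r1 e"] by auto
    have "e = v (i1 x \<oplus>\<^bsub>E\<^esub> i2 (r2 e))" using x e(1) biprod_simps(5)[OF t e(1)] by (simp add: v_def)
    then show "\<exists>x \<in> carrier E. e = v x" using x e(1) by (intro bexI[of _ "i1 x \<oplus>\<^bsub>E\<^esub> i2 (r2 e)"]) simp_all
  qed simp_all
  have vh: "(\<lambda>x. v (h x)) \<in> hom X ?S" by (rule c[OF s1(4) v])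
  have "inj_on (\<lambda>x. v (h x)) (carrier X)"
    using ses_inj[OF vs] ses_inj[OF s] by (intro hom_inj[OF vh]) simp_all
  then obtain Z2 q2 where q2: "ses X ?S Z2 (\<lambda>x. v (h x)) q2"
    using cokernel_exists[OF s1(1) biprodD(3)[OF t] vh] by blast
  obtain a b where "ses Z Z2 Z' a b" using ses_comp[OF s vs q2] .
  then have "ord.pd r Z2" using ord.pd_ext[OF ord.sq_tri[OF ses_sq]] Z IH(6) by blast
  moreover have "(\<lambda>x. j1 (i x)) \<in> hom X ?S" "(\<lambda>t. p (r1 t)) \<in> hom ?S X"
    by (intro c[OF IH(2) biprodD(4)[OF t]] c[OF biprodD(6)[OF t] IH(3)])+
  moreover have "\<forall>x \<in> carrier X. p (r1 (j1 (i x))) = x" using IH(4) hom_simps(1)[OF IH(2) s1(1) s2(2)] by simp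
  moreover have "\<forall>x \<in> carrier X. p (r1 (v (h x))) = ((\<lambda>x. p1 (h x)) ^^ Suc n) x"
    using IH(5) by (simp add: funpow_Suc_right del: funpow.simps)
  ultimately show ?case using q2
    by (intro exI[of _ ?S] exI[of _ Z2] exI[of _ "\<lambda>x. v (h x)"] exI[of _ q2] exI[of _ "\<lambda>x. j1 (i x)"] exI[of _ "\<lambda>t. p (r1 t)"] conjI)
qed

lemma iterated_cokernelE:
  assumes b: "biprod X P E i1 i2 p1 p2" and s: "ses X E Z h q" and Z: "ord.pd r Z" and f: "f = (\<lambda>x. p1 (h x))"
  obtains T Z' h' q' i p where "ses X T Z' h' q'" "i \<in> hom X T" "p \<in> hom T X" "\<forall>x \<in> carrier X. p (i x) = x"
    "\<forall>x \<in> carrier X. p (h' x) = (f ^^ n) x" "ord.pd r Z'"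
  using iterated_cokernel[OF b s Z, of n, folded f] by (elim exE conjE) (rule that)

text \<open>The Fitting decomposition of the endomorphism of \<open>X\<close> induced by \<open>X \<rightarrow> X \<oplus> P\<close>: the summand on which it is
  bijective can be cancelled, the nilpotent one is a direct summand of an iterated extension of copies of \<open>Z\<close>.\<close>

lemma fitting_ses:
  assumes d: "dsum X P E" and P: "ord.prj P" and s: "ses X E Z h q" and Z: "ord.pd r Z"
  obtains X1 where "retr X1 X" "ord.pd r X1" "\<And>c. ord.pd c X1 \<Longrightarrow> ord.pd (Suc c) Z"
proof -
  obtain i1 i2 p1 p2 where b: "biprod X P E i1 i2 p1 p2" using d by (rule dsumE)
  note s1 = sesD[OF s]
  note c = module_hom_comp
  define f where "f x = p1 (h x)" for x
  then have ff: "f = (\<lambda>x. p1 (h x))" by (simp add: fun_eq_iff)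
  have f: "f \<in> hom X X" unfolding f_def by (rule c[OF s1(4) biprodD(6)[OF b]])
  note [simp] = biprod_simps[OF b] hom_simps[OF s1(4,1,2)] hom_simps[OF s1(5,2,3)] s1(3,9) hom_simps[OF f s1(1,1)]
  obtain n where n: "n > 0" and ds: "internal_direct_sum A X {x \<in> carrier X. (f ^^ n) x = \<zero>\<^bsub>X\<^esub>} ((f ^^ n) ` carrier X)"
    and fi: "inj_on f ((f ^^ n) ` carrier X)" "f ` (f ^^ n) ` carrier X = (f ^^ n) ` carrier X"
    by (rule fitting_direct_sum[OF s1(1) f])
  \<comment> \<open>\<open>f\<close> is nilpotent on \<open>K\<close> and bijective on
    \<open>I\<close>; the module \<open>X1\<close> to be found is \<open>K\<close>.\<close>
  define K where "K = {x \<in> carrier X. (f ^^ n) x = \<zero>\<^bsub>X\<^esub>}"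
  define I where "I = (f ^^ n) ` carrier X"
  note ds = ds[folded K_def I_def] and fi = fi[folded I_def]
  from ds have KI: "submodule K A X" "submodule I A X" "K \<inter> I = {\<zero>\<^bsub>X\<^esub>}"
    and sum: "\<And>x. x \<in> carrier X \<Longrightarrow> \<exists>u\<in>K. \<exists>v\<in>I. x = u \<oplus>\<^bsub>X\<^esub> v"
    unfolding internal_direct_sum_iff[OF s1(1)] by simp_all
  note DK = left_module.submoduleD[OF objD[OF s1(1)] KI(1)] and DI = left_module.submoduleD[OF objD[OF s1(1)] KI(2)]
  let ?X1 = "X\<lparr>carrier := K\<rparr>"
  obtain \<pi>1 \<pi>2 where pb: "biprod ?X1 (X\<lparr>carrier := I\<rparr>) X (\<lambda>x. x) (\<lambda>x. x) \<pi>1 \<pi>2" by (rule internal_biprod[OF s1(1) KI sum])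
  have X1: "obj ?X1" using biprodD(1)[OF pb] .
  have fK: "f x \<in> K" if "x \<in> K" for x
    using that hom_simps(4)[OF f s1(1,1)] by (auto simp: K_def funpow_swap1[symmetric])
  have fI: "f x \<in> I" if "x \<in> I" for x using fi(2) that by blast
  obtain T Z' h' q' i p where it: "ses X T Z' h' q'" "i \<in> hom X T" "p \<in> hom T X" "\<forall>x \<in> carrier X. p (i x) = x"
    "\<forall>x \<in> carrier X. p (h' x) = (f ^^ n) x" "ord.pd r Z'" by (rule iterated_cokernelE[OF b s Z ff])
  note s2 = sesD[OF it(1)]
  \<comment> \<open>After \<open>h'\<close> the map \<open>p\<close> becomes \<open>f ^^ n\<close>,
    with values in \<open>I\<close>. So the projection to \<open>K\<close> after \<open>p\<close>
    kills the image of \<open>h'\<close> and descends to \<open>Z'\<close>; as \<open>p\<close> is a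
    retraction for \<open>i\<close>, this makes \<open>K\<close> a retract of \<open>Z'\<close>,
    hence of finite dimension even where \<open>X\<close> is not.\<close>
  have kz: "\<pi>1 (p e) = \<zero>\<^bsub>?X1\<^esub>" if e: "e \<in> carrier T" "q' e = \<zero>\<^bsub>Z'\<^esub>" for e
  proof -
    obtain x where "x \<in> carrier X" "e = h' x" using ses_ker[OF it(1) e] by blast
    then have "p e \<in> I" using it(5) by (simp add: I_def)
    then show ?thesis using biprod_simps(3)[OF pb] by simp
  qed
  obtain \<beta> where \<beta>: "\<beta> \<in> hom Z' ?X1" "\<forall>x \<in> carrier T. \<beta> (q' x) = \<pi>1 (p x)"
    using desc_epi[OF s2(2,3) X1 s2(5,7) c[OF it(3) biprodD(6)[OF pb]] kz] by blast
  have "retr ?X1 Z'"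
  proof (rule retrI[OF X1 s2(3) c[OF c[OF biprodD(4)[OF pb] it(2)] s2(5)] \<beta>(1)])
    fix x assume x: "x \<in> carrier ?X1"
    then have "i x \<in> carrier T" using DK(1) hom_simps(1)[OF it(2) s1(1) s2(2)] by simp
    then show "\<beta> (q' (i x)) = x" using \<beta>(2) it(4) x DK(1) biprod_simps(1)[OF pb, of x] by simp
  qed
  then have pdX1: "ord.pd r ?X1" using ord.pd_retr[OF it(6)] by blast
  obtain k1 k2 t1 t2 where kb: "biprod ?X1 P (?X1 \<boxplus> P) k1 k2 t1 t2" using dsum_plus[OF X1 ord.prjD[OF P]] by (rule dsumE)
  let ?E = "?X1 \<boxplus> P"
  note [simp] = biprod_simps[OF kb, simplified]
  have t1X [simp]: "t1 e \<in> carrier X" if "e \<in> carrier ?E" for e using biprod_simps(21)[OF kb that] DK(1) by simp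
  have i1K: "i1 \<in> hom ?X1 E" using module_hom_from[OF biprodD(4)[OF b]] DK(1) by blast
  define inc where "inc e = i1 (t1 e) \<oplus>\<^bsub>E\<^esub> i2 (t2 e)" for e
  have inc: "inc \<in> hom ?E E" unfolding inc_def
    by (intro hom_add c[OF biprodD(6)[OF kb] i1K] c[OF biprodD(7)[OF kb] biprodD(5)[OF b]]) simp_all
  note incs = hom_simps[OF inc biprodD(3)[OF kb] biprodD(3)[OF b]]
  have pinc: "p1 (inc e) = t1 e" "p2 (inc e) = t2 e" if "e \<in> carrier ?E" for e
    using that by (simp_all add: inc_def)
  have inc_inj: "e = e'" if "inc e = inc e'" "e \<in> carrier ?E" "e' \<in> carrier ?E" for e e'
  proof -
    have t: "t1 e = t1 e'" "t2 e = t2 e'"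
      using pinc[OF that(2)] pinc[OF that(3)] unfolding that(1) by simp_all
    have "e = k1 (t1 e) \<oplus>\<^bsub>?E\<^esub> k2 (t2 e)" using biprod_simps(5)[OF kb that(2)] by (rule sym)
    also have "\<dots> = e'" unfolding t by (rule biprod_simps(5)[OF kb that(3)])
    finally show ?thesis .
  qed
  have fX1: "f \<in> hom ?X1 ?X1" using module_hom_into[OF module_hom_from[OF f], of K K] fK DK(1) by auto
  have hX1: "h \<in> hom ?X1 E" using module_hom_from[OF s1(4)] DK(1) by blast
  \<comment> \<open>The restriction of \<open>h\<close> to \<open>K\<close>. Its values lie in
    \<open>K\<close> plus \<open>P\<close>, because \<open>f\<close> preserves \<open>K\<close>;
    \<open>inc\<close> is the embedding of that sum into \<open>E\<close>.\<close>
  define h1 where "h1 x = k1 (f x) \<oplus>\<^bsub>?E\<^esub> k2 (p2 (h x))" for x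
  have h1: "h1 \<in> hom ?X1 ?E" unfolding h1_def
    by (intro hom_add c[OF fX1 biprodD(4)[OF kb]] c[OF c[OF hX1 biprodD(7)[OF b]] biprodD(5)[OF kb]] X1) simp
  have inch1: "inc (h1 x) = h x" if x: "x \<in> K" for x
  proof -
    have "t1 (h1 x) = f x" "t2 (h1 x) = p2 (h x)" using x fK[OF x] DK(1)[OF x] by (simp_all add: h1_def)
    then have "inc (h1 x) = i1 (p1 (h x)) \<oplus>\<^bsub>E\<^esub> i2 (p2 (h x))" by (simp add: inc_def f_def)
    then show ?thesis using DK(1)[OF x] by simp
  qed
  have h1c: "h1 x \<in> carrier ?E" if "x \<in> K" for x using module_hom_closed[OF h1] that by simp
  have "ses ?X1 ?E Z h1 (\<lambda>e. q (inc e))"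
  proof (rule sesI[OF X1 biprodD(3)[OF kb] s1(3) h1 c[OF inc s1(5)]])
    fix x assume x: "x \<in> carrier ?X1" "h1 x = \<zero>\<^bsub>?E\<^esub>"
    then have "h x = \<zero>\<^bsub>E\<^esub>" using inch1[of x] incs(4) by simp
    then show "x = \<zero>\<^bsub>?X1\<^esub>" using ses_inj[OF s] x DK(1) by simp
  next
    fix x assume "x \<in> carrier ?X1" then show "q (inc (h1 x)) = \<zero>\<^bsub>Z\<^esub>" using inch1 DK(1) by simp
  next
    fix z assume "z \<in> carrier Z"
    then obtain e where e: "e \<in> carrier E" "z = q e" using ses_surj[OF s] by blast
    obtain u v where uv: "u \<in> K" "v \<in> I" "p1 e = u \<oplus>\<^bsub>X\<^esub> v" using sum[of "p1 e"] e by auto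
    \<comment> \<open>The \<open>I\<close>-part of \<open>p1 e\<close> is \<open>f w\<close> with
      \<open>w\<close> in \<open>I\<close>. Subtracting \<open>h w\<close> removes it without
      changing the image in \<open>Z\<close>, so \<open>K\<close> plus \<open>P\<close> still maps
      onto \<open>Z\<close>.\<close>
    obtain w where w: "w \<in> I" "v = f w" using fi(2) uv(2) by blast
    have cc: "u \<in> carrier X" "f w \<in> carrier X" "w \<in> carrier X" using uv w DK(1) DI(1) by auto
    define e' where "e' = e \<ominus>\<^bsub>E\<^esub> h w"
    have e': "e' \<in> carrier E" "q e' = z" using e cc by (simp_all add: e'_def)
    have "p1 e' = u" using e cc uv(3) by (simp add: e'_def f_def[symmetric] w(2))
    then have "inc (k1 u \<oplus>\<^bsub>?E\<^esub> k2 (p2 e')) = e'" using uv(1) cc(1) e'(1) biprod_simps(5)[OF b e'(1)] by (simp add: inc_def)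
    then show "\<exists>x \<in> carrier ?E. z = q (inc x)" using e' uv(1) by (intro bexI[of _ "k1 u \<oplus>\<^bsub>?E\<^esub> k2 (p2 e')"]) simp_all
  next
    fix e assume e: "e \<in> carrier ?E" "q (inc e) = \<zero>\<^bsub>Z\<^esub>"
    then obtain x where x: "x \<in> carrier X" "inc e = h x" using ses_ker[OF s, of "inc e"] incs(1) by blast
    have fx: "f x \<in> K" using pinc(1)[OF e(1)] biprod_simps(21)[OF kb e(1)] x(2) by (simp add: f_def)
    obtain u v where uv: "u \<in> K" "v \<in> I" "x = u \<oplus>\<^bsub>X\<^esub> v" using sum[OF x(1)] by blast
    have cc: "u \<in> carrier X" "v \<in> carrier X" using uv DK(1) DI(1) by auto
    have "f x \<ominus>\<^bsub>X\<^esub> f u = f v" using cc s1(1) by (simp add: uv(3))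
    \<comment> \<open>Both \<open>f x\<close> and \<open>f u\<close> are in \<open>K\<close>, so
      \<open>f v\<close> lies in the two complementary summands and is zero. Injectivity of
      \<open>f\<close> on \<open>I\<close> gives \<open>v = 0\<close>: the preimage \<open>x\<close>
      was in \<open>K\<close> from the start.\<close>
    then have "f v \<in> K \<inter> I" using DK(6)[OF fx fK[OF uv(1)]] fI[OF uv(2)] by simp
    then have "f v = f \<zero>\<^bsub>X\<^esub>" using KI(3) by simp
    then have "v = \<zero>\<^bsub>X\<^esub>" using inj_onD[OF fi(1)] uv(2) DI(2) by blast
    then have xK: "x \<in> K" using uv(1,3) cc s1(1) by simp
    have "inc e = inc (h1 x)" using inch1[OF xK] x(2) by simp
    then have "e = h1 x" by (rule inc_inj[OF _ e(1) h1c[OF xK]])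
    then show "\<exists>x \<in> carrier ?X1. e = h1 x" using xK by auto
  qed
  then have t: "ord.tri ?X1 ?E Z" using ord.sq_tri ses_sq by blast
  have st: "ord.stab ?E ?X1" by (rule ord.stab_dsum_prj[OF dsumI[OF kb] P])
  have "ord.pd (Suc c) Z" if "ord.pd c ?X1" for c
    using ord.pd_cokernel[OF t that] ord.pd_stab[OF that ord.stab_sym[OF st]] by blast
  then show thesis using that[OF dsum_retr(1)[OF dsumI[OF pb]] pdX1] by blast
qed

end

section \<open>The bound of Igusa and Todorov\<close>

context module_category
begin

lemma msum_pd: "msum J X \<Longrightarrow> (\<And>U. U \<in># J \<Longrightarrow> ord.pd c U) \<Longrightarrow> ord.pd c X"
proof (induction rule: msum.induct)
  case (msum_zero Z)
  then show ?case using ord.pd_mono[of 0 Z c] ord.prj_zero by simp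
next
  case (msum_add J X U Y)
  then have X: "ord.pd c X" and U: "ord.pd c U" by auto
  obtain i1 i2 p1 p2 where b: "biprod U X Y i1 i2 p1 p2" using msum_add(2) by (rule dsumE)
  have "ses U Y X i1 p2"
  proof (rule sesI[OF biprodD(1,3,2,4,7)[OF b]])
    fix x assume "x \<in> carrier U" "i1 x = \<zero>\<^bsub>Y\<^esub>"
    then show "x = \<zero>\<^bsub>U\<^esub>" using biprod_simps(1)[OF b, of x] biprod_simps(24)[OF b] by simp
  next
    fix y assume "y \<in> carrier X"
    then show "\<exists>x \<in> carrier Y. y = p2 x" using biprod_simps(4,15)[OF b] by (intro bexI[of _ "i2 y"]) simp_all
  next
    fix e assume "e \<in> carrier Y" "p2 e = \<zero>\<^bsub>X\<^esub>"
    then show "\<exists>x \<in> carrier U. e = i1 x" using biprod_simps(5)[OF b, of e] biprod_simps[OF b]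
      by (intro bexI[of _ "p1 e"]) simp_all
  qed (use biprod_simps(2)[OF b] in simp)
  then show ?case using ord.pd_ext[OF ord.sq_tri[OF ses_sq]] U X by blast
qed

text \<open>\<open>X\<close> need not be a sum of members of \<open>\<U>\<close>, but each of its
  indecomposable summands is projective or isomorphic to such a member. In the latter case that
  member has finite dimension too, and only finitely many finite dimensions occur in
  \<open>\<U>\<close>.\<close>

lemma pd_bound:
  assumes "finite \<U>" and \<U>: "\<And>U. U \<in> \<U> \<Longrightarrow> indec U"
  obtains c where "\<forall>X J Y Q r. ord.pd r X \<and> set_mset J \<subseteq> \<U> \<and> msum J Y \<and> ord.prj Q \<and> retr X (Y \<boxplus> Q) \<longrightarrow> ord.pd c X"
proof -
  \<comment> \<open>For \<open>U\<close> of infinite projective dimension this value is unspecified;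
    it can only enlarge the maximum \<open>c\<close>, which does no harm.\<close>
  define d where "d U = (LEAST r. ord.pd r U)" for U
  have d: "ord.pd (d U) U" if "ord.pd r U" for r U unfolding d_def using that by (rule LeastI)
  define c where "c = Max (insert 0 (d ` \<U>))"
  have c: "ord.pd c U" if "U \<in> \<U>" "ord.pd r U" for U r
  proof (rule ord.pd_mono[OF d[OF that(2)]])
    show "d U \<le> c" unfolding c_def using assms(1) that(1) by (intro Max_ge) auto
  qed
  have "ord.pd c X" if X: "ord.pd r X" and J: "set_mset J \<subseteq> \<U>" "msum J Y" and Q: "ord.prj Q" and XYQ: "retr X (Y \<boxplus> Q)" for X J Y Q r
  proof -
    obtain K where K: "msum K X" "\<forall>T \<in># K. indec T" using decompose[OF ord.pd_obj[OF X]] .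
    show ?thesis
    proof (rule msum_pd[OF K(1)])
      fix T assume T: "T \<in># K"
      have TX: "retr T X" by (rule msum_retr[OF K(1) T])
      have iT: "indec T" using K(2) T by blast
      have "retr T Y \<or> retr T Q"
        by (rule indec_retr_dsum[OF iT retr_trans[OF TX XYQ] dsum_plus[OF msum_obj[OF J(2)] ord.prjD[OF Q]]])
      then show "ord.pd c T"
      proof
        assume "retr T Q"
        then have "ord.pd 0 T" using ord.retr_prj Q by simp
        then show ?thesis using ord.pd_mono by blast
      next
        assume "retr T Y"
        then obtain U where U: "U \<in># J" "retr T U" using indec_retr_msum[OF iT J(2)] by blast
        have U': "U \<in> \<U>" using U J(1) by blast
        have i: "iso T U" by (rule indec_retr_indec[OF iT \<U>[OF U'] U(2)])
        have "ord.pd r U" by (rule ord.pd_stab[OF ord.pd_retr[OF X TX] ord.iso_stab[OF i]])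
        then have "ord.pd c U" by (rule c[OF U'])
        then show ?thesis by (rule ord.pd_stab[OF _ ord.iso_stab[OF iso_sym[OF i]]])
      qed
    qed
  qed
  then show thesis by (intro that[of c]) blast
qed

lemma decompose_finite:
  assumes "finite \<W>" "\<And>W. W \<in> \<W> \<Longrightarrow> obj W"
  obtains \<U> where "finite \<U>" "\<forall>U \<in> \<U>. indec U" "\<forall>W \<in> \<W>. \<exists>K. set_mset K \<subseteq> \<U> \<and> msum K W"
proof -
  have "\<exists>K. msum K W \<and> (\<forall>U \<in># K. indec U)" if "W \<in> \<W>" for W using decompose[OF assms(2)[OF that]] by blast
  then obtain K where K: "\<And>W. W \<in> \<W> \<Longrightarrow> msum (K W) W \<and> (\<forall>U \<in># K W. indec U)" by metis
  show thesis
  proof (rule that[of "\<Union>W\<in>\<W>. set_mset (K W)"])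
    show "finite (\<Union>W\<in>\<W>. set_mset (K W))" using assms(1) by simp
    show "\<forall>U \<in> (\<Union>W\<in>\<W>. set_mset (K W)). indec U" using K by blast
    show "\<forall>W \<in> \<W>. \<exists>J. set_mset J \<subseteq> (\<Union>W\<in>\<W>. set_mset (K W)) \<and> msum J W"
      using K by (intro ballI exI conjI) (rule UN_upper, assumption, blast)
  qed
qed

text \<open>Syzygies commute with direct sums up to \<open>stab\<close>, so the \<open>n\<close>-th
  syzygies of all direct sums over \<open>\<W>\<close> are, stably, direct sums over the one set
  \<open>\<U>\<close>.\<close>

lemma Om_pow_msum:
  assumes dec: "\<And>U. U \<in> \<W> \<Longrightarrow> \<exists>K. set_mset K \<subseteq> \<U> \<and> msum K ((ord.Om ^^ n) U)"
  shows "msum J X \<Longrightarrow> set_mset J \<subseteq> \<W> \<Longrightarrow> \<exists>K Y. set_mset K \<subseteq> \<U> \<and> msum K Y \<and> ord.stab ((ord.Om ^^ n) X) Y"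
proof (induction rule: msum.induct)
  case (msum_zero Z)
  have "ord.pd n Z" using ord.pd_mono[of 0 Z n] ord.prj_zero msum_zero by simp
  then have "ord.stab ((ord.Om ^^ n) Z) Z" using ord.prj_stab ord.prj_zero msum_zero unfolding ord.pd_def by blast
  then show ?case using msum.msum_zero[OF msum_zero(1,2)] by (intro exI[of _ "{#}"] exI[of _ Z]) simp
next
  case (msum_add J X U Y)
  note o = dsumD[OF msum_add(2)]
  obtain K S where K: "set_mset K \<subseteq> \<U>" "msum K S" "ord.stab ((ord.Om ^^ n) X) S" using msum_add by auto
  obtain L where L: "set_mset L \<subseteq> \<U>" "msum L ((ord.Om ^^ n) U)" using dec[of U] msum_add(4) by auto
  have oS: "obj S" by (rule msum_obj[OF K(2)])
  have "msum (L + K) ((ord.Om ^^ n) U \<boxplus> S)" by (rule msum_union[OF L(2) K(2) dsum_plus]) (use o oS in simp_all)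
  moreover have "ord.stab ((ord.Om ^^ n) Y) ((ord.Om ^^ n) U \<boxplus> S)"
  proof -
    have "ord.stab ((ord.Om ^^ n) Y) ((ord.Om ^^ n) (U \<boxplus> X))"
      using msum_add(2) dsum_iff iso_sym by (intro ord.Om_pow_stab ord.iso_stab) blast
    also have "ord.stab \<dots> ((ord.Om ^^ n) U \<boxplus> (ord.Om ^^ n) X)" by (rule ord.Om_pow_plus[OF o(1,2)])
    also have "ord.stab \<dots> ((ord.Om ^^ n) U \<boxplus> S)" using o K(3) by (intro ord.stab_plus) simp_all
    finally show ?thesis .
  qed
  moreover have "set_mset (L + K) \<subseteq> \<U>" using K L by simp
  ultimately show ?case by blast
qed

text \<open>The direct sums over \<open>J\<close> and \<open>J'\<close> get the same class when the
  syzygy operator acts \<open>k\<close> times on the split Grothendieck group modulo projectives.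
  Stating this for multisets avoids building the group.\<close>

definition srel :: "nat \<Rightarrow> 'a umodule multiset \<Rightarrow> 'a umodule multiset \<Rightarrow> bool" where
  "srel k J J' \<longleftrightarrow> (\<exists>X X'. msum J X \<and> msum J' X' \<and> ord.stab ((ord.Om ^^ k) X) ((ord.Om ^^ k) X'))"

lemma srelD: "srel k J J' \<Longrightarrow> msum J X \<Longrightarrow> msum J' X' \<Longrightarrow> ord.stab ((ord.Om ^^ k) X) ((ord.Om ^^ k) X')"
proof -
  assume "srel k J J'" and X: "msum J X" "msum J' X'"
  then obtain Y Y' where Y: "msum J Y" "msum J' Y'" "ord.stab ((ord.Om ^^ k) Y) ((ord.Om ^^ k) Y')" unfolding srel_def by blast
  have "ord.stab ((ord.Om ^^ k) X) ((ord.Om ^^ k) Y)" by (rule ord.Om_pow_stab[OF ord.iso_stab[OF msum_unique[OF X(1) Y(1)]]])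
  also note Y(3)
  also have "ord.stab ((ord.Om ^^ k) Y') ((ord.Om ^^ k) X')" by (rule ord.Om_pow_stab[OF ord.iso_stab[OF msum_unique[OF Y(2) X(2)]]])
  finally show ?thesis .
qed

lemma srel_sym: "srel k J J' \<Longrightarrow> srel k J' J"
  unfolding srel_def using ord.stab_sym by blast

lemma srel_mono: "srel k J J' \<Longrightarrow> srel (k + m) J J'"
  unfolding srel_def using ord.Om_pow_stab[of _ _ m] by (fastforce simp: funpow_add add.commute[of k])

lemma srel_refl: "msum J X \<Longrightarrow> srel k J J"
  unfolding srel_def using msum_obj by (metis ord.obj_Om_pow ord.stab_refl)

lemma msum_plus: "msum J X \<Longrightarrow> msum J' X' \<Longrightarrow> msum (J + J') (X \<boxplus> X')"
  by (rule msum_union[OF _ _ dsum_plus]) (auto intro: msum_obj)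

lemma stab_plus_Om: "obj X \<Longrightarrow> obj Y \<Longrightarrow> ord.stab Z ((ord.Om ^^ k) (X \<boxplus> Y)) \<longleftrightarrow> ord.stab Z ((ord.Om ^^ k) X \<boxplus> (ord.Om ^^ k) Y)"
  using ord.Om_pow_plus[of X Y k] ord.stab_trans ord.stab_sym by blast

lemma srel_add: "srel k J J' \<Longrightarrow> srel k L L' \<Longrightarrow> srel k (J + L) (J' + L')"
proof -
  assume "srel k J J'" "srel k L L'"
  then obtain X X' Y Y' where *: "msum J X" "msum J' X'" "ord.stab ((ord.Om ^^ k) X) ((ord.Om ^^ k) X')"
    "msum L Y" "msum L' Y'" "ord.stab ((ord.Om ^^ k) Y) ((ord.Om ^^ k) Y')" unfolding srel_def by blast
  note o = *(1,2,4,5)[THEN msum_obj]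
  have "ord.stab ((ord.Om ^^ k) X \<boxplus> (ord.Om ^^ k) Y) ((ord.Om ^^ k) X' \<boxplus> (ord.Om ^^ k) Y')" by (rule ord.stab_plus[OF *(3,6)])
  then have "ord.stab ((ord.Om ^^ k) (X \<boxplus> Y)) ((ord.Om ^^ k) (X' \<boxplus> Y'))"
    using stab_plus_Om o ord.stab_sym by blast
  then show ?thesis unfolding srel_def using msum_plus *(1,2,4,5) by blast
qed

text \<open>Inherited from \<open>stab_cancel\<close>. It makes the relation depend only on the
  difference of the multiplicities of the two multisets.\<close>

lemma srel_cancel:
  assumes r: "srel k (J + L) (J' + L)" and J: "msum J X" "msum J' X'" "msum L Y"
  shows "srel k J J'"
proof -
  note o = J[THEN msum_obj]
  have "ord.stab ((ord.Om ^^ k) (X \<boxplus> Y)) ((ord.Om ^^ k) (X' \<boxplus> Y))" by (rule srelD[OF r msum_plus[OF J(1,3)] msum_plus[OF J(2,3)]])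
  then have "ord.stab ((ord.Om ^^ k) X \<boxplus> (ord.Om ^^ k) Y) ((ord.Om ^^ k) X' \<boxplus> (ord.Om ^^ k) Y)"
    using stab_plus_Om o ord.stab_sym by blast
  then have "ord.stab ((ord.Om ^^ k) X) ((ord.Om ^^ k) X')" by (rule ord.stab_cancel[rotated 3]) (use o in simp_all)
  then show ?thesis unfolding srel_def using J by blast
qed

text \<open>The differences of multiplicities of multisets related at stage \<open>k\<close> form a
  subgroup \<open>V k\<close> of the integer functions on \<open>\<W>\<close>, growing with
  \<open>k\<close>. Beyond the stage \<open>\<eta>\<close> where this chain stops no new relation
  appears.\<close>

lemma srel_stabilises:
  assumes fin: "finite \<W>" and \<W>: "\<And>W. W \<in> \<W> \<Longrightarrow> obj W"
  obtains \<eta> where "\<forall>J J' r. set_mset J \<subseteq> \<W> \<and> set_mset J' \<subseteq> \<W> \<and> srel r J J' \<longrightarrow> srel \<eta> J J'"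
proof (cases "\<W> = {}")
  \<comment> \<open>The empty \<open>\<W>\<close> is set apart because the other case takes its zero
    module from a member of \<open>\<W>\<close>.\<close>
  case True
  have "srel 0 J J'" if "set_mset J \<subseteq> \<W>" "set_mset J' \<subseteq> \<W>" "srel r J J'" for J J' r
  proof -
    have "J = {#}" "J' = {#}" using that True by auto
    then show ?thesis using that(3) srel_refl unfolding srel_def by blast
  qed
  then show thesis by (intro that[of 0]) blast
next
  case False
  then obtain W0 :: "'a umodule" where W0: "obj W0" using \<W> by blast
  have ex: "\<exists>X. msum J X" if "set_mset J \<subseteq> \<W>" for J by (rule msum_exists[OF _ W0]) (use that \<W> in blast)
  define diff :: "'a umodule multiset \<Rightarrow> 'a umodule multiset \<Rightarrow> 'a umodule \<Rightarrow> int"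
    where "diff J J' U = int (count J U) - int (count J' U)" for J J' U
  define V where "V k = {diff J J' | J J'. set_mset J \<subseteq> \<W> \<and> set_mset J' \<subseteq> \<W> \<and> srel k J J'}" for k
  have "\<exists>n. \<forall>k\<ge>n. V k = V n"
  proof (rule subgroup_chain[OF fin])
    fix k
    have "srel k {#} {#}" using ex[of "{#}"] srel_refl by auto
    moreover have "(\<lambda>_. 0) = diff {#} {#}" by (simp add: diff_def fun_eq_iff)
    ultimately show "(\<lambda>_. 0) \<in> V k" unfolding V_def by (intro CollectI exI[of _ "{#}"] conjI) simp_all
  next
    fix k f g assume "f \<in> V k" "g \<in> V k"
    then obtain J J' L L' where *: "f = diff J J'" "set_mset J \<subseteq> \<W>" "set_mset J' \<subseteq> \<W>" "srel k J J'"
      "g = diff L L'" "set_mset L \<subseteq> \<W>" "set_mset L' \<subseteq> \<W>" "srel k L L'" unfolding V_def by blast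
    have "srel k (J + L') (J' + L)" by (rule srel_add[OF *(4) srel_sym[OF *(8)]])
    moreover have "(\<lambda>i. f i - g i) = diff (J + L') (J' + L)" by (simp add: *(1,5) diff_def fun_eq_iff)
    moreover have "set_mset (J + L') \<subseteq> \<W>" "set_mset (J' + L) \<subseteq> \<W>" using * by simp_all
    ultimately show "(\<lambda>i. f i - g i) \<in> V k"
      unfolding V_def by (intro CollectI exI[of _ "J + L'"] exI[of _ "J' + L"] conjI)
  next
    show "V k \<subseteq> V (Suc k)" for k
    proof
      fix f assume "f \<in> V k"
      then obtain J J' where "f = diff J J'" "set_mset J \<subseteq> \<W>" "set_mset J' \<subseteq> \<W>" "srel k J J'" unfolding V_def by blast
      then show "f \<in> V (Suc k)" unfolding V_def using srel_mono[of k J J' 1] by (intro CollectI exI[of _ J] exI[of _ J'] conjI) simp_all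
    qed
  next
    fix k f U assume "f \<in> V k" "U \<notin> \<W>"
    then obtain J J' where "f = diff J J'" "set_mset J \<subseteq> \<W>" "set_mset J' \<subseteq> \<W>" unfolding V_def by blast
    moreover have "U \<notin># J" "U \<notin># J'" using calculation(2,3) \<open>U \<notin> \<W>\<close> by blast+
    ultimately show "f U = 0" by (simp add: diff_def not_in_iff)
  qed
  then obtain \<eta> where \<eta>: "\<And>k. k \<ge> \<eta> \<Longrightarrow> V k = V \<eta>" by blast
  have "srel \<eta> J J'" if J: "set_mset J \<subseteq> \<W>" "set_mset J' \<subseteq> \<W>" "srel r J J'" for J J' r
  proof -
    have "srel (\<eta> + r) J J'" using srel_mono[OF J(3), of \<eta>] by (simp add: add.commute)
    then have "diff J J' \<in> V (\<eta> + r)" unfolding V_def using J by blast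
    then have "diff J J' \<in> V \<eta>" using \<eta>[of "\<eta> + r"] by simp
    then obtain L L' where L: "diff J J' = diff L L'" "set_mset L \<subseteq> \<W>" "set_mset L' \<subseteq> \<W>" "srel \<eta> L L'" unfolding V_def by blast
    \<comment> \<open>Equal differences mean \<open>J + L' = L + J'\<close>. Adding
      \<open>J'\<close> to both sides of the relation between \<open>L\<close> and \<open>L'\<close>
      relates \<open>J + L'\<close> to \<open>J' + L'\<close>, and then \<open>L'\<close>
      cancels.\<close>
    have "count (J + L') U = count (J' + L) U" for U
      using fun_cong[OF L(1), of U] by (simp add: diff_def)
    then have eq: "J + L' = L + J'" by (simp add: multiset_eq_iff add.commute)
    obtain X where X: "msum J X" using ex[OF J(1)] by blast
    obtain X' where X': "msum J' X'" using ex[OF J(2)] by blast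
    obtain Y' where Y': "msum L' Y'" using ex[OF L(3)] by blast
    have "srel \<eta> (L + J') (L' + J')" by (rule srel_add[OF L(4) srel_refl[OF X']])
    then have "srel \<eta> (J + L') (J' + L')" using eq by (simp add: add.commute)
    then show ?thesis by (rule srel_cancel[OF _ X X' Y'])
  qed
  then show thesis by (intro that[of \<eta>]) blast
qed

text \<open>With \<open>J = {#}\<close> this also bounds the projective dimensions of the direct sums of modules in \<open>\<W>\<close>.\<close>

theorem igusa_todorov:
  assumes fin: "finite \<W>" and \<W>: "\<And>W. W \<in> \<W> \<Longrightarrow> obj W"
  obtains d where "\<forall>J J' X Y Z r. set_mset J \<subseteq> \<W> \<and> set_mset J' \<subseteq> \<W> \<and> msum J X \<and> msum J' Y \<and> ord.sq X Y Z \<and> ord.pd r Z \<longrightarrow> ord.pd d Z"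
proof -
  obtain \<eta> where \<eta>: "\<forall>J J' r. set_mset J \<subseteq> \<W> \<and> set_mset J' \<subseteq> \<W> \<and> srel r J J' \<longrightarrow> srel \<eta> J J'"
    by (rule srel_stabilises[OF fin \<W>])
  let ?O = "ord.Om ^^ \<eta>"
  have fin': "finite (?O ` \<W>)" using fin by simp
  have \<W>': "\<And>W. W \<in> ?O ` \<W> \<Longrightarrow> obj W" using \<W> by auto
  obtain \<U> where \<U>: "finite \<U>" "\<forall>U \<in> \<U>. indec U" "\<forall>W \<in> ?O ` \<W>. \<exists>K. set_mset K \<subseteq> \<U> \<and> msum K W"
    by (rule decompose_finite[OF fin' \<W>'])
  obtain c where c: "\<forall>X J Y Q r. ord.pd r X \<and> set_mset J \<subseteq> \<U> \<and> msum J Y \<and> ord.prj Q \<and> retr X (Y \<boxplus> Q) \<longrightarrow> ord.pd c X"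
    by (rule pd_bound[OF \<U>(1)]) (use \<U>(2) in blast)+
  \<comment> \<open>\<open>\<eta>\<close> syzygies make the two left terms stably isomorphic,
    \<open>c\<close> bounds the Fitting summand of the first of them, and the successor is the price
    of passing to the cokernel.\<close>
  have "ord.pd (\<eta> + Suc c) Z" if J: "set_mset J \<subseteq> \<W>" "set_mset J' \<subseteq> \<W>" "msum J X" "msum J' Y" and s: "ord.sq X Y Z" and Z: "ord.pd r Z"
    for J J' X Y Z r
  proof -
    note t = ord.sq_tri[OF s]
    \<comment> \<open>\<open>r\<close> depends on \<open>Z\<close>, but the relation it yields
      between \<open>J\<close> and \<open>J'\<close> already holds at the uniform stage
      \<open>\<eta>\<close>.\<close>
    have "ord.stab ((ord.Om ^^ r) X) ((ord.Om ^^ r) Y)"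
      using ord.tri_prj[OF ord.tri_Om[OF t]] Z by (simp add: ord.pd_def)
    then have "srel r J J'" unfolding srel_def using J by blast
    then have "srel \<eta> J J'" using \<eta> J(1,2) by blast
    then have XY: "ord.stab (?O X) (?O Y)" by (rule srelD[OF _ J(3,4)])
    have pdZ: "ord.pd r (?O Z)"
      using ord.pd_mono[OF Z, of "r + \<eta>"] by (simp add: ord.pd_def funpow_add)
    obtain X' Y' Z' where s': "ord.stab (?O X) X'" "ord.stab (?O Y) Y'" "ord.stab (?O Z) Z'" "ord.sq X' Y' Z'"
      using ord.tri_Om[OF t, of \<eta>] unfolding ord.tri_def by blast
    note o = ord.sqD[OF s'(4)]
    have "ord.stab X' Y'" using s' XY ord.stab_trans ord.stab_sym by blast
    then obtain P Q where PQ: "ord.prj P" "ord.prj Q" "iso (X' \<boxplus> P) (Y' \<boxplus> Q)" unfolding ord.stab_def by blast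
    have oPQ: "obj P" "obj Q" using PQ ord.prjD by auto
    \<comment> \<open>Projectives are added until the middle term is the left term plus
      \<open>P\<close>: as \<open>X' + P\<close> is isomorphic to \<open>Y' + Q\<close>, the module
      \<open>Y' + P + Q\<close> is isomorphic to \<open>(X' + P) + P\<close>.\<close>
    have "ord.sq (X' \<boxplus> P) (Y' \<boxplus> P \<boxplus> Q) (Z' \<boxplus> Q)"
      by (rule ord.sq_add_right[OF ord.sq_add_left[OF s'(4) oPQ(1)] oPQ(2)])
    then obtain h q where hq: "ses (X' \<boxplus> P) (Y' \<boxplus> P \<boxplus> Q) (Z' \<boxplus> Q) h q" by (rule ord.sqE)
    have "iso (X' \<boxplus> P \<boxplus> P) (Y' \<boxplus> Q \<boxplus> P)" using oPQ by (intro plus_cong[OF PQ(3)]) simp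
    also have "iso (Y' \<boxplus> Q \<boxplus> P) (Y' \<boxplus> P \<boxplus> Q)" using o oPQ by (intro plus_right_comm)
    finally have d: "dsum (X' \<boxplus> P) P (Y' \<boxplus> P \<boxplus> Q)" using o oPQ dsum_iff by simp
    have ZQ: "ord.stab (?O Z) (Z' \<boxplus> Q)" using s'(3) ord.stab_plus_prj[OF o(3) PQ(2)] ord.stab_trans ord.stab_sym by blast
    obtain X1 where X1: "retr X1 (X' \<boxplus> P)" "ord.pd r X1" "\<And>c. ord.pd c X1 \<Longrightarrow> ord.pd (Suc c) (Z' \<boxplus> Q)"
      using fitting_ses[OF d PQ(1) hq ord.pd_stab[OF pdZ ZQ]] by blast
    \<comment> \<open>The left term is stably an \<open>\<eta>\<close>-th syzygy of a sum over
      \<open>\<W>\<close>, hence stably a sum over \<open>\<U>\<close>. So its Fitting summand, of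
      finite dimension, falls under the bound \<open>c\<close>.\<close>
    obtain K S where K: "set_mset K \<subseteq> \<U>" "msum K S" "ord.stab (?O X) S"
      using Om_pow_msum[of \<W> \<U> \<eta> J X] \<U>(3) J by blast
    have "ord.stab (X' \<boxplus> P) S" using ord.stab_plus_prj[OF o(1) PQ(1)] s'(1) K(3) ord.stab_trans ord.stab_sym by blast
    then obtain P1 Q1 where P1: "ord.prj P1" "ord.prj Q1" "iso (X' \<boxplus> P \<boxplus> P1) (S \<boxplus> Q1)" unfolding ord.stab_def by blast
    have "retr (X' \<boxplus> P) (X' \<boxplus> P \<boxplus> P1)" by (rule dsum_retr(1)[OF dsum_plus]) (use o oPQ ord.prjD[OF P1(1)] in simp_all)
    then have "retr X1 (S \<boxplus> Q1)" using retr_trans[OF X1(1)] retr_trans iso_retr[OF P1(3)] by blast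
    then have "ord.pd c X1" using c X1(2) K(1,2) P1(2) by blast
    then have "ord.pd (Suc c) (?O Z)" using X1(3) ord.pd_stab ord.stab_sym[OF ZQ] by blast
    moreover have "(ord.Om ^^ (\<eta> + Suc c)) Z = (ord.Om ^^ Suc c) (?O Z)"
      unfolding add.commute[of \<eta>] funpow_add comp_apply ..
    ultimately show ?thesis using ord.sqD(3)[OF s] by (simp add: ord.pd_def del: funpow.simps)
  qed
  then show thesis by (intro that[of "\<eta> + Suc c"]) blast
qed

end

section \<open>Modules over Artin algebras\<close>

lemma restrict_scalars_simps [simp]:
  "carrier (restrict_scalars \<phi> M) = carrier M" "\<zero>\<^bsub>restrict_scalars \<phi> M\<^esub> = \<zero>\<^bsub>M\<^esub>"
  "x \<oplus>\<^bsub>restrict_scalars \<phi> M\<^esub> y = x \<oplus>\<^bsub>M\<^esub> y" "b \<odot>\<^bsub>restrict_scalars \<phi> M\<^esub> x = \<phi> b \<odot>\<^bsub>M\<^esub> x"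
  "restrict_scalars \<phi> (M\<lparr>carrier := K\<rparr>) = (restrict_scalars \<phi> M)\<lparr>carrier := K\<rparr>"
  by (simp_all add: restrict_scalars_def)

lemma submodule_restrict:
  assumes "left_module A M" "left_module B (restrict_scalars \<phi> M)" "\<phi> \<in> ring_hom B A" "submodule K A M"
  shows "submodule K B (restrict_scalars \<phi> M)"
  using left_module.submoduleD[OF assms(1,4)] ring_hom_closed[OF assms(3)]
  by (intro left_module.submoduleI[OF assms(2)]) auto

context artin_algebra
begin

abbreviation scalar :: "'r \<Rightarrow> 'a" where "scalar r \<equiv> r \<odot>\<^bsub>A\<^esub> \<one>\<^bsub>A\<^esub>"

lemma ring_A: "ring A" by unfold_locales

lemma scalar_mult: "\<lbrakk>r \<in> carrier R; a \<in> carrier A\<rbrakk> \<Longrightarrow> scalar r \<otimes>\<^bsub>A\<^esub> a = r \<odot>\<^bsub>A\<^esub> a"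
  by (simp add: smult_mult_left)

lemma scalar_hom: "scalar \<in> ring_hom R A"
  by (rule ring_hom_memI) (simp_all add: smult_l_distr scalar_mult smult_assoc1)

text \<open>Products of generators of \<open>A\<close> over \<open>R\<close> with generators of
  \<open>M\<close> over \<open>A\<close> generate \<open>M\<close> over \<open>R\<close>. In terms
  of \<open>gen_by\<close> this takes two passes for a given \<open>K\<close>: over the
  \<open>a\<close> with \<open>a m\<close> in \<open>K\<close> for a fixed generator
  \<open>m\<close>, and over the \<open>x\<close> all of whose multiples lie in
  \<open>K\<close>.\<close>

lemma restrict_scalar_fg:
  fixes M :: "('a, 'm) module"
  assumes M: "fg_module A M"
  shows "fg_module R (restrict_scalars scalar M)"
proof -
  let ?M = "restrict_scalars scalar M"
  interpret M: left_module A M using M by (simp add: fg_module_def)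
  have lm: "left_module R ?M"
    by (rule restrict_scalars_left_module[OF M.left_module_axioms R.ring_axioms scalar_hom])
  interpret M': left_module R ?M by (rule lm)
  obtain T where T: "finite T" "gen_by T (carrier A)"
    using fin_gen finitely_generated_iff by blast
  obtain S where S: "finite S" "M.gen_by S (carrier M)"
    using M M.finitely_generated_iff unfolding fg_module_def by blast
  have TA: "T \<subseteq> carrier A" and SM: "S \<subseteq> carrier M" using T S by (simp_all add: gen_by_def M.gen_by_def)
  let ?U = "(\<lambda>(a, m). a \<odot>\<^bsub>M\<^esub> m) ` (T \<times> S)"
  have "M'.gen_by ?U (carrier ?M)"
    unfolding M'.gen_by_def
  proof (intro conjI allI impI)
    show "?U \<subseteq> carrier ?M" using TA SM by auto
    fix K assume K: "submodule K R ?M" "?U \<subseteq> K"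
    note D = M'.submoduleD[OF K(1), simplified]
    have all: "a \<odot>\<^bsub>M\<^esub> m \<in> K" if m: "m \<in> S" and a: "a \<in> carrier A" for a m
    proof -
      have mM: "m \<in> carrier M" using m SM by blast
      have "submodule {a \<in> carrier A. a \<odot>\<^bsub>M\<^esub> m \<in> K} R A"
      proof (rule submoduleI)
        show "\<zero>\<^bsub>A\<^esub> \<in> {a \<in> carrier A. a \<odot>\<^bsub>M\<^esub> m \<in> K}" using D(2) mM by simp
        fix r a assume r: "r \<in> carrier R" and "a \<in> {a \<in> carrier A. a \<odot>\<^bsub>M\<^esub> m \<in> K}"
        then have a: "a \<in> carrier A" "a \<odot>\<^bsub>M\<^esub> m \<in> K" by simp_all
        have "(r \<odot>\<^bsub>A\<^esub> a) \<odot>\<^bsub>M\<^esub> m = scalar r \<odot>\<^bsub>M\<^esub> (a \<odot>\<^bsub>M\<^esub> m)"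
          unfolding scalar_mult[OF r a(1), symmetric] by (rule M.smult_assoc1) (use r a mM in simp_all)
        then show "r \<odot>\<^bsub>A\<^esub> a \<in> {a \<in> carrier A. a \<odot>\<^bsub>M\<^esub> m \<in> K}" using r a D(4) by simp
      qed (use D(3) mM in \<open>auto simp: M.smult_l_distr\<close>)
      moreover have "T \<subseteq> {a \<in> carrier A. a \<odot>\<^bsub>M\<^esub> m \<in> K}" using K(2) TA m by auto
      ultimately have "carrier A \<subseteq> {a \<in> carrier A. a \<odot>\<^bsub>M\<^esub> m \<in> K}" by (rule gen_byD[OF T(2)])
      then show ?thesis using a by blast
    qed
    have "submodule {x \<in> carrier M. \<forall>a \<in> carrier A. a \<odot>\<^bsub>M\<^esub> x \<in> K} A M"
    proof (rule M.submoduleI)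
      show "\<zero>\<^bsub>M\<^esub> \<in> {x \<in> carrier M. \<forall>a \<in> carrier A. a \<odot>\<^bsub>M\<^esub> x \<in> K}" using D(2) by simp
    qed (use D(3) in \<open>auto simp: M.smult_r_distr M.smult_assoc1[symmetric]\<close>)
    moreover have "S \<subseteq> {x \<in> carrier M. \<forall>a \<in> carrier A. a \<odot>\<^bsub>M\<^esub> x \<in> K}" using all SM by auto
    ultimately have "carrier M \<subseteq> {x \<in> carrier M. \<forall>a \<in> carrier A. a \<odot>\<^bsub>M\<^esub> x \<in> K}" by (rule M.gen_byD[OF S(2)])
    then have "x \<in> K" if "x \<in> carrier M" for x using that M.smult_one[OF that] A.one_closed by force
    then show "carrier ?M \<subseteq> K" by auto
  qed
  moreover have "finite ?U" using T(1) S(1) by simp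
  ultimately have "finitely_generated R ?M" unfolding M'.finitely_generated_iff by (intro exI[of _ ?U] conjI)
  then show ?thesis using lm by (simp add: fg_module_def)
qed

text \<open>Submodules over \<open>A\<close> are submodules over \<open>R\<close>, so both
  properties are inherited from the base ring; a set that generates over \<open>R\<close> generates
  over \<open>A\<close> all the more.\<close>

lemma module_category: "module_category A"
proof (intro module_category.intro module_category_axioms.intro ring_A)
  fix M :: "'a umodule" and N
  assume M: "fg_module A M" and N: "submodule N A M"
  interpret M: left_module A M using M by (simp add: fg_module_def)
  note fgR = restrict_scalar_fg[OF M]
  have lm: "left_module R (restrict_scalars scalar M)" using fgR by (simp add: fg_module_def)
  have NR: "submodule N R (restrict_scalars scalar M)" by (rule submodule_restrict[OF M.left_module_axioms lm scalar_hom N])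
  obtain S where S: "finite S" "left_module.gen_by R (restrict_scalars scalar M) S N"
    using artinian_cring_submodule_fg[OF R.artinian_cring_axioms fgR NR] left_module.finitely_generated_submodule_iff[OF lm NR]
    unfolding fg_module_def by blast
  have "M.gen_by S N"
    unfolding M.gen_by_def
  proof (intro conjI allI impI)
    show "S \<subseteq> N" using S(2) unfolding left_module.gen_by_def[OF lm] by blast
    fix K assume "submodule K A M" "S \<subseteq> K"
    then show "N \<subseteq> K" using left_module.gen_byD[OF lm S(2)] submodule_restrict[OF M.left_module_axioms lm scalar_hom] by blast
  qed
  then show "fg_module A (M\<lparr>carrier := N\<rparr>)"
    using M.finitely_generated_submodule_iff[OF N] M.left_module_submodule[OF N] S(1) unfolding fg_module_def by blast
next
  fix M :: "'a umodule" and F :: "nat \<Rightarrow> _"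
  assume M: "fg_module A M" and F: "\<And>n. submodule (F n) A M" "\<And>n. F (Suc n) \<subseteq> F n"
  interpret M: left_module A M using M by (simp add: fg_module_def)
  note fgR = restrict_scalar_fg[OF M]
  have lm: "left_module R (restrict_scalars scalar M)" using fgR by (simp add: fg_module_def)
  show "\<exists>k. \<forall>n\<ge>k. F n = F k"
    by (rule artinian_cring_dcc[where N = F, OF R.artinian_cring_axioms fgR submodule_restrict[OF M.left_module_axioms lm scalar_hom F(1)] F(2)])
qed

end

text \<open>\<open>\<phi>\<close> carries the scalar multiples of the identity of \<open>B\<close>
  to those of \<open>A\<close>. Hence a \<open>B\<close>-submodule is an \<open>R\<close>-submodule,
  and generators over \<open>R\<close> suffice.\<close>

lemma algebra_hom_restrict_fg:
  assumes B: "artin_algebra R B" and A: "artin_algebra R A" and \<phi>: "\<phi> \<in> algebra_hom R B A" and M: "fg_module A M"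
  shows "fg_module B (restrict_scalars \<phi> M)"
proof -
  interpret B: artin_algebra R B by fact
  interpret A: artin_algebra R A by fact
  have ph: "\<phi> \<in> ring_hom B A" and pm: "\<phi> \<in> module_hom R B A" using \<phi> by (auto simp: algebra_hom_def)
  have lA: "left_module A M" using M by (simp add: fg_module_def)
  let ?B = "restrict_scalars \<phi> M"
  have lB: "left_module B ?B" by (rule restrict_scalars_left_module[OF lA B.ring_A ph])
  have eq: "\<phi> (B.scalar r) = A.scalar r" if "r \<in> carrier R" for r
    using module_hom_smult[OF pm that B.A.one_closed] ring_hom_one[OF ph] by simp
  have fgR: "fg_module R (restrict_scalars A.scalar M)" by (rule A.restrict_scalar_fg[OF M])
  then have lR: "left_module R (restrict_scalars A.scalar M)" by (simp add: fg_module_def)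
  obtain S where S: "finite S" "left_module.gen_by R (restrict_scalars A.scalar M) S (carrier M)"
    using fgR left_module.finitely_generated_iff[OF lR] unfolding fg_module_def by auto
  have "left_module.gen_by B ?B S (carrier ?B)"
    unfolding left_module.gen_by_def[OF lB]
  proof (intro conjI allI impI)
    show "S \<subseteq> carrier ?B" using S(2) unfolding left_module.gen_by_def[OF lR] by simp
    fix K assume K: "submodule K B ?B" "S \<subseteq> K"
    note D = left_module.submoduleD[OF lB K(1), simplified]
    have "submodule K R (restrict_scalars A.scalar M)"
      using D(1-4) D(4)[OF B.smult_closed[OF _ B.A.one_closed]] by (intro left_module.submoduleI[OF lR]) (auto simp: eq)
    then show "carrier ?B \<subseteq> K" using left_module.gen_byD[OF lR S(2) _ K(2)] by simp
  qed
  then show ?thesis using lB S(1) left_module.finitely_generated_iff[OF lB] unfolding fg_module_def by blast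
qed

section \<open>The universal property of the tensor product\<close>

text \<open>Names for the ingredients of \<open>tensor\<close>: \<open>q\<close> is the coset map
  from the free abelian group, \<open>L a\<close> the action of \<open>a\<close> before passing to
  cosets, and \<open>\<eta>\<close> sends \<open>y\<close> to the tensor of 1 and \<open>y\<close>.
  Afterwards only the properties of \<open>\<eta>\<close> matter.\<close>

locale tensor_product =
  fixes A :: "('a, 'c) ring_scheme" and B :: "('b, 'd) ring_scheme" and \<phi> :: "'b \<Rightarrow> 'a" and Y :: "('b, 'm) module"
  assumes ring_A: "ring A" and Y: "left_module B Y" and \<phi>: "\<phi> \<in> ring_hom B A"
begin

definition F where "F = free_Abelian_group (carrier A \<times> carrier Y)"
definition N where "N = generate F (tensor_relations A B \<phi> Y)"
definition T where "T = tensor A B \<phi> Y"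
definition q where "q c = N #>\<^bsub>F\<^esub> c"
definition L where "L a = frag_extend (\<lambda>(a', y). frag_of (a \<otimes>\<^bsub>A\<^esub> a', y))"
definition \<eta> where "\<eta> y = q (frag_of (\<one>\<^bsub>A\<^esub>, y))"

sublocale A: ring A by (rule ring_A)
sublocale Y: left_module B Y by (rule Y)
sublocale F: comm_group F unfolding F_def by (rule abelian_free_Abelian_group)

lemma car_F: "c \<in> carrier F \<longleftrightarrow> Poly_Mapping.keys c \<subseteq> carrier A \<times> carrier Y" by (simp add: F_def)

lemma F_simps [simp]: "x \<otimes>\<^bsub>F\<^esub> y = x + y" "\<one>\<^bsub>F\<^esub> = 0" by (simp_all add: F_def)

lemma \<phi>_closed: "b \<in> carrier B \<Longrightarrow> \<phi> b \<in> carrier A" using \<phi> by (rule ring_hom_closed)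

lemma frag_F: "\<lbrakk>a \<in> carrier A; y \<in> carrier Y\<rbrakk> \<Longrightarrow> frag_of (a, y) \<in> carrier F" by (simp add: car_F)

lemma diff_F: "\<lbrakk>x \<in> carrier F; y \<in> carrier F\<rbrakk> \<Longrightarrow> x - y \<in> carrier F"
  using keys_diff[of x y] unfolding car_F by blast

lemma add_F: "\<lbrakk>x \<in> carrier F; y \<in> carrier F\<rbrakk> \<Longrightarrow> x + y \<in> carrier F"
  using F.m_closed[of x y] by simp

lemma rel_F: "tensor_relations A B \<phi> Y \<subseteq> carrier F"
  unfolding tensor_relations_def using \<phi>_closed by (auto intro!: diff_F frag_F)

lemma subgroup_N: "subgroup N F" unfolding N_def by (rule F.generate_is_subgroup[OF rel_F])

lemma normal_N: "N \<lhd> F" using F.normal_iff_subgroup subgroup_N by blast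

lemma left_module_T: "left_module A T" unfolding T_def by (rule tensor_left_module[OF ring_A Y \<phi>])

sublocale T: left_module A T by (rule left_module_T)

lemma car_T: "carrier T = carrier (F Mod N)" and zero_T: "\<zero>\<^bsub>T\<^esub> = N" and add_T: "x \<oplus>\<^bsub>T\<^esub> y = x \<otimes>\<^bsub>F Mod N\<^esub> y"
  and smult_T: "a \<odot>\<^bsub>T\<^esub> C = (\<Union>c\<in>C. q (L a c))"
  by (simp_all add: T_def tensor_def Let_def F_def N_def q_def L_def FactGroup_def)

lemma car_T': "carrier T = q ` carrier F"
  unfolding car_T q_def by (auto simp: FactGroup_def RCOSETS_def)

lemma q_closed: "c \<in> carrier F \<Longrightarrow> q c \<in> carrier T" by (simp add: car_T')

lemma q_add: "\<lbrakk>c \<in> carrier F; d \<in> carrier F\<rbrakk> \<Longrightarrow> q (c + d) = q c \<oplus>\<^bsub>T\<^esub> q d"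
  unfolding add_T q_def using normal.rcos_sum[OF normal_N, of c d] by (simp add: FactGroup_def)

lemma q_N: "c \<in> N \<Longrightarrow> q c = \<zero>\<^bsub>T\<^esub>"
  unfolding q_def zero_T using F.coset_join2[OF _ subgroup_N] subgroup.mem_carrier[OF subgroup_N] by blast

lemma q_diff: "\<lbrakk>c \<in> carrier F; d \<in> carrier F\<rbrakk> \<Longrightarrow> q (c - d) = q c \<ominus>\<^bsub>T\<^esub> q d"
proof -
  assume c: "c \<in> carrier F" "d \<in> carrier F"
  have "q c = q (c - d) \<oplus>\<^bsub>T\<^esub> q d" using q_add[OF diff_F[OF c] c(2)] by simp
  then show ?thesis using T.M.minus_add_cancel(2)[OF q_closed[OF diff_F[OF c]] q_closed[OF c(2)]] by simp
qed

lemma q_eq: "\<lbrakk>c \<in> carrier F; d \<in> carrier F; c - d \<in> N\<rbrakk> \<Longrightarrow> q c = q d"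
  using q_diff[of c d] q_N[of "c - d"] T.M.diff_eq_0_iff[OF q_closed q_closed, of c d] by simp

lemma L_F: assumes a: "a \<in> carrier A" and c: "c \<in> carrier F" shows "L a c \<in> carrier F"
proof -
  have "(\<Union>x \<in> Poly_Mapping.keys c. Poly_Mapping.keys (case x of (a', y) \<Rightarrow> frag_of (a \<otimes>\<^bsub>A\<^esub> a', y))) \<subseteq> carrier A \<times> carrier Y"
    using a c unfolding car_F by (intro UN_least) auto
  then show ?thesis using keys_frag_extend unfolding car_F L_def by (rule order_trans[rotated])
qed

text \<open>The action is defined as a union over a whole coset. The result is known to be a coset
  and contains \<open>L a c\<close>, so it is the coset of \<open>L a c\<close>; independence of the
  representative need not be checked again.\<close>

lemma q_smult: assumes a: "a \<in> carrier A" and c: "c \<in> carrier F" shows "a \<odot>\<^bsub>T\<^esub> q c = q (L a c)"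
proof -
  have "a \<odot>\<^bsub>T\<^esub> q c \<in> carrier T" using a q_closed[OF c] by simp
  then obtain d where d: "d \<in> carrier F" "a \<odot>\<^bsub>T\<^esub> q c = q d" unfolding car_T' by blast
  have "c \<in> q c" unfolding q_def by (rule F.rcos_self[OF c subgroup_N])
  then have "q (L a c) \<subseteq> q d" using d(2) unfolding smult_T by blast
  moreover have "L a c \<in> q (L a c)" unfolding q_def by (rule F.rcos_self[OF L_F[OF a c] subgroup_N])
  ultimately have "L a c \<in> q d" by blast
  then have "q d = q (L a c)" unfolding q_def by (rule F.repr_independence[OF _ d(1) subgroup_N])
  then show ?thesis using d by simp
qed

lemma rel_N: "x \<in> tensor_relations A B \<phi> Y \<Longrightarrow> x \<in> N"
  unfolding N_def by (rule generate.incl)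

lemma q_frag_smult: "\<lbrakk>a \<in> carrier A; a' \<in> carrier A; y \<in> carrier Y\<rbrakk> \<Longrightarrow> a \<odot>\<^bsub>T\<^esub> q (frag_of (a', y)) = q (frag_of (a \<otimes>\<^bsub>A\<^esub> a', y))"
  using q_smult[OF _ frag_F, of a a' y] by (simp add: L_def)

lemma \<eta>_hom: "\<eta> \<in> module_hom B Y (restrict_scalars \<phi> T)"
proof (rule module_homI)
  fix x assume "x \<in> carrier Y" then show "\<eta> x \<in> carrier (restrict_scalars \<phi> T)" by (simp add: \<eta>_def q_closed frag_F)
next
  fix x y assume xy: "x \<in> carrier Y" "y \<in> carrier Y"
  have "frag_of (\<one>\<^bsub>A\<^esub>, x \<oplus>\<^bsub>Y\<^esub> y) - frag_of (\<one>\<^bsub>A\<^esub>, x) - frag_of (\<one>\<^bsub>A\<^esub>, y) \<in> N"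
    using xy A.one_closed by (intro rel_N) (unfold tensor_relations_def, blast)
  then have "frag_of (\<one>\<^bsub>A\<^esub>, x \<oplus>\<^bsub>Y\<^esub> y) - (frag_of (\<one>\<^bsub>A\<^esub>, x) + frag_of (\<one>\<^bsub>A\<^esub>, y)) \<in> N" by (simp add: diff_diff_eq)
  then have "q (frag_of (\<one>\<^bsub>A\<^esub>, x \<oplus>\<^bsub>Y\<^esub> y)) = q (frag_of (\<one>\<^bsub>A\<^esub>, x) + frag_of (\<one>\<^bsub>A\<^esub>, y))"
    using xy by (intro q_eq add_F frag_F) auto
  then show "\<eta> (x \<oplus>\<^bsub>Y\<^esub> y) = \<eta> x \<oplus>\<^bsub>restrict_scalars \<phi> T\<^esub> \<eta> y" using xy by (simp add: \<eta>_def q_add frag_F)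
next
  fix b y assume bY: "b \<in> carrier B" "y \<in> carrier Y"
  have "frag_of (\<one>\<^bsub>A\<^esub> \<otimes>\<^bsub>A\<^esub> \<phi> b, y) - frag_of (\<one>\<^bsub>A\<^esub>, b \<odot>\<^bsub>Y\<^esub> y) \<in> N"
    using bY A.one_closed by (intro rel_N) (unfold tensor_relations_def, blast)
  then have "q (frag_of (\<one>\<^bsub>A\<^esub> \<otimes>\<^bsub>A\<^esub> \<phi> b, y)) = q (frag_of (\<one>\<^bsub>A\<^esub>, b \<odot>\<^bsub>Y\<^esub> y))"
    using bY \<phi>_closed by (intro q_eq frag_F) auto
  then show "\<eta> (b \<odot>\<^bsub>Y\<^esub> y) = b \<odot>\<^bsub>restrict_scalars \<phi> T\<^esub> \<eta> y"
    using bY \<phi>_closed by (simp add: \<eta>_def q_frag_smult)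
qed

text \<open>The tensor of \<open>a\<close> and \<open>y\<close> is \<open>a\<close> times
  \<open>\<eta> y\<close>, and such tensors span additively.\<close>

lemma \<eta>_generates:
  assumes K: "submodule K A T" "\<eta> ` carrier Y \<subseteq> K"
  shows "carrier T \<subseteq> K"
proof -
  note D = T.submoduleD[OF K(1)]
  have "q c \<in> K" if "Poly_Mapping.keys c \<subseteq> carrier A \<times> carrier Y" for c
    using that
  proof (induction c rule: free_Abelian_group_induct[consumes 1, case_names zero diff one])
    case zero
    have "q 0 = \<zero>\<^bsub>T\<^esub>" using q_N subgroup.one_closed[OF subgroup_N] by simp
    then show ?case using D(2) by simp
  next
    case (diff x y)
    then show ?case using q_diff[of x y] D(6) by (simp add: car_F)
  next
    case (one p)
    obtain a y where p: "p = (a, y)" "a \<in> carrier A" "y \<in> carrier Y" using one by blast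
    have "a \<odot>\<^bsub>T\<^esub> \<eta> y \<in> K" using D(4) K(2) p by blast
    then show ?case using p q_frag_smult[of a "\<one>\<^bsub>A\<^esub>" y] by (simp add: \<eta>_def)
  qed
  then show ?thesis unfolding car_T' car_F by (auto simp: car_F)
qed

text \<open>The additive map on the free abelian group taking the pair of \<open>a\<close> and
  \<open>y\<close> to \<open>a\<close> times \<open>u y\<close> kills the three kinds of relations:
  by additivity of the action in \<open>a\<close>, by additivity of \<open>u\<close> and by
  \<open>B\<close>-linearity of \<open>u\<close>.\<close>

lemma \<eta>_extend:
  assumes M: "left_module A M" and u: "u \<in> module_hom B Y (restrict_scalars \<phi> M)"
  obtains l where "l \<in> module_hom A T M" "\<forall>y \<in> carrier Y. l (\<eta> y) = u y"
proof -
  interpret M: left_module A M by fact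
  have uc: "u y \<in> carrier M" if "y \<in> carrier Y" for y using module_hom_closed[OF u that] by simp
  have im: "(\<lambda>(a, y). a \<odot>\<^bsub>M\<^esub> u y) ` (carrier A \<times> carrier Y) \<subseteq> carrier (add_monoid M)" using uc by auto
  have "\<exists>h. h \<in> Group.hom F (add_monoid M) \<and> (\<forall>x \<in> carrier A \<times> carrier Y. h (frag_of x) = (\<lambda>(a, y). a \<odot>\<^bsub>M\<^esub> u y) x)"
  proof (rule comm_group.free_Abelian_group_universal[OF M.M.a_comm_group im, folded F_def])
    fix h assume "h \<in> Group.hom F (add_monoid M)"
      and "\<And>x. x \<in> carrier A \<times> carrier Y \<Longrightarrow> h (frag_of x) = (\<lambda>(a, y). a \<odot>\<^bsub>M\<^esub> u y) x"
    then show ?thesis by (intro exI[of _ h] conjI ballI)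
  qed
  then obtain h where h: "h \<in> Group.hom F (add_monoid M)"
    and hf: "\<forall>x \<in> carrier A \<times> carrier Y. h (frag_of x) = (\<lambda>(a, y). a \<odot>\<^bsub>M\<^esub> u y) x"
    by (elim exE conjE) (rule that)
  have hf': "h (frag_of (a, y)) = a \<odot>\<^bsub>M\<^esub> u y" if "a \<in> carrier A" "y \<in> carrier Y" for a y using hf that by simp
  interpret h: group_hom F "add_monoid M" h
    by (simp add: group_hom_def group_hom_axioms_def h F.is_group M.M.a_group)
  have hc: "h c \<in> carrier M" if "c \<in> carrier F" for c using h.hom_closed[OF that] by simp
  have hadd: "h (c + d) = h c \<oplus>\<^bsub>M\<^esub> h d" if "c \<in> carrier F" "d \<in> carrier F" for c d using h.hom_mult[OF that] by simp
  have hdiff: "h (c - d) = h c \<ominus>\<^bsub>M\<^esub> h d" if "c \<in> carrier F" "d \<in> carrier F" for c d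
  proof -
    have "h c = h (c - d) \<oplus>\<^bsub>M\<^esub> h d" using hadd[OF diff_F[OF that] that(2)] by simp
    then show ?thesis using M.M.minus_add_cancel(2)[OF hc[OF diff_F[OF that]] hc[OF that(2)]] by simp
  qed
  have "tensor_relations A B \<phi> Y \<subseteq> kernel F (add_monoid M) h"
  proof
    fix x assume x: "x \<in> tensor_relations A B \<phi> Y"
    then have xF: "x \<in> carrier F" using rel_F by blast
    consider
      b b' y where "x = frag_of (b \<oplus>\<^bsub>A\<^esub> b', y) - frag_of (b, y) - frag_of (b', y)"
        "b \<in> carrier A" "b' \<in> carrier A" "y \<in> carrier Y"
    | b y y' where "x = frag_of (b, y \<oplus>\<^bsub>Y\<^esub> y') - frag_of (b, y) - frag_of (b, y')"
        "b \<in> carrier A" "y \<in> carrier Y" "y' \<in> carrier Y"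
    | b r y where "x = frag_of (b \<otimes>\<^bsub>A\<^esub> \<phi> r, y) - frag_of (b, r \<odot>\<^bsub>Y\<^esub> y)"
        "b \<in> carrier A" "r \<in> carrier B" "y \<in> carrier Y"
      using x unfolding tensor_relations_def by blast
    then have "h x = \<zero>\<^bsub>M\<^esub>"
    proof cases
      case 1
      then show ?thesis
        using uc by (simp add: hdiff frag_F diff_F hf' M.smult_l_distr M.M.minus_add_cancel M.M.diff_eq_0_iff)
    next
      case 2
      then have "u (y \<oplus>\<^bsub>Y\<^esub> y') = u y \<oplus>\<^bsub>M\<^esub> u y'" using module_hom_add[OF u] by simp
      then show ?thesis
        using 2 uc by (simp add: hdiff frag_F diff_F hf' M.smult_r_distr M.M.minus_add_cancel M.M.diff_eq_0_iff)
    next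
      case 3
      then have "u (r \<odot>\<^bsub>Y\<^esub> y) = \<phi> r \<odot>\<^bsub>M\<^esub> u y" using module_hom_smult[OF u] by simp
      then show ?thesis
        using 3 uc \<phi>_closed by (simp add: hdiff frag_F diff_F hf' M.smult_assoc1 M.M.diff_eq_0_iff)
    qed
    then show "x \<in> kernel F (add_monoid M) h" using xF by (simp add: kernel_def)
  qed
  then have NK: "N \<subseteq> kernel F (add_monoid M) h"
    unfolding N_def by (rule F.generate_subgroup_incl[OF _ h.subgroup_kernel])
  have "\<exists>l. l \<in> Group.hom (F Mod N) (add_monoid M) \<and> (\<forall>c \<in> carrier F. l (N #>\<^bsub>F\<^esub> c) = h c)"
  proof (rule h.FactGroup_universal_kernel[OF normal_N NK])
    fix l assume "l \<in> Group.hom (F Mod N) (add_monoid M)" and "\<And>c. c \<in> carrier F \<Longrightarrow> l (N #>\<^bsub>F\<^esub> c) = h c"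
    then show ?thesis by (intro exI[of _ l] conjI ballI)
  qed
  then obtain l where l: "\<forall>c \<in> carrier F. l (N #>\<^bsub>F\<^esub> c) = h c"
    by (elim exE conjE) (rule that)
  have lq: "l (q c) = h c" if "c \<in> carrier F" for c using l that by (simp add: q_def)
  have hL: "h (L a c) = a \<odot>\<^bsub>M\<^esub> h c" if a: "a \<in> carrier A" and c: "Poly_Mapping.keys c \<subseteq> carrier A \<times> carrier Y" for a c
    using c
  proof (induction c rule: free_Abelian_group_induct[consumes 1, case_names zero diff one])
    case zero
    have "h 0 = \<zero>\<^bsub>M\<^esub>" using h.hom_one by simp
    then show ?case using a by (simp add: L_def)
  next
    case (diff x y)
    then have xy: "x \<in> carrier F" "y \<in> carrier F" by (simp_all add: car_F)
    have "h (L a (x - y)) = h (L a x) \<ominus>\<^bsub>M\<^esub> h (L a y)"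
      using hdiff[OF L_F[OF a xy(1)] L_F[OF a xy(2)]] by (simp add: L_def frag_extend_diff)
    also have "\<dots> = a \<odot>\<^bsub>M\<^esub> (h x \<ominus>\<^bsub>M\<^esub> h y)" using diff(3,4) a hc[OF xy(1)] hc[OF xy(2)]
      by (simp add: a_minus_def M.smult_r_distr M.smult_r_minus)
    finally show ?case using hdiff[OF xy] by simp
  next
    case (one p)
    then obtain a' y where "p = (a', y)" "a' \<in> carrier A" "y \<in> carrier Y" by blast
    then show ?case using a uc by (simp add: L_def hf' M.smult_assoc1)
  qed
  have "l \<in> module_hom A T M"
  proof (rule module_homI)
    fix x assume "x \<in> carrier T"
    then show "l x \<in> carrier M" using lq hc unfolding car_T' by auto
  next
    fix x y assume "x \<in> carrier T" "y \<in> carrier T"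
    then obtain c d where cd: "c \<in> carrier F" "d \<in> carrier F" "x = q c" "y = q d" unfolding car_T' by blast
    then show "l (x \<oplus>\<^bsub>T\<^esub> y) = l x \<oplus>\<^bsub>M\<^esub> l y" by (simp add: q_add[symmetric] lq hadd add_F)
  next
    fix a x assume "a \<in> carrier A" "x \<in> carrier T"
    then obtain c where c: "a \<in> carrier A" "c \<in> carrier F" "x = q c" unfolding car_T' by blast
    then show "l (a \<odot>\<^bsub>T\<^esub> x) = a \<odot>\<^bsub>M\<^esub> l x" using hL[of a c] by (simp add: q_smult lq L_F car_F[symmetric])
  qed
  moreover have "\<forall>y \<in> carrier Y. l (\<eta> y) = u y"
    using uc by (simp add: \<eta>_def lq frag_F hf')
  ultimately show thesis by (rule that)
qed

end

section \<open>Resolutions\<close>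

text \<open>Were all members above \<open>k\<close>, then \<open>Suc k\<close> would be a lower
  bound. This turns a bound on either projective dimension into an actual resolution of at most that
  length.\<close>

lemma Inf_enat_le: "Inf {enat n | n. P n} \<le> enat k \<Longrightarrow> \<exists>n\<le>k. P n"
proof (rule ccontr)
  assume le: "Inf {enat n | n. P n} \<le> enat k" and no: "\<not> (\<exists>n\<le>k. P n)"
  have "enat (Suc k) \<le> Inf {enat n | n. P n}"
    using no by (intro Inf_greatest) (force simp: not_less_eq_eq)
  then have "enat (Suc k) \<le> enat k" using le by (rule order_trans)
  then show False by simp
qed

context exact_structure
begin

lemma sq_kernel:
  assumes "obj M" "obj N" "adm M N g"
  shows "sq (M\<lparr>carrier := {x \<in> carrier M. g x = \<zero>\<^bsub>N\<^esub>}\<rparr>) M N"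
proof -
  have "g \<in> hom M N" using assms(3) by (simp add: adm_def)
  then show ?thesis using sqI[OF ses_kernel[OF assms(1,2) _ adm_surj[OF assms(3,1,2)]] assms(3)] by blast
qed

lemma sq_zero_iso:
  assumes s: "sq K E Q" and K: "zero_module K"
  shows "iso E Q"
proof -
  obtain f g where fg: "ses K E Q f g" using s by (rule sqE)
  note o = sesD(1-5)[OF fg]
  have "x = \<zero>\<^bsub>E\<^esub>" if "x \<in> carrier E" "g x = \<zero>\<^bsub>Q\<^esub>" for x
    using ses_ker[OF fg that] K hom_simps(4)[OF o(4,1,2)] by (auto simp: zero_module_def)
  then have "inj_on g (carrier E)" by (rule hom_inj[OF o(5,2,3)])
  then show ?thesis using sesD(7)[OF fg] by (intro iso_bij[OF o(2,3,5)]) (simp add: bij_betw_def)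
qed

end

context enough_projectives
begin

text \<open>The kernels \<open>Z i\<close> are the successive syzygies. The last hypothesis asks
  \<open>t i\<close> to be admissible onto the kernel below it: for ordinary resolutions this is
  exactness, for relative ones the splitting maps provide it.\<close>

lemma pd_resolution:
  fixes M :: "int \<Rightarrow> 'a umodule"
  assumes ex: "exact_sequence A M t"
    and zero: "\<And>i. i < -1 \<or> int n < i \<Longrightarrow> zero_module (M i)"
    and prj: "\<And>i. 0 \<le> i \<Longrightarrow> prj (M i)"
    and adm: "\<And>i. 0 \<le> i \<Longrightarrow> adm (M i) ((M (i - 1))\<lparr>carrier := {x \<in> carrier (M (i - 1)). t (i - 1) x = \<zero>\<^bsub>M (i - 1 - 1)\<^esub>}\<rparr>) (t i)"
  shows "pd n (M (-1))"
proof -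
  define Z where "Z i = (M i)\<lparr>carrier := {x \<in> carrier (M i). t i x = \<zero>\<^bsub>M (i - 1)\<^esub>}\<rparr>" for i
  have obj: "obj (M i)" and t: "t i \<in> hom (M i) (M (i - 1))" for i using ex by (auto simp: exact_sequence_def)
  have im: "t (i + 1) ` carrier (M (i + 1)) = carrier (Z i)" for i
    using ex by (simp add: exact_sequence_def Z_def a_kernel_def')
  have oZ: "obj (Z i)" for i unfolding Z_def by (rule fg_submodule[OF obj submodule_kernel[OF t obj obj]])
  have sq: "sq (Z i) (M i) (Z (i - 1))" if "0 \<le> i" for i
  proof -
    have a: "adm (M i) (Z (i - 1)) (t i)" unfolding Z_def by (rule adm[OF that])
    have "Z i = (M i)\<lparr>carrier := {x \<in> carrier (M i). t i x = \<zero>\<^bsub>Z (i - 1)\<^esub>}\<rparr>" by (simp add: Z_def)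
    then show ?thesis using sq_kernel[OF obj oZ a] by simp
  qed
  have zZ: "zero_module (Z (int n))"
  proof -
    have "carrier (M (int n + 1)) = {\<zero>\<^bsub>M (int n + 1)\<^esub>}" using zero[of "int n + 1"] by (simp add: zero_module_def)
    then have "carrier (Z (int n)) = {t (int n + 1) \<zero>\<^bsub>M (int n + 1)\<^esub>}" using im[of "int n"] by simp
    then show ?thesis using zero_mem[OF oZ[of "int n"]] by (simp add: zero_module_def)
  qed
  \<comment> \<open>Counted from the left end: \<open>Z n\<close> is zero, so
    \<open>Z (n - 1)\<close> is isomorphic to the projective \<open>M n\<close>, and
    \<open>k = n\<close> reaches the index -1 of the resolved module.\<close>
  have "pd k (Z (int n - 1 - int k))" if "k \<le> n" for k
    using that
  proof (induction k)
    case 0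
    have "iso (M (int n)) (Z (int n - 1))" using sq_zero_iso[OF sq[of "int n"] zZ] by simp
    then show ?case using prj_iso[OF prj[of "int n"]] by simp
  next
    case (Suc k)
    have i: "0 \<le> int n - 1 - int k" "int n - 1 - int (Suc k) = int n - 1 - int k - 1" using Suc.prems by simp_all
    show ?case unfolding i(2) pd_Suc_sq[OF sq[OF i(1)] prj[OF i(1)]] using Suc by simp
  qed
  from this[of n] have "pd n (Z (-1))" by simp
  moreover have "{x \<in> carrier (M (-1)). t (-1) x = \<zero>\<^bsub>M (-2)\<^esub>} = carrier (M (-1))"
    using zero[of "-2"] module_hom_closed[OF t[of "-1"]] by (auto simp: zero_module_def)
  then have "Z (-1) = M (-1)" by (simp add: Z_def)
  ultimately show ?thesis by simp
qed

end

context module_category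
begin

lemma projective_iff: "obj P \<Longrightarrow> projective A P \<longleftrightarrow> ord.prj P" for P :: "'a umodule"
proof -
  assume P: "obj P"
  have "ord.adm M N g \<longleftrightarrow> g \<in> hom M N \<and> g ` carrier M = carrier N" for M N :: "'a umodule" and g
    unfolding adm_iff using module_hom_closed[of g A M N] by blast
  then show ?thesis using P unfolding projective_def ord.prj_def by auto
qed

text \<open>A resolution of the syzygy, shifted up by one, is spliced onto a projective presentation
  of \<open>X\<close>. The term \<open>M' (-1)\<close> disappears, and \<open>t 1\<close> goes from
  \<open>M' 0\<close> through the syzygy into \<open>P\<close>.\<close>

lemma resolution_exists:
  "ord.pd n X \<Longrightarrow> \<exists>M t. exact_sequence A M t \<and> M (-1) = X \<and> (\<forall>i. i < -1 \<or> int n < i \<longrightarrow> zero_module (M i)) \<and>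
     (\<forall>i\<ge>0. ord.prj (M i))"
proof (induction n arbitrary: X)
  case 0
  then have P: "ord.prj X" by simp
  note X = ord.prjD[OF P]
  define Z where "Z = X\<lparr>carrier := {\<zero>\<^bsub>X\<^esub>}\<rparr>"
  have Z: "obj Z" "zero_module Z" "carrier Z = {\<zero>\<^bsub>X\<^esub>}" "\<zero>\<^bsub>Z\<^esub> = \<zero>\<^bsub>X\<^esub>"
    unfolding Z_def using obj_zero_submodule[OF X] zero_module_submodule by simp_all
  \<comment> \<open>A projective module is resolved by its own identity in degrees 0 and -1, with a
    zero submodule of it everywhere else.\<close>
  define M where "M i = (if i = 0 \<or> i = -1 then X else Z)" for i :: int
  define t where "t i = (if i = 0 then (\<lambda>x. x) else (\<lambda>_. \<zero>\<^bsub>X\<^esub>))" for i :: int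
  have h: "(\<lambda>_. \<zero>\<^bsub>X\<^esub>) \<in> hom M' X" "(\<lambda>_. \<zero>\<^bsub>X\<^esub>) \<in> hom M' Z" for M' :: "'a umodule"
    using hom_zero[OF X] hom_zero[OF Z(1)] Z(4) by simp_all
  have "carrier X \<noteq> {}" using X zero_mem by blast
  then have "exact_sequence A M t"
    unfolding exact_sequence_def a_kernel_def' using X Z h
    by (auto simp: M_def t_def module_hom_id)
  moreover have "M (-1) = X" "\<forall>i. i < -1 \<or> int 0 < i \<longrightarrow> zero_module (M i)" "\<forall>i\<ge>0. ord.prj (M i)"
    using P Z(2) ord.prj_zero[OF Z(1,2)] by (auto simp: M_def)
  ultimately show ?case by blast
next
  case (Suc n)
  then have X: "obj X" and O: "ord.pd n (ord.Om X)" by (simp_all add: ord.pd_Suc)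
  obtain P where P: "ord.prj P" "ord.sq (ord.Om X) P X" using ord.Om[OF X] .
  obtain f g where fg: "ses (ord.Om X) P X f g" "ord.adm P X g" using P(2) by (rule ord.sqE)
  obtain M' t' where M': "exact_sequence A M' t'" "M' (-1) = ord.Om X" "\<forall>i. i < -1 \<or> int n < i \<longrightarrow> zero_module (M' i)"
    "\<forall>i\<ge>0. ord.prj (M' i)" using Suc.IH[OF O] by blast
  have M'obj: "obj (M' i)" and t': "t' i \<in> hom (M' i) (M' (i - 1))"
    and im: "t' (i + 1) ` carrier (M' (i + 1)) = {x \<in> carrier (M' i). t' i x = \<zero>\<^bsub>M' (i - 1)\<^esub>}" for i
    using M'(1) by (simp_all add: exact_sequence_def a_kernel_def')
  define Z where "Z = X\<lparr>carrier := {\<zero>\<^bsub>X\<^esub>}\<rparr>"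
  have Z: "obj Z" "zero_module Z" "carrier Z = {\<zero>\<^bsub>X\<^esub>}" "\<zero>\<^bsub>Z\<^esub> = \<zero>\<^bsub>X\<^esub>"
    unfolding Z_def using obj_zero_submodule[OF X] zero_module_submodule by simp_all
  define M where "M i = (if i \<ge> 1 then M' (i - 1) else if i = 0 then P else if i = -1 then X else Z)" for i :: int
  define t where "t i = (if i \<ge> 2 then t' (i - 1) else if i = 1 then (\<lambda>x. f (t' 0 x)) else if i = 0 then g else (\<lambda>_. \<zero>\<^bsub>X\<^esub>))" for i :: int
  have h: "(\<lambda>_. \<zero>\<^bsub>X\<^esub>) \<in> hom N X" "(\<lambda>_. \<zero>\<^bsub>X\<^esub>) \<in> hom N Z" for N :: "'a umodule"
    using hom_zero[OF X] hom_zero[OF Z(1)] Z(4) by simp_all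
  have t0: "t' 0 \<in> hom (M' 0) (ord.Om X)" using t'[of 0] M'(2) by simp
  have im0: "t' 0 ` carrier (M' 0) = carrier (ord.Om X)"
    using im[of "-1"] M'(2) M'(3)[rule_format, of "-2"] module_hom_closed[OF t'[of "-1"]] by (auto simp: zero_module_def)
  have f0: "f x = \<zero>\<^bsub>P\<^esub> \<longleftrightarrow> x = \<zero>\<^bsub>ord.Om X\<^esub>" if "x \<in> carrier (ord.Om X)" for x
    using ses_inj[OF fg(1) that] hom_simps(4)[OF sesD(4,1,2)[OF fg(1)]] by blast
  have "exact_sequence A M t"
    unfolding exact_sequence_def a_kernel_def'
  proof (intro allI)
    fix i :: int
    consider "i \<ge> 2" | "i = 1" | "i = 0" | "i = -1" | "i = -2" | "i < -2" by linarith
    then show "obj (M i) \<and> t i \<in> hom (M i) (M (i - 1)) \<and>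
        t (i + 1) ` carrier (M (i + 1)) = {x \<in> carrier (M i). t i x = \<zero>\<^bsub>M (i - 1)\<^esub>}"
    proof cases
      case 1
      then show ?thesis using M'obj t'[of "i - 1"] im[of "i - 1"] by (simp add: M_def t_def)
    next
      case 2
      have "t' 1 ` carrier (M' 1) = {x \<in> carrier (M' 0). f (t' 0 x) = \<zero>\<^bsub>P\<^esub>}"
        using im[of 0] M'(2) f0[OF module_hom_closed[OF t0]] by (simp cong: conj_cong)
      then show ?thesis using 2 M'obj module_hom_comp[OF t0 sesD(4)[OF fg(1)]] by (simp add: M_def t_def)
    next
      case 3
      have "(\<lambda>x. f (t' 0 x)) ` carrier (M' 0) = f ` carrier (ord.Om X)" unfolding im0[symmetric] by (simp add: image_image)
      also have "\<dots> = {x \<in> carrier P. g x = \<zero>\<^bsub>X\<^esub>}"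
        using sesD(8)[OF fg(1)] module_hom_closed[OF sesD(4)[OF fg(1)]] by blast
      finally show ?thesis using 3 sesD(2,5)[OF fg(1)] by (simp add: M_def t_def)
    next
      case 4
      then show ?thesis using X sesD(7)[OF fg(1)] h Z by (simp add: M_def t_def)
    next
      case 5
      have "carrier X \<noteq> {}" using X zero_mem by blast
      then show ?thesis using 5 h Z by (auto simp: M_def t_def)
    next
      case 6
      then show ?thesis using h Z by (auto simp: M_def t_def)
    qed
  qed
  moreover have "M (-1) = X" by (simp add: M_def)
  moreover have "\<forall>i. i < -1 \<or> int (Suc n) < i \<longrightarrow> zero_module (M i)" using M'(3) Z(2) by (simp add: M_def)
  moreover have "\<forall>i\<ge>0. ord.prj (M i)" using M'(4) P(1) by (simp add: M_def)
  ultimately show ?case by blast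
qed

lemma pd_proj_dim:
  assumes "ord.pd n X'" "module_isomorphic A X' X" shows "proj_dim A X \<le> enat n"
proof -
  obtain M t where M: "exact_sequence A M t" "M (-1) = X'" "\<forall>i. i < -1 \<or> int n < i \<longrightarrow> zero_module (M i)"
    "\<forall>i\<ge>0. ord.prj (M i)" using resolution_exists[OF assms(1)] by blast
  have "\<forall>i\<ge>0. projective A (M i)" using M(4) projective_iff ord.prjD by blast
  then have "\<exists>M t. bounded_resolution_shape A X n M t \<and> (\<forall>i\<ge>0. projective A (M i))"
    unfolding bounded_resolution_shape_def using M(1-3) assms(2) by blast
  then show ?thesis unfolding proj_dim_def by (intro Inf_lower) blast
qed

lemma resolution_iso:
  fixes X :: "('a, 'm) module" and X' :: "'a umodule"
  assumes "bounded_resolution_shape A X n M t" "obj X" "obj X'" "module_isomorphic A X' X"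
  shows "iso (M (-1)) X'"
proof -
  have M: "obj (M (-1))" "module_isomorphic A (M (-1)) X"
    using assms(1) by (simp_all add: bounded_resolution_shape_def exact_sequence_def)
  obtain f g where f: "f \<in> hom (M (-1)) X" "g \<in> hom X (M (-1))" "\<forall>x \<in> carrier (M (-1)). g (f x) = x"
    "\<forall>x \<in> carrier X. f (g x) = x" using M(2,1) assms(2) by (rule module_isomorphicE)
  obtain h k where h: "h \<in> hom X' X" "k \<in> hom X X'" "\<forall>x \<in> carrier X'. k (h x) = x"
    "\<forall>x \<in> carrier X. h (k x) = x" using assms(4,3,2) by (rule module_isomorphicE)
  show ?thesis
    using f h module_hom_closed[OF f(1)] module_hom_closed[OF h(1)]
    by (intro isoI[OF M(1) assms(3) module_hom_comp[OF f(1) h(2)] module_hom_comp[OF h(1) f(2)]]) simp_all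
qed

text \<open>\<open>X\<close> may live over any type, as induced modules do; the conclusion is
  therefore about a copy \<open>X'\<close> among the objects.\<close>

lemma proj_dim_pd:
  fixes X :: "('a, 'm) module"
  assumes fin: "proj_dim A X < \<infinity>" and X: "obj X" "obj X'" "module_isomorphic A X' X"
  shows "\<exists>n. ord.pd n X'"
proof -
  obtain k where "proj_dim A X \<le> enat k" using fin by (cases "proj_dim A X") auto
  from Inf_enat_le[OF this[unfolded proj_dim_def]]
  obtain n M t where s: "bounded_resolution_shape A X n M t" and p: "\<forall>i\<ge>0. projective A (M i)"
    by blast
  then have ex: "exact_sequence A M t" and z: "\<And>i. i < -1 \<or> int n < i \<Longrightarrow> zero_module (M i)"
    unfolding bounded_resolution_shape_def by blast+
  have M: "obj (M i)" and t: "t i \<in> hom (M i) (M (i - 1))" for i using ex by (simp_all add: exact_sequence_def)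
  have im: "t i ` carrier (M i) = {x \<in> carrier (M (i - 1)). t (i - 1) x = \<zero>\<^bsub>M (i - 1 - 1)\<^esub>}" for i
    using ex[unfolded exact_sequence_def a_kernel_def', rule_format, of "i - 1"] by simp
  have "ord.pd n (M (-1))"
  proof (rule ord.pd_resolution[OF ex z])
    fix i :: int assume i: "0 \<le> i"
    show "ord.prj (M i)" using p i projective_iff[OF M] by blast
    show "ord.adm (M i) ((M (i - 1))\<lparr>carrier := {x \<in> carrier (M (i - 1)). t (i - 1) x = \<zero>\<^bsub>M (i - 1 - 1)\<^esub>}\<rparr>) (t i)"
      unfolding adm_iff
    proof (intro conjI ballI)
      show "t i \<in> hom (M i) ((M (i - 1))\<lparr>carrier := {x \<in> carrier (M (i - 1)). t (i - 1) x = \<zero>\<^bsub>M (i - 1 - 1)\<^esub>}\<rparr>)"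
        unfolding im[symmetric] by (rule module_hom_into[OF t]) blast
      fix y assume "y \<in> carrier ((M (i - 1))\<lparr>carrier := {x \<in> carrier (M (i - 1)). t (i - 1) x = \<zero>\<^bsub>M (i - 1 - 1)\<^esub>}\<rparr>)"
      then show "\<exists>x \<in> carrier (M i). y = t i x" unfolding im[symmetric] by (simp add: image_iff)
    qed
  qed
  then show ?thesis using ord.pd_stab ord.iso_stab resolution_iso[OF s X] by blast
qed

end

section \<open>Relative homological algebra\<close>

lemma (in module_category) msum_image_iso:
  "msum J X \<Longrightarrow> (\<And>U. U \<in># J \<Longrightarrow> iso U (r U)) \<Longrightarrow> msum (image_mset r J) X"
proof (induction rule: msum.induct)
  case (msum_zero Z)
  then show ?case using msum.msum_zero by simp
next
  case (msum_add J X U Y)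
  have "iso U (r U)" using msum_add.prems by simp
  moreover have "iso X X" "iso Y Y" using dsumD[OF msum_add.hyps(2)] by simp_all
  ultimately have "dsum (r U) X Y" by (rule dsum_iso[OF msum_add.hyps(2) iso_sym])
  then show ?case using msum.msum_add msum_add by simp
qed

text \<open>The summands of \<open>I\<close> are carried into its copy \<open>T\<close>, which lies
  among the objects, so that the calculus of direct sums applies.\<close>

lemma (in module_category) internal_direct_sum_retr:
  fixes I :: "('a, 'm) module" and X T :: "'a umodule"
  assumes X: "iso_to_direct_summand A X I" "obj X" and I: "obj I" and T: "obj T" "module_isomorphic A T I"
  shows "retr X T"
proof -
  interpret I: left_module A I by (rule objD[OF I])
  obtain g f where g: "g \<in> hom T I" and f1: "f \<in> hom I T" and gf: "\<forall>x \<in> carrier T. f (g x) = x" "\<forall>x \<in> carrier I. g (f x) = x"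
    using module_isomorphicE[OF T(2,1) I] .
  have "bij_betw f (carrier I) (carrier T)"
    using gf module_hom_closed[OF g] module_hom_closed[OF f1] by (intro bij_betw_byWitness[of _ g]) auto
  note f = f1 this
  have inj: "inj_on f (carrier I)" and onto: "f ` carrier I = carrier T" using f(2) by (simp_all add: bij_betw_def)
  obtain U V h where UV: "internal_direct_sum A I U V" and h: "h \<in> hom X (I\<lparr>carrier := U\<rparr>)" "bij_betw h (carrier X) U"
    using X(1) unfolding iso_to_direct_summand_def module_isomorphic_def by auto
  have U: "submodule U A I" and V: "submodule V A I" and int: "U \<inter> V = {\<zero>\<^bsub>I\<^esub>}" and sum: "U <+>\<^bsub>I\<^esub> V = carrier I"
    using UV by (simp_all add: internal_direct_sum_def)
  have sub: "U \<subseteq> carrier I" "V \<subseteq> carrier I" using I.submoduleD(1)[OF U] I.submoduleD(1)[OF V] by blast+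
  have fU: "submodule (f ` U) A T" and fV: "submodule (f ` V) A T"
    by (rule module_hom_image[OF objD[OF I] objD[OF T(1)] f(1)], fact)+
  have int': "f ` U \<inter> f ` V = {\<zero>\<^bsub>T\<^esub>}"
    using inj_on_image_Int[OF inj sub] int hom_simps(4)[OF f(1) I T(1)] by simp
  have sum': "\<exists>u \<in> f ` U. \<exists>v \<in> f ` V. y = u \<oplus>\<^bsub>T\<^esub> v" if y: "y \<in> carrier T" for y
  proof -
    obtain x where x: "x \<in> carrier I" "y = f x" using y onto by blast
    then obtain u v where uv: "u \<in> U" "v \<in> V" "x = u \<oplus>\<^bsub>I\<^esub> v" using sum unfolding set_add_def' by blast
    then have "y = f u \<oplus>\<^bsub>T\<^esub> f v" using x(2) module_hom_add[OF f(1)] sub by auto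
    then show ?thesis using uv by blast
  qed
  obtain p1 p2 where b: "biprod (T\<lparr>carrier := f ` U\<rparr>) (T\<lparr>carrier := f ` V\<rparr>) T (\<lambda>x. x) (\<lambda>x. x) p1 p2"
    using internal_biprod[OF T(1) fU fV int' sum'] .
  have fh: "(\<lambda>x. f (h x)) \<in> hom X (T\<lparr>carrier := f ` U\<rparr>)"
    using h(2) by (intro module_hom_into[OF module_hom_comp[OF module_hom_out[OF h(1) sub(1)] f(1)]]) (auto simp: bij_betw_def)
  have "bij_betw (f \<circ> h) (carrier X) (f ` U)"
    using h(2) inj_on_subset[OF inj sub(1)] by (intro bij_betw_trans[OF h(2)]) (simp add: bij_betw_def)
  then have "iso X (T\<lparr>carrier := f ` U\<rparr>)"
    by (intro iso_bij[OF X(2) fg_submodule[OF T(1) fU] fh]) (simp add: comp_def)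
  then show ?thesis using retr_trans[OF iso_retr dsum_retr(1)[OF dsumI[OF b]]] by blast
qed

lemma (in module_category) copy_isomorphic:
  fixes M :: "('a, 'm) module"
  assumes "obj M" obtains N :: "'a umodule" where "obj N" "module_isomorphic A N M"
proof -
  obtain N :: "'a umodule" and f g where N: "obj N" "f \<in> hom M N" "g \<in> hom N M"
    "\<forall>x \<in> carrier M. g (f x) = x" "\<forall>y \<in> carrier N. f (g y) = y" using copy_obj[OF assms] .
  have "bij_betw g (carrier N) (carrier M)"
    using N module_hom_closed[OF N(2)] module_hom_closed[OF N(3)] by (intro bij_betw_byWitness[of _ f]) auto
  then show thesis using that[OF N(1)] N(3) unfolding module_isomorphic_def by blast
qed

lemma module_isomorphic_refl: "module_isomorphic A M M"
  unfolding module_isomorphic_def by (intro bexI[of _ "\<lambda>x. x"] module_hom_id) (simp add: bij_betw_def)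

text \<open>Only preservation of finite generation under restriction is required of
  \<open>\<phi>\<close> beyond being a ring homomorphism; for Artin algebras it comes from
  finiteness over the common base ring.\<close>

locale ring_extension = A: module_category A + B: module_category B
  for A :: "('a, 'c) ring_scheme" and B :: "('b, 'd) ring_scheme" +
  fixes \<phi> :: "'b \<Rightarrow> 'a"
  assumes \<phi>: "\<phi> \<in> ring_hom B A"
    and obj_res: "fg_module A (M :: 'a umodule) \<Longrightarrow> fg_module B (restrict_scalars \<phi> M)"
begin

abbreviation res :: "('a, 'm) module \<Rightarrow> ('b, 'm) module" where "res \<equiv> restrict_scalars \<phi>"

lemma hom_res: "f \<in> A.hom M N \<Longrightarrow> f \<in> B.hom (res M) (res N)"
  using ring_hom_closed[OF \<phi>] by (auto simp: module_hom_def)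

lemma left_module_res: "left_module A M \<Longrightarrow> left_module B (res M)"
  by (rule restrict_scalars_left_module[OF _ B.ring_axioms \<phi>])

end

sublocale ring_extension \<subseteq> rel: exact_structure A "\<lambda>M N. module_hom B (restrict_scalars \<phi> M) (restrict_scalars \<phi> N)"
proof
  fix M N :: "'a umodule" and f
  assume *: "A.obj M" "A.obj N"
  show "f \<in> A.hom M N \<Longrightarrow> f \<in> B.hom (res M) (res N)" by (rule hom_res)
  show "f x \<in> carrier N" if "f \<in> B.hom (res M) (res N)" "x \<in> carrier M" for x using module_hom_closed[OF that(1)] that(2) by simp
  show "(\<lambda>x. f x \<oplus>\<^bsub>N\<^esub> g x) \<in> B.hom (res M) (res N)" if "f \<in> B.hom (res M) (res N)" "g \<in> B.hom (res M) (res N)" for g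
    using B.hom_add[OF that obj_res[OF *(1)] obj_res[OF *(2)]] by simp
  show "f \<in> B.hom (res M) (res (N\<lparr>carrier := K\<rparr>))" if "f \<in> B.hom (res M) (res N)" "\<And>x. x \<in> carrier M \<Longrightarrow> f x \<in> K" for K
    using module_hom_into[OF that(1), of K] that(2) by simp
qed (rule module_hom_comp)

context ring_extension
begin

text \<open>\<open>T\<close> with \<open>\<eta>\<close> is a copy of \<open>A \<otimes>\<^sub>B Y\<close>, characterised by its universal property.\<close>

definition free_over :: "('b, 'm) module \<Rightarrow> 'a umodule \<Rightarrow> ('m \<Rightarrow> (nat \<Rightarrow> 'a) set) \<Rightarrow> bool" where
  "free_over Y T \<eta> \<longleftrightarrow> A.obj T \<and> \<eta> \<in> B.hom Y (res T) \<and>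
     (\<forall>N. submodule N A T \<and> \<eta> ` carrier Y \<subseteq> N \<longrightarrow> carrier T \<subseteq> N) \<and>
     (\<forall>(M :: 'a umodule) u. A.obj M \<and> u \<in> B.hom Y (res M) \<longrightarrow> (\<exists>l \<in> A.hom T M. \<forall>y \<in> carrier Y. l (\<eta> y) = u y))"

lemma free_overD:
  assumes "free_over Y T \<eta>" shows "A.obj T" "\<eta> \<in> B.hom Y (res T)"
  using assms by (simp_all add: free_over_def)

lemma free_over_extend:
  assumes "free_over Y T \<eta>" "A.obj (M :: 'a umodule)" "u \<in> B.hom Y (res M)"
  obtains l where "l \<in> A.hom T M" "\<forall>y \<in> carrier Y. l (\<eta> y) = u y"
proof -
  have "\<forall>(M :: 'a umodule) u. A.obj M \<and> u \<in> B.hom Y (res M) \<longrightarrow> (\<exists>l \<in> A.hom T M. \<forall>y \<in> carrier Y. l (\<eta> y) = u y)"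
    using assms(1) unfolding free_over_def by (elim conjE)
  from this[rule_format, OF conjI[OF assms(2,3)]] show thesis by (elim bexE) (rule that)
qed

text \<open>The equaliser of two homomorphisms is a submodule. If it contains the image of
  \<open>\<eta>\<close>, it is everything; this is the uniqueness part of the universal
  property.\<close>

lemma free_over_eq:
  assumes F: "free_over Y T \<eta>" and M: "A.obj (M :: 'a umodule)" and l: "l \<in> A.hom T M" "l' \<in> A.hom T M"
    and eq: "\<And>y. y \<in> carrier Y \<Longrightarrow> l (\<eta> y) = l' (\<eta> y)" and x: "x \<in> carrier T"
  shows "l x = l' x"
proof -
  note T = free_overD(1)[OF F]
  have \<eta>: "\<eta> y \<in> carrier T" if "y \<in> carrier Y" for y using module_hom_closed[OF free_overD(2)[OF F] that] by simp
  note [simp] = M T A.hom_simps[OF l(1) T M] A.hom_simps[OF l(2) T M]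
  have "submodule {x \<in> carrier T. l x \<ominus>\<^bsub>M\<^esub> l' x = \<zero>\<^bsub>M\<^esub>} A T"
    by (rule A.submodule_kernel[OF A.hom_diff[OF l T M] T M])
  moreover have "\<eta> ` carrier Y \<subseteq> {x \<in> carrier T. l x \<ominus>\<^bsub>M\<^esub> l' x = \<zero>\<^bsub>M\<^esub>}"
    using \<eta> eq A.diff_zero_iff[OF M] by auto
  ultimately have "carrier T \<subseteq> {x \<in> carrier T. l x \<ominus>\<^bsub>M\<^esub> l' x = \<zero>\<^bsub>M\<^esub>}" using F unfolding free_over_def by blast
  then show ?thesis using x A.diff_zero_iff[OF M] by auto
qed

lemma obj_tensor:
  assumes Y: "B.obj Y" shows "A.obj (tensor A B \<phi> Y)"
proof -
  interpret tp: tensor_product A B \<phi> Y by (rule tensor_product.intro[OF A.ring_axioms B.objD[OF Y] \<phi>])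
  obtain S where S: "finite S" "left_module.gen_by B Y S (carrier Y)" using B.obj_gen[OF Y] .
  have SY: "S \<subseteq> carrier Y" using S(2) by (simp add: tp.Y.gen_by_def)
  note lT = left_module_res[OF tp.left_module_T]
  have "tp.T.gen_by (tp.\<eta> ` S) (carrier tp.T)"
    unfolding tp.T.gen_by_def
  proof (intro conjI allI impI)
    show "tp.\<eta> ` S \<subseteq> carrier tp.T" using SY module_hom_closed[OF tp.\<eta>_hom] by auto
    fix K assume K: "submodule K A tp.T" "tp.\<eta> ` S \<subseteq> K"
    have "submodule {y \<in> carrier Y. tp.\<eta> y \<in> K} B Y"
      by (rule module_hom_vimage[OF B.objD[OF Y] lT tp.\<eta>_hom submodule_restrict[OF tp.left_module_T lT \<phi> K(1)]])
    moreover have "S \<subseteq> {y \<in> carrier Y. tp.\<eta> y \<in> K}" using K(2) SY by blast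
    ultimately have "carrier Y \<subseteq> {y \<in> carrier Y. tp.\<eta> y \<in> K}" by (rule tp.Y.gen_byD[OF S(2)])
    then show "carrier tp.T \<subseteq> K" by (intro tp.\<eta>_generates[OF K(1)]) blast
  qed
  then show ?thesis using A.objI_gen[OF tp.left_module_T _ _] S(1) unfolding tp.T_def by blast
qed

lemma free_over_tensor:
  assumes Y: "B.obj Y" and T: "A.obj (T :: 'a umodule)" "module_isomorphic A T (tensor A B \<phi> Y)"
  shows "\<exists>\<eta>. free_over Y T \<eta>"
proof -
  interpret tp: tensor_product A B \<phi> Y by (rule tensor_product.intro[OF A.ring_axioms B.objD[OF Y] \<phi>])
  have oT: "A.obj tp.T" using obj_tensor[OF Y] by (simp add: tp.T_def)
  obtain f g where f: "f \<in> A.hom T tp.T" "g \<in> A.hom tp.T T" "\<forall>x \<in> carrier T. g (f x) = x" "\<forall>y \<in> carrier tp.T. f (g y) = y"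
    using A.module_isomorphicE[OF T(2,1) obj_tensor[OF Y], folded tp.T_def] .
  have "free_over Y T (\<lambda>y. g (tp.\<eta> y))"
    unfolding free_over_def
  proof (intro conjI allI impI)
    show "A.obj T" by fact
    show "(\<lambda>y. g (tp.\<eta> y)) \<in> B.hom Y (res T)" by (rule module_hom_comp[OF tp.\<eta>_hom hom_res[OF f(2)]])
    fix N assume N: "submodule N A T \<and> (\<lambda>y. g (tp.\<eta> y)) ` carrier Y \<subseteq> N"
    have "submodule {x \<in> carrier tp.T. g x \<in> N} A tp.T"
      using N by (intro module_hom_vimage[OF tp.left_module_T A.objD[OF T(1)] f(2)]) simp
    moreover have "tp.\<eta> ` carrier Y \<subseteq> {x \<in> carrier tp.T. g x \<in> N}" using N module_hom_closed[OF tp.\<eta>_hom] by auto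
    ultimately have "carrier tp.T \<subseteq> {x \<in> carrier tp.T. g x \<in> N}" by (rule tp.\<eta>_generates)
    then have "g (f x) \<in> N" if "x \<in> carrier T" for x using module_hom_closed[OF f(1) that] by blast
    then show "carrier T \<subseteq> N" using f(3) by auto
  next
    fix M :: "'a umodule" and u assume M: "A.obj M \<and> u \<in> B.hom Y (res M)"
    then obtain l where l: "l \<in> A.hom tp.T M" "\<forall>y \<in> carrier Y. l (tp.\<eta> y) = u y" using tp.\<eta>_extend[of M u] A.objD by blast
    have "\<forall>y \<in> carrier Y. l (f (g (tp.\<eta> y))) = u y" using l(2) f(4) module_hom_closed[OF tp.\<eta>_hom] by simp
    then show "\<exists>l \<in> A.hom T M. \<forall>y \<in> carrier Y. l (g (tp.\<eta> y)) = u y" by (rule bexI[OF _ module_hom_comp[OF f(1) l(1)]])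
  qed
  then show ?thesis by blast
qed

lemma free_over_exists:
  assumes Y: "B.obj Y" obtains T \<eta> where "free_over Y T \<eta>"
proof -
  obtain T :: "'a umodule" where "A.obj T" "module_isomorphic A T (tensor A B \<phi> Y)" using A.copy_isomorphic[OF obj_tensor[OF Y]] .
  then show thesis using free_over_tensor[OF Y] that by blast
qed

lemma free_over_map:
  assumes "free_over Y T \<eta>" "free_over Y' T' \<eta>'" "a \<in> B.hom Y Y'"
  obtains l where "l \<in> A.hom T T'" "\<forall>y \<in> carrier Y. l (\<eta> y) = \<eta>' (a y)"
  using free_over_extend[OF assms(1) free_overD(1)[OF assms(2)] module_hom_comp[OF assms(3) free_overD(2)[OF assms(2)]]] .

text \<open>Induction is a functor, hence preserves retracts. With identities for \<open>i\<close>
  and \<open>p\<close> it also compares two copies of the same induced module.\<close>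

lemma free_over_retr:
  assumes F: "free_over Y T \<eta>" "free_over Y' T' \<eta>'" and i: "i \<in> B.hom Y Y'" and p: "p \<in> B.hom Y' Y" and pi: "\<forall>y \<in> carrier Y. p (i y) = y"
  shows "A.retr T T'"
proof -
  obtain l where l: "l \<in> A.hom T T'" "\<forall>y \<in> carrier Y. l (\<eta> y) = \<eta>' (i y)" using free_over_map[OF F i] .
  obtain m where m: "m \<in> A.hom T' T" "\<forall>y \<in> carrier Y'. m (\<eta>' y) = \<eta> (p y)" using free_over_map[OF F(2,1) p] .
  show ?thesis
  proof (rule A.retrI[OF free_overD(1)[OF F(1)] free_overD(1)[OF F(2)] l(1) m(1)])
    fix x assume x: "x \<in> carrier T"
    show "m (l x) = x"
      by (rule free_over_eq[OF F(1) free_overD(1)[OF F(1)] module_hom_comp[OF l(1) m(1)] module_hom_id _ x])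
        (use l(2) m(2) pi module_hom_closed[OF i] in simp)
  qed
qed

lemma free_over_zero:
  assumes F: "free_over Y T \<eta>" and Y: "B.obj Y" "zero_module Y" shows "zero_module T"
proof -
  note T = free_overD(1)[OF F]
  have "\<eta> \<zero>\<^bsub>Y\<^esub> = \<zero>\<^bsub>T\<^esub>" using module_hom_zero[OF B.objD[OF Y(1)] B.objD[OF obj_res[OF T]] free_overD(2)[OF F]] by simp
  then have "x = \<zero>\<^bsub>T\<^esub>" if "x \<in> carrier T" for x
    using Y(2) A.hom_zero[OF T] by (intro free_over_eq[OF F T module_hom_id _ _ that]) (simp_all add: zero_module_def)
  then show ?thesis using T by (auto simp: zero_module_def)
qed

text \<open>Induction is additive: the structure maps are the induced ones, and the biproduct
  equations need only be checked on the images of the universal maps.\<close>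

lemma free_over_dsum:
  assumes F1: "free_over Y1 T1 \<eta>1" and F2: "free_over Y2 T2 \<eta>2" and F: "free_over Y T \<eta>" and d: "B.dsum Y1 Y2 Y"
  shows "A.dsum T1 T2 T"
proof -
  obtain i1 i2 p1 p2 where b: "B.biprod Y1 Y2 Y i1 i2 p1 p2" using d by (rule B.dsumE)
  note h = B.biprodD[OF b] and [simp] = B.biprod_simps[OF b]
  note T = free_overD(1)[OF F1] free_overD(1)[OF F2] free_overD(1)[OF F]
  have z: "\<eta>1 \<zero>\<^bsub>Y1\<^esub> = \<zero>\<^bsub>T1\<^esub>" "\<eta>2 \<zero>\<^bsub>Y2\<^esub> = \<zero>\<^bsub>T2\<^esub>"
    using module_hom_zero[OF B.objD[OF h(1)] B.objD[OF obj_res[OF T(1)]] free_overD(2)[OF F1]]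
      module_hom_zero[OF B.objD[OF h(2)] B.objD[OF obj_res[OF T(2)]] free_overD(2)[OF F2]] by simp_all
  obtain j1 where j1: "j1 \<in> A.hom T1 T" "\<forall>y \<in> carrier Y1. j1 (\<eta>1 y) = \<eta> (i1 y)" using free_over_map[OF F1 F h(4)] .
  obtain j2 where j2: "j2 \<in> A.hom T2 T" "\<forall>y \<in> carrier Y2. j2 (\<eta>2 y) = \<eta> (i2 y)" using free_over_map[OF F2 F h(5)] .
  obtain q1 where q1: "q1 \<in> A.hom T T1" "\<forall>y \<in> carrier Y. q1 (\<eta> y) = \<eta>1 (p1 y)" using free_over_map[OF F F1 h(6)] .
  obtain q2 where q2: "q2 \<in> A.hom T T2" "\<forall>y \<in> carrier Y. q2 (\<eta> y) = \<eta>2 (p2 y)" using free_over_map[OF F F2 h(7)] .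
  have "A.biprod T1 T2 T j1 j2 q1 q2"
  proof (rule A.biprodI[OF T j1(1) j2(1) q1(1) q2(1)])
    fix x assume x: "x \<in> carrier T1"
    show "q1 (j1 x) = x" by (rule free_over_eq[OF F1 T(1) module_hom_comp[OF j1(1) q1(1)] module_hom_id _ x]) (use j1(2) q1(2) in simp)
    show "q2 (j1 x) = \<zero>\<^bsub>T2\<^esub>" by (rule free_over_eq[OF F1 T(2) module_hom_comp[OF j1(1) q2(1)] A.hom_zero[OF T(2)] _ x]) (use j1(2) q2(2) z in simp)
  next
    fix y assume y: "y \<in> carrier T2"
    show "q1 (j2 y) = \<zero>\<^bsub>T1\<^esub>" by (rule free_over_eq[OF F2 T(1) module_hom_comp[OF j2(1) q1(1)] A.hom_zero[OF T(1)] _ y]) (use j2(2) q1(2) z in simp)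
    show "q2 (j2 y) = y" by (rule free_over_eq[OF F2 T(2) module_hom_comp[OF j2(1) q2(1)] module_hom_id _ y]) (use j2(2) q2(2) in simp)
  next
    fix s assume s: "s \<in> carrier T"
    have "j1 (q1 (\<eta> y)) \<oplus>\<^bsub>T\<^esub> j2 (q2 (\<eta> y)) = \<eta> y" if y: "y \<in> carrier Y" for y
    proof -
      have "j1 (q1 (\<eta> y)) \<oplus>\<^bsub>T\<^esub> j2 (q2 (\<eta> y)) = \<eta> (i1 (p1 y)) \<oplus>\<^bsub>T\<^esub> \<eta> (i2 (p2 y))" using y j1(2) j2(2) q1(2) q2(2) by simp
      also have "\<dots> = \<eta> (i1 (p1 y) \<oplus>\<^bsub>Y\<^esub> i2 (p2 y))" using module_hom_add[OF free_overD(2)[OF F], of "i1 (p1 y)" "i2 (p2 y)"] y by simp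
      finally show ?thesis using y by simp
    qed
    then show "j1 (q1 s) \<oplus>\<^bsub>T\<^esub> j2 (q2 s) = s"
      by (rule free_over_eq[OF F T(3) A.hom_add[OF module_hom_comp[OF q1(1) j1(1)] module_hom_comp[OF q2(1) j2(1)] T(3) T(3)] module_hom_id _ s])
  qed
  then show ?thesis by (rule A.dsumI)
qed

text \<open>By adjunction, lifting an \<open>A\<close>-map out of \<open>T\<close> amounts to
  lifting a \<open>B\<close>-map out of \<open>Y\<close>, and the \<open>B\<close>-linear section of
  \<open>g\<close> does that.\<close>

lemma free_over_prj:
  assumes F: "free_over Y T \<eta>" shows "rel.prj T"
  unfolding rel.prj_def
proof (intro conjI allI impI)
  note T = free_overD(1)[OF F]
  show "A.obj T" by (rule T)
  fix M N g k assume "A.obj M \<and> A.obj N \<and> rel.adm M N g \<and> k \<in> A.hom T N"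
  then have M: "A.obj M" and N: "A.obj N" and g: "rel.adm M N g" and k: "k \<in> A.hom T N" by simp_all
  obtain s where s: "g \<in> A.hom M N" "s \<in> B.hom (res N) (res M)" "\<forall>y \<in> carrier N. g (s y) = y" using g by (rule rel.admE)
  obtain l where l: "l \<in> A.hom T M" "\<forall>y \<in> carrier Y. l (\<eta> y) = s (k (\<eta> y))"
    using free_over_extend[OF F M module_hom_comp[OF module_hom_comp[OF free_overD(2)[OF F] hom_res[OF k]] s(2)]] .
  have \<eta>: "\<eta> y \<in> carrier T" if "y \<in> carrier Y" for y using module_hom_closed[OF free_overD(2)[OF F] that] by simp
  have "g (l x) = k x" if "x \<in> carrier T" for x
    by (rule free_over_eq[OF F N module_hom_comp[OF l(1) s(1)] k _ that]) (use l(2) s(3) \<eta> module_hom_closed[OF k] in simp)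
  then show "\<exists>l \<in> A.hom T M. \<forall>x \<in> carrier T. g (l x) = k x" by (intro bexI[OF _ l(1)] ballI)
qed

text \<open>This is the multiplication map from the induced module to \<open>X\<close>; its
  \<open>B\<close>-linear section is \<open>\<eta>\<close>.\<close>

lemma counit:
  assumes F: "free_over (res X) T \<eta>" and X: "A.obj X"
  obtains l where "rel.adm T X l"
proof -
  obtain l where l: "l \<in> A.hom T X" "\<forall>x \<in> carrier (res X). l (\<eta> x) = x" using free_over_extend[OF F X module_hom_id] .
  then show thesis using that rel.admI[OF l(1) free_overD(2)[OF F]] by simp
qed

lemma rel_enough:
  assumes X: "A.obj X" shows "\<exists>K P. rel.prj P \<and> rel.sq K P X"
proof -
  obtain T \<eta> where F: "free_over (res X) T \<eta>" using free_over_exists[OF obj_res[OF X]] .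
  obtain l where "rel.adm T X l" using counit[OF F X] .
  then show ?thesis using rel.sq_kernel[OF free_overD(1)[OF F] X] free_over_prj[OF F] by blast
qed

end

sublocale ring_extension \<subseteq> rel: enough_projectives A "\<lambda>M N. module_hom B (restrict_scalars \<phi> M) (restrict_scalars \<phi> N)"
  by unfold_locales (rule rel_enough)

section \<open>Relative projectives and relative resolutions\<close>

context ring_extension
begin

text \<open>The counit is admissible, so the lifting property of \<open>X\<close> splits it.\<close>

lemma prj_retr_free:
  assumes X: "rel.prj X" and F: "free_over (res X) T \<eta>" shows "A.retr X T"
proof -
  note X' = rel.prjD[OF X]
  obtain l where l: "rel.adm T X l" using counit[OF F X'] .
  obtain m where m: "m \<in> A.hom X T" "\<forall>x \<in> carrier X. l (m x) = x"
    using rel.prj_lift[OF X free_overD(1)[OF F] X' l module_hom_id] .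
  have lh: "l \<in> A.hom T X" using l by (simp add: rel.adm_def)
  show ?thesis by (rule A.retrI[OF X' free_overD(1)[OF F] m(1) lh m(2)[rule_format]])
qed

lemma relatively_projective_prj:
  fixes X :: "'a umodule"
  assumes "relatively_projective A B \<phi> X" and X: "A.obj X" shows "rel.prj X"
proof -
  have I: "A.obj (induced A B \<phi> X)" unfolding induced_def by (rule obj_tensor[OF obj_res[OF X]])
  obtain T :: "'a umodule" where T: "A.obj T" "module_isomorphic A T (induced A B \<phi> X)" using A.copy_isomorphic[OF I] .
  obtain \<eta> where F: "free_over (res X) T \<eta>" using free_over_tensor[OF obj_res[OF X] T(1)] T(2) unfolding induced_def by blast
  have "A.retr X T" using A.internal_direct_sum_retr[OF _ X I T] assms(1) unfolding relatively_projective_def by blast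
  then show ?thesis using free_over_prj[OF F] by (rule rel.retr_prj)
qed

lemma rel_proj_dim_pd:
  fixes X :: "'a umodule"
  assumes le: "rel_proj_dim A B \<phi> X \<le> enat k" and X: "A.obj X"
  shows "rel.pd k X"
proof -
  from Inf_enat_le[OF le[unfolded rel_proj_dim_def]]
  obtain n M t where n: "n \<le> k" and s: "bounded_resolution_shape A X n M t" and r: "relatively_exact A B \<phi> M t"
    and p: "\<forall>i\<ge>0. relatively_projective A B \<phi> (M i)" by blast
  have ex: "exact_sequence A M t" and z: "\<And>i. i < -1 \<or> int n < i \<Longrightarrow> zero_module (M i)"
    using s unfolding bounded_resolution_shape_def by blast+
  obtain h where h: "\<And>i. h i \<in> B.hom (res (M i)) (res (M (i + 1)))" "\<And>i x. x \<in> carrier (M i) \<Longrightarrow> t i x = t i (h (i - 1) (t i x))"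
    using r unfolding relatively_exact_def by blast
  have M: "A.obj (M i)" and t: "t i \<in> A.hom (M i) (M (i - 1))" for i using ex by (simp_all add: exact_sequence_def)
  have im: "t i ` carrier (M i) = {x \<in> carrier (M (i - 1)). t (i - 1) x = \<zero>\<^bsub>M (i - 1 - 1)\<^esub>}" for i
    using ex[unfolded exact_sequence_def a_kernel_def', rule_format, of "i - 1"] by simp
  have "rel.pd n (M (-1))"
  proof (rule rel.pd_resolution[OF ex z])
    fix i :: int assume i: "0 \<le> i"
    show "rel.prj (M i)" using p i relatively_projective_prj[OF _ M] by blast
    show "rel.adm (M i) ((M (i - 1))\<lparr>carrier := {x \<in> carrier (M (i - 1)). t (i - 1) x = \<zero>\<^bsub>M (i - 1 - 1)\<^esub>}\<rparr>) (t i)"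
      unfolding im[symmetric]
    proof (rule rel.admI)
      show "t i \<in> A.hom (M i) ((M (i - 1))\<lparr>carrier := t i ` carrier (M i)\<rparr>)" by (rule module_hom_into[OF t]) blast
      \<comment> \<open>Restricted to the image of \<open>t i\<close>, the map
        \<open>h (i - 1)\<close> is a \<open>B\<close>-linear section of \<open>t i\<close>: that is
        what the splitting equation says there.\<close>
      have "t i ` carrier (M i) \<subseteq> carrier (M (i - 1))" using module_hom_closed[OF t] by blast
      then show "h (i - 1) \<in> B.hom (res ((M (i - 1))\<lparr>carrier := t i ` carrier (M i)\<rparr>)) (res (M i))"
        using module_hom_from[OF h(1)[of "i - 1"], of "t i ` carrier (M i)"] by simp
      show "\<forall>y \<in> carrier ((M (i - 1))\<lparr>carrier := t i ` carrier (M i)\<rparr>). t i (h (i - 1) y) = y" using h(2)[of _ i] by simp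
    qed
  qed
  moreover have "A.iso (M (-1)) X" by (rule A.resolution_iso[OF s X X module_isomorphic_refl])
  ultimately show ?thesis using rel.pd_mono[OF _ n] rel.pd_stab rel.iso_stab by blast
qed

end

section \<open>Finiteness of the finitistic dimension\<close>

lemma representation_finite_representatives:
  assumes "representation_finite B" and cat: "module_category B"
  obtains \<R> :: "'b umodule set" where "finite \<R>" "\<forall>N \<in> \<R>. fg_module B N"
    "\<forall>N :: 'b umodule. fg_module B N \<and> indecomposable B N \<longrightarrow> (\<exists>N' \<in> \<R>. module_category.iso B N N')"
proof -
  interpret module_category B by (rule cat)
  define Ind where "Ind = {M :: 'b umodule. indec M}"
  define r where "r = {(M, N) \<in> Ind \<times> Ind. module_isomorphic B M N}"
  have iso: "iso M N" if "(M, N) \<in> r" for M N using that by (auto simp: r_def Ind_def iso_iff)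
  have fin: "finite (Ind // r)" using assms(1) unfolding representation_finite_def Let_def Ind_def r_def by simp
  define c where "c C = (SOME N. N \<in> C)" for C :: "'b umodule set"
  have c: "c C \<in> C" if C: "C \<in> Ind // r" for C
  proof -
    obtain N where N: "N \<in> Ind" "C = r `` {N}" using C by (rule quotientE)
    have "N \<in> C" using N module_isomorphic_refl[of B N] by (simp add: r_def)
    then show ?thesis unfolding c_def by (rule someI)
  qed
  have sub: "C \<subseteq> Ind" if C: "C \<in> Ind // r" for C
    using C by (elim quotientE) (auto simp: r_def)
  show thesis
  proof (rule that[of "c ` (Ind // r)"])
    show "finite (c ` (Ind // r))" using fin by simp
    show "\<forall>N \<in> c ` (Ind // r). obj N" using c sub unfolding Ind_def by blast
    show "\<forall>N. indec N \<longrightarrow> (\<exists>N' \<in> c ` (Ind // r). iso N N')"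
    proof (intro allI impI)
      fix N :: "'b umodule" assume "indec N"
      then have N: "N \<in> Ind" by (simp add: Ind_def)
      then have C: "r `` {N} \<in> Ind // r" by (rule quotientI)
      then have "(N, c (r `` {N})) \<in> r" using c by blast
      then have "iso N (c (r `` {N}))" by (rule iso)
      then show "\<exists>N' \<in> c ` (Ind // r). iso N N'" using C by blast
    qed
  qed
qed

context ring_extension
begin

text \<open>Additivity of induction turns a decomposition of \<open>Y\<close> into one of
  \<open>P\<close>, and by locality \<open>T\<close> is a summand of one of the pieces.\<close>

lemma indec_retr_free:
  assumes T: "A.indec T" shows "B.msum J Y \<Longrightarrow> free_over Y P \<eta> \<Longrightarrow> A.retr T P \<Longrightarrow>
    \<exists>N \<in># J. \<exists>P' \<eta>'. free_over N P' \<eta>' \<and> A.retr T P'"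
proof (induction arbitrary: P \<eta> rule: B.msum.induct)
  case (msum_zero Z)
  have "zero_module P" by (rule free_over_zero[OF msum_zero.prems(1) msum_zero.hyps])
  then have "A.msum {#} P" using A.msum.msum_zero free_overD(1)[OF msum_zero.prems(1)] by blast
  from A.indec_retr_msum[OF T this msum_zero.prems(2)] show ?case by simp
next
  case (msum_add J X U Y)
  obtain P1 \<eta>1 where P1: "free_over U P1 \<eta>1" using free_over_exists[OF B.dsumD(1)[OF msum_add.hyps(2)]] .
  obtain P2 \<eta>2 where P2: "free_over X P2 \<eta>2" using free_over_exists[OF B.dsumD(2)[OF msum_add.hyps(2)]] .
  have "A.dsum P1 P2 P" by (rule free_over_dsum[OF P1 P2 msum_add.prems(1) msum_add.hyps(2)])
  then have "A.retr T P1 \<or> A.retr T P2" by (rule A.indec_retr_dsum[OF T msum_add.prems(2)])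
  then show ?case
  proof
    assume "A.retr T P1"
    then show ?thesis using P1 by (intro bexI[of _ U] exI[of _ P1] exI[of _ \<eta>1]) simp_all
  next
    assume "A.retr T P2"
    from msum_add.IH[OF P2 this] show ?thesis by auto
  qed
qed

lemma finite_relative_projectives:
  assumes fin: "representation_finite B"
  obtains \<U> where "finite \<U>" "\<forall>U \<in> \<U>. A.indec U" "\<forall>X. rel.prj X \<longrightarrow> (\<exists>J. set_mset J \<subseteq> \<U> \<and> A.msum J X)"
proof -
  obtain \<R> :: "'b umodule set" where R: "finite \<R>" "\<forall>N \<in> \<R>. B.obj N" "\<forall>N. B.indec N \<longrightarrow> (\<exists>N' \<in> \<R>. B.iso N N')"
    using representation_finite_representatives[OF fin B.module_category_axioms] .
  have "\<forall>N. \<exists>P. N \<in> \<R> \<longrightarrow> (\<exists>\<eta>. free_over N P \<eta>)" using R(2) free_over_exists by metis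
  then obtain F where F: "\<And>N. N \<in> \<R> \<Longrightarrow> \<exists>\<eta>. free_over N (F N) \<eta>" by metis
  have oF: "A.obj W" if "W \<in> F ` \<R>" for W using that F free_overD(1) by blast
  obtain \<U> where U: "finite \<U>" "\<forall>U \<in> \<U>. A.indec U" "\<forall>W \<in> F ` \<R>. \<exists>K. set_mset K \<subseteq> \<U> \<and> A.msum K W"
    using A.decompose_finite[of "F ` \<R>"] R(1) oF by blast
  have "\<exists>J. set_mset J \<subseteq> \<U> \<and> A.msum J X" if X: "rel.prj X" for X
  proof -
    note X' = rel.prjD[OF X]
    obtain P \<eta> where P: "free_over (res X) P \<eta>" using free_over_exists[OF obj_res[OF X']] .
    \<comment> \<open>The restriction of \<open>X\<close> is a \<open>B\<close>-module whose
      elements have the type belonging to \<open>A\<close>. It is decomposed in a copy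
      \<open>Y\<close>, and \<open>free_over_retr\<close> compares the induced modules.\<close>
    obtain Y :: "'b umodule" and f g where Y: "B.obj Y" "f \<in> B.hom (res X) Y" "g \<in> B.hom Y (res X)"
      "\<forall>x \<in> carrier (res X). g (f x) = x" "\<forall>y \<in> carrier Y. f (g y) = y" using B.copy_obj[OF obj_res[OF X']] .
    obtain Q \<theta> where Q: "free_over Y Q \<theta>" using free_over_exists[OF Y(1)] .
    have XQ: "A.retr X Q" by (rule A.retr_trans[OF prj_retr_free[OF X P] free_over_retr[OF P Q Y(2,3,4)]])
    obtain L where L: "B.msum L Y" "\<forall>N \<in># L. B.indec N" using B.decompose[OF Y(1)] .
    obtain J where J: "A.msum J X" "\<forall>T \<in># J. A.indec T" using A.decompose[OF X'] .
    have "\<exists>U \<in> \<U>. A.iso T U" if TJ: "T \<in># J" for T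
    proof -
      have T: "A.indec T" using J(2) TJ by blast
      have "A.retr T Q" by (rule A.retr_trans[OF A.msum_retr[OF J(1) TJ] XQ])
      then obtain N P' \<eta>' where N: "N \<in># L" "free_over N P' \<eta>'" "A.retr T P'"
        using indec_retr_free[OF T L(1) Q] by blast
      obtain N' where N': "N' \<in> \<R>" "B.iso N N'" using R(3) L(2) N(1) by blast
      obtain a b where ab: "a \<in> B.hom N N'" "b \<in> B.hom N' N" "\<forall>x \<in> carrier N. b (a x) = x" using N'(2) by (rule B.isoE)
      obtain \<zeta> where Z: "free_over N' (F N') \<zeta>" using F[OF N'(1)] by blast
      have TF: "A.retr T (F N')" by (rule A.retr_trans[OF N(3) free_over_retr[OF N(2) Z ab]])
      obtain K where K: "set_mset K \<subseteq> \<U>" "A.msum K (F N')" using U(3) N'(1) by blast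
      obtain U where "U \<in># K" "A.retr T U" using A.indec_retr_msum[OF T K(2) TF] by blast
      moreover from this have "U \<in> \<U>" using K(1) by blast
      moreover from this have "A.indec U" using U(2) by blast
      ultimately show ?thesis using A.indec_retr_indec[OF T] by blast
    qed
    then obtain r where r: "\<And>T. T \<in># J \<Longrightarrow> r T \<in> \<U> \<and> A.iso T (r T)" by metis
    have "set_mset (image_mset r J) \<subseteq> \<U>" using r by auto
    moreover have "A.msum (image_mset r J) X" using A.msum_image_iso[OF J(1)] r by blast
    ultimately show ?thesis by blast
  qed
  then show thesis using that U(1,2) by blast
qed

text \<open>A relative presentation with relatively projective kernel is in particular exact, and
  both its left terms are sums over one finite set. They may have infinite projective dimension;
  finiteness is assumed only for their cokernel \<open>X\<close>.\<close>

lemma pd_bound_one: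
  assumes "representation_finite B"
  shows "\<exists>d. \<forall>X r. rel.pd 1 X \<and> A.ord.pd r X \<longrightarrow> A.ord.pd d X"
proof -
  obtain \<U> where U: "finite \<U>" "\<forall>U \<in> \<U>. A.indec U" "\<forall>X. rel.prj X \<longrightarrow> (\<exists>J. set_mset J \<subseteq> \<U> \<and> A.msum J X)"
    using finite_relative_projectives[OF assms] .
  obtain d where d: "\<forall>J J' X Y Z r. set_mset J \<subseteq> \<U> \<and> set_mset J' \<subseteq> \<U> \<and> A.msum J X \<and> A.msum J' Y \<and>
      A.ord.sq X Y Z \<and> A.ord.pd r Z \<longrightarrow> A.ord.pd d Z"
    using A.igusa_todorov[of \<U>] U(1,2) by metis
  have "A.ord.pd d X" if X: "rel.pd 1 X" "A.ord.pd r X" for X r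
  proof -
    have X': "A.obj X" and Om: "rel.prj (rel.Om X)" using X(1) rel.pd_Suc[of 0 X] by simp_all
    obtain P where P: "rel.prj P" "rel.sq (rel.Om X) P X" using rel.Om[OF X'] .
    obtain f g where "A.ses (rel.Om X) P X f g" using P(2) by (rule rel.sqE)
    then have s: "A.ord.sq (rel.Om X) P X" by (rule A.ses_sq)
    obtain J where J: "set_mset J \<subseteq> \<U>" "A.msum J (rel.Om X)" using U(3)[rule_format, OF Om] by blast
    obtain J' where J': "set_mset J' \<subseteq> \<U>" "A.msum J' P" using U(3)[rule_format, OF P(1)] by blast
    show ?thesis by (rule d[rule_format]) (use J J' s X(2) in blast)
  qed
  then show ?thesis by blast
qed

text \<open>The bound is \<open>c + n\<close>: relative projectives of finite dimension have
  dimension at most \<open>c\<close>, and each further step of relative dimension costs one for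
  passing to a cokernel. The assumption \<open>ind\<close> expresses the hypothesis on induced
  modules through their universal property.\<close>

lemma pd_bound_finite:
  assumes "representation_finite B"
    and ind: "\<And>X T \<eta> r. A.obj X \<Longrightarrow> A.ord.pd r X \<Longrightarrow> free_over (res X) T \<eta> \<Longrightarrow> \<exists>r. A.ord.pd r T"
  shows "\<exists>d. \<forall>X r. rel.pd n X \<and> A.ord.pd r X \<longrightarrow> A.ord.pd d X"
proof -
  obtain c where c: "\<forall>X r. rel.pd 1 X \<and> A.ord.pd r X \<longrightarrow> A.ord.pd c X"
    using pd_bound_one[OF assms(1)] by blast
  \<comment> \<open>A relative projective has relative dimension at most 1 as well, so the bound
    \<open>c\<close> covers it.\<close>
  have prj: "A.ord.pd c X" if X: "rel.prj X" "A.ord.pd r X" for X r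
  proof -
    have "rel.pd 1 X" by (rule rel.pd_mono[of 0]) (simp_all add: X(1))
    then show ?thesis using c X(2) by blast
  qed
  have "A.ord.pd (c + n) X" if "rel.pd n X" "A.ord.pd r X" for X r
    using that
  proof (induction n arbitrary: X r)
    case 0
    then show ?case using prj by simp
  next
    case (Suc n)
    have X: "A.obj X" by (rule rel.pd_obj[OF Suc.prems(1)])
    obtain T \<eta> where F: "free_over (res X) T \<eta>" using free_over_exists[OF obj_res[OF X]] .
    note T = free_overD(1)[OF F] and Tp = free_over_prj[OF F]
    obtain l where l: "rel.adm T X l" using counit[OF F X] .
    let ?K = "T\<lparr>carrier := {x \<in> carrier T. l x = \<zero>\<^bsub>X\<^esub>}\<rparr>"
    have sq: "rel.sq ?K T X" by (rule rel.sq_kernel[OF T X l])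
    obtain f g where "A.ses ?K T X f g" using sq by (rule rel.sqE)
    then have tri: "A.ord.tri ?K T X" by (intro A.ord.sq_tri A.ses_sq)
    obtain s where s: "A.ord.pd s T" using ind[OF X Suc.prems(2) F] by blast
    \<comment> \<open>This bound depends on \<open>X\<close>, but it only serves to know that the
      dimension of \<open>?K\<close> is finite; the induction hypothesis then replaces it by
      \<open>c + n\<close>.\<close>
    have "A.ord.pd (max r s) ?K"
      by (rule A.ord.pd_kernel[OF tri A.ord.pd_mono[OF s] A.ord.pd_mono[OF Suc.prems(2)]]) simp_all
    moreover have "rel.pd n ?K" using rel.pd_Suc_sq[OF sq Tp] Suc.prems(1) by simp
    ultimately have K: "A.ord.pd (c + n) ?K" by (rule Suc.IH[rotated])
    \<comment> \<open>Likewise \<open>s\<close> is traded for the uniform \<open>c\<close>, as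
      \<open>T\<close> is relatively projective.\<close>
    have "A.ord.pd (c + n) T" by (rule A.ord.pd_mono[OF prj[OF Tp s]]) simp
    then show ?case using A.ord.pd_cokernel[OF tri K] by simp
  qed
  then show ?thesis by blast
qed

text \<open>Every module of finite projective dimension has relative dimension at most
  \<open>n\<close>, so the uniform \<open>d\<close> is an upper bound of the set whose supremum is
  taken.\<close>

lemma fin_dim_finite:
  assumes le: "rel_fin_dim A B \<phi> \<le> enat n"
    and "\<exists>d. \<forall>X r. rel.pd n X \<and> A.ord.pd r X \<longrightarrow> A.ord.pd d X"
  shows "fin_dim A < \<infinity>"
proof -
  obtain d where d: "\<forall>X r. rel.pd n X \<and> A.ord.pd r X \<longrightarrow> A.ord.pd d X" using assms(2) by blast
  have "fin_dim A \<le> enat d"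
    unfolding fin_dim_def
  proof (rule Sup_least, elim CollectE exE conjE)
    fix e and X :: "'a umodule" assume e: "e = proj_dim A X" and X: "A.obj X" and fin: "proj_dim A X < \<infinity>"
    have "rel_proj_dim A B \<phi> X \<le> rel_fin_dim A B \<phi>"
      unfolding rel_fin_dim_def using X fin by (intro Sup_upper) blast
    then have "rel.pd n X" using le by (intro rel_proj_dim_pd[OF _ X]) (rule order_trans)
    moreover obtain r where "A.ord.pd r X" using A.proj_dim_pd[OF fin X X module_isomorphic_refl] by blast
    ultimately have "A.ord.pd d X" using d by blast
    then show "e \<le> enat d" unfolding e by (rule A.pd_proj_dim[OF _ module_isomorphic_refl])
  qed
  then show ?thesis by (rule le_less_trans) simp
qed

end

theorem theorem1p1:
  fixes R :: "'r ring" and A :: "('r, 'a) module" and B :: "('r, 'b) module"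
    and \<phi> :: "'b \<Rightarrow> 'a"
  assumes "artin_algebra R B" and "artin_algebra R A"
    and "representation_finite B"
    and "\<phi> \<in> algebra_hom R B A"
  shows "(rel_fin_dim A B \<phi> \<le> 1 \<longrightarrow> fin_dim A < \<infinity>) \<and>
         (2 \<le> rel_fin_dim A B \<phi> \<and> rel_fin_dim A B \<phi> < \<infinity> \<and>
          (\<forall>M :: 'a umodule. fg_module A M \<and> proj_dim A M < \<infinity> \<longrightarrow>
             proj_dim A (induced A B \<phi> M) < \<infinity>) \<longrightarrow>
          fin_dim A < \<infinity>)"
proof (intro conjI impI)
  interpret ring_extension A B \<phi>
  proof (intro ring_extension.intro ring_extension_axioms.intro)
    show "module_category A" "module_category B" by (rule artin_algebra.module_category, fact)+
    show "\<phi> \<in> ring_hom B A" using assms(4) by (simp add: algebra_hom_def)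
    show "fg_module B (restrict_scalars \<phi> M)" if "fg_module A M" for M :: "'a umodule"
      by (rule algebra_hom_restrict_fg[OF assms(1,2,4) that])
  qed
  {
    assume "rel_fin_dim A B \<phi> \<le> 1"
    then have "rel_fin_dim A B \<phi> \<le> enat 1" by (simp add: one_enat_def)
    then show "fin_dim A < \<infinity>" using pd_bound_one[OF assms(3)] by (rule fin_dim_finite)
  next
    assume *: "2 \<le> rel_fin_dim A B \<phi> \<and> rel_fin_dim A B \<phi> < \<infinity> \<and>
      (\<forall>M :: 'a umodule. fg_module A M \<and> proj_dim A M < \<infinity> \<longrightarrow> proj_dim A (induced A B \<phi> M) < \<infinity>)"
    then obtain n where n: "rel_fin_dim A B \<phi> \<le> enat n" by (cases "rel_fin_dim A B \<phi>") auto
    have "\<exists>r. A.ord.pd r T" if X: "A.obj X" "A.ord.pd r X" and F: "free_over (res X) T \<eta>" for X T :: "'a umodule" and \<eta> r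
    proof -
      have "proj_dim A X < \<infinity>" using A.pd_proj_dim[OF X(2) module_isomorphic_refl] by (rule le_less_trans) simp
      then have fin: "proj_dim A (induced A B \<phi> X) < \<infinity>" using * X(1) by simp
      have I: "A.obj (induced A B \<phi> X)" unfolding induced_def by (rule obj_tensor[OF obj_res[OF X(1)]])
      \<comment> \<open>The hypothesis concerns the tensor product itself, whereas \<open>T\<close>
        is any module with its universal property. A copy \<open>T'\<close> of the tensor product
        links the two, having \<open>T\<close> as a retract.\<close>
      obtain T' :: "'a umodule" where T': "A.obj T'" "module_isomorphic A T' (induced A B \<phi> X)"
        using A.copy_isomorphic[OF I] .
      obtain r' where r': "A.ord.pd r' T'" using A.proj_dim_pd[OF fin I T'] by blast
      obtain \<theta> where F': "free_over (res X) T' \<theta>" using free_over_tensor[OF obj_res[OF X(1)] T'(1)] T'(2) unfolding induced_def by blast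
      have "A.retr T T'" by (rule free_over_retr[OF F F' module_hom_id module_hom_id]) simp
      then show ?thesis using A.ord.pd_retr[OF r'] by blast
    qed
    then have "\<exists>d. \<forall>X r. rel.pd n X \<and> A.ord.pd r X \<longrightarrow> A.ord.pd d X" by (rule pd_bound_finite[OF assms(3)])
    then show "fin_dim A < \<infinity>" by (rule fin_dim_finite[OF n])
  }
qed

end
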